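(* Let $G_1$ and $G_2$ be groups in $\mathcal{C}$ with a common cyclic subgroup $A$, and suppose that $G_1$ and $G_2$ are residually $p$-finite for every prime $p$. Then $G_1\ast_A G_2$ belongs to $\mathcal{C}$.
   Context: For a group $G$ and prime $p$, $\hat{G}^p$ denotes the pro-$p$ completion of $G$ and $c_G^p:G\to\hat{G}^p$ the completion map. $\mathbb Z/p$ is regarded as a trivial module for discrete groups and as a trivial discrete topological module for pro-$p$ groups. $\mathcal{C}$ is the class of all groups $G$ such that for every prime $p$ and every integer $n\ge 0$, the map $H^n_{\rm cont}(\hat{G}^p,\mathbb Z/p)\to H^n(G,\mathbb Z/p)$ induced by $c_G^p$ is an isomorphism. A group is $p$-finite if its order is a finite power of $p$; a group $G$ is residually $p$-finite if for every $g\ne 1$ in $G$ there is a $p$-finite quotient of $G$ in which the image of $g$ is nontrivial. *)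

theory Defs
  imports "HOL-Analysis.Analysis" "HOL-Algebra.Coset" "HOL-Algebra.Generated_Groups" "HOL-Number_Theory.Cong"
begin

definition pfin_normals :: "('a, 'm) monoid_scheme \<Rightarrow> nat \<Rightarrow> 'a set set" where
  "pfin_normals G p = {N. N \<lhd> G \<and> finite (rcosets\<^bsub>G\<^esub> N) \<and> (\<exists>k. card (rcosets\<^bsub>G\<^esub> N) = p ^ k)}"

text \<open>Pro-p completion: inverse limit of the p-finite quotients G/N, as compatible families
  of cosets (extensional outside the index set).\<close>
definition prop_carrier :: "('a, 'm) monoid_scheme \<Rightarrow> nat \<Rightarrow> ('a set \<Rightarrow> 'a set) set" where
  "prop_carrier G p = {x.
     (\<forall>N\<in>pfin_normals G p. x N \<in> rcosets\<^bsub>G\<^esub> N) \<and>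
     (\<forall>N. N \<notin> pfin_normals G p \<longrightarrow> x N = undefined) \<and>
     (\<forall>N\<in>pfin_normals G p. \<forall>M\<in>pfin_normals G p. N \<subseteq> M \<longrightarrow> x N \<subseteq> x M)}"

definition pro_p_completion :: "('a, 'm) monoid_scheme \<Rightarrow> nat \<Rightarrow> ('a set \<Rightarrow> 'a set) monoid" where
  "pro_p_completion G p =
     \<lparr> carrier = prop_carrier G p,
       mult = (\<lambda>x y. (\<lambda>N. if N \<in> pfin_normals G p then x N <#>\<^bsub>G\<^esub> y N else undefined)),
       one = (\<lambda>N. if N \<in> pfin_normals G p then N else undefined) \<rparr>"

definition pro_p_topology :: "('a, 'm) monoid_scheme \<Rightarrow> nat \<Rightarrow> ('a set \<Rightarrow> 'a set) topology" where
  "pro_p_topology G p =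
     subtopology (product_topology (\<lambda>N. discrete_topology (rcosets\<^bsub>G\<^esub> N)) (pfin_normals G p))
                 (prop_carrier G p)"

definition completion_map :: "('a, 'm) monoid_scheme \<Rightarrow> nat \<Rightarrow> 'a \<Rightarrow> ('a set \<Rightarrow> 'a set)" where
  "completion_map G p g = (\<lambda>N. if N \<in> pfin_normals G p then N #>\<^bsub>G\<^esub> g else undefined)"

text \<open>An n-cochain is a function on lists of length n of group elements, with values in
  int regarded modulo p (i.e. in Z/p).\<close>
definition tuples :: "'a set \<Rightarrow> nat \<Rightarrow> 'a list set" where
  "tuples S n = {xs. length xs = n \<and> set xs \<subseteq> S}"

definition cobound :: "('a, 'm) monoid_scheme \<Rightarrow> nat \<Rightarrow> ('a list \<Rightarrow> int) \<Rightarrow> 'a list \<Rightarrow> int" where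
  "cobound G n f xs =
     f (tl xs)
     + (\<Sum>i\<in>{1..n}. (-1) ^ i * f (take (i - 1) xs @ [xs ! (i - 1) \<otimes>\<^bsub>G\<^esub> xs ! i] @ drop (i + 1) xs))
     + (-1) ^ (n + 1) * f (take n xs)"

definition is_cocycle :: "('a, 'm) monoid_scheme \<Rightarrow> nat \<Rightarrow> nat \<Rightarrow> ('a list \<Rightarrow> int) \<Rightarrow> bool" where
  "is_cocycle G p n f = (\<forall>xs\<in>tuples (carrier G) (Suc n). [cobound G n f xs = 0] (mod int p))"

definition is_coboundary ::
  "('a, 'm) monoid_scheme \<Rightarrow> nat \<Rightarrow> (nat \<Rightarrow> ('a list \<Rightarrow> int) \<Rightarrow> bool) \<Rightarrow> nat \<Rightarrow> ('a list \<Rightarrow> int) \<Rightarrow> bool" where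
  "is_coboundary G p adm n f =
     (case n of
        0 \<Rightarrow> (\<forall>xs\<in>tuples (carrier G) 0. [f xs = 0] (mod int p))
      | Suc m \<Rightarrow> (\<exists>h. adm m h \<and> (\<forall>xs\<in>tuples (carrier G) n. [f xs = cobound G m h xs] (mod int p))))"

definition cont_cochain :: "('a, 'm) monoid_scheme \<Rightarrow> nat \<Rightarrow> nat \<Rightarrow> (('a set \<Rightarrow> 'a set) list \<Rightarrow> int) \<Rightarrow> bool" where
  "cont_cochain G p n F =
     continuous_map (product_topology (\<lambda>i. pro_p_topology G p) {..<n}) (discrete_topology UNIV)
                    (\<lambda>v. F (map v [0..<n]))"

text \<open>The map H^n_cont(completion, Z/p) \<rightarrow> H^n(G, Z/p), [F] \<mapsto> [F \<circ> c^n], is an isomorphism: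
  surjective and injective on cohomology classes.\<close>
definition completion_iso :: "('a, 'm) monoid_scheme \<Rightarrow> nat \<Rightarrow> nat \<Rightarrow> bool" where
  "completion_iso G p n =
     ((\<forall>f. is_cocycle G p n f \<longrightarrow>
          (\<exists>F. cont_cochain G p n F \<and> is_cocycle (pro_p_completion G p) p n F \<and>
               is_coboundary G p (\<lambda>_ _. True) n (\<lambda>xs. f xs - F (map (completion_map G p) xs)))) \<and>
      (\<forall>F. cont_cochain G p n F \<and> is_cocycle (pro_p_completion G p) p n F \<and>
           is_coboundary G p (\<lambda>_ _. True) n (\<lambda>xs. F (map (completion_map G p) xs)) \<longrightarrow>
           is_coboundary (pro_p_completion G p) p (cont_cochain G p) n F))"

definition class_C :: "('a, 'm) monoid_scheme \<Rightarrow> bool" where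
  "class_C G = (\<forall>p n. prime p \<longrightarrow> completion_iso G p n)"

definition residually_p_finite :: "('a, 'm) monoid_scheme \<Rightarrow> nat \<Rightarrow> bool" where
  "residually_p_finite G p =
     (\<forall>g\<in>carrier G. g \<noteq> \<one>\<^bsub>G\<^esub> \<longrightarrow> (\<exists>N\<in>pfin_normals G p. g \<notin> N))"

definition cyclic_group :: "('a, 'm) monoid_scheme \<Rightarrow> bool" where
  "cyclic_group A = (\<exists>g\<in>carrier A. carrier A = generate A {g})"

inductive amal_rel ::
  "('a, 'm) monoid_scheme \<Rightarrow> ('b, 'n) monoid_scheme \<Rightarrow> ('c, 'k) monoid_scheme \<Rightarrow>
   ('c \<Rightarrow> 'a) \<Rightarrow> ('c \<Rightarrow> 'b) \<Rightarrow> ('a + 'b) list \<Rightarrow> ('a + 'b) list \<Rightarrow> bool"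
  for G1 G2 A i1 i2 where
  refl: "amal_rel G1 G2 A i1 i2 w w"
| sym: "amal_rel G1 G2 A i1 i2 u v \<Longrightarrow> amal_rel G1 G2 A i1 i2 v u"
| trans: "amal_rel G1 G2 A i1 i2 u v \<Longrightarrow> amal_rel G1 G2 A i1 i2 v w \<Longrightarrow> amal_rel G1 G2 A i1 i2 u w"
| ctx: "amal_rel G1 G2 A i1 i2 u v \<Longrightarrow> amal_rel G1 G2 A i1 i2 (l @ u @ r) (l @ v @ r)"
| mult1: "x \<in> carrier G1 \<Longrightarrow> y \<in> carrier G1 \<Longrightarrow>
          amal_rel G1 G2 A i1 i2 [Inl x, Inl y] [Inl (x \<otimes>\<^bsub>G1\<^esub> y)]"
| mult2: "x \<in> carrier G2 \<Longrightarrow> y \<in> carrier G2 \<Longrightarrow>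
          amal_rel G1 G2 A i1 i2 [Inr x, Inr y] [Inr (x \<otimes>\<^bsub>G2\<^esub> y)]"
| one1: "amal_rel G1 G2 A i1 i2 [Inl \<one>\<^bsub>G1\<^esub>] []"
| one2: "amal_rel G1 G2 A i1 i2 [Inr \<one>\<^bsub>G2\<^esub>] []"
| amal: "a \<in> carrier A \<Longrightarrow> amal_rel G1 G2 A i1 i2 [Inl (i1 a)] [Inr (i2 a)]"

definition amal_class where
  "amal_class G1 G2 A i1 i2 w = {v. amal_rel G1 G2 A i1 i2 w v}"

definition amal_product ::
  "('a, 'm) monoid_scheme \<Rightarrow> ('b, 'n) monoid_scheme \<Rightarrow> ('c, 'k) monoid_scheme \<Rightarrow>
   ('c \<Rightarrow> 'a) \<Rightarrow> ('c \<Rightarrow> 'b) \<Rightarrow> ('a + 'b) list set monoid" where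
  "amal_product G1 G2 A i1 i2 =
     \<lparr> carrier = amal_class G1 G2 A i1 i2 ` lists (Inl ` carrier G1 \<union> Inr ` carrier G2),
       mult = (\<lambda>X Y. amal_class G1 G2 A i1 i2 ((SOME u. u \<in> X) @ (SOME v. v \<in> Y))),
       one = amal_class G1 G2 A i1 i2 [] \<rparr>"

end

theory Submission
  imports "HOL-Algebra.Sylow" "HOL-Algebra.Group_Action" "HOL-Algebra.Multiplicative_Group" Defs
begin

text \<open>For every prime \<open>p\<close>, continuous and abstract cohomology with coefficients $\mathbb{Z}/p$ agree in all degrees
  if and only if the direct limit of $H^n(N, \mathbb{Z}/p)$ over the normal subgroups \<open>N\<close> of p-power index vanishes
  for all $n \ge 1$ (Serre's criterion). One direction compares both sides with the double complex of cochains that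
  are locally constant in one half of the variables; for the other, a fixed vector argument for finite p-groups
  turns a nonzero limit class into one that contradicts the agreement.

  Since \<open>G1\<close> is residually p-finite for all \<open>p\<close>, the cyclic group \<open>A\<close> is trivial or infinite cyclic, so it satisfies
  the criterion. Moreover \<open>G1\<close>, \<open>G2\<close> and \<open>A\<close> inherit their full pro-p topologies from the amalgam: two p-finite
  quotients with the same trace on \<open>A\<close> are reached by central steps of order \<open>p\<close>, each step extending characters that
  agree on \<open>A\<close>, and arbitrary traces are first made equal, using that \<open>A\<close> is cyclic. Then the direct limit of the
  Mayer-Vietoris sequences of the amalgam gives the criterion for \<open>G\<close> in degrees at least 2, and degree 1
  holds for every group, because the kernel of a character is open.\<close>

subsection \<open>Normal subgroups of p-power index\<close>

text \<open>The double complex stands in for the spectral sequence from H^i of the completion with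
  coefficients in lim H^j(N, Z/p) to H^(i+j)(G, Z/p). At the lowest row j = n >= 1 that could
  survive, surjectivity in degree n and injectivity in degree n + 1 exclude a nonzero invariant
  class in lim H^n(N, Z/p). Every class is fixed by some N of p-power index, and G/N is a p-group
  acting on p-torsion, so a nonzero class would produce a nonzero invariant one. For the amalgam the
  obstacle is topological: a p-finite quotient of a factor has to be dominated by one of the
  amalgam. Cyclicity of A helps twice: traces on A are compared by a single exponent, and a
  nontrivial finite cyclic p-group has just one subgroup of order p. The amalgam enters only through
  the extension of crossed homomorphisms from the factors. Reduced words never occur; that the
  factors embed is a consequence of separation by p-finite quotients.\<close>

lemma (in group) normal_Mod_eq_iff:
  assumes "N \<lhd> G" "x \<in> carrier G" "y \<in> carrier G"
  shows "N #> x = N #> y \<longleftrightarrow> x \<otimes> inv y \<in> N"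
  using assms by (metis group.rcos_self is_group normal_imp_subgroup repr_independence
      subgroup.rcos_module)

lemma (in group) subgroup_nat_pow_closed:
  assumes "subgroup N G" "x \<in> N"
  shows "x [^] (n::nat) \<in> N"
  by (induction n) (use assms in \<open>auto intro: subgroup.m_closed subgroup.one_closed\<close>)

text \<open>Elements with equal \<open>f\<close> lie in one coset of \<open>N\<close>, so the values
  of \<open>f\<close> are at least as numerous as the cosets. In the applications \<open>f\<close>
  lists invariants such as cosets of other subgroups.\<close>

lemma (in group) finite_index_via:
  assumes "N \<lhd> G" "finite (f ` carrier G)"
    and "\<And>x y. x \<in> carrier G \<Longrightarrow> y \<in> carrier G \<Longrightarrow> f x = f y \<Longrightarrow> x \<otimes> inv y \<in> N"
  shows "finite (rcosets N)"
proof -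
  have "rcosets N \<subseteq> (\<lambda>v. N #> (SOME x. x \<in> carrier G \<and> f x = v)) ` f ` carrier G"
  proof
    fix c assume "c \<in> rcosets N"
    then obtain x where x: "x \<in> carrier G" "c = N #> x" by (auto simp: RCOSETS_def)
    define y where "y = (SOME y. y \<in> carrier G \<and> f y = f x)"
    have y: "y \<in> carrier G \<and> f y = f x" unfolding y_def by (rule someI[of _ x]) (use x in simp)
    then have "c = N #> y" using x assms(3)[of x y] normal_Mod_eq_iff[OF assms(1)] by auto
    then show "c \<in> (\<lambda>v. N #> (SOME x. x \<in> carrier G \<and> f x = v)) ` f ` carrier G"
      using x(1) unfolding y_def by blast
  qed
  then show ?thesis using assms(2) finite_surj by blast
qed

lemma (in group) Mod_pow_eq_one_iff:
  assumes "N \<lhd> G" "x \<in> carrier G"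
  shows "(N #> x) [^]\<^bsub>G Mod N\<^esub> (n::nat) = \<one>\<^bsub>G Mod N\<^esub> \<longleftrightarrow> x [^] n \<in> N"
proof -
  have "(N #> x) [^]\<^bsub>G Mod N\<^esub> n = N #> (x [^] n)"
    using normal.FactGroup_pow[OF assms] .
  then show ?thesis
    using assms by (simp add: coset_join1 coset_join2 normal_imp_subgroup subgroup.subset
        nat_pow_closed) (metis assms coset_join1 coset_join2 nat_pow_closed normal_imp_subgroup
        subgroup.subset)
qed

text \<open>For a prime \<open>q\<close> dividing the index, Cauchy's theorem gives an element of
  order \<open>q\<close> in the quotient, whose order is also a power of \<open>p\<close>; so
  \<open>q = p\<close>. Membership in \<open>pfin_normals\<close> is thereby tested on powers of
  elements, which pass to intersections and preimages more easily than indices do.\<close>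

lemma (in group) finite_normal_prime_power_index_iff:
  assumes p: "prime p" and N: "N \<lhd> G" and fin: "finite (rcosets N)"
  shows "(\<exists>k. card (rcosets N) = p ^ k) \<longleftrightarrow> (\<forall>g\<in>carrier G. \<exists>k. g [^] (p ^ k) \<in> N)"
proof
  interpret Q: group "G Mod N" by (rule normal.factorgroup_is_group[OF N])
  have ord: "Coset.order (G Mod N) = card (rcosets N)" by (simp add: Coset.order_def FactGroup_def)
  have finQ: "finite (carrier (G Mod N))" using fin by (simp add: FactGroup_def)
  assume "\<exists>k. card (rcosets N) = p ^ k"
  then obtain k where k: "card (rcosets N) = p ^ k" by blast
  show "\<forall>g\<in>carrier G. \<exists>k. g [^] (p ^ k) \<in> N"
  proof
    fix g assume g: "g \<in> carrier G"
    have "N #> g \<in> carrier (G Mod N)" using g by (auto simp: carrier_FactGroup)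
    then have "(N #> g) [^]\<^bsub>G Mod N\<^esub> (p ^ k) = \<one>\<^bsub>G Mod N\<^esub>"
      using Q.pow_order_eq_1[of "N #> g"] ord k by simp
    then show "\<exists>k. g [^] (p ^ k) \<in> N" using Mod_pow_eq_one_iff[OF N g] by blast
  qed
next
  interpret Q: group "G Mod N" by (rule normal.factorgroup_is_group[OF N])
  have ord: "Coset.order (G Mod N) = card (rcosets N)" by (simp add: Coset.order_def FactGroup_def)
  have finQ: "finite (carrier (G Mod N))" using fin by (simp add: FactGroup_def)
  assume pw: "\<forall>g\<in>carrier G. \<exists>k. g [^] (p ^ k) \<in> N"
  let ?m = "Coset.order (G Mod N)"
  have m0: "?m \<noteq> 0" using finQ Q.order_gt_0_iff_finite by auto
  have only_p: "q = p" if q: "prime q" "q dvd ?m" for q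
  proof (rule ccontr)
    assume "q \<noteq> p"
    \<comment> \<open>The exponent 1 turns Sylow's theorem into Cauchy's: it yields a subgroup of
      order \<open>q\<close>.\<close>
    from q obtain r where "?m = q ^ 1 * r" by (auto elim: dvdE)
    from sylow_thm[OF q(1) Q.is_group this finQ]
    obtain H where H: "subgroup H (G Mod N)" "card H = q" by auto
    have "H \<noteq> {\<one>\<^bsub>G Mod N\<^esub>}" using H(2) q(1) by (metis card_1_singleton_iff not_prime_1 One_nat_def)
    then obtain h where h: "h \<in> H" "h \<noteq> \<one>\<^bsub>G Mod N\<^esub>"
      using subgroup.one_closed[OF H(1)] by blast
    then have hc: "h \<in> carrier (G Mod N)" using H(1) subgroup.subset by blast
    interpret HG: group "(G Mod N)\<lparr>carrier := H\<rparr>" by (rule Q.subgroup_imp_group[OF H(1)])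
    have "h [^]\<^bsub>(G Mod N)\<lparr>carrier := H\<rparr>\<^esub> Coset.order ((G Mod N)\<lparr>carrier := H\<rparr>) = \<one>\<^bsub>(G Mod N)\<lparr>carrier := H\<rparr>\<^esub>"
      by (rule HG.pow_order_eq_1) (use h in simp)
    then have "h [^]\<^bsub>G Mod N\<^esub> q = \<one>\<^bsub>G Mod N\<^esub>"
      using H(2) by (simp add: Coset.order_def nat_pow_def)
    then have "Q.ord h dvd q" using hc Q.pow_eq_id by blast
    moreover obtain g where g: "g \<in> carrier G" "h = N #> g" using hc by (auto simp: carrier_FactGroup)
    obtain k where "g [^] (p ^ k) \<in> N" using pw g by blast
    then have "h [^]\<^bsub>G Mod N\<^esub> (p ^ k) = \<one>\<^bsub>G Mod N\<^esub>" using g Mod_pow_eq_one_iff[OF N] by blast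
    then have "Q.ord h dvd p ^ k" using hc Q.pow_eq_id by blast
    moreover have "coprime q (p ^ k)" using \<open>q \<noteq> p\<close> p q(1) by (simp add: primes_coprime)
    ultimately have "Q.ord h = 1" by (metis coprime_common_divisor_nat)
    then show False using h hc Q.ord_eq_1 by blast
  qed
  have "\<not> is_unit p" using p by auto
  then obtain r where r: "?m = p ^ multiplicity p ?m * r" "\<not> p dvd r"
    using multiplicity_decompose'[OF m0] by metis
  have "r = 1"
  proof (rule ccontr)
    assume "r \<noteq> 1"
    then obtain q where "prime q" "q dvd r" using prime_factor_nat by blast
    then show False using only_p r by (metis dvd_mult)
  qed
  then show "\<exists>k. card (rcosets N) = p ^ k" using r ord by auto
qed

lemma (in group) pfin_iff:
  assumes "prime p"
  shows "N \<in> pfin_normals G p \<longleftrightarrow>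
    N \<lhd> G \<and> finite (rcosets N) \<and> (\<forall>g\<in>carrier G. \<exists>k. g [^] (p ^ k) \<in> N)"
  using finite_normal_prime_power_index_iff[OF assms] unfolding pfin_normals_def by auto

lemma pfinD:
  assumes "N \<in> pfin_normals G p"
  shows "N \<lhd> G" "subgroup N G" "finite (rcosets\<^bsub>G\<^esub> N)" "N \<subseteq> carrier G"
  using assms normal_imp_subgroup subgroup.subset unfolding pfin_normals_def by blast+

lemma (in group) carrier_pfin: "carrier G \<in> pfin_normals G p"
proof -
  have "rcosets (carrier G) = {carrier G}"
    using coset_join2[OF _ subgroup_self] one_closed unfolding RCOSETS_def by blast
  then show ?thesis unfolding pfin_normals_def
    using normal_inv_iff subgroup_self by (auto intro!: exI[of _ 0])
qed

lemma (in group) pfin_inter: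
  assumes p: "prime p" and N: "N \<in> pfin_normals G p" and M: "M \<in> pfin_normals G p"
  shows "N \<inter> M \<in> pfin_normals G p"
proof -
  have nor: "N \<inter> M \<lhd> G" using pfinD(1)[OF N] pfinD(1)[OF M] by (rule normal_subgroup_intersect)
  have "finite ((\<lambda>x. Pair (N #> x) (M #> x)) ` carrier G)"
  proof (rule finite_subset)
    show "(\<lambda>x. Pair (N #> x) (M #> x)) ` carrier G \<subseteq> (rcosets N) \<times> (rcosets M)"
      by (auto simp: RCOSETS_def)
  qed (use pfinD(3)[OF N] pfinD(3)[OF M] in simp)
  then have "finite (rcosets (N \<inter> M))"
    by (rule finite_index_via[OF nor])
      (simp add: normal_Mod_eq_iff[OF pfinD(1)[OF N]] normal_Mod_eq_iff[OF pfinD(1)[OF M]])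
  moreover have "\<exists>k. g [^] (p ^ k) \<in> N \<inter> M" if g: "g \<in> carrier G" for g
  proof -
    obtain k l where k: "g [^] (p ^ k) \<in> N" and l: "g [^] (p ^ l) \<in> M"
      using N M g unfolding pfin_iff[OF p] by blast
    have "g [^] (p ^ (k + l)) = (g [^] (p ^ k)) [^] (p ^ l)"
      using g by (simp add: nat_pow_pow power_add)
    then have "g [^] (p ^ (k + l)) \<in> N"
      using subgroup_nat_pow_closed[OF pfinD(2)[OF N] k] by simp
    moreover have "g [^] (p ^ (k + l)) = (g [^] (p ^ l)) [^] (p ^ k)"
      using g by (simp add: nat_pow_pow power_add mult.commute)
    then have "g [^] (p ^ (k + l)) \<in> M"
      using subgroup_nat_pow_closed[OF pfinD(2)[OF M] l] by simp
    ultimately show ?thesis by blast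
  qed
  ultimately show ?thesis using nor unfolding pfin_iff[OF p] by blast
qed

lemma (in group) pfin_refine:
  assumes p: "prime p" and "finite \<N>" "\<N> \<subseteq> pfin_normals G p"
  shows "\<exists>N\<in>pfin_normals G p. \<forall>M\<in>\<N>. N \<subseteq> M"
  using assms(2,3)
proof (induction \<N>)
  case empty
  then show ?case using carrier_pfin by blast
next
  case (insert M \<N>)
  then obtain N where "N \<in> pfin_normals G p" "\<forall>M\<in>\<N>. N \<subseteq> M" by auto
  then show ?case using pfin_inter[OF p, of N M] insert.prems by (intro bexI[of _ "N \<inter> M"]) auto
qed

lemma pfin_preimage:
  assumes p: "prime p" and S: "group S" and G: "group G" and j: "j \<in> hom S G"
    and K: "K \<in> pfin_normals G p"
  shows "{s \<in> carrier S. j s \<in> K} \<in> pfin_normals S p"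
proof -
  interpret S: group S by fact
  interpret G: group G by fact
  interpret j: group_hom S G j using S G j by (simp add: group_hom_def group_hom_axioms_def)
  interpret K: normal K G by (rule pfinD(1)[OF K])
  let ?L = "{s \<in> carrier S. j s \<in> K}"
  have sub: "subgroup ?L S"
    by (rule S.subgroupI) auto
  have nor: "?L \<lhd> S"
    unfolding S.normal_inv_iff using sub K.inv_op_closed2 by auto
  have "finite ((\<lambda>s. K #>\<^bsub>G\<^esub> j s) ` carrier S)"
    by (rule finite_subset[OF _ pfinD(3)[OF K]]) (auto intro!: G.rcosetsI pfinD(4)[OF K])
  then have "finite (rcosets\<^bsub>S\<^esub> ?L)"
    by (rule S.finite_index_via[OF nor]) (use G.normal_Mod_eq_iff[OF pfinD(1)[OF K]] in auto)
  moreover have "\<exists>k. s [^]\<^bsub>S\<^esub> (p ^ k) \<in> ?L" if s: "s \<in> carrier S" for s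
  proof -
    obtain k where "j s [^]\<^bsub>G\<^esub> (p ^ k) \<in> K" using K j.hom_closed[OF s] unfolding G.pfin_iff[OF p] by blast
    then show ?thesis using s by (auto simp flip: j.hom_nat_pow intro!: exI[of _ k])
  qed
  ultimately show ?thesis using nor unfolding S.pfin_iff[OF p] by blast
qed

lemma (in group) pfin_superset:
  assumes p: "prime p" and L: "L \<in> pfin_normals G p" and M: "M \<lhd> G" "L \<subseteq> M"
  shows "M \<in> pfin_normals G p"
proof -
  have "finite ((\<lambda>x. L #> x) ` carrier G)"
    by (rule finite_subset[OF _ pfinD(3)[OF L]]) (auto simp: RCOSETS_def)
  then have "finite (rcosets M)"
    by (rule finite_index_via[OF M(1)]) (use normal_Mod_eq_iff[OF pfinD(1)[OF L]] M in blast)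
  then show ?thesis using L M unfolding pfin_iff[OF p] by blast
qed

section \<open>Fixed points of finite p-groups and central elements of order p\<close>

text \<open>Orbit sizes are powers of \<open>p\<close>. Without a second fixed point all orbits but
  one would have size divisible by \<open>p\<close>, and \<open>card E\<close> would be 1 modulo
  \<open>p\<close>.\<close>

lemma (in group_action) p_group_second_fixed_point:
  assumes p: "prime p" and ordG: "Coset.order G = p ^ k"
    and fin: "finite E" and dvd: "p dvd card E"
    and x: "x \<in> E" "\<And>g. g \<in> carrier G \<Longrightarrow> \<phi> g x = x"
  shows "\<exists>y\<in>E. y \<noteq> x \<and> (\<forall>g\<in>carrier G. \<phi> g y = y)"
proof (rule ccontr)
  assume neg: "\<not> ?thesis"
  interpret G: group G using group_hom by (simp add: group_hom_def)
  have part: "partition E (orbits G E \<phi>)" by (rule orbit_partition)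
  have finO: "finite (orbits G E \<phi>)" unfolding orbits_def using fin by auto
  have un: "\<Union>(orbits G E \<phi>) = E" using orbits_coverture .
  have orbx: "orbit G \<phi> x = {x}" unfolding orbit_def using x by (auto intro!: exI[of _ "\<one>"])
  have xin: "{x} \<in> orbits G E \<phi>" unfolding orbits_def using orbx x by auto
  have pd: "p dvd card Or" if Or: "Or \<in> orbits G E \<phi> - {{x}}" for Or
  proof -
    obtain y where y: "y \<in> E" "Or = orbit G \<phi> y" using Or unfolding orbits_def by auto
    have "card Or dvd p ^ k" using orbit_stabilizer_theorem[OF y(1)] ordG y(2) by (metis dvd_triv_left)
    then obtain i where i: "card Or = p ^ i" using p by (metis divides_primepow_nat)
    show ?thesis
    proof (cases "i = 0")
      case True
      then obtain z where z: "Or = {z}" using i by (metis card_1_singletonE power_0)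
      have "y \<in> Or" using orbit_refl[OF y(1)] y by simp
      then have "Or = {y}" using z by auto
      then have "\<forall>g\<in>carrier G. \<phi> g y = y" using y(2) unfolding orbit_def by blast
      then have "y = x" using neg y by blast
      then show ?thesis using Or \<open>Or = {y}\<close> by simp
    qed (use i in auto)
  qed
  have "card E = (\<Sum>Or\<in>orbits G E \<phi>. card Or)"
    using card_Union_disjoint[of "orbits G E \<phi>"] un fin finO disjoint_union
    by (metis (no_types, lifting) Union_upper finite_subset pairwiseI disjnt_def)
  also have "\<dots> = 1 + (\<Sum>Or\<in>orbits G E \<phi> - {{x}}. card Or)"
    using finO xin by (simp add: sum.remove)
  finally have "card E = 1 + (\<Sum>Or\<in>orbits G E \<phi> - {{x}}. card Or)" .
  moreover have "p dvd (\<Sum>Or\<in>orbits G E \<phi> - {{x}}. card Or)" using pd by (rule dvd_sum)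
  ultimately have "p dvd 1" using dvd by (metis dvd_add_left_iff)
  then show False using p by auto
qed

text \<open>Conjugation on \<open>R\<close> fixes the identity and hence another element, which is
  central; a suitable power of it has order \<open>p\<close>.\<close>

lemma (in group) p_group_normal_meets_centre:
  assumes p: "prime p" and ordG: "Coset.order G = p ^ k"
    and R: "R \<lhd> G" "R \<noteq> {\<one>}"
  shows "\<exists>z\<in>R. z \<noteq> \<one> \<and> z [^] p = \<one> \<and> (\<forall>g\<in>carrier G. g \<otimes> z \<otimes> inv g = z)"
proof -
  interpret R: normal R G by fact
  have finG: "finite (carrier G)" using ordG p
    by (metis order_gt_0_iff_finite prime_gt_0_nat zero_less_power)
  then have finR: "finite R" using R.subset finite_subset by blast
  \<comment> \<open>\<open>BijGroup\<close> consists of extensional maps, hence the restriction to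
    \<open>R\<close>.\<close>
  define \<phi> where "\<phi> = (\<lambda>g. \<lambda>h\<in>R. g \<otimes> h \<otimes> inv g)"
  have \<phi>R: "\<phi> g h \<in> R" if "g \<in> carrier G" "h \<in> R" for g h
    using that R.inv_op_closed2 by (simp add: \<phi>_def)
  have conj2: "g \<otimes> (h \<otimes> x \<otimes> inv h) \<otimes> inv g = (g \<otimes> h) \<otimes> x \<otimes> inv (g \<otimes> h)"
    if "g \<in> carrier G" "h \<in> carrier G" "x \<in> carrier G" for g h x
    using that by (simp add: m_assoc inv_mult_group)
  have undo: "g \<otimes> (inv g \<otimes> x \<otimes> g) \<otimes> inv g = x" "inv g \<otimes> (g \<otimes> x \<otimes> inv g) \<otimes> g = x"
    if "g \<in> carrier G" "x \<in> carrier G" for g x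
    using conj2[of g "inv g" x] conj2[of "inv g" g x] that by simp_all
  have B: "\<phi> g \<in> Bij R" if g: "g \<in> carrier G" for g
  proof -
    have "bij_betw (\<phi> g) R R"
    proof (rule bij_betw_byWitness[where f' = "\<phi> (inv g)"])
      show "\<forall>a\<in>R. \<phi> (inv g) (\<phi> g a) = a" "\<forall>a\<in>R. \<phi> g (\<phi> (inv g) a) = a"
        using g R.inv_op_closed2[of g] R.inv_op_closed1[of g] R.mem_carrier undo
        by (simp_all add: \<phi>_def)
    qed (use g \<phi>R in auto)
    then show ?thesis by (simp add: Bij_def \<phi>_def)
  qed
  have "\<phi> \<in> hom G (BijGroup R)"
  proof (rule homI)
    fix g assume g: "g \<in> carrier G"
    show "\<phi> g \<in> carrier (BijGroup R)" using B[OF g] by (simp add: BijGroup_def)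
  next
    fix g h assume gh: "g \<in> carrier G" "h \<in> carrier G"
    have "\<phi> (g \<otimes> h) = compose R (\<phi> g) (\<phi> h)"
      using gh R.inv_op_closed2 conj2 by (auto simp: \<phi>_def compose_def fun_eq_iff R.mem_carrier)
    then show "\<phi> (g \<otimes> h) = \<phi> g \<otimes>\<^bsub>BijGroup R\<^esub> \<phi> h"
      using gh B by (simp add: BijGroup_def)
  qed
  then interpret \<phi>: group_action G R \<phi>
    by (simp add: group_action_def group_hom_def group_hom_axioms_def is_group group_BijGroup)
  have "card R dvd p ^ k" using lagrange[OF R.subgroup_axioms] ordG by (metis dvd_triv_right)
  then obtain i where i: "card R = p ^ i" using p by (metis divides_primepow_nat)
  have "i \<noteq> 0" using i R(2) R.one_closed by (metis card_1_singletonE power_0 singletonD)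
  then have pR: "p dvd card R" using i by auto
  obtain y where y: "y \<in> R" "y \<noteq> \<one>" "\<forall>g\<in>carrier G. \<phi> g y = y"
    using \<phi>.p_group_second_fixed_point[OF p ordG finR pR R.one_closed] R.one_closed
    by (auto simp: \<phi>_def)
  then have cen: "g \<otimes> y \<otimes> inv g = y" if "g \<in> carrier G" for g
    using that by (auto simp: \<phi>_def)
  have yc: "y \<in> carrier G" using y R.mem_carrier by blast
  have "ord y dvd p ^ k" using ord_dvd_group_order[OF yc] ordG by simp
  then obtain l where l: "ord y = p ^ l" using p by (metis divides_primepow_nat)
  have "l \<noteq> 0" using l y ord_eq_1[OF yc] by (metis power_0)
  \<comment> \<open>As \<open>y\<close> has order \<open>p ^ l\<close>, this power has order exactly
    \<open>p\<close>.\<close>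
  define z where "z = y [^] (p ^ (l - 1))"
  have "z \<noteq> \<one>"
  proof
    assume "z = \<one>"
    then have "p ^ l dvd p ^ (l - 1)" unfolding z_def using pow_eq_id[OF yc] l by metis
    then have "l \<le> l - 1" using p by (metis power_dvd_imp_le prime_gt_1_nat)
    then show False using \<open>l \<noteq> 0\<close> by simp
  qed
  moreover have "z [^] p = \<one>"
  proof -
    have "z [^] p = y [^] (p ^ (l - 1) * p)" unfolding z_def by (rule nat_pow_pow[OF yc])
    also have "p ^ (l - 1) * p = p ^ l" using \<open>l \<noteq> 0\<close> by (metis power_minus_mult neq0_conv)
    finally show ?thesis using pow_ord_eq_1[OF yc] l by metis
  qed
  moreover have "z \<in> R" unfolding z_def
    using y(1) R.subgroup_axioms by (rule subgroup_nat_pow_closed[rotated])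
  moreover have "g \<otimes> z \<otimes> inv g = z" if g: "g \<in> carrier G" for g
  proof -
    have "g \<otimes> y = y \<otimes> g" using cen[OF g] g yc by (metis inv_closed inv_solve_right m_closed)
    then have "z \<otimes> g = g \<otimes> z" unfolding z_def using group_commutes_pow[of y g] g yc by metis
    then show ?thesis using g yc unfolding z_def by (metis inv_solve_right m_closed nat_pow_closed)
  qed
  ultimately show ?thesis by blast
qed

lemma (in group) coset_mult_cong:
  assumes "N \<lhd> G" "x \<in> carrier G" "x' \<in> carrier G" "y \<in> carrier G" "y' \<in> carrier G"
    "N #> x = N #> x'" "N #> y = N #> y'"
  shows "N #> (x \<otimes> y) = N #> (x' \<otimes> y')"
  using normal.rcos_sum[OF assms(1)] assms by metis

lemma (in group) coset_mult_left_cancel: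
  assumes "N \<lhd> G" "x \<in> carrier G" "y \<in> carrier G" "y' \<in> carrier G"
  shows "N #> (x \<otimes> y) = N #> (x \<otimes> y') \<longleftrightarrow> N #> y = N #> y'"
proof
  assume "N #> (x \<otimes> y) = N #> (x \<otimes> y')"
  then have "N #> (inv x \<otimes> (x \<otimes> y)) = N #> (inv x \<otimes> (x \<otimes> y'))"
    using assms by (simp only: coset_mult_cong[of N "inv x" "inv x" "x \<otimes> y" "x \<otimes> y'"] m_closed inv_closed)
  moreover have "inv x \<otimes> (x \<otimes> y) = y" "inv x \<otimes> (x \<otimes> y') = y'"
    using assms by (simp_all add: m_assoc[symmetric])
  ultimately show "N #> y = N #> y'" by simp
qed (rule coset_mult_cong[OF assms(1)], use assms in auto)

lemma (in group) coset_mult_right_cancel: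
  assumes "N \<lhd> G" "x \<in> carrier G" "y \<in> carrier G" "y' \<in> carrier G"
  shows "N #> (y \<otimes> x) = N #> (y' \<otimes> x) \<longleftrightarrow> N #> y = N #> y'"
proof
  assume "N #> (y \<otimes> x) = N #> (y' \<otimes> x)"
  then have "N #> ((y \<otimes> x) \<otimes> inv x) = N #> ((y' \<otimes> x) \<otimes> inv x)"
    using assms by (simp only: coset_mult_cong[of N "y \<otimes> x" "y' \<otimes> x" "inv x" "inv x"] m_closed inv_closed)
  moreover have "(y \<otimes> x) \<otimes> inv x = y" "(y' \<otimes> x) \<otimes> inv x = y'"
    using assms by (simp_all add: m_assoc)
  ultimately show "N #> y = N #> y'" by simp
qed (rule coset_mult_cong[OF assms(1)], use assms in auto)

lemma (in group) coset_eq_subgroup_iff: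
  assumes "N \<lhd> G" "x \<in> carrier G"
  shows "N #> x = N \<longleftrightarrow> x \<in> N"
  by (metis assms coset_join1 coset_join2 normal_imp_subgroup subgroup.subset)

lemma (in group) coset_inv_mult_eq_iff:
  assumes "N \<lhd> G" "x \<in> carrier G" "y \<in> carrier G"
  shows "N #> x = N #> y \<longleftrightarrow> inv x \<otimes> y \<in> N"
proof -
  have "N #> x = N #> y \<longleftrightarrow> N #> (inv x \<otimes> x) = N #> (inv x \<otimes> y)"
    using coset_mult_left_cancel[OF assms(1), of "inv x" x y] assms by simp
  also have "\<dots> \<longleftrightarrow> N = N #> (inv x \<otimes> y)"
    using assms by (simp add: normal_imp_subgroup subgroup.subset)
  also have "\<dots> \<longleftrightarrow> inv x \<otimes> y \<in> N"
    using coset_eq_subgroup_iff[OF assms(1), of "inv x \<otimes> y"] assms by auto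
  finally show ?thesis .
qed

text \<open>For prime \<open>p\<close>: \<open>z\<close> represents a central element of order
  \<open>p\<close> in the quotient by \<open>L\<close>. The condition is put on a representative and
  not on a coset, so that \<open>i1 a\<close> and \<open>i2 a\<close> can satisfy it for one and the
  same \<open>a\<close>.\<close>

definition central_mod :: "('a, 'm) monoid_scheme \<Rightarrow> nat \<Rightarrow> 'a set \<Rightarrow> 'a \<Rightarrow> bool" where
  "central_mod G p L z \<longleftrightarrow> z \<in> carrier G \<and> z \<notin> L \<and> z [^]\<^bsub>G\<^esub> p \<in> L \<and>
     (\<forall>g\<in>carrier G. L #>\<^bsub>G\<^esub> (g \<otimes>\<^bsub>G\<^esub> z) = L #>\<^bsub>G\<^esub> (z \<otimes>\<^bsub>G\<^esub> g))"

text \<open>The preimage of the subgroup generated by \<open>z\<close> in the quotient by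
  \<open>L\<close>; natural exponents suffice because \<open>z\<close> has finite order
  there.\<close>

definition central_ext :: "('a, 'm) monoid_scheme \<Rightarrow> 'a set \<Rightarrow> 'a \<Rightarrow> 'a set" where
  "central_ext G L z = {g \<in> carrier G. \<exists>i::nat. L #>\<^bsub>G\<^esub> g = L #>\<^bsub>G\<^esub> (z [^]\<^bsub>G\<^esub> i)}"

text \<open>The image of \<open>N\<close> in the p-group of cosets of \<open>L\<close> is a
  nontrivial normal subgroup, so it meets the centre in an element of order \<open>p\<close>. This
  supplies the elementary step of the inductions over p-finite quotients.\<close>

lemma (in group) ex_central_mod:
  assumes p: "prime p" and L: "L \<in> pfin_normals G p"
    and N: "N \<lhd> G" "L \<subset> N"
  shows "\<exists>z\<in>N. central_mod G p L z"
proof -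
  interpret L: normal L G by (rule pfinD(1)[OF L])
  interpret Q: group "G Mod L" by (rule L.factorgroup_is_group)
  interpret N: normal N G by (rule N(1))
  let ?R = "(\<lambda>x. L #> x) ` N"
  obtain k where k: "Coset.order (G Mod L) = p ^ k"
    using L unfolding pfin_normals_def by (auto simp: Coset.order_def FactGroup_def)
  have R: "?R \<lhd> G Mod L"
  proof -
    have sub: "subgroup ?R (G Mod L)"
    proof (rule Q.subgroupI)
      show "?R \<subseteq> carrier (G Mod L)" using N.mem_carrier by (auto simp: carrier_FactGroup)
      show "?R \<noteq> {}" using N.one_closed by blast
    next
      fix a assume "a \<in> ?R"
      then obtain x where x: "x \<in> N" "a = L #> x" by blast
      then have "inv\<^bsub>G Mod L\<^esub> a = L #> inv x"
        using L.inv_FactGroup[of a] L.rcos_inv N.mem_carrier by (auto simp: carrier_FactGroup)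
      then show "inv\<^bsub>G Mod L\<^esub> a \<in> ?R" using x by auto
    next
      fix a b assume "a \<in> ?R" "b \<in> ?R"
      then show "a \<otimes>\<^bsub>G Mod L\<^esub> b \<in> ?R" using L.rcos_sum N.mem_carrier by auto
    qed
    have "x \<otimes>\<^bsub>G Mod L\<^esub> h \<otimes>\<^bsub>G Mod L\<^esub> inv\<^bsub>G Mod L\<^esub> x \<in> ?R"
      if x: "x \<in> carrier (G Mod L)" and h: "h \<in> ?R" for x h
    proof -
      obtain g where g: "g \<in> carrier G" "x = L #> g" using x unfolding carrier_FactGroup by blast
      obtain n where n: "n \<in> N" "h = L #> n" using h by blast
      have "inv\<^bsub>G Mod L\<^esub> x = L #> inv g"
        using L.inv_FactGroup[of x] L.rcos_inv g by (auto simp: carrier_FactGroup)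
      then have "x \<otimes>\<^bsub>G Mod L\<^esub> h \<otimes>\<^bsub>G Mod L\<^esub> inv\<^bsub>G Mod L\<^esub> x = L #> (g \<otimes> n \<otimes> inv g)"
        using g n L.rcos_sum N.mem_carrier by simp
      then show ?thesis using N.inv_op_closed2[OF g(1) n(1)] by auto
    qed
    then show ?thesis unfolding Q.normal_inv_iff using sub by blast
  qed
  obtain n where "n \<in> N" "n \<notin> L" using N by blast
  then have "L #> n \<noteq> L" using coset_eq_subgroup_iff[OF L.normal_axioms] N.mem_carrier by blast
  then have "?R \<noteq> {\<one>\<^bsub>G Mod L\<^esub>}" using \<open>n \<in> N\<close> by auto
  from Q.p_group_normal_meets_centre[OF p k R this]
  obtain c where c: "c \<in> ?R" "c \<noteq> L" "c [^]\<^bsub>G Mod L\<^esub> p = \<one>\<^bsub>G Mod L\<^esub>"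
    "\<And>g. g \<in> carrier (G Mod L) \<Longrightarrow> g \<otimes>\<^bsub>G Mod L\<^esub> c \<otimes>\<^bsub>G Mod L\<^esub> inv\<^bsub>G Mod L\<^esub> g = c"
    by auto
  then obtain z where z: "z \<in> N" "c = L #> z" by blast
  have zc: "z \<in> carrier G" using z N.mem_carrier by blast
  have cc: "c \<in> carrier (G Mod L)" using zc z by (auto simp: carrier_FactGroup)
  have "L #> (g \<otimes> z) = L #> (z \<otimes> g)" if g: "g \<in> carrier G" for g
  proof -
    have gc: "L #> g \<in> carrier (G Mod L)" using g by (auto simp: carrier_FactGroup)
    have "(L #> g) \<otimes>\<^bsub>G Mod L\<^esub> c = c \<otimes>\<^bsub>G Mod L\<^esub> (L #> g)"
      using c(4)[OF gc] gc cc by (metis Q.inv_solve_right Q.m_closed)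
    then show ?thesis using z g zc L.rcos_sum by simp
  qed
  moreover have "z \<notin> L" using c(2) z coset_eq_subgroup_iff[OF L.normal_axioms zc] by blast
  moreover have "z [^] p \<in> L" using c(3) z Mod_pow_eq_one_iff[OF L.normal_axioms zc] by blast
  ultimately show ?thesis using z zc unfolding central_mod_def by blast
qed

context group begin

context
  fixes p L z
  assumes p: "prime p" and L: "L \<in> pfin_normals G p" and z: "central_mod G p L z"
begin

lemma central_mod_closed: "z \<in> carrier G" using z by (simp add: central_mod_def)

lemma central_mod_pow_cong:
  "L #> (z [^] (i::nat)) = L #> (z [^] (j::nat)) \<longleftrightarrow> [int i = int j] (mod int p)"
proof -
  interpret L: normal L G by (rule pfinD(1)[OF L])
  interpret Q: group "G Mod L" by (rule L.factorgroup_is_group)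
  have zc: "z \<in> carrier G" by (rule central_mod_closed)
  let ?c = "L #> z"
  have cc: "?c \<in> carrier (G Mod L)" using zc by (auto simp: carrier_FactGroup)
  have "?c [^]\<^bsub>G Mod L\<^esub> p = \<one>\<^bsub>G Mod L\<^esub>"
    using z Mod_pow_eq_one_iff[OF L.normal_axioms zc] unfolding central_mod_def by blast
  then have "Q.ord ?c dvd p" using Q.pow_eq_id[OF cc] by blast
  moreover have "?c \<noteq> \<one>\<^bsub>G Mod L\<^esub>"
    using z coset_eq_subgroup_iff[OF L.normal_axioms zc] unfolding central_mod_def by simp
  then have "Q.ord ?c \<noteq> 1" using Q.ord_eq_1[OF cc] by blast
  ultimately have ord: "Q.ord ?c = p" using p by (metis prime_nat_iff)
  have "L #> (z [^] i) = L #> (z [^] j) \<longleftrightarrow> ?c [^]\<^bsub>G Mod L\<^esub> i = ?c [^]\<^bsub>G Mod L\<^esub> j"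
    using L.FactGroup_pow[OF zc] by simp
  also have "\<dots> \<longleftrightarrow> ?c [^]\<^bsub>G Mod L\<^esub> int i = ?c [^]\<^bsub>G Mod L\<^esub> int j" by (simp add: int_pow_int)
  also have "\<dots> \<longleftrightarrow> [int i = int j] (mod int p)"
    using Q.int_pow_eq[OF cc, of "int i" "int j"] ord by (simp add: cong_iff_dvd_diff dvd_diff_commute)
  finally show ?thesis .
qed

lemma central_mod_pow_comm:
  assumes "g \<in> carrier G"
  shows "L #> (g \<otimes> z [^] (i::nat)) = L #> (z [^] i \<otimes> g)"
proof (induction i)
  case (Suc i)
  have zc: "z \<in> carrier G" by (rule central_mod_closed)
  have "L #> (g \<otimes> z [^] Suc i) = L #> ((g \<otimes> z [^] i) \<otimes> z)" using assms zc by (simp add: m_assoc)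
  also have "\<dots> = L #> ((z [^] i \<otimes> g) \<otimes> z)"
    by (rule coset_mult_cong[OF pfinD(1)[OF L]]) (use assms zc Suc in auto)
  also have "\<dots> = L #> (z [^] i \<otimes> (g \<otimes> z))" using assms zc by (simp add: m_assoc)
  also have "\<dots> = L #> (z [^] i \<otimes> (z \<otimes> g))"
    by (rule coset_mult_cong[OF pfinD(1)[OF L]]) (use assms zc z in \<open>auto simp: central_mod_def\<close>)
  also have "\<dots> = L #> (z [^] Suc i \<otimes> g)" using assms zc by (simp add: m_assoc)
  finally show ?case .
qed (use assms in simp)

lemma central_ext_subset: "L \<subseteq> central_ext G L z"
proof
  fix x assume x: "x \<in> L"
  then have xc: "x \<in> carrier G" using pfinD(4)[OF L] by blast
  then have "L #> x = L #> z [^] (0::nat)"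
    using coset_eq_subgroup_iff[OF pfinD(1)[OF L] xc] x pfinD(4)[OF L] by simp
  then show "x \<in> central_ext G L z" using xc unfolding central_ext_def by blast
qed

lemma central_mod_in_ext: "z \<in> central_ext G L z"
  using central_mod_closed unfolding central_ext_def by (auto intro!: exI[of _ "1::nat"])

lemma central_ext_pfin: "central_ext G L z \<in> pfin_normals G p"
proof (rule pfin_superset[OF p L _ central_ext_subset])
  have zc: "z \<in> carrier G" by (rule central_mod_closed)
  note LN = pfinD(1)[OF L]
  have sub: "subgroup (central_ext G L z) G"
  proof (rule subgroupI)
    show "central_ext G L z \<subseteq> carrier G" unfolding central_ext_def by blast
    show "central_ext G L z \<noteq> {}" using central_mod_in_ext by blast
  next
    fix a assume "a \<in> central_ext G L z"
    then obtain i where a: "a \<in> carrier G" and i: "L #> a = L #> z [^] (i::nat)"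
      unfolding central_ext_def by blast
    \<comment> \<open>Since \<open>z [^] p\<close> lies in \<open>L\<close>, the exponent
      \<open>i * (p - 1)\<close> inverts \<open>z [^] i\<close> without negative powers.\<close>
    have "L #> (z [^] (i * (p - 1)) \<otimes> a) = L #> (z [^] (i * (p - 1)) \<otimes> z [^] i)"
      by (rule coset_mult_cong[OF LN]) (use a i zc in auto)
    also have "z [^] (i * (p - 1)) \<otimes> z [^] i = z [^] (i * p)"
      using zc p by (simp add: nat_pow_mult flip: mult_Suc_right)
        (metis add.commute mult_Suc_right Suc_pred prime_gt_0_nat One_nat_def)
    also have "L #> z [^] (i * p) = L #> z [^] (0::nat)"
      unfolding central_mod_pow_cong by (simp add: cong_def)
    also have "\<dots> = L #> (inv a \<otimes> a)" using a by simp
    finally have "L #> inv a = L #> z [^] (i * (p - 1))"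
      using coset_mult_right_cancel[OF LN, of a "z [^] (i * (p - 1))" "inv a"] a zc by simp
    then show "inv a \<in> central_ext G L z" using a unfolding central_ext_def by blast
  next
    fix a b assume "a \<in> central_ext G L z" "b \<in> central_ext G L z"
    then obtain i j where ab: "a \<in> carrier G" "b \<in> carrier G" "L #> a = L #> z [^] (i::nat)"
      "L #> b = L #> z [^] (j::nat)" unfolding central_ext_def by blast
    have "L #> (a \<otimes> b) = L #> (z [^] i \<otimes> z [^] j)"
      by (rule coset_mult_cong[OF LN]) (use ab zc in auto)
    then show "a \<otimes> b \<in> central_ext G L z"
      using ab zc unfolding central_ext_def by (auto simp: nat_pow_mult)
  qed
  have "x \<otimes> h \<otimes> inv x \<in> central_ext G L z" if x: "x \<in> carrier G" and h: "h \<in> central_ext G L z" for x h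
  proof -
    obtain i where h: "h \<in> carrier G" "L #> h = L #> z [^] (i::nat)"
      using h unfolding central_ext_def by blast
    have "L #> (x \<otimes> h \<otimes> inv x) = L #> (x \<otimes> z [^] i \<otimes> inv x)"
      by (intro coset_mult_cong[OF LN]) (use x h zc in auto)
    also have "\<dots> = L #> (z [^] i \<otimes> x \<otimes> inv x)"
      by (rule coset_mult_cong[OF LN]) (use x h zc central_mod_pow_comm[OF x] in auto)
    also have "\<dots> = L #> z [^] i" using x zc by (simp add: m_assoc)
    finally show ?thesis using x h unfolding central_ext_def by blast
  qed
  then show "central_ext G L z \<lhd> G" unfolding normal_inv_iff using sub by blast
qed

text \<open>The exponent of \<open>z\<close> identifies \<open>central_ext G L z\<close> modulo
  \<open>L\<close> with Z/p. It is a homomorphism with kernel \<open>L\<close>, and conjugation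
  preserves it because \<open>z\<close> is central modulo \<open>L\<close>.\<close>

lemma ex_central_character:
  "\<exists>\<psi>::'a \<Rightarrow> int. (\<forall>g\<in>central_ext G L z. \<forall>h\<in>central_ext G L z. [\<psi> (g \<otimes> h) = \<psi> g + \<psi> h] (mod int p)) \<and>
    (\<forall>g\<in>central_ext G L z. [\<psi> g = 0] (mod int p) \<longrightarrow> g \<in> L) \<and>
    (\<forall>g\<in>carrier G. \<forall>h\<in>central_ext G L z. [\<psi> (g \<otimes> h \<otimes> inv g) = \<psi> h] (mod int p)) \<and>
    (\<forall>g\<in>central_ext G L z. \<forall>i::nat. L #> g = L #> z [^] i \<longrightarrow> [\<psi> g = int i] (mod int p))"
proof -
  have zc: "z \<in> carrier G" by (rule central_mod_closed)
  note LN = pfinD(1)[OF L]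
  define n where "n = (\<lambda>g. SOME i::nat. L #> g = L #> z [^] i)"
  have n: "L #> g = L #> z [^] n g" if "g \<in> central_ext G L z" for g
    using that someI_ex[of "\<lambda>i::nat. L #> g = L #> z [^] i"] unfolding central_ext_def n_def by blast
  have eq: "[int (n g) = int i] (mod int p)" if "g \<in> central_ext G L z" "L #> g = L #> z [^] i" for g i
    using n[OF that(1)] that(2) central_mod_pow_cong[of "n g" i] by simp
  have cl: "g \<in> carrier G" if "g \<in> central_ext G L z" for g using that unfolding central_ext_def by blast
  have "[int (n (g \<otimes> h)) = int (n g) + int (n h)] (mod int p)"
    if gh: "g \<in> central_ext G L z" "h \<in> central_ext G L z" for g h
  proof -
    have "L #> (g \<otimes> h) = L #> (z [^] n g \<otimes> z [^] n h)"
      by (rule coset_mult_cong[OF LN]) (use n[OF gh(1)] n[OF gh(2)] cl gh zc in auto)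
    also have "\<dots> = L #> z [^] (n g + n h)" using zc by (simp add: nat_pow_mult)
    finally have "L #> (g \<otimes> h) = L #> z [^] (n g + n h)" .
    moreover have "g \<otimes> h \<in> central_ext G L z"
      using gh pfinD(2)[OF central_ext_pfin] subgroup.m_closed by metis
    ultimately show ?thesis using eq[of "g \<otimes> h" "n g + n h"] by simp
  qed
  moreover have "g \<in> L" if g: "g \<in> central_ext G L z" "[int (n g) = 0] (mod int p)" for g
  proof -
    have "L #> g = L #> z [^] (0::nat)"
      using n[OF g(1)] central_mod_pow_cong[of "n g" 0] g(2) by simp
    then show ?thesis using coset_eq_subgroup_iff[OF LN cl[OF g(1)]] pfinD(4)[OF L] by simp
  qed
  moreover have "[int (n (g \<otimes> h \<otimes> inv g)) = int (n h)] (mod int p)"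
    if g: "g \<in> carrier G" and h: "h \<in> central_ext G L z" for g h
  proof -
    have "L #> (g \<otimes> h \<otimes> inv g) = L #> (g \<otimes> z [^] n h \<otimes> inv g)"
      by (intro coset_mult_cong[OF LN]) (use g n[OF h] cl[OF h] zc in auto)
    also have "\<dots> = L #> (z [^] n h \<otimes> g \<otimes> inv g)"
      by (rule coset_mult_cong[OF LN]) (use g zc central_mod_pow_comm[OF g] in auto)
    also have "\<dots> = L #> z [^] n h" using g zc by (simp add: m_assoc)
    finally show ?thesis
      using eq normal.inv_op_closed2[OF pfinD(1)[OF central_ext_pfin] g h] by blast
  qed
  ultimately show ?thesis using eq by (intro exI[of _ "\<lambda>g. int (n g)"]) simp
qed

end

end

section \<open>Sections of orbit maps\<close>

text \<open>\<open>S\<close> acts on the cosets of \<open>K\<close> by translation through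
  \<open>j\<close>. With one representative chosen per orbit, \<open>\<sigma> x\<close> carries the
  representative to the coset of \<open>x\<close>. It is equivariant only up to the stabiliser,
  which is the preimage of \<open>K\<close> because \<open>K\<close> is normal. For trivial
  \<open>K\<close> and injective \<open>j\<close> it is an equivariant map from \<open>G\<close> to
  \<open>S\<close>.\<close>

lemma equivariant_section:
  assumes S: "group S" and G: "group G" and j: "j \<in> hom S G" and K: "K \<lhd> G"
  obtains \<sigma> where "\<And>x. x \<in> carrier G \<Longrightarrow> \<sigma> x \<in> carrier S"
    "\<And>x y. x \<in> carrier G \<Longrightarrow> y \<in> carrier G \<Longrightarrow> K #>\<^bsub>G\<^esub> x = K #>\<^bsub>G\<^esub> y \<Longrightarrow> \<sigma> x = \<sigma> y"
    "\<And>x s. x \<in> carrier G \<Longrightarrow> s \<in> carrier S \<Longrightarrow>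
      K #>\<^bsub>G\<^esub> j (\<sigma> (j s \<otimes>\<^bsub>G\<^esub> x)) = K #>\<^bsub>G\<^esub> j (s \<otimes>\<^bsub>S\<^esub> \<sigma> x)"
proof -
  interpret S: group S by fact
  interpret G: group G by fact
  interpret j: group_hom S G j using S G j by (simp add: group_hom_def group_hom_axioms_def)
  define orb where "orb x = {y \<in> carrier G. \<exists>s\<in>carrier S. K #>\<^bsub>G\<^esub> y = K #>\<^bsub>G\<^esub> (j s \<otimes>\<^bsub>G\<^esub> x)}" for x
  \<comment> \<open>Choosing from the orbit as a set makes \<open>rep\<close> equal, not merely
    equivalent, at all points of an orbit; likewise \<open>\<sigma>\<close> depends on the coset
    alone.\<close>
  define rep where "rep x = (SOME y. y \<in> orb x)" for x
  define \<sigma> where "\<sigma> x = (SOME s. s \<in> carrier S \<and> K #>\<^bsub>G\<^esub> x = K #>\<^bsub>G\<^esub> (j s \<otimes>\<^bsub>G\<^esub> rep x))" for x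
  have orb_cong: "orb x = orb y" if "x \<in> carrier G" "y \<in> carrier G" "K #>\<^bsub>G\<^esub> x = K #>\<^bsub>G\<^esub> y" for x y
  proof -
    have "K #>\<^bsub>G\<^esub> (j s \<otimes>\<^bsub>G\<^esub> x) = K #>\<^bsub>G\<^esub> (j s \<otimes>\<^bsub>G\<^esub> y)" if "s \<in> carrier S" for s
      using \<open>K #>\<^bsub>G\<^esub> x = K #>\<^bsub>G\<^esub> y\<close> \<open>x \<in> carrier G\<close> \<open>y \<in> carrier G\<close> that
      by (simp add: G.coset_mult_left_cancel[OF K])
    then show ?thesis unfolding orb_def by auto
  qed
  have sub: "orb (j s \<otimes>\<^bsub>G\<^esub> x) \<subseteq> orb x" if "x \<in> carrier G" "s \<in> carrier S" for s x
  proof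
    fix y assume "y \<in> orb (j s \<otimes>\<^bsub>G\<^esub> x)"
    then obtain t where y: "y \<in> carrier G" and t: "t \<in> carrier S"
      and eq: "K #>\<^bsub>G\<^esub> y = K #>\<^bsub>G\<^esub> (j t \<otimes>\<^bsub>G\<^esub> (j s \<otimes>\<^bsub>G\<^esub> x))" unfolding orb_def by blast
    have "j t \<otimes>\<^bsub>G\<^esub> (j s \<otimes>\<^bsub>G\<^esub> x) = j (t \<otimes>\<^bsub>S\<^esub> s) \<otimes>\<^bsub>G\<^esub> x" using that t by (simp add: G.m_assoc)
    then have "K #>\<^bsub>G\<^esub> y = K #>\<^bsub>G\<^esub> (j (t \<otimes>\<^bsub>S\<^esub> s) \<otimes>\<^bsub>G\<^esub> x)" using eq by metis
    moreover have "t \<otimes>\<^bsub>S\<^esub> s \<in> carrier S" using t that by simp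
    ultimately show "y \<in> orb x" unfolding orb_def using y by blast
  qed
  have undo: "j (inv\<^bsub>S\<^esub> s) \<otimes>\<^bsub>G\<^esub> (j s \<otimes>\<^bsub>G\<^esub> x) = x" if "x \<in> carrier G" "s \<in> carrier S" for s x
    using that G.m_assoc[of "inv\<^bsub>G\<^esub> (j s)" "j s" x, symmetric] by simp
  have orb_act: "orb (j s \<otimes>\<^bsub>G\<^esub> x) = orb x" if "x \<in> carrier G" "s \<in> carrier S" for s x
  proof
    show "orb x \<subseteq> orb (j s \<otimes>\<^bsub>G\<^esub> x)"
      using sub[of "j s \<otimes>\<^bsub>G\<^esub> x" "inv\<^bsub>S\<^esub> s"] undo[OF that] that by simp
  qed (rule sub[OF that])
  have rep: "rep x \<in> carrier G" "\<exists>s\<in>carrier S. K #>\<^bsub>G\<^esub> x = K #>\<^bsub>G\<^esub> (j s \<otimes>\<^bsub>G\<^esub> rep x)"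
    if x: "x \<in> carrier G" for x
  proof -
    have "x \<in> orb x" unfolding orb_def using x by (auto intro!: bexI[of _ "\<one>\<^bsub>S\<^esub>"])
    then have r: "rep x \<in> orb x" unfolding rep_def by (rule someI)
    then show rc: "rep x \<in> carrier G" unfolding orb_def by blast
    obtain s where s: "s \<in> carrier S" "K #>\<^bsub>G\<^esub> rep x = K #>\<^bsub>G\<^esub> (j s \<otimes>\<^bsub>G\<^esub> x)" using r unfolding orb_def by blast
    have "K #>\<^bsub>G\<^esub> (j (inv\<^bsub>S\<^esub> s) \<otimes>\<^bsub>G\<^esub> rep x) = K #>\<^bsub>G\<^esub> (j (inv\<^bsub>S\<^esub> s) \<otimes>\<^bsub>G\<^esub> (j s \<otimes>\<^bsub>G\<^esub> x))"
      by (intro G.coset_mult_cong[OF K]) (use s rc x in auto)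
    also have "j (inv\<^bsub>S\<^esub> s) \<otimes>\<^bsub>G\<^esub> (j s \<otimes>\<^bsub>G\<^esub> x) = x" using undo s x by blast
    finally show "\<exists>s\<in>carrier S. K #>\<^bsub>G\<^esub> x = K #>\<^bsub>G\<^esub> (j s \<otimes>\<^bsub>G\<^esub> rep x)"
      using s by (intro bexI[of _ "inv\<^bsub>S\<^esub> s"]) auto
  qed
  have \<sigma>: "\<sigma> x \<in> carrier S" "K #>\<^bsub>G\<^esub> x = K #>\<^bsub>G\<^esub> (j (\<sigma> x) \<otimes>\<^bsub>G\<^esub> rep x)" if x: "x \<in> carrier G" for x
    using someI_ex[of "\<lambda>s. s \<in> carrier S \<and> K #>\<^bsub>G\<^esub> x = K #>\<^bsub>G\<^esub> (j s \<otimes>\<^bsub>G\<^esub> rep x)"] rep(2)[OF x]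
    unfolding \<sigma>_def by blast+
  have "\<sigma> x = \<sigma> y" if "x \<in> carrier G" "y \<in> carrier G" "K #>\<^bsub>G\<^esub> x = K #>\<^bsub>G\<^esub> y" for x y
    using orb_cong[OF that] that(3) unfolding \<sigma>_def rep_def by simp
  moreover have "K #>\<^bsub>G\<^esub> j (\<sigma> (j s \<otimes>\<^bsub>G\<^esub> x)) = K #>\<^bsub>G\<^esub> j (s \<otimes>\<^bsub>S\<^esub> \<sigma> x)"
    if x: "x \<in> carrier G" and s: "s \<in> carrier S" for x s
  proof -
    have c: "j s \<otimes>\<^bsub>G\<^esub> x \<in> carrier G" using x s by simp
    have "rep (j s \<otimes>\<^bsub>G\<^esub> x) = rep x" unfolding rep_def orb_act[OF x s] ..
    then have "K #>\<^bsub>G\<^esub> (j (\<sigma> (j s \<otimes>\<^bsub>G\<^esub> x)) \<otimes>\<^bsub>G\<^esub> rep x) = K #>\<^bsub>G\<^esub> (j s \<otimes>\<^bsub>G\<^esub> x)"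
      using \<sigma>(2)[OF c] by simp
    also have "\<dots> = K #>\<^bsub>G\<^esub> (j s \<otimes>\<^bsub>G\<^esub> (j (\<sigma> x) \<otimes>\<^bsub>G\<^esub> rep x))"
      by (intro G.coset_mult_cong[OF K]) (use \<sigma>[OF x] x s rep(1)[OF x] in auto)
    also have "\<dots> = K #>\<^bsub>G\<^esub> (j (s \<otimes>\<^bsub>S\<^esub> \<sigma> x) \<otimes>\<^bsub>G\<^esub> rep x)"
      using \<sigma>[OF x] x s rep(1)[OF x] by (simp add: G.m_assoc)
    finally show ?thesis
      using G.coset_mult_right_cancel[OF K rep(1)[OF x]] \<sigma>(1)[OF x] \<sigma>(1)[OF c] s by auto
  qed
  ultimately show thesis using that \<sigma>(1) by blast
qed

subsection \<open>Coefficients\<close>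

text \<open>\<open>e\<close> embeds $\mathbb{Z}/p$ into an abelian group, and its range \<open>V\<close> serves as the coefficient module:
  for a variable \<open>p\<close> there is no type of residues.\<close>

locale zmod_coeff =
  fixes p :: nat and e :: "int \<Rightarrow> 'k::ab_group_add"
  assumes prime_p: "prime p"
    and e_add: "e (a + b) = e a + e b"
    and e_eq_0_iff: "e a = 0 \<longleftrightarrow> int p dvd a"
begin

definition V :: "'k set" where "V = range e"

lemma e_in_V [simp]: "e a \<in> V" by (simp add: V_def)

lemma e_0 [simp]: "e 0 = 0" by (simp add: e_eq_0_iff)

lemma e_minus: "e (- a) = - e a"
  using e_add[of a "- a"] by (simp add: add_eq_0_iff)

lemma e_diff: "e (a - b) = e a - e b"
  using e_add[of a "- b"] by (simp add: e_minus)

lemma e_eq_iff: "e a = e b \<longleftrightarrow> [a = b] (mod int p)"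
  using e_eq_0_iff[of "a - b"] by (simp add: e_diff cong_iff_dvd_diff)

lemma V_0 [simp]: "0 \<in> V" using e_in_V[of 0] by simp

lemma V_add [simp]: "a \<in> V \<Longrightarrow> b \<in> V \<Longrightarrow> a + b \<in> V"
  by (auto simp: V_def simp flip: e_add)

lemma V_minus [simp]: "a \<in> V \<Longrightarrow> - a \<in> V"
  by (auto simp: V_def simp flip: e_minus)

lemma V_diff [simp]: "a \<in> V \<Longrightarrow> b \<in> V \<Longrightarrow> a - b \<in> V"
  by (auto simp: V_def simp flip: e_diff)

lemma V_sum: "(\<And>i. i \<in> I \<Longrightarrow> f i \<in> V) \<Longrightarrow> sum f I \<in> V"
  by (induction I rule: infinite_finite_induct) auto

lemma finite_V: "finite V"
proof -
  have "V \<subseteq> e ` {0..<int p}"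
  proof
    fix v assume "v \<in> V"
    then obtain a where "v = e a" by (auto simp: V_def)
    then have "v = e (a mod int p)" by (simp add: e_eq_iff cong_def)
    then show "v \<in> e ` {0..<int p}" using prime_gt_0_nat[OF prime_p] by auto
  qed
  then show ?thesis by (rule finite_subset) simp
qed

lemma sum_const_e: "(\<Sum>i<n. e a) = e (int n * a)" for n :: nat
  by (induction n) (simp_all add: algebra_simps e_add)

lemma sum_const_V: "v \<in> V \<Longrightarrow> p dvd n \<Longrightarrow> (\<Sum>i<n. v) = 0" for n :: nat
  by (auto simp: V_def sum_const_e e_eq_0_iff)

text \<open>\<delta> is a crossed homomorphism into the \<open>V\<close>-valued functions on the
  cosets of \<open>K\<close>, on which \<open>g\<close> acts by translating the argument.
  \<open>K\<close> acts trivially there, so \<delta> restricts to a homomorphism from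
  \<open>K\<close> into a finite elementary abelian p-group, and the kernel keeps p-power index in
  \<open>G\<close>.\<close>

lemma derivation_kernel_pfin:
  fixes G :: "('a, 'm) monoid_scheme" and \<delta> :: "'a \<Rightarrow> 'a \<Rightarrow> 'k"
  assumes G: "group G" and K: "K \<in> pfin_normals G p"
    and V: "\<And>g x. g \<in> carrier G \<Longrightarrow> x \<in> carrier G \<Longrightarrow> \<delta> g x \<in> V"
    and der: "\<And>g h x. g \<in> carrier G \<Longrightarrow> h \<in> carrier G \<Longrightarrow> x \<in> carrier G \<Longrightarrow>
      \<delta> (g \<otimes>\<^bsub>G\<^esub> h) x = \<delta> g x + \<delta> h (inv\<^bsub>G\<^esub> g \<otimes>\<^bsub>G\<^esub> x)"
    and inv: "\<And>g x y. g \<in> carrier G \<Longrightarrow> x \<in> carrier G \<Longrightarrow> y \<in> carrier G \<Longrightarrow>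
      K #>\<^bsub>G\<^esub> x = K #>\<^bsub>G\<^esub> y \<Longrightarrow> \<delta> g x = \<delta> g y"
  shows "{k \<in> K. \<forall>x\<in>carrier G. \<delta> k x = 0} \<in> pfin_normals G p"
proof -
  interpret G: group G by fact
  interpret K: normal K G by (rule pfinD(1)[OF K])
  let ?K = "{k \<in> K. \<forall>x\<in>carrier G. \<delta> k x = 0}"
  have act: "\<delta> h (inv\<^bsub>G\<^esub> k \<otimes>\<^bsub>G\<^esub> x) = \<delta> h x"
    if "h \<in> carrier G" "k \<in> K" "x \<in> carrier G" for h k x
    using that by (intro inv) (auto simp: G.normal_Mod_eq_iff[OF pfinD(1)[OF K]] G.m_assoc)
  have derK: "\<delta> (k \<otimes>\<^bsub>G\<^esub> h) x = \<delta> k x + \<delta> h x" if "h \<in> carrier G" "k \<in> K" "x \<in> carrier G" for h k x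
    using der[of k h x] act[of h k x] that by simp
  have one: "\<delta> \<one>\<^bsub>G\<^esub> x = 0" if "x \<in> carrier G" for x
    using derK[of "\<one>\<^bsub>G\<^esub>" "\<one>\<^bsub>G\<^esub>" x] that by simp
  have invK: "\<delta> (inv\<^bsub>G\<^esub> k) x = - \<delta> k x" if "k \<in> K" "x \<in> carrier G" for k x
    using derK[of "inv\<^bsub>G\<^esub> k" k x] one that by (simp add: eq_neg_iff_add_eq_0 add.commute)
  have pw: "\<delta> (k [^]\<^bsub>G\<^esub> n) x = (\<Sum>i<n. \<delta> k x)" if "k \<in> K" "x \<in> carrier G" for k x and n :: nat
  proof (induction n)
    case (Suc n)
    have "k [^]\<^bsub>G\<^esub> Suc n = k \<otimes>\<^bsub>G\<^esub> k [^]\<^bsub>G\<^esub> n" using that G.nat_pow_Suc2[of k n] by simp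
    then show ?case using derK[of "k [^]\<^bsub>G\<^esub> n" k x] that Suc by (simp add: add.commute)
  qed (use one that in simp)
  have conj: "\<delta> (g \<otimes>\<^bsub>G\<^esub> k \<otimes>\<^bsub>G\<^esub> inv\<^bsub>G\<^esub> g) x = \<delta> k (inv\<^bsub>G\<^esub> g \<otimes>\<^bsub>G\<^esub> x)"
    if "g \<in> carrier G" "k \<in> K" "x \<in> carrier G" for g k x
  proof -
    have "\<delta> (g \<otimes>\<^bsub>G\<^esub> (k \<otimes>\<^bsub>G\<^esub> inv\<^bsub>G\<^esub> g)) x
        = \<delta> g x + (\<delta> k (inv\<^bsub>G\<^esub> g \<otimes>\<^bsub>G\<^esub> x) + \<delta> (inv\<^bsub>G\<^esub> g) (inv\<^bsub>G\<^esub> g \<otimes>\<^bsub>G\<^esub> x))"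
      using that der derK by simp
    moreover have "\<delta> (g \<otimes>\<^bsub>G\<^esub> inv\<^bsub>G\<^esub> g) x = \<delta> g x + \<delta> (inv\<^bsub>G\<^esub> g) (inv\<^bsub>G\<^esub> g \<otimes>\<^bsub>G\<^esub> x)"
      using that by (intro der) auto
    ultimately show ?thesis using that one by (simp add: G.m_assoc algebra_simps)
  qed
  have sub: "subgroup ?K G"
    by (rule G.subgroupI) (use one invK derK in \<open>auto intro!: exI[of _ "\<one>\<^bsub>G\<^esub>"]\<close>)
  have nor: "?K \<lhd> G"
    unfolding G.normal_inv_iff using sub conj K.inv_op_closed2 by auto
  \<comment> \<open>Coset representatives turn \<open>\<delta> x\<close> into a function on a finite
    set; together with the coset of \<open>x\<close> it determines \<open>x\<close> modulo the
    kernel.\<close>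
  define c where "c X = (SOME y. y \<in> carrier G \<and> K #>\<^bsub>G\<^esub> y = X)" for X
  have c: "c (K #>\<^bsub>G\<^esub> x) \<in> carrier G \<and> K #>\<^bsub>G\<^esub> c (K #>\<^bsub>G\<^esub> x) = K #>\<^bsub>G\<^esub> x" if "x \<in> carrier G" for x
    unfolding c_def by (rule someI[of _ x]) (use that in simp)
  have "finite ((\<lambda>x. Pair (K #>\<^bsub>G\<^esub> x) (restrict (\<lambda>X. \<delta> x (c X)) (rcosets\<^bsub>G\<^esub> K))) ` carrier G)"
  proof (rule finite_subset)
    show "(\<lambda>x. Pair (K #>\<^bsub>G\<^esub> x) (restrict (\<lambda>X. \<delta> x (c X)) (rcosets\<^bsub>G\<^esub> K))) ` carrier G
      \<subseteq> (rcosets\<^bsub>G\<^esub> K) \<times> ((rcosets\<^bsub>G\<^esub> K) \<rightarrow>\<^sub>E V)"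
      using c V by (auto simp: RCOSETS_def)
  qed (use pfinD(3)[OF K] finite_V in \<open>simp add: finite_PiE\<close>)
  then have "finite (rcosets\<^bsub>G\<^esub> ?K)"
  proof (rule G.finite_index_via[OF nor])
    fix x y assume x: "x \<in> carrier G" and y: "y \<in> carrier G"
      and eq: "(K #>\<^bsub>G\<^esub> x, restrict (\<lambda>X. \<delta> x (c X)) (rcosets\<^bsub>G\<^esub> K)) =
        (K #>\<^bsub>G\<^esub> y, restrict (\<lambda>X. \<delta> y (c X)) (rcosets\<^bsub>G\<^esub> K))"
    let ?k = "x \<otimes>\<^bsub>G\<^esub> inv\<^bsub>G\<^esub> y"
    have eq2: "restrict (\<lambda>X. \<delta> x (c X)) (rcosets\<^bsub>G\<^esub> K) = restrict (\<lambda>X. \<delta> y (c X)) (rcosets\<^bsub>G\<^esub> K)"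
      using eq by simp
    have k: "?k \<in> K" using eq G.normal_Mod_eq_iff[OF pfinD(1)[OF K] x y] by blast
    have "\<delta> ?k u = 0" if u: "u \<in> carrier G" for u
    proof -
      have "K #>\<^bsub>G\<^esub> u \<in> rcosets\<^bsub>G\<^esub> K" using u by (auto simp: RCOSETS_def)
      then have "\<delta> x (c (K #>\<^bsub>G\<^esub> u)) = \<delta> y (c (K #>\<^bsub>G\<^esub> u))"
        using fun_cong[OF eq2, of "K #>\<^bsub>G\<^esub> u"] by simp
      moreover have "\<delta> x u = \<delta> x (c (K #>\<^bsub>G\<^esub> u))" "\<delta> y u = \<delta> y (c (K #>\<^bsub>G\<^esub> u))"
        using inv[OF x u, of "c (K #>\<^bsub>G\<^esub> u)"] inv[OF y u, of "c (K #>\<^bsub>G\<^esub> u)"] c[OF u] by simp_all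
      ultimately have "\<delta> x u = \<delta> y u" by simp
      moreover have "\<delta> (?k \<otimes>\<^bsub>G\<^esub> y) u = \<delta> ?k u + \<delta> y u" by (rule derK) (use k y u in auto)
      ultimately show ?thesis using x y by (simp add: G.m_assoc)
    qed
    then show "?k \<in> ?K" using k by blast
  qed
  moreover have "\<exists>k. g [^]\<^bsub>G\<^esub> (p ^ k) \<in> ?K" if g: "g \<in> carrier G" for g
  proof -
    obtain k where k: "g [^]\<^bsub>G\<^esub> (p ^ k) \<in> K" using K g unfolding G.pfin_iff[OF prime_p] by blast
    \<comment> \<open>One more factor \<open>p\<close> suffices: \<delta> is additive on
      \<open>K\<close> and \<open>p\<close> annihilates \<open>V\<close>.\<close>
    have "\<delta> ((g [^]\<^bsub>G\<^esub> (p ^ k)) [^]\<^bsub>G\<^esub> p) x = 0" if "x \<in> carrier G" for x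
      using pw[OF k that] sum_const_V[of _ p] V g that by simp
    moreover have "(g [^]\<^bsub>G\<^esub> (p ^ k)) [^]\<^bsub>G\<^esub> p \<in> K"
      by (rule G.subgroup_nat_pow_closed[OF pfinD(2)[OF K] k])
    moreover have "(g [^]\<^bsub>G\<^esub> (p ^ k)) [^]\<^bsub>G\<^esub> p = g [^]\<^bsub>G\<^esub> (p ^ Suc k)"
      using g by (simp add: G.nat_pow_pow mult.commute)
    ultimately show ?thesis by (intro exI[of _ "Suc k"]) auto
  qed
  ultimately show ?thesis using nor unfolding G.pfin_iff[OF prime_p] by blast
qed

end

subsection \<open>The amalgamated product\<close>

definition lact :: "('a, 'm) monoid_scheme \<Rightarrow> 'a \<Rightarrow> 'a list \<Rightarrow> 'a list" where
  "lact G g zs = map (\<lambda>x. g \<otimes>\<^bsub>G\<^esub> x) zs"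

lemma lact_simps [simp]:
  "lact G g [] = []" "lact G g (x # xs) = (g \<otimes>\<^bsub>G\<^esub> x) # lact G g xs"
  "length (lact G g xs) = length xs" "lact G g (xs @ ys) = lact G g xs @ lact G g ys"
  by (simp_all add: lact_def)

lemma (in group) lact_closed [simp]:
  "g \<in> carrier G \<Longrightarrow> xs \<in> lists (carrier G) \<Longrightarrow> lact G g xs \<in> lists (carrier G)"
  by (induction xs) auto

lemma (in group) lact_one [simp]: "xs \<in> lists (carrier G) \<Longrightarrow> lact G \<one> xs = xs"
  by (induction xs) auto

lemma (in group) lact_lact:
  "g \<in> carrier G \<Longrightarrow> h \<in> carrier G \<Longrightarrow> xs \<in> lists (carrier G) \<Longrightarrow>
    lact G g (lact G h xs) = lact G (g \<otimes> h) xs"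
  by (induction xs) (auto simp: m_assoc)

text \<open>The value that the rule D(gh) = D(g) + g D(h) forces on a word, where a group element
  acts on functions of lists by translating the list with its inverse.\<close>

fun word_der :: "('g, 'm) monoid_scheme \<Rightarrow> ('l \<Rightarrow> 'g) \<Rightarrow> ('l \<Rightarrow> 'g list \<Rightarrow> 'k::ab_group_add) \<Rightarrow>
    'l list \<Rightarrow> 'g list \<Rightarrow> 'k" where
  "word_der G J D [] zs = 0"
| "word_der G J D (l # w) zs = D l zs + word_der G J D w (lact G (inv\<^bsub>G\<^esub> J l) zs)"

locale amalgam =
  G1: group G1 + G2: group G2 + A: group A
  for G1 :: "('a, 'm) monoid_scheme" and G2 :: "('b, 'n) monoid_scheme" and A :: "('c, 'l) monoid_scheme" +
  fixes i1 :: "'c \<Rightarrow> 'a" and i2 :: "'c \<Rightarrow> 'b"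
  assumes i1: "i1 \<in> hom A G1" and i2: "i2 \<in> hom A G2"
begin

abbreviation rel where "rel \<equiv> amal_rel G1 G2 A i1 i2"
abbreviation cls where "cls \<equiv> amal_class G1 G2 A i1 i2"
abbreviation G where "G \<equiv> amal_product G1 G2 A i1 i2"

definition letters where "letters = Inl ` carrier G1 \<union> Inr ` carrier G2"
definition j1 where "j1 g = cls [Inl g]"
definition j2 where "j2 g = cls [Inr g]"

lemma i_closed: "a \<in> carrier A \<Longrightarrow> i1 a \<in> carrier G1" "a \<in> carrier A \<Longrightarrow> i2 a \<in> carrier G2"
  using i1 i2 by (auto simp: hom_def)

lemma rel_lists: "rel u v \<Longrightarrow> u \<in> lists letters \<longleftrightarrow> v \<in> lists letters"
  by (induction rule: amal_rel.induct) (auto simp: letters_def i_closed)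

lemma cls_eq_iff: "cls u = cls v \<longleftrightarrow> rel u v"
proof
  assume "cls u = cls v"
  moreover have "v \<in> cls v" by (simp add: amal_class_def amal_rel.refl)
  ultimately show "rel u v" by (auto simp: amal_class_def)
qed (auto simp: amal_class_def intro: amal_rel.sym amal_rel.trans)

lemma rel_append: "rel u u' \<Longrightarrow> rel v v' \<Longrightarrow> rel (u @ v) (u' @ v')"
  using amal_rel.ctx[of G1 G2 A i1 i2 u u' "[]" v] amal_rel.ctx[of G1 G2 A i1 i2 v v' u' "[]"]
    amal_rel.trans by fastforce

lemma rel_some: "rel u (SOME v. v \<in> cls u)"
  using someI[of "\<lambda>v. v \<in> cls u" u] by (simp add: amal_class_def amal_rel.refl)

lemma cls_mult [simp]: "cls u \<otimes>\<^bsub>G\<^esub> cls v = cls (u @ v)"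
  using rel_append[OF rel_some[of u] rel_some[of v]]
  by (simp add: amal_product_def cls_eq_iff amal_rel.sym)

lemma one_G: "\<one>\<^bsub>G\<^esub> = cls []" by (simp add: amal_product_def)

lemma carrier_G: "carrier G = cls ` lists letters"
  by (simp add: amal_product_def letters_def)

definition inv_letter where
  "inv_letter l = (case l of Inl g \<Rightarrow> Inl (inv\<^bsub>G1\<^esub> g) | Inr g \<Rightarrow> Inr (inv\<^bsub>G2\<^esub> g))"

lemma rel_inv_letter: "l \<in> letters \<Longrightarrow> rel [inv_letter l, l] []"
proof -
  assume "l \<in> letters"
  then consider g where "g \<in> carrier G1" "l = Inl g" | g where "g \<in> carrier G2" "l = Inr g"
    by (auto simp: letters_def)
  then show ?thesis
  proof cases
    case 1
    then show ?thesis
      using amal_rel.mult1[of "inv\<^bsub>G1\<^esub> g" G1 g G2 A i1 i2] amal_rel.one1[of G1 G2 A i1 i2]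
      by (auto simp: inv_letter_def intro: amal_rel.trans)
  next
    case 2
    then show ?thesis
      using amal_rel.mult2[of "inv\<^bsub>G2\<^esub> g" G2 g G1 A i1 i2] amal_rel.one2[of G1 G2 A i1 i2]
      by (auto simp: inv_letter_def intro: amal_rel.trans)
  qed
qed

lemma inv_letter_closed: "l \<in> letters \<Longrightarrow> inv_letter l \<in> letters"
  by (auto simp: letters_def inv_letter_def)

lemma rel_inverse: "w \<in> lists letters \<Longrightarrow> rel (rev (map inv_letter w) @ w) []"
proof (induction w)
  case (Cons l w)
  have "rel (rev (map inv_letter w) @ [inv_letter l, l] @ w) (rev (map inv_letter w) @ [] @ w)"
    by (rule amal_rel.ctx, rule rel_inv_letter) (use Cons in auto)
  then show ?case using Cons by (auto intro: amal_rel.trans)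
qed (simp add: amal_rel.refl)

lemma group_G: "group G"
proof (rule groupI)
  fix x assume "x \<in> carrier G"
  then obtain w where w: "w \<in> lists letters" "x = cls w" by (auto simp: carrier_G)
  have "rev (map inv_letter w) \<in> lists letters"
    using w inv_letter_closed by (auto simp: in_lists_conv_set)
  then show "\<exists>y\<in>carrier G. y \<otimes>\<^bsub>G\<^esub> x = \<one>\<^bsub>G\<^esub>"
    using w rel_inverse[OF w(1)]
    by (intro bexI[of _ "cls (rev (map inv_letter w))"]) (auto simp: carrier_G one_G cls_eq_iff)
qed (auto simp: carrier_G one_G intro!: imageI)

sublocale G: group G by (rule group_G)

lemma j1_hom: "j1 \<in> hom G1 G"
  by (rule homI) (auto simp: j1_def carrier_G letters_def cls_eq_iff intro!: amal_rel.sym[OF amal_rel.mult1])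

lemma j2_hom: "j2 \<in> hom G2 G"
  by (rule homI) (auto simp: j2_def carrier_G letters_def cls_eq_iff intro!: amal_rel.sym[OF amal_rel.mult2])

sublocale j1: group_hom G1 G j1
  by (simp add: group_hom_def group_hom_axioms_def j1_hom G1.is_group G.is_group)
sublocale j2: group_hom G2 G j2
  by (simp add: group_hom_def group_hom_axioms_def j2_hom G2.is_group G.is_group)

lemma j_agree: "a \<in> carrier A \<Longrightarrow> j1 (i1 a) = j2 (i2 a)"
  by (simp add: j1_def j2_def cls_eq_iff amal_rel.amal)

text \<open>An element is the class of a word, hence a product of images of letters.\<close>

lemma amalgam_induct [consumes 1, case_names left right mult]:
  assumes x: "x \<in> carrier G"
    and P1: "\<And>s. s \<in> carrier G1 \<Longrightarrow> P (j1 s)" and P2: "\<And>s. s \<in> carrier G2 \<Longrightarrow> P (j2 s)"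
    and mult: "\<And>x y. x \<in> carrier G \<Longrightarrow> y \<in> carrier G \<Longrightarrow> P x \<Longrightarrow> P y \<Longrightarrow> P (x \<otimes>\<^bsub>G\<^esub> y)"
  shows "P x"
proof -
  have "P (cls w)" if "w \<in> lists letters" for w
    using that
  proof (induction w)
    case Nil
    then show ?case using P1[OF G1.one_closed] by (simp add: one_G)
  next
    case (Cons l w)
    have "cls (l # w) = cls [l] \<otimes>\<^bsub>G\<^esub> cls w" by simp
    moreover have "P (cls [l])" using Cons P1 P2 by (auto simp: letters_def j1_def j2_def)
    moreover have "cls [l] \<in> carrier G" "cls w \<in> carrier G" using Cons by (auto simp: carrier_G)
    ultimately show ?case using mult[of "cls [l]" "cls w"] Cons by simp
  qed
  then show ?thesis using x by (auto simp: carrier_G)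
qed

lemma word_der_append:
  assumes "u \<in> lists letters" "v \<in> lists letters" "zs \<in> lists (carrier G)"
  shows "word_der G (\<lambda>l. cls [l]) D (u @ v) zs
    = word_der G (\<lambda>l. cls [l]) D u zs + word_der G (\<lambda>l. cls [l]) D v (lact G (inv\<^bsub>G\<^esub> cls u) zs)"
  using assms(1,3)
proof (induction u arbitrary: zs)
  case Nil
  then show ?case by (simp flip: one_G)
next
  case (Cons l u)
  have c: "cls [l] \<in> carrier G" "cls u \<in> carrier G" using Cons by (auto simp: carrier_G)
  have "cls (l # u) = cls [l] \<otimes>\<^bsub>G\<^esub> cls u" by simp
  then have "inv\<^bsub>G\<^esub> cls (l # u) = inv\<^bsub>G\<^esub> cls u \<otimes>\<^bsub>G\<^esub> inv\<^bsub>G\<^esub> cls [l]" using c by (metis G.inv_mult_group)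
  then show ?case using Cons c by (simp add: G.lact_lact add.assoc del: cls_mult)
qed

text \<open>The universal property of the amalgam for crossed homomorphisms, which correspond to
  homomorphisms into a semidirect product. Here the value is computed on words and shown to be
  constant on classes. Lists of any length are allowed as arguments: singletons serve characters,
  longer lists serve cochains.\<close>

lemma ex_derivation:
  fixes \<delta>1 :: "'a \<Rightarrow> ('a + 'b) list set list \<Rightarrow> 'k::ab_group_add" and \<delta>2
  assumes d1: "\<And>s t zs. s \<in> carrier G1 \<Longrightarrow> t \<in> carrier G1 \<Longrightarrow> zs \<in> lists (carrier G) \<Longrightarrow>
      \<delta>1 (s \<otimes>\<^bsub>G1\<^esub> t) zs = \<delta>1 s zs + \<delta>1 t (lact G (inv\<^bsub>G\<^esub> j1 s) zs)"
    and d2: "\<And>s t zs. s \<in> carrier G2 \<Longrightarrow> t \<in> carrier G2 \<Longrightarrow> zs \<in> lists (carrier G) \<Longrightarrow>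
      \<delta>2 (s \<otimes>\<^bsub>G2\<^esub> t) zs = \<delta>2 s zs + \<delta>2 t (lact G (inv\<^bsub>G\<^esub> j2 s) zs)"
    and agree: "\<And>a zs. a \<in> carrier A \<Longrightarrow> zs \<in> lists (carrier G) \<Longrightarrow> \<delta>1 (i1 a) zs = \<delta>2 (i2 a) zs"
  obtains \<delta> where "\<And>g h zs. g \<in> carrier G \<Longrightarrow> h \<in> carrier G \<Longrightarrow> zs \<in> lists (carrier G) \<Longrightarrow>
        \<delta> (g \<otimes>\<^bsub>G\<^esub> h) zs = \<delta> g zs + \<delta> h (lact G (inv\<^bsub>G\<^esub> g) zs)"
    "\<And>s zs. s \<in> carrier G1 \<Longrightarrow> zs \<in> lists (carrier G) \<Longrightarrow> \<delta> (j1 s) zs = \<delta>1 s zs"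
    "\<And>s zs. s \<in> carrier G2 \<Longrightarrow> zs \<in> lists (carrier G) \<Longrightarrow> \<delta> (j2 s) zs = \<delta>2 s zs"
proof -
  define W where "W = word_der G (\<lambda>l. cls [l]) (case_sum \<delta>1 \<delta>2)"
  have W_Nil: "W [] zs = 0" for zs by (simp add: W_def)
  have W_app: "W (u @ v) zs = W u zs + W v (lact G (inv\<^bsub>G\<^esub> cls u) zs)"
    if "u \<in> lists letters" "v \<in> lists letters" "zs \<in> lists (carrier G)" for u v zs
    unfolding W_def by (rule word_der_append[OF that])
  have W1: "W [Inl s] zs = \<delta>1 s zs" and W2: "W [Inr t] zs = \<delta>2 t zs" for s t zs by (simp_all add: W_def)
  have one1: "\<delta>1 \<one>\<^bsub>G1\<^esub> zs = 0" if "zs \<in> lists (carrier G)" for zs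
    using d1[of "\<one>\<^bsub>G1\<^esub>" "\<one>\<^bsub>G1\<^esub>" zs] that by simp
  have one2: "\<delta>2 \<one>\<^bsub>G2\<^esub> zs = 0" if "zs \<in> lists (carrier G)" for zs
    using d2[of "\<one>\<^bsub>G2\<^esub>" "\<one>\<^bsub>G2\<^esub>" zs] that by simp
  have cl: "cls u \<in> carrier G" if "u \<in> lists letters" for u using that by (simp add: carrier_G)
  \<comment> \<open>In a context \<open>l @ u @ r\<close> the value on \<open>r\<close> is
    translated by the classes of \<open>l\<close> and \<open>u\<close>, so the case
    \<open>ctx\<close> uses that \<open>u\<close> and \<open>v\<close> have the same class, besides
    the induction hypothesis.\<close>
  have inv: "u \<in> lists letters \<longrightarrow> (\<forall>zs\<in>lists (carrier G). W u zs = W v zs)" if "rel u v" for u v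
    using that
  proof (induction rule: amal_rel.induct)
    case (ctx u v l r)
    have "W (l @ u @ r) zs = W (l @ v @ r) zs"
      if u: "l @ u @ r \<in> lists letters" and zs: "zs \<in> lists (carrier G)" for zs
    proof -
      have lur: "l \<in> lists letters" "u \<in> lists letters" "r \<in> lists letters" using u by auto
      have v: "v \<in> lists letters" using rel_lists[OF ctx.hyps] lur by blast
      have "cls u = cls v" using ctx.hyps cls_eq_iff by blast
      then show ?thesis using ctx.IH lur v zs cl by (simp add: W_app)
    qed
    then show ?case by blast
  next
    case (mult1 x y)
    then show ?case using d1 W_app[of "[Inl x]" "[Inl y]"] by (auto simp: W1 j1_def letters_def)
  next
    case (mult2 x y)
    then show ?case using d2 W_app[of "[Inr x]" "[Inr y]"] by (auto simp: W2 j2_def letters_def)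
  next
    case (sym u v)
    then show ?case using rel_lists by metis
  next
    case (trans u v w)
    then show ?case using rel_lists by metis
  qed (auto simp: W1 W2 W_Nil one1 one2 agree)
  define \<delta> where "\<delta> X = W (SOME w. w \<in> X)" for X
  have \<delta>: "\<delta> (cls u) zs = W u zs" if "u \<in> lists letters" "zs \<in> lists (carrier G)" for u zs
    using inv[OF rel_some[of u]] that unfolding \<delta>_def by simp
  have "\<delta> (g \<otimes>\<^bsub>G\<^esub> h) zs = \<delta> g zs + \<delta> h (lact G (inv\<^bsub>G\<^esub> g) zs)"
    if gh: "g \<in> carrier G" "h \<in> carrier G" and zs: "zs \<in> lists (carrier G)" for g h zs
  proof -
    obtain u v where uv: "u \<in> lists letters" "v \<in> lists letters" "g = cls u" "h = cls v"
      using gh by (auto simp: carrier_G)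
    show ?thesis using uv zs cl[OF uv(1)] by (simp add: \<delta> W_app)
  qed
  moreover have "\<delta> (j1 s) zs = \<delta>1 s zs" if "s \<in> carrier G1" "zs \<in> lists (carrier G)" for s zs
    using that \<delta>[of "[Inl s]"] by (simp add: j1_def letters_def W1)
  moreover have "\<delta> (j2 s) zs = \<delta>2 s zs" if "s \<in> carrier G2" "zs \<in> lists (carrier G)" for s zs
    using that \<delta>[of "[Inr s]"] by (simp add: j2_def letters_def W2)
  ultimately show thesis by (rule that)
qed

end

subsection \<open>Extending characters to the amalgam\<close>

definition conj_char :: "('a, 'm) monoid_scheme \<Rightarrow> nat \<Rightarrow> 'a set \<Rightarrow> ('a \<Rightarrow> int) \<Rightarrow> bool" where
  "conj_char G p M c \<longleftrightarrow>
     (\<forall>g\<in>M. \<forall>h\<in>M. [c (g \<otimes>\<^bsub>G\<^esub> h) = c g + c h] (mod int p)) \<and>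
     (\<forall>g\<in>carrier G. \<forall>h\<in>M. [c (g \<otimes>\<^bsub>G\<^esub> h \<otimes>\<^bsub>G\<^esub> inv\<^bsub>G\<^esub> g) = c h] (mod int p))"

context zmod_coeff begin

text \<open>Shapiro's lemma for H^1. Functions on the cosets of \<open>K\<close> form a product of
  modules coinduced from the preimage of \<open>K\<close>, and \<open>m s x\<close> is the usual
  factor comparing \<open>s\<close> with a section; the character applied to it is a crossed
  homomorphism. Invariance under conjugation makes it constant in \<open>x\<close> as soon as
  \<open>j s\<close> lies in \<open>K\<close>.\<close>

lemma coinduced_derivation:
  fixes S :: "('s, 'm) monoid_scheme" and G :: "('g, 'n) monoid_scheme"
  assumes S: "group S" and G: "group G" and j: "j \<in> hom S G" and K: "K \<lhd> G"
    and c: "conj_char S p {s \<in> carrier S. j s \<in> K} c"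
  obtains \<delta> :: "'s \<Rightarrow> 'g \<Rightarrow> 'k" where
    "\<And>s t x. s \<in> carrier S \<Longrightarrow> t \<in> carrier S \<Longrightarrow> x \<in> carrier G \<Longrightarrow>
      \<delta> (s \<otimes>\<^bsub>S\<^esub> t) x = \<delta> s x + \<delta> t (inv\<^bsub>G\<^esub> j s \<otimes>\<^bsub>G\<^esub> x)"
    "\<And>s x. s \<in> carrier S \<Longrightarrow> x \<in> carrier G \<Longrightarrow> \<delta> s x \<in> V"
    "\<And>s x y. s \<in> carrier S \<Longrightarrow> x \<in> carrier G \<Longrightarrow> y \<in> carrier G \<Longrightarrow>
      K #>\<^bsub>G\<^esub> x = K #>\<^bsub>G\<^esub> y \<Longrightarrow> \<delta> s x = \<delta> s y"
    "\<And>s x. s \<in> carrier S \<Longrightarrow> x \<in> carrier G \<Longrightarrow> j s \<in> K \<Longrightarrow> \<delta> s x = e (c s)"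
proof -
  interpret S: group S by fact
  interpret G: group G by fact
  interpret j: group_hom S G j using S G j by (simp add: group_hom_def group_hom_axioms_def)
  interpret K: normal K G by fact
  obtain \<sigma> where \<sigma>: "\<And>x. x \<in> carrier G \<Longrightarrow> \<sigma> x \<in> carrier S"
    and \<sigma>_cong: "\<And>x y. x \<in> carrier G \<Longrightarrow> y \<in> carrier G \<Longrightarrow> K #>\<^bsub>G\<^esub> x = K #>\<^bsub>G\<^esub> y \<Longrightarrow> \<sigma> x = \<sigma> y"
    and \<sigma>_eq: "\<And>x s. x \<in> carrier G \<Longrightarrow> s \<in> carrier S \<Longrightarrow>
      K #>\<^bsub>G\<^esub> j (\<sigma> (j s \<otimes>\<^bsub>G\<^esub> x)) = K #>\<^bsub>G\<^esub> j (s \<otimes>\<^bsub>S\<^esub> \<sigma> x)"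
    by (rule equivariant_section[OF S G j K]) blast
  let ?J = "{s \<in> carrier S. j s \<in> K}"
  let ?t = "\<lambda>s x. \<sigma> (inv\<^bsub>G\<^esub> j s \<otimes>\<^bsub>G\<^esub> x)"
  \<comment> \<open>Equivariance of \<sigma> modulo \<open>K\<close> says precisely that
    \<open>j\<close> maps this element into \<open>K\<close>.\<close>
  define m where "m s x = inv\<^bsub>S\<^esub> \<sigma> x \<otimes>\<^bsub>S\<^esub> s \<otimes>\<^bsub>S\<^esub> ?t s x" for s x
  have t: "?t s x \<in> carrier S" if "s \<in> carrier S" "x \<in> carrier G" for s x
    using that by (intro \<sigma>) auto
  have mJ: "m s x \<in> ?J" if sx: "s \<in> carrier S" "x \<in> carrier G" for s x
  proof -
    have "K #>\<^bsub>G\<^esub> j (inv\<^bsub>S\<^esub> s \<otimes>\<^bsub>S\<^esub> \<sigma> x) = K #>\<^bsub>G\<^esub> j (?t s x)"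
      using \<sigma>_eq[of x "inv\<^bsub>S\<^esub> s"] sx by simp
    then have "inv\<^bsub>G\<^esub> j (inv\<^bsub>S\<^esub> s \<otimes>\<^bsub>S\<^esub> \<sigma> x) \<otimes>\<^bsub>G\<^esub> j (?t s x) \<in> K"
      using G.coset_inv_mult_eq_iff[OF K] sx \<sigma> t by simp
    moreover have "inv\<^bsub>G\<^esub> j (inv\<^bsub>S\<^esub> s \<otimes>\<^bsub>S\<^esub> \<sigma> x) = j (inv\<^bsub>S\<^esub> \<sigma> x \<otimes>\<^bsub>S\<^esub> s)"
      using sx \<sigma> by (simp add: S.inv_mult_group G.inv_mult_group)
    ultimately show ?thesis using sx \<sigma> t by (simp add: m_def)
  qed
  define \<delta> where "\<delta> s x = e (c (m s x))" for s x
  have r1: "\<delta> (s \<otimes>\<^bsub>S\<^esub> u) x = \<delta> s x + \<delta> u (inv\<^bsub>G\<^esub> j s \<otimes>\<^bsub>G\<^esub> x)"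
    if su: "s \<in> carrier S" "u \<in> carrier S" and x: "x \<in> carrier G" for s u x
  proof -
    let ?x = "inv\<^bsub>G\<^esub> j s \<otimes>\<^bsub>G\<^esub> x"
    have x': "?x \<in> carrier G" using su x by simp
    have "inv\<^bsub>G\<^esub> j (s \<otimes>\<^bsub>S\<^esub> u) \<otimes>\<^bsub>G\<^esub> x = inv\<^bsub>G\<^esub> j u \<otimes>\<^bsub>G\<^esub> ?x"
      using su x by (simp add: G.inv_mult_group G.m_assoc)
    then have eq: "?t (s \<otimes>\<^bsub>S\<^esub> u) x = ?t u ?x" by simp
    have cancel: "a \<otimes>\<^bsub>S\<^esub> (inv\<^bsub>S\<^esub> a \<otimes>\<^bsub>S\<^esub> b) = b" if "a \<in> carrier S" "b \<in> carrier S" for a b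
      using that by (simp add: S.m_assoc[symmetric])
    have "m (s \<otimes>\<^bsub>S\<^esub> u) x = m s x \<otimes>\<^bsub>S\<^esub> m u ?x"
      using su \<sigma>[OF x] t[OF su(1) x] t[OF su(2) x'] eq unfolding m_def
      by (simp add: S.m_assoc cancel del: S.inv_mult_group)
    moreover have "[c (m s x \<otimes>\<^bsub>S\<^esub> m u ?x) = c (m s x) + c (m u ?x)] (mod int p)"
      using c mJ[OF su(1) x] mJ[OF su(2) x'] unfolding conj_char_def by blast
    ultimately show ?thesis by (simp add: \<delta>_def e_add[symmetric] e_eq_iff)
  qed
  have r2: "\<delta> s x = \<delta> s y"
    if s: "s \<in> carrier S" and xy: "x \<in> carrier G" "y \<in> carrier G" "K #>\<^bsub>G\<^esub> x = K #>\<^bsub>G\<^esub> y" for s x y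
  proof -
    have "?t s x = ?t s y" using s xy by (intro \<sigma>_cong) (auto simp: G.coset_mult_left_cancel[OF K])
    then show ?thesis using \<sigma>_cong[OF xy] by (simp add: \<delta>_def m_def)
  qed
  have r3: "\<delta> s x = e (c s)" if s1: "s \<in> carrier S" and x: "x \<in> carrier G" and s2: "j s \<in> K" for s x
  proof -
    note s = s1 s2
    have "K #>\<^bsub>G\<^esub> (inv\<^bsub>G\<^esub> j s \<otimes>\<^bsub>G\<^esub> x) = K #>\<^bsub>G\<^esub> x"
      using s x by (simp add: G.normal_Mod_eq_iff[OF K] G.m_assoc)
    then have "?t s x = \<sigma> x" using s x by (intro \<sigma>_cong) auto
    then have "m s x = inv\<^bsub>S\<^esub> \<sigma> x \<otimes>\<^bsub>S\<^esub> s \<otimes>\<^bsub>S\<^esub> inv\<^bsub>S\<^esub> (inv\<^bsub>S\<^esub> \<sigma> x)"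
      using \<sigma>[OF x] by (simp add: m_def)
    moreover have "[c (inv\<^bsub>S\<^esub> \<sigma> x \<otimes>\<^bsub>S\<^esub> s \<otimes>\<^bsub>S\<^esub> inv\<^bsub>S\<^esub> (inv\<^bsub>S\<^esub> \<sigma> x)) = c s] (mod int p)"
      using c s S.inv_closed[OF \<sigma>[OF x]] unfolding conj_char_def by blast
    ultimately show ?thesis by (simp add: \<delta>_def e_eq_iff)
  qed
  have r4: "\<delta> s x \<in> V" for s x by (simp add: \<delta>_def)
  show thesis by (rule that[of \<delta>]) (rule r1 r2 r3 r4; assumption)+
qed

text \<open>As \<delta> vanishes on the preimage of \<open>K\<close>, it belongs to the quotient of
  \<open>S\<close> by it, which acts freely on the cosets of \<open>K\<close>. For such a coinduced
  module H^1 vanishes; \<open>w\<close> comes from evaluating \<delta> at the section.\<close>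

lemma derivation_inner:
  fixes S :: "('s, 'm) monoid_scheme" and G :: "('g, 'n) monoid_scheme" and \<delta> :: "'s \<Rightarrow> 'g \<Rightarrow> 'k"
  assumes S: "group S" and G: "group G" and j: "j \<in> hom S G" and K: "K \<lhd> G"
    and der: "\<And>s t x. s \<in> carrier S \<Longrightarrow> t \<in> carrier S \<Longrightarrow> x \<in> carrier G \<Longrightarrow>
      \<delta> (s \<otimes>\<^bsub>S\<^esub> t) x = \<delta> s x + \<delta> t (inv\<^bsub>G\<^esub> j s \<otimes>\<^bsub>G\<^esub> x)"
    and V: "\<And>s x. s \<in> carrier S \<Longrightarrow> x \<in> carrier G \<Longrightarrow> \<delta> s x \<in> V"
    and inv: "\<And>s x y. s \<in> carrier S \<Longrightarrow> x \<in> carrier G \<Longrightarrow> y \<in> carrier G \<Longrightarrow>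
      K #>\<^bsub>G\<^esub> x = K #>\<^bsub>G\<^esub> y \<Longrightarrow> \<delta> s x = \<delta> s y"
    and stab: "\<And>s x. s \<in> carrier S \<Longrightarrow> x \<in> carrier G \<Longrightarrow> j s \<in> K \<Longrightarrow> \<delta> s x = 0"
  obtains w :: "'g \<Rightarrow> 'k" where "\<And>x. x \<in> carrier G \<Longrightarrow> w x \<in> V"
    "\<And>x y. x \<in> carrier G \<Longrightarrow> y \<in> carrier G \<Longrightarrow> K #>\<^bsub>G\<^esub> x = K #>\<^bsub>G\<^esub> y \<Longrightarrow> w x = w y"
    "\<And>s x. s \<in> carrier S \<Longrightarrow> x \<in> carrier G \<Longrightarrow> \<delta> s x = w x - w (inv\<^bsub>G\<^esub> j s \<otimes>\<^bsub>G\<^esub> x)"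
proof -
  interpret S: group S by fact
  interpret G: group G by fact
  interpret j: group_hom S G j using S G j by (simp add: group_hom_def group_hom_axioms_def)
  interpret K: normal K G by fact
  obtain \<sigma> where \<sigma>: "\<And>x. x \<in> carrier G \<Longrightarrow> \<sigma> x \<in> carrier S"
    and \<sigma>_cong: "\<And>x y. x \<in> carrier G \<Longrightarrow> y \<in> carrier G \<Longrightarrow> K #>\<^bsub>G\<^esub> x = K #>\<^bsub>G\<^esub> y \<Longrightarrow> \<sigma> x = \<sigma> y"
    and \<sigma>_eq: "\<And>x s. x \<in> carrier G \<Longrightarrow> s \<in> carrier S \<Longrightarrow>
      K #>\<^bsub>G\<^esub> j (\<sigma> (j s \<otimes>\<^bsub>G\<^esub> x)) = K #>\<^bsub>G\<^esub> j (s \<otimes>\<^bsub>S\<^esub> \<sigma> x)"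
    by (rule equivariant_section[OF S G j K]) blast
  define w where "w x = \<delta> (\<sigma> x) x" for x
  have "\<delta> s x = w x - w (inv\<^bsub>G\<^esub> j s \<otimes>\<^bsub>G\<^esub> x)" if s: "s \<in> carrier S" and x: "x \<in> carrier G" for s x
  proof -
    let ?x = "inv\<^bsub>G\<^esub> j s \<otimes>\<^bsub>G\<^esub> x"
    let ?b = "inv\<^bsub>S\<^esub> s \<otimes>\<^bsub>S\<^esub> \<sigma> x"
    define \<nu> where "\<nu> = inv\<^bsub>S\<^esub> ?b \<otimes>\<^bsub>S\<^esub> \<sigma> ?x"
    have x': "?x \<in> carrier G" using s x by simp
    have b: "?b \<in> carrier S" using s \<sigma>[OF x] by simp
    have \<nu>c: "\<nu> \<in> carrier S" unfolding \<nu>_def using b \<sigma>[OF x'] by simp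
    have "K #>\<^bsub>G\<^esub> j ?b = K #>\<^bsub>G\<^esub> j (\<sigma> ?x)"
      using \<sigma>_eq[of x "inv\<^bsub>S\<^esub> s"] s x by simp
    then have "inv\<^bsub>G\<^esub> j ?b \<otimes>\<^bsub>G\<^esub> j (\<sigma> ?x) \<in> K"
      using G.coset_inv_mult_eq_iff[OF K, of "j ?b" "j (\<sigma> ?x)"] j.hom_closed[OF b] j.hom_closed[OF \<sigma>[OF x']]
      by blast
    then have \<nu>K: "j \<nu> \<in> K" unfolding \<nu>_def using j.hom_inv[OF b] b \<sigma>[OF x'] by simp
    have "s \<otimes>\<^bsub>S\<^esub> \<sigma> ?x = \<sigma> x \<otimes>\<^bsub>S\<^esub> \<nu>"
      unfolding \<nu>_def using s \<sigma>[OF x] \<sigma>[OF x']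
      by (simp add: S.inv_mult_group S.m_assoc[symmetric])
    then have "\<delta> s x + \<delta> (\<sigma> ?x) ?x = \<delta> (\<sigma> x) x + \<delta> \<nu> (inv\<^bsub>G\<^esub> j (\<sigma> x) \<otimes>\<^bsub>G\<^esub> x)"
      using der[OF s \<sigma>[OF x'] x] der[OF \<sigma>[OF x] \<nu>c x] by metis
    moreover have "\<delta> \<nu> (inv\<^bsub>G\<^esub> j (\<sigma> x) \<otimes>\<^bsub>G\<^esub> x) = 0"
      using \<nu>c \<nu>K \<sigma>[OF x] x by (intro stab) auto
    ultimately show ?thesis by (simp add: w_def algebra_simps)
  qed
  moreover have "w x = w y" if "x \<in> carrier G" "y \<in> carrier G" "K #>\<^bsub>G\<^esub> x = K #>\<^bsub>G\<^esub> y" for x y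
    using that \<sigma>_cong[OF that] inv[of "\<sigma> x" x y] \<sigma> by (simp add: w_def)
  moreover have "w x \<in> V" if "x \<in> carrier G" for x using that V \<sigma> by (simp add: w_def)
  ultimately show thesis using that by blast
qed

end

locale amalgam_coeff = amalgam G1 G2 A i1 i2 + zmod_coeff p e
  for G1 :: "('a, 'm) monoid_scheme" and G2 :: "('b, 'n) monoid_scheme" and A :: "('c, 'l) monoid_scheme"
    and i1 i2 p and e :: "int \<Rightarrow> 'k::ab_group_add"
begin

lemma i1_hom: "group_hom A G1 i1"
  by (simp add: group_hom_def group_hom_axioms_def i1 A.is_group G1.is_group)
lemma i2_hom: "group_hom A G2 i2"
  by (simp add: group_hom_def group_hom_axioms_def i2 A.is_group G2.is_group)

lemma j1i1_hom: "(\<lambda>a. j1 (i1 a)) \<in> hom A G"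
  using hom_compose[OF i1 j1_hom] by (simp add: comp_def)

text \<open>By Shapiro's lemma a conjugation invariant character extends to a derivation with values in the functions on
  \<open>G/K\<close>. On \<open>A\<close> the two derivations differ by an inner one, so after a correction they glue.\<close>

lemma extend_characters:
  assumes K: "K \<in> pfin_normals G p"
    and c1: "conj_char G1 p {s \<in> carrier G1. j1 s \<in> K} c1"
    and c2: "conj_char G2 p {s \<in> carrier G2. j2 s \<in> K} c2"
    and agree: "\<And>a. a \<in> carrier A \<Longrightarrow> j1 (i1 a) \<in> K \<Longrightarrow> [c1 (i1 a) = c2 (i2 a)] (mod int p)"
  shows "\<exists>K'\<in>pfin_normals G p. K' \<subseteq> K \<and> (\<forall>s\<in>carrier G1. j1 s \<in> K' \<longrightarrow> [c1 s = 0] (mod int p)) \<and>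
    (\<forall>s\<in>carrier G2. j2 s \<in> K' \<longrightarrow> [c2 s = 0] (mod int p))"
proof -
  note KN = pfinD(1)[OF K]
  obtain \<delta>1 :: "'a \<Rightarrow> ('a + 'b) list set \<Rightarrow> 'k" where
    d1: "\<And>s t x. s \<in> carrier G1 \<Longrightarrow> t \<in> carrier G1 \<Longrightarrow> x \<in> carrier G \<Longrightarrow>
      \<delta>1 (s \<otimes>\<^bsub>G1\<^esub> t) x = \<delta>1 s x + \<delta>1 t (inv\<^bsub>G\<^esub> j1 s \<otimes>\<^bsub>G\<^esub> x)"
    and V1: "\<And>s x. s \<in> carrier G1 \<Longrightarrow> x \<in> carrier G \<Longrightarrow> \<delta>1 s x \<in> V"
    and K1: "\<And>s x y. s \<in> carrier G1 \<Longrightarrow> x \<in> carrier G \<Longrightarrow> y \<in> carrier G \<Longrightarrow>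
      K #>\<^bsub>G\<^esub> x = K #>\<^bsub>G\<^esub> y \<Longrightarrow> \<delta>1 s x = \<delta>1 s y"
    and s1: "\<And>s x. s \<in> carrier G1 \<Longrightarrow> x \<in> carrier G \<Longrightarrow> j1 s \<in> K \<Longrightarrow> \<delta>1 s x = e (c1 s)"
    by (rule coinduced_derivation[OF G1.is_group G.is_group j1_hom KN c1]) blast
  obtain \<delta>2 :: "'b \<Rightarrow> ('a + 'b) list set \<Rightarrow> 'k" where
    d2: "\<And>s t x. s \<in> carrier G2 \<Longrightarrow> t \<in> carrier G2 \<Longrightarrow> x \<in> carrier G \<Longrightarrow>
      \<delta>2 (s \<otimes>\<^bsub>G2\<^esub> t) x = \<delta>2 s x + \<delta>2 t (inv\<^bsub>G\<^esub> j2 s \<otimes>\<^bsub>G\<^esub> x)"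
    and V2: "\<And>s x. s \<in> carrier G2 \<Longrightarrow> x \<in> carrier G \<Longrightarrow> \<delta>2 s x \<in> V"
    and K2: "\<And>s x y. s \<in> carrier G2 \<Longrightarrow> x \<in> carrier G \<Longrightarrow> y \<in> carrier G \<Longrightarrow>
      K #>\<^bsub>G\<^esub> x = K #>\<^bsub>G\<^esub> y \<Longrightarrow> \<delta>2 s x = \<delta>2 s y"
    and s2: "\<And>s x. s \<in> carrier G2 \<Longrightarrow> x \<in> carrier G \<Longrightarrow> j2 s \<in> K \<Longrightarrow> \<delta>2 s x = e (c2 s)"
    by (rule coinduced_derivation[OF G2.is_group G.is_group j2_hom KN c2]) blast
  interpret i1: group_hom A G1 i1 by (rule i1_hom)
  interpret i2: group_hom A G2 i2 by (rule i2_hom)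
  obtain w where wV: "\<And>x. x \<in> carrier G \<Longrightarrow> w x \<in> V"
    and wK: "\<And>x y. x \<in> carrier G \<Longrightarrow> y \<in> carrier G \<Longrightarrow> K #>\<^bsub>G\<^esub> x = K #>\<^bsub>G\<^esub> y \<Longrightarrow> w x = w y"
    and w: "\<And>s x. s \<in> carrier A \<Longrightarrow> x \<in> carrier G \<Longrightarrow>
      \<delta>1 (i1 s) x - \<delta>2 (i2 s) x = w x - w (inv\<^bsub>G\<^esub> j1 (i1 s) \<otimes>\<^bsub>G\<^esub> x)"
  proof (rule derivation_inner[OF A.is_group G.is_group j1i1_hom KN, of "\<lambda>s x. \<delta>1 (i1 s) x - \<delta>2 (i2 s) x"])
    fix s t x assume "s \<in> carrier A" "t \<in> carrier A" "x \<in> carrier G"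
    then show "\<delta>1 (i1 (s \<otimes>\<^bsub>A\<^esub> t)) x - \<delta>2 (i2 (s \<otimes>\<^bsub>A\<^esub> t)) x
      = \<delta>1 (i1 s) x - \<delta>2 (i2 s) x + (\<delta>1 (i1 t) (inv\<^bsub>G\<^esub> j1 (i1 s) \<otimes>\<^bsub>G\<^esub> x)
        - \<delta>2 (i2 t) (inv\<^bsub>G\<^esub> j1 (i1 s) \<otimes>\<^bsub>G\<^esub> x))"
      using j_agree[of s] by (simp add: d1 d2)
  next
    fix s x assume s: "s \<in> carrier A" and x: "x \<in> carrier G" and jK: "j1 (i1 s) \<in> K"
    have "\<delta>1 (i1 s) x = e (c1 (i1 s))" using s x jK by (intro s1) auto
    moreover have "\<delta>2 (i2 s) x = e (c2 (i2 s))" using s x jK j_agree[OF s] by (intro s2) auto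
    moreover have "e (c1 (i1 s)) = e (c2 (i2 s))" using agree[OF s jK] by (simp add: e_eq_iff)
    ultimately show "\<delta>1 (i1 s) x - \<delta>2 (i2 s) x = 0" by simp
  next
    fix s x y assume "s \<in> carrier A" "x \<in> carrier G" "y \<in> carrier G" "K #>\<^bsub>G\<^esub> x = K #>\<^bsub>G\<^esub> y"
    then show "\<delta>1 (i1 s) x - \<delta>2 (i2 s) x = \<delta>1 (i1 s) y - \<delta>2 (i2 s) y"
      using K1[of "i1 s" x y] K2[of "i2 s" x y] by simp
  next
    fix s x assume "s \<in> carrier A" "x \<in> carrier G"
    then show "\<delta>1 (i1 s) x - \<delta>2 (i2 s) x \<in> V" using V1 V2 by simp
  qed (rule that)
  \<comment> \<open>Subtracting the inner derivation of \<open>w\<close> removes the discrepancy on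
    \<open>A\<close>. Only the head of the list matters, and 0 on the empty list is a
    filler.\<close>
  define \<epsilon>1 where "\<epsilon>1 s zs = (if zs = [] then 0 else \<delta>1 s (hd zs) - w (hd zs) + w (inv\<^bsub>G\<^esub> j1 s \<otimes>\<^bsub>G\<^esub> hd zs))" for s zs
  define \<epsilon>2 where "\<epsilon>2 s zs = (if zs = [] then 0 else \<delta>2 s (hd zs))" for s zs
  obtain \<delta> where der: "\<And>g h zs. g \<in> carrier G \<Longrightarrow> h \<in> carrier G \<Longrightarrow> zs \<in> lists (carrier G) \<Longrightarrow>
        \<delta> (g \<otimes>\<^bsub>G\<^esub> h) zs = \<delta> g zs + \<delta> h (lact G (inv\<^bsub>G\<^esub> g) zs)"
    and \<delta>j1: "\<And>s zs. s \<in> carrier G1 \<Longrightarrow> zs \<in> lists (carrier G) \<Longrightarrow> \<delta> (j1 s) zs = \<epsilon>1 s zs"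
    and \<delta>j2: "\<And>s zs. s \<in> carrier G2 \<Longrightarrow> zs \<in> lists (carrier G) \<Longrightarrow> \<delta> (j2 s) zs = \<epsilon>2 s zs"
  proof (rule ex_derivation[of \<epsilon>1 \<epsilon>2])
    fix s t zs assume "s \<in> carrier G1" "t \<in> carrier G1" "zs \<in> lists (carrier G)"
    then show "\<epsilon>1 (s \<otimes>\<^bsub>G1\<^esub> t) zs = \<epsilon>1 s zs + \<epsilon>1 t (lact G (inv\<^bsub>G\<^esub> j1 s) zs)"
      by (cases zs) (simp_all add: \<epsilon>1_def d1 G.inv_mult_group G.m_assoc)
  next
    fix s t zs assume "s \<in> carrier G2" "t \<in> carrier G2" "zs \<in> lists (carrier G)"
    then show "\<epsilon>2 (s \<otimes>\<^bsub>G2\<^esub> t) zs = \<epsilon>2 s zs + \<epsilon>2 t (lact G (inv\<^bsub>G\<^esub> j2 s) zs)"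
      by (cases zs) (simp_all add: \<epsilon>2_def d2)
  next
    fix a zs assume "a \<in> carrier A" "zs \<in> lists (carrier G)"
    then show "\<epsilon>1 (i1 a) zs = \<epsilon>2 (i2 a) zs"
      using w[of a "hd zs"] by (cases zs) (simp_all add: \<epsilon>1_def \<epsilon>2_def algebra_simps)
  qed (rule that)
  define \<Delta> where "\<Delta> g x = \<delta> g [x]" for g x
  have \<Delta>j1: "\<Delta> (j1 s) x = \<delta>1 s x - w x + w (inv\<^bsub>G\<^esub> j1 s \<otimes>\<^bsub>G\<^esub> x)"
    if "s \<in> carrier G1" "x \<in> carrier G" for s x using that \<delta>j1 by (simp add: \<Delta>_def \<epsilon>1_def)
  have \<Delta>j2: "\<Delta> (j2 s) x = \<delta>2 s x"
    if "s \<in> carrier G2" "x \<in> carrier G" for s x using that \<delta>j2 by (simp add: \<Delta>_def \<epsilon>2_def)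
  have \<Delta>der: "\<Delta> (g \<otimes>\<^bsub>G\<^esub> h) x = \<Delta> g x + \<Delta> h (inv\<^bsub>G\<^esub> g \<otimes>\<^bsub>G\<^esub> x)"
    if "g \<in> carrier G" "h \<in> carrier G" "x \<in> carrier G" for g h x using that der by (simp add: \<Delta>_def)
  have cong: "K #>\<^bsub>G\<^esub> (g \<otimes>\<^bsub>G\<^esub> x) = K #>\<^bsub>G\<^esub> (g \<otimes>\<^bsub>G\<^esub> y)"
    if "g \<in> carrier G" "x \<in> carrier G" "y \<in> carrier G" "K #>\<^bsub>G\<^esub> x = K #>\<^bsub>G\<^esub> y" for g x y
    using that G.coset_mult_left_cancel[OF KN] by blast
  have \<Delta>V: "\<forall>x\<in>carrier G. \<Delta> g x \<in> V" if "g \<in> carrier G" for g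
    using that
  proof (induction rule: amalgam_induct)
    case (left s)
    then show ?case by (simp add: \<Delta>j1 V1 wV)
  next
    case (mult g h)
    then show ?case using \<Delta>der by simp
  qed (simp add: \<Delta>j2 V2)
  have \<Delta>K: "\<forall>x\<in>carrier G. \<forall>y\<in>carrier G. K #>\<^bsub>G\<^esub> x = K #>\<^bsub>G\<^esub> y \<longrightarrow> \<Delta> g x = \<Delta> g y" if "g \<in> carrier G" for g
    using that
  proof (induction rule: amalgam_induct)
    case (left s)
    show ?case
    proof (intro ballI impI)
      fix x y assume xy: "x \<in> carrier G" "y \<in> carrier G" "K #>\<^bsub>G\<^esub> x = K #>\<^bsub>G\<^esub> y"
      have "w (inv\<^bsub>G\<^esub> j1 s \<otimes>\<^bsub>G\<^esub> x) = w (inv\<^bsub>G\<^esub> j1 s \<otimes>\<^bsub>G\<^esub> y)"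
        using left xy cong[of "inv\<^bsub>G\<^esub> j1 s" x y] by (intro wK) auto
      then show "\<Delta> (j1 s) x = \<Delta> (j1 s) y"
        using left xy K1[OF left xy] wK[OF xy] by (simp add: \<Delta>j1)
    qed
  next
    case (right s)
    show ?case
    proof (intro ballI impI)
      fix x y assume xy: "x \<in> carrier G" "y \<in> carrier G" "K #>\<^bsub>G\<^esub> x = K #>\<^bsub>G\<^esub> y"
      show "\<Delta> (j2 s) x = \<Delta> (j2 s) y" using K2[OF right xy] right xy by (simp add: \<Delta>j2)
    qed
  next
    case (mult g h)
    show ?case
    proof (intro ballI impI)
      fix x y assume xy: "x \<in> carrier G" "y \<in> carrier G" "K #>\<^bsub>G\<^esub> x = K #>\<^bsub>G\<^esub> y"
      have "K #>\<^bsub>G\<^esub> (inv\<^bsub>G\<^esub> g \<otimes>\<^bsub>G\<^esub> x) = K #>\<^bsub>G\<^esub> (inv\<^bsub>G\<^esub> g \<otimes>\<^bsub>G\<^esub> y)"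
        using cong[of "inv\<^bsub>G\<^esub> g" x y] mult xy by simp
      then have "\<Delta> h (inv\<^bsub>G\<^esub> g \<otimes>\<^bsub>G\<^esub> x) = \<Delta> h (inv\<^bsub>G\<^esub> g \<otimes>\<^bsub>G\<^esub> y)"
        using mult xy by simp
      moreover have "\<Delta> g x = \<Delta> g y" using mult xy by blast
      ultimately show "\<Delta> (g \<otimes>\<^bsub>G\<^esub> h) x = \<Delta> (g \<otimes>\<^bsub>G\<^esub> h) y" 
        using \<Delta>der[OF mult(1,2) xy(1)] \<Delta>der[OF mult(1,2) xy(2)] by simp
    qed
  qed
  \<comment> \<open>The characters are recovered as values of the glued derivation at the identity.
    For \<open>G1\<close> the two terms with \<open>w\<close> cancel, since \<open>w\<close> is
    constant on cosets of \<open>K\<close> and \<open>j1 s\<close> lies in \<open>K\<close>.\<close>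
  let ?K = "{k \<in> K. \<forall>x\<in>carrier G. \<Delta> k x = 0}"
  have K': "?K \<in> pfin_normals G p"
  proof (rule derivation_kernel_pfin[OF G.is_group K])
    fix g x assume "g \<in> carrier G" "x \<in> carrier G"
    then show "\<Delta> g x \<in> V" by (rule \<Delta>V[rule_format])
  next
    fix g x y assume "g \<in> carrier G" "x \<in> carrier G" "y \<in> carrier G" "K #>\<^bsub>G\<^esub> x = K #>\<^bsub>G\<^esub> y"
    then show "\<Delta> g x = \<Delta> g y" by (rule \<Delta>K[rule_format])
  qed (rule \<Delta>der)
  moreover have "[c1 s = 0] (mod int p)" if s: "s \<in> carrier G1" "j1 s \<in> ?K" for s
  proof -
    have 1: "\<one>\<^bsub>G\<^esub> \<in> carrier G" by simp
    have jc: "j1 s \<in> carrier G" using s by simp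
    have "K #>\<^bsub>G\<^esub> (inv\<^bsub>G\<^esub> j1 s \<otimes>\<^bsub>G\<^esub> \<one>\<^bsub>G\<^esub>) = K #>\<^bsub>G\<^esub> \<one>\<^bsub>G\<^esub>"
      using s jc pfinD(2)[OF K] by (simp add: G.normal_Mod_eq_iff[OF KN] subgroup.m_inv_closed del: j1.hom_closed)
    then have "w (inv\<^bsub>G\<^esub> j1 s \<otimes>\<^bsub>G\<^esub> \<one>\<^bsub>G\<^esub>) = w \<one>\<^bsub>G\<^esub>" using jc by (intro wK) auto
    then have "\<delta>1 s \<one>\<^bsub>G\<^esub> = 0" using s \<Delta>j1[OF s(1) 1] by simp
    then have "e (c1 s) = e 0" using s1[OF s(1) 1] s by simp
    then show ?thesis by (simp only: e_eq_iff)
  qed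
  moreover have "[c2 s = 0] (mod int p)" if s: "s \<in> carrier G2" "j2 s \<in> ?K" for s
  proof -
    have 1: "\<one>\<^bsub>G\<^esub> \<in> carrier G" by simp
    have "\<delta>2 s \<one>\<^bsub>G\<^esub> = 0" using s \<Delta>j2[OF s(1) 1] by simp
    then have "e (c2 s) = e 0" using s2[OF s(1) 1] s by simp
    then show ?thesis by (simp only: e_eq_iff)
  qed
  ultimately show ?thesis by (intro bexI[of _ ?K]) auto
qed

end

subsection \<open>The pro-p topology of the amalgam\<close>

text \<open>The index is the decreasing measure when a p-finite quotient is divided by a central
  subgroup of order \<open>p\<close>.\<close>

lemma (in group) pfin_index_less:
  assumes L: "L \<in> pfin_normals G p" and M: "M \<in> pfin_normals G p" and "L \<subset> M"
  shows "card (rcosets M) < card (rcosets L)"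
proof -
  note LN = pfinD(1)[OF L] and MN = pfinD(1)[OF M]
  define f where "f X = M #> (SOME x. x \<in> carrier G \<and> L #> x = X)" for X
  have f: "f (L #> x) = M #> x" if x: "x \<in> carrier G" for x
  proof -
    define y where "y = (SOME y. y \<in> carrier G \<and> L #> y = L #> x)"
    have y: "y \<in> carrier G \<and> L #> y = L #> x" unfolding y_def by (rule someI[of _ x]) (use x in simp)
    then have "y \<otimes> inv x \<in> M" using normal_Mod_eq_iff[OF LN] x \<open>L \<subset> M\<close> by blast
    then have "M #> y = M #> x" using normal_Mod_eq_iff[OF MN] x y by blast
    then show ?thesis by (simp add: f_def y_def)
  qed
  have im: "rcosets M = f ` (rcosets L)"
    using f unfolding RCOSETS_def by (auto simp: image_iff)
  obtain m where m: "m \<in> M" "m \<notin> L" using \<open>L \<subset> M\<close> by blast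
  have mc: "m \<in> carrier G" using m pfinD(4)[OF M] by blast
  have "\<not> inj_on f (rcosets L)"
  proof
    assume inj: "inj_on f (rcosets L)"
    have "f (L #> m) = f (L #> \<one>)"
      using f[OF mc] f[OF one_closed] coset_eq_subgroup_iff[OF MN mc] coset_eq_subgroup_iff[OF MN one_closed]
        m pfinD(2)[OF M] subgroup.one_closed by metis
    then have "L #> m = L #> \<one>"
      using inj mc one_closed unfolding inj_on_def RCOSETS_def by blast
    then have "m \<in> L"
      using coset_eq_subgroup_iff[OF LN mc] coset_eq_subgroup_iff[OF LN one_closed] pfinD(2)[OF L]
        subgroup.one_closed by metis
    then show False using m by blast
  qed
  then have "card (f ` (rcosets L)) \<noteq> card (rcosets L)"
    using eq_card_imp_inj_on[OF pfinD(3)[OF L]] by blast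
  moreover have "card (f ` (rcosets L)) \<le> card (rcosets L)" by (rule card_image_le[OF pfinD(3)[OF L]])
  ultimately show ?thesis using im by simp
qed

text \<open>Modulo \<open>L\<close> the subgroup generated by \<open>z\<close> has prime order, so
  any nontrivial element of it can take the place of \<open>z\<close>. This is how the central
  element is moved into the image of \<open>A\<close>.\<close>

lemma (in group) central_mod_of_ext:
  assumes p: "prime p" and L: "L \<in> pfin_normals G p" and z: "central_mod G p L z"
    and g: "g \<in> central_ext G L z" "g \<notin> L"
  shows "central_mod G p L g"
proof -
  interpret L: normal L G by (rule pfinD(1)[OF L])
  have zc: "z \<in> carrier G" by (rule central_mod_closed[OF p L z])
  obtain i where gc: "g \<in> carrier G" and i: "L #> g = L #> z [^] (i::nat)"
    using g unfolding central_ext_def by blast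
  have zi: "z [^] i \<in> carrier G" using zc by simp
  have "L #> g [^] p = L #> (z [^] i) [^] p"
    using L.FactGroup_pow[OF gc, of p] L.FactGroup_pow[OF zi, of p] i by simp
  also have "\<dots> = L #> z [^] (i * p)" using zc by (simp add: nat_pow_pow)
  also have "\<dots> = L #> z [^] (0::nat)"
    unfolding central_mod_pow_cong[OF p L z] by (simp add: cong_def)
  also have "\<dots> = L" using pfinD(4)[OF L] by simp
  finally have "g [^] p \<in> L" using coset_eq_subgroup_iff[OF L.normal_axioms] gc by simp
  moreover have "L #> (h \<otimes> g) = L #> (g \<otimes> h)" if h: "h \<in> carrier G" for h
  proof -
    have "L #> (h \<otimes> g) = L #> (h \<otimes> z [^] i)"
      by (rule coset_mult_cong[OF L.normal_axioms]) (use h gc zi i in auto)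
    also have "\<dots> = L #> (z [^] i \<otimes> h)" by (rule central_mod_pow_comm[OF p L z h])
    also have "\<dots> = L #> (g \<otimes> h)"
      by (rule coset_mult_cong[OF L.normal_axioms]) (use h gc zi i in auto)
    finally show ?thesis .
  qed
  ultimately show ?thesis using gc g(2) unfolding central_mod_def by blast
qed

section \<open>Traces on a cyclic subgroup\<close>

text \<open>The image of \<open>g\<close> in the quotient has order \<open>p ^ k\<close>. Traces on
  a cyclic group are thus labelled by one exponent and can be compared.\<close>

lemma (in group) pfin_cyclic_trace:
  assumes p: "prime p" and g: "g \<in> carrier G" and T: "T \<in> pfin_normals G p"
  obtains k where "\<And>t::int. g [^] t \<in> T \<longleftrightarrow> int (p ^ k) dvd t"
proof -
  interpret T: normal T G by (rule pfinD(1)[OF T])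
  interpret Q: group "G Mod T" by (rule T.factorgroup_is_group)
  let ?c = "T #> g"
  have cc: "?c \<in> carrier (G Mod T)" using g by (auto simp: carrier_FactGroup)
  obtain j where "g [^] (p ^ j) \<in> T" using T g unfolding pfin_iff[OF p] by blast
  then have "?c [^]\<^bsub>G Mod T\<^esub> (p ^ j) = \<one>\<^bsub>G Mod T\<^esub>"
    using Mod_pow_eq_one_iff[OF T.normal_axioms g] by blast
  then have "Q.ord ?c dvd p ^ j" using Q.pow_eq_id[OF cc] by blast
  then obtain k where k: "Q.ord ?c = p ^ k" using p by (metis divides_primepow_nat)
  have "g [^] t \<in> T \<longleftrightarrow> int (p ^ k) dvd t" for t :: int
  proof -
    have "g [^] t \<in> T \<longleftrightarrow> T #> g [^] t = T"
      using coset_eq_subgroup_iff[OF T.normal_axioms] g by simp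
    also have "\<dots> \<longleftrightarrow> ?c [^]\<^bsub>G Mod T\<^esub> t = \<one>\<^bsub>G Mod T\<^esub>"
      using T.FactGroup_int_pow[OF g, of t] by simp
    also have "\<dots> \<longleftrightarrow> int (p ^ k) dvd t" using Q.int_pow_eq_id[OF cc] k by simp
    finally show ?thesis .
  qed
  then show thesis by (rule that)
qed

text \<open>A nontrivial finite cyclic p-group has a single subgroup of order \<open>p\<close>, and
  \<open>a\<close> and \<open>b\<close> both represent generators of it.\<close>

lemma (in group) cyclic_order_p_cosets:
  assumes p: "prime p" and g: "g \<in> carrier G" "carrier G = {g [^] t | t::int. True}"
    and T: "T \<in> pfin_normals G p"
    and a: "a \<in> carrier G" "a \<notin> T" "a [^] p \<in> T" and b: "b \<in> carrier G" "b \<notin> T" "b [^] p \<in> T"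
  shows "\<exists>i::nat. T #> a = T #> b [^] i"
proof -
  obtain k where k: "\<And>t::int. g [^] t \<in> T \<longleftrightarrow> int (p ^ k) dvd t"
    by (rule pfin_cyclic_trace[OF p g(1) T]) (rule that)
  obtain s t :: int where s: "a = g [^] s" and t: "b = g [^] t" using a(1) b(1) g(2) by blast
  have "k \<noteq> 0" using k[of s] s a(2) by (cases k) auto
  then obtain m where m: "k = Suc m" by (cases k) auto
  have pw: "x [^] p = g [^] (r * int p)" if "x = g [^] r" for x r
    using that g(1) int_pow_pow[of g r "int p"] by (simp add: int_pow_int)
  \<comment> \<open>With \<open>k = Suc m\<close>, multiplying the exponents by \<open>p\<close>
    lands in the multiples of \<open>p ^ k\<close>, so both are multiples of \<open>p ^ m\<close>.
    Because \<open>b\<close> is outside \<open>T\<close>, the cofactor \<open>v\<close> is a unit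
    modulo \<open>p\<close>.\<close>
  have "int (p ^ m) dvd s" "int (p ^ m) dvd t"
    using a(3) b(3) k[of "s * int p"] k[of "t * int p"] pw[OF s] pw[OF t] m p
    by (auto simp: mult.commute)
  then obtain u v where u: "s = int (p ^ m) * u" and v: "t = int (p ^ m) * v" by (auto elim!: dvdE)
  have "\<not> int p dvd v"
  proof
    assume "int p dvd v"
    then have "int (p ^ k) dvd t" using v m by (auto simp: mult.assoc mult.left_commute)
    then show False using k[of t] t b(2) by simp
  qed
  moreover have "prime (int p)" using p by simp
  ultimately have "coprime (int p) v" by (intro prime_imp_coprime)
  then have "coprime v (int p)" by (simp add: coprime_commute)
  then obtain x where x: "[v * x = 1] (mod int p)" using cong_solve_coprime_int by blast
  \<comment> \<open>\<open>i\<close> solves \<open>v * i = u\<close> modulo \<open>p\<close>, where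
    \<open>x\<close> inverts \<open>v\<close>.\<close>
  define i where "i = nat ((x * u) mod int p)"
  have pp: "int p > 0" using p prime_gt_0_nat by simp
  have "[v * int i = v * (x * u)] (mod int p)"
    using pp by (simp add: i_def cong_def mod_mult_right_eq)
  also have "[v * (x * u) = 1 * u] (mod int p)"
    using cong_mult[OF x cong_refl[of u]] by (simp add: mult.assoc)
  finally have "int p dvd u - v * int i"
    by (simp add: cong_iff_dvd_diff dvd_diff_commute)
  then have "int (p ^ k) dvd s - t * int i"
    unfolding u v m by (auto simp: algebra_simps elim!: dvdE)
  then have "g [^] (s - t * int i) \<in> T" using k by blast
  moreover have "b [^] i = g [^] (t * int i)" using t g(1) int_pow_pow[of g t "int i"] by (simp add: int_pow_int)
  then have "a \<otimes> inv (b [^] i) = g [^] (s - t * int i)"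
    using s g(1) by (simp add: int_pow_diff)
  ultimately have "a \<otimes> inv (b [^] i) \<in> T" by simp
  then show ?thesis using normal_Mod_eq_iff[OF pfinD(1)[OF T]] a b by auto
qed

text \<open>Let \<open>b\<close> be the image of the \<open>p ^ k\<close>-th power of
  \<open>g\<close>, and let \<open>L\<close> have least index among the subgroups inside
  \<open>N\<close> that miss \<open>b\<close>; residual p-finiteness provides a candidate. Enlarging
  \<open>L\<close> inside \<open>N\<close> by a central element of order \<open>p\<close> must catch
  \<open>b\<close>, so \<open>b\<close> has order \<open>p\<close> modulo \<open>L\<close>, and the
  trace drops by exactly one step.\<close>

lemma pfin_deepen_trace:
  assumes p: "prime p" and H: "group H" and A: "group A" and i: "i \<in> hom A H"
    and inj: "inj_on i (carrier A)" and res: "residually_p_finite H p"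
    and g: "g \<in> carrier A" "\<And>m::nat. m > 0 \<Longrightarrow> g [^]\<^bsub>A\<^esub> m \<noteq> \<one>\<^bsub>A\<^esub>"
    and N: "N \<in> pfin_normals H p" and k: "\<And>t::int. i (g [^]\<^bsub>A\<^esub> t) \<in> N \<longleftrightarrow> int (p ^ k) dvd t"
  shows "\<exists>N'\<in>pfin_normals H p. N' \<subseteq> N \<and> (\<forall>t::int. i (g [^]\<^bsub>A\<^esub> t) \<in> N' \<longleftrightarrow> int (p ^ Suc k) dvd t)"
proof -
  interpret H: group H by fact
  interpret A: group A by fact
  interpret i: group_hom A H i using A H i by (simp add: group_hom_def group_hom_axioms_def)
  define b where "b = i (g [^]\<^bsub>A\<^esub> int (p ^ k))"
  have bN: "b \<in> N" unfolding b_def k by simp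
  have bc: "b \<in> carrier H" using g by (simp add: b_def)
  have "g [^]\<^bsub>A\<^esub> int (p ^ k) \<noteq> \<one>\<^bsub>A\<^esub>" using g(2)[of "p ^ k"] p prime_gt_0_nat by (simp only: int_pow_int) simp
  then have "b \<noteq> \<one>\<^bsub>H\<^esub>"
    using inj_onD[OF inj, of "g [^]\<^bsub>A\<^esub> int (p ^ k)" "\<one>\<^bsub>A\<^esub>"] g(1) unfolding b_def by auto
  then obtain N0 where N0: "N0 \<in> pfin_normals H p" "b \<notin> N0"
    using res bc unfolding residually_p_finite_def by blast
  let ?P = "\<lambda>L. L \<in> pfin_normals H p \<and> L \<subseteq> N \<and> b \<notin> L"
  have P0: "?P (N \<inter> N0)" using H.pfin_inter[OF p N N0(1)] N0 by blast
  define L where "L = arg_min (\<lambda>L. card (rcosets\<^bsub>H\<^esub> L)) ?P"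
  have L: "?P L" unfolding L_def by (rule arg_min_natI[of ?P, OF P0])
  have min: "card (rcosets\<^bsub>H\<^esub> L) \<le> card (rcosets\<^bsub>H\<^esub> M)" if "?P M" for M
    unfolding L_def by (rule arg_min_nat_le[of ?P, OF that])
  have Lp: "L \<in> pfin_normals H p" using L by blast
  have "L \<subset> N" using L bN by blast
  then obtain z where z: "z \<in> N" "central_mod H p L z"
    using H.ex_central_mod[OF p Lp pfinD(1)[OF N]] by blast
  let ?M = "central_ext H L z"
  have M: "?M \<in> pfin_normals H p" by (rule H.central_ext_pfin[OF p Lp z(2)])
  have LM: "L \<subseteq> ?M" by (rule H.central_ext_subset[OF p Lp z(2)])
  have "z \<in> ?M" "z \<notin> L" using H.central_mod_in_ext[OF p Lp z(2)] z(2) unfolding central_mod_def by blast+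
  then have "L \<subset> ?M" using LM by blast
  then have less: "card (rcosets\<^bsub>H\<^esub> ?M) < card (rcosets\<^bsub>H\<^esub> L)" by (rule H.pfin_index_less[OF Lp M])
  have "?M \<subseteq> N"
  proof
    fix h assume "h \<in> ?M"
    then obtain n where h: "h \<in> carrier H" and n: "L #>\<^bsub>H\<^esub> h = L #>\<^bsub>H\<^esub> z [^]\<^bsub>H\<^esub> (n::nat)"
      unfolding central_ext_def by blast
    have zn: "z [^]\<^bsub>H\<^esub> n \<in> N" by (rule H.subgroup_nat_pow_closed[OF pfinD(2)[OF N] z(1)])
    then have znc: "z [^]\<^bsub>H\<^esub> n \<in> carrier H" using pfinD(4)[OF N] by blast
    have "h \<otimes>\<^bsub>H\<^esub> inv\<^bsub>H\<^esub> (z [^]\<^bsub>H\<^esub> n) \<in> N"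
      using n L H.normal_Mod_eq_iff[OF pfinD(1)[OF Lp] h znc] by blast
    then have "h \<otimes>\<^bsub>H\<^esub> inv\<^bsub>H\<^esub> (z [^]\<^bsub>H\<^esub> n) \<otimes>\<^bsub>H\<^esub> z [^]\<^bsub>H\<^esub> n \<in> N"
      using zn subgroup.m_closed[OF pfinD(2)[OF N]] by blast
    then show "h \<in> N" using h znc by (simp add: H.m_assoc del: H.nat_pow_closed)
  qed
  then have "b \<in> ?M" using min[of ?M] M less by linarith
  then have "central_mod H p L b" using H.central_mod_of_ext[OF p Lp z(2)] L by blast
  then have "b [^]\<^bsub>H\<^esub> p \<in> L" by (simp add: central_mod_def)
  moreover have "b [^]\<^bsub>H\<^esub> p = i (g [^]\<^bsub>A\<^esub> int (p ^ Suc k))"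
  proof -
    have "(g [^]\<^bsub>A\<^esub> int (p ^ k)) [^]\<^bsub>A\<^esub> p = g [^]\<^bsub>A\<^esub> int (p ^ Suc k)"
      using g(1) by (simp only: int_pow_int A.nat_pow_pow power_Suc mult.commute)
    then show ?thesis unfolding b_def using i.hom_nat_pow[of "g [^]\<^bsub>A\<^esub> int (p ^ k)" p] g(1) by simp
  qed
  ultimately have in1: "i (g [^]\<^bsub>A\<^esub> int (p ^ Suc k)) \<in> L" by simp
  let ?T = "{a \<in> carrier A. i a \<in> L}"
  have T: "?T \<in> pfin_normals A p" by (rule pfin_preimage[OF p A H i Lp])
  obtain l where l: "\<And>t::int. g [^]\<^bsub>A\<^esub> t \<in> ?T \<longleftrightarrow> int (p ^ l) dvd t"
    by (rule A.pfin_cyclic_trace[OF p g(1) T]) (rule that)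
  have l': "i (g [^]\<^bsub>A\<^esub> t) \<in> L \<longleftrightarrow> int (p ^ l) dvd t" for t :: int using l[of t] g(1) by simp
  have p1: "1 < p" using p prime_gt_1_nat by blast
  have "int (p ^ l) dvd int (p ^ Suc k)" using l' in1 by blast
  then have "p ^ l dvd p ^ Suc k" by (simp only: int_dvd_int_iff)
  then have "l \<le> Suc k" using p1 power_dvd_imp_le by blast
  moreover have "\<not> int (p ^ l) dvd int (p ^ k)" using l' L unfolding b_def by blast
  then have "\<not> l \<le> k" using le_imp_power_dvd[of l k "int p"] by auto
  ultimately have "l = Suc k" by simp
  then show ?thesis using l' L by blast
qed

lemma pfin_deepen_trace_le:
  assumes p: "prime p" and H: "group H" and A: "group A" and i: "i \<in> hom A H"
    and inj: "inj_on i (carrier A)" and res: "residually_p_finite H p"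
    and g: "g \<in> carrier A" "\<And>m::nat. m > 0 \<Longrightarrow> g [^]\<^bsub>A\<^esub> m \<noteq> \<one>\<^bsub>A\<^esub>"
    and N: "N \<in> pfin_normals H p" and k: "\<And>t::int. i (g [^]\<^bsub>A\<^esub> t) \<in> N \<longleftrightarrow> int (p ^ k) dvd t"
    and kl: "k \<le> l"
  shows "\<exists>N'\<in>pfin_normals H p. N' \<subseteq> N \<and> (\<forall>t::int. i (g [^]\<^bsub>A\<^esub> t) \<in> N' \<longleftrightarrow> int (p ^ l) dvd t)"
  using kl
proof (induction l rule: dec_induct)
  case base
  then show ?case using N k by blast
next
  case (step l)
  then obtain N' where N': "N' \<in> pfin_normals H p" "N' \<subseteq> N"
    "\<And>t::int. i (g [^]\<^bsub>A\<^esub> t) \<in> N' \<longleftrightarrow> int (p ^ l) dvd t" by blast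
  show ?case using pfin_deepen_trace[OF p H A i inj res g N'(1,3)] N'(2) by blast
qed

section \<open>Descent along central extensions of order p\<close>

context amalgam_coeff begin

text \<open>\<open>K\<close> already forces elements into \<open>M1\<close> and \<open>M2\<close>,
  so the characters can be restricted to the preimages of \<open>K\<close>. A smaller subgroup that
  kills both restrictions forces elements into the kernels.\<close>

lemma separate_step:
  assumes K: "K \<in> pfin_normals G p"
    and pre1: "\<And>s. s \<in> carrier G1 \<Longrightarrow> j1 s \<in> K \<Longrightarrow> s \<in> M1" and pre2: "\<And>s. s \<in> carrier G2 \<Longrightarrow> j2 s \<in> K \<Longrightarrow> s \<in> M2"
    and c1: "conj_char G1 p M1 c1" and c2: "conj_char G2 p M2 c2"
    and ker1: "\<And>s. s \<in> M1 \<Longrightarrow> [c1 s = 0] (mod int p) \<Longrightarrow> s \<in> N1"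
    and ker2: "\<And>s. s \<in> M2 \<Longrightarrow> [c2 s = 0] (mod int p) \<Longrightarrow> s \<in> N2"
    and agree: "\<And>a. a \<in> carrier A \<Longrightarrow> i1 a \<in> M1 \<Longrightarrow> i2 a \<in> M2 \<Longrightarrow> [c1 (i1 a) = c2 (i2 a)] (mod int p)"
  shows "\<exists>K'\<in>pfin_normals G p. (\<forall>s\<in>carrier G1. j1 s \<in> K' \<longrightarrow> s \<in> N1) \<and>
    (\<forall>s\<in>carrier G2. j2 s \<in> K' \<longrightarrow> s \<in> N2)"
proof -
  have "\<exists>K'\<in>pfin_normals G p. K' \<subseteq> K \<and> (\<forall>s\<in>carrier G1. j1 s \<in> K' \<longrightarrow> [c1 s = 0] (mod int p)) \<and>
    (\<forall>s\<in>carrier G2. j2 s \<in> K' \<longrightarrow> [c2 s = 0] (mod int p))"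
  proof (rule extend_characters[OF K])
    show "conj_char G1 p {s \<in> carrier G1. j1 s \<in> K} c1"
      using c1 pre1 unfolding conj_char_def by blast
    show "conj_char G2 p {s \<in> carrier G2. j2 s \<in> K} c2"
      using c2 pre2 unfolding conj_char_def by blast
    fix a assume a: "a \<in> carrier A" "j1 (i1 a) \<in> K"
    have "i1 a \<in> M1" using pre1 a i_closed(1)[OF a(1)] by blast
    moreover have "i2 a \<in> M2" using pre2 a i_closed(2)[OF a(1)] j_agree[OF a(1)] by metis
    ultimately show "[c1 (i1 a) = c2 (i2 a)] (mod int p)" by (rule agree[OF a(1)])
  qed
  then obtain K' where K': "K' \<in> pfin_normals G p" "K' \<subseteq> K"
    and z1: "\<forall>s\<in>carrier G1. j1 s \<in> K' \<longrightarrow> [c1 s = 0] (mod int p)"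
    and z2: "\<forall>s\<in>carrier G2. j2 s \<in> K' \<longrightarrow> [c2 s = 0] (mod int p)" by blast
  have "s \<in> N1" if "s \<in> carrier G1" "j1 s \<in> K'" for s
    using that z1 K'(2) by (intro ker1 pre1) auto
  moreover have "s \<in> N2" if "s \<in> carrier G2" "j2 s \<in> K'" for s
    using that z2 K'(2) by (intro ker2 pre2) auto
  ultimately show ?thesis using K'(1) by blast
qed

end

lemma (in group) central_character:
  assumes p: "prime p" and L: "L \<in> pfin_normals G p" and z: "central_mod G p L z"
  obtains c :: "'a \<Rightarrow> int" where "conj_char G p (central_ext G L z) c"
    "\<And>g. g \<in> central_ext G L z \<Longrightarrow> [c g = 0] (mod int p) \<Longrightarrow> g \<in> L"
    "\<And>g i. g \<in> central_ext G L z \<Longrightarrow> L #> g = L #> z [^] (i::nat) \<Longrightarrow> [c g = int i] (mod int p)"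
proof -
  obtain c :: "'a \<Rightarrow> int" where c: "(\<forall>g\<in>central_ext G L z. \<forall>h\<in>central_ext G L z. [c (g \<otimes> h) = c g + c h] (mod int p)) \<and>
    (\<forall>g\<in>central_ext G L z. [c g = 0] (mod int p) \<longrightarrow> g \<in> L) \<and>
    (\<forall>g\<in>carrier G. \<forall>h\<in>central_ext G L z. [c (g \<otimes> h \<otimes> inv g) = c h] (mod int p)) \<and>
    (\<forall>g\<in>central_ext G L z. \<forall>i::nat. L #> g = L #> z [^] i \<longrightarrow> [c g = int i] (mod int p))"
    using ex_central_character[OF p L z] ..
  show thesis
  proof (rule that[of c])
    show "conj_char G p (central_ext G L z) c" using c unfolding conj_char_def by (intro conjI) (elim conjE; assumption)+
  qed (use c in blast)+
qed

lemma (in group) conj_char_zero: "conj_char G p M (\<lambda>_. 0)"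
  unfolding conj_char_def by simp

context amalgam_coeff begin

text \<open>\<open>N1\<close> and \<open>N2\<close> are open for the topologies induced by the pro-p topology of the amalgam.\<close>

definition separable :: "'a set \<Rightarrow> 'b set \<Rightarrow> bool" where
  "separable N1 N2 \<longleftrightarrow> (\<exists>K\<in>pfin_normals G p. (\<forall>s\<in>carrier G1. j1 s \<in> K \<longrightarrow> s \<in> N1) \<and>
    (\<forall>s\<in>carrier G2. j2 s \<in> K \<longrightarrow> s \<in> N2))"

lemma separable_step:
  assumes "separable M1 M2"
    and c1: "conj_char G1 p M1 c1" and c2: "conj_char G2 p M2 c2"
    and ker1: "\<And>s. s \<in> M1 \<Longrightarrow> [c1 s = 0] (mod int p) \<Longrightarrow> s \<in> N1"
    and ker2: "\<And>s. s \<in> M2 \<Longrightarrow> [c2 s = 0] (mod int p) \<Longrightarrow> s \<in> N2"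
    and agree: "\<And>a. a \<in> carrier A \<Longrightarrow> i1 a \<in> M1 \<Longrightarrow> i2 a \<in> M2 \<Longrightarrow> [c1 (i1 a) = c2 (i2 a)] (mod int p)"
  shows "separable N1 N2"
proof -
  obtain K where K: "K \<in> pfin_normals G p" "\<forall>s\<in>carrier G1. j1 s \<in> K \<longrightarrow> s \<in> M1"
    "\<forall>s\<in>carrier G2. j2 s \<in> K \<longrightarrow> s \<in> M2" using assms(1) unfolding separable_def by blast
  show ?thesis unfolding separable_def
    by (rule separate_step[OF K(1) _ _ c1 c2 ker1 ker2 agree]) (use K in blast)+
qed

lemma trace_mult_iff:
  assumes N: "N \<lhd> G1" and a: "a \<in> carrier A" "b \<in> carrier A"
  shows "N #>\<^bsub>G1\<^esub> i1 a = N #>\<^bsub>G1\<^esub> i1 b [^]\<^bsub>G1\<^esub> (n::nat) \<longleftrightarrow> i1 (a \<otimes>\<^bsub>A\<^esub> inv\<^bsub>A\<^esub> (b [^]\<^bsub>A\<^esub> n)) \<in> N"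
proof -
  interpret i1: group_hom A G1 i1 by (rule i1_hom)
  show ?thesis using G1.normal_Mod_eq_iff[OF N, of "i1 a" "i1 b [^]\<^bsub>G1\<^esub> n"] a by (simp add: i1.hom_nat_pow)
qed

lemma trace_mult_iff2:
  assumes N: "N \<lhd> G2" and a: "a \<in> carrier A" "b \<in> carrier A"
  shows "N #>\<^bsub>G2\<^esub> i2 a = N #>\<^bsub>G2\<^esub> i2 b [^]\<^bsub>G2\<^esub> (n::nat) \<longleftrightarrow> i2 (a \<otimes>\<^bsub>A\<^esub> inv\<^bsub>A\<^esub> (b [^]\<^bsub>A\<^esub> n)) \<in> N"
proof -
  interpret i2: group_hom A G2 i2 by (rule i2_hom)
  show ?thesis using G2.normal_Mod_eq_iff[OF N, of "i2 a" "i2 b [^]\<^bsub>G2\<^esub> n"] a by (simp add: i2.hom_nat_pow)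
qed

text \<open>In both quotients the image of the same \<open>a0\<close> generates a central subgroup
  of order \<open>p\<close>. The two central characters, normalised to be 1 there, agree on
  \<open>A\<close> because \<open>N1\<close> and \<open>N2\<close> have the same trace.\<close>

lemma separable_jump:
  assumes N1: "N1 \<in> pfin_normals G1 p" and N2: "N2 \<in> pfin_normals G2 p"
    and tr: "\<And>a. a \<in> carrier A \<Longrightarrow> i1 a \<in> N1 \<longleftrightarrow> i2 a \<in> N2"
    and a0: "a0 \<in> carrier A" and z1: "central_mod G1 p N1 (i1 a0)" and z2: "central_mod G2 p N2 (i2 a0)"
    and IH: "(\<And>a. a \<in> carrier A \<Longrightarrow> i1 a \<in> central_ext G1 N1 (i1 a0) \<longleftrightarrow> i2 a \<in> central_ext G2 N2 (i2 a0))
      \<Longrightarrow> separable (central_ext G1 N1 (i1 a0)) (central_ext G2 N2 (i2 a0))"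
  shows "separable N1 N2"
proof -
  have tr': "N1 #>\<^bsub>G1\<^esub> i1 a = N1 #>\<^bsub>G1\<^esub> i1 a0 [^]\<^bsub>G1\<^esub> (n::nat) \<longleftrightarrow> N2 #>\<^bsub>G2\<^esub> i2 a = N2 #>\<^bsub>G2\<^esub> i2 a0 [^]\<^bsub>G2\<^esub> n"
    if a: "a \<in> carrier A" for a n
    unfolding trace_mult_iff[OF pfinD(1)[OF N1] a a0] trace_mult_iff2[OF pfinD(1)[OF N2] a a0]
    by (rule tr) (use a a0 in simp)
  have ext: "i1 a \<in> central_ext G1 N1 (i1 a0) \<longleftrightarrow> i2 a \<in> central_ext G2 N2 (i2 a0)" if a: "a \<in> carrier A" for a
    unfolding central_ext_def using tr'[OF a] i_closed[OF a] by simp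
  obtain c1 where c1: "conj_char G1 p (central_ext G1 N1 (i1 a0)) c1"
    and k1: "\<And>g. g \<in> central_ext G1 N1 (i1 a0) \<Longrightarrow> [c1 g = 0] (mod int p) \<Longrightarrow> g \<in> N1"
    and n1: "\<And>g i. g \<in> central_ext G1 N1 (i1 a0) \<Longrightarrow> N1 #>\<^bsub>G1\<^esub> g = N1 #>\<^bsub>G1\<^esub> i1 a0 [^]\<^bsub>G1\<^esub> (i::nat) \<Longrightarrow> [c1 g = int i] (mod int p)"
    using G1.central_character[OF prime_p N1 z1] by metis
  obtain c2 where c2: "conj_char G2 p (central_ext G2 N2 (i2 a0)) c2"
    and k2: "\<And>g. g \<in> central_ext G2 N2 (i2 a0) \<Longrightarrow> [c2 g = 0] (mod int p) \<Longrightarrow> g \<in> N2"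
    and n2: "\<And>g i. g \<in> central_ext G2 N2 (i2 a0) \<Longrightarrow> N2 #>\<^bsub>G2\<^esub> g = N2 #>\<^bsub>G2\<^esub> i2 a0 [^]\<^bsub>G2\<^esub> (i::nat) \<Longrightarrow> [c2 g = int i] (mod int p)"
    using G2.central_character[OF prime_p N2 z2] by metis
  show ?thesis
  proof (rule separable_step[OF IH[OF ext] c1 c2 k1 k2])
    fix a assume a: "a \<in> carrier A" "i1 a \<in> central_ext G1 N1 (i1 a0)" "i2 a \<in> central_ext G2 N2 (i2 a0)"
    then obtain n where n: "N1 #>\<^bsub>G1\<^esub> i1 a = N1 #>\<^bsub>G1\<^esub> i1 a0 [^]\<^bsub>G1\<^esub> (n::nat)" unfolding central_ext_def by blast
    have "[c1 (i1 a) = int n] (mod int p)" by (rule n1[OF a(2) n])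
    moreover have "[c2 (i2 a) = int n] (mod int p)" by (rule n2[OF a(3)]) (rule iffD1[OF tr'[OF a(1)] n])
    ultimately show "[c1 (i1 a) = c2 (i2 a)] (mod int p)" by (meson cong_sym cong_trans)
  qed
qed

text \<open>The extension by \<open>z\<close> catches nothing new from \<open>A\<close>, so the
  central character vanishes on \<open>A\<close> and is compatible with the zero character of the
  other factor.\<close>

lemma separable_left:
  assumes N1: "N1 \<in> pfin_normals G1 p" and z: "central_mod G1 p N1 z"
    and tr: "\<And>a. a \<in> carrier A \<Longrightarrow> i1 a \<in> central_ext G1 N1 z \<Longrightarrow> i1 a \<in> N1"
    and sep: "separable (central_ext G1 N1 z) N2"
  shows "separable N1 N2"
proof -
  obtain c where c: "conj_char G1 p (central_ext G1 N1 z) c"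
    and k: "\<And>g. g \<in> central_ext G1 N1 z \<Longrightarrow> [c g = 0] (mod int p) \<Longrightarrow> g \<in> N1"
    and n: "\<And>g i. g \<in> central_ext G1 N1 z \<Longrightarrow> N1 #>\<^bsub>G1\<^esub> g = N1 #>\<^bsub>G1\<^esub> z [^]\<^bsub>G1\<^esub> (i::nat) \<Longrightarrow> [c g = int i] (mod int p)"
    using G1.central_character[OF prime_p N1 z] by metis
  show ?thesis
  proof (rule separable_step[OF sep c G2.conj_char_zero[of p N2] k])
    fix a assume a: "a \<in> carrier A" "i1 a \<in> central_ext G1 N1 z"
    have "i1 a \<in> N1" by (rule tr[OF a])
    then have "N1 #>\<^bsub>G1\<^esub> i1 a = N1 #>\<^bsub>G1\<^esub> z [^]\<^bsub>G1\<^esub> (0::nat)"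
      using G1.coset_eq_subgroup_iff[OF pfinD(1)[OF N1]] i_closed(1)[OF a(1)] pfinD(4)[OF N1] by simp
    then show "[c (i1 a) = 0] (mod int p)" using n[OF a(2), of 0] by simp
  qed
qed

lemma separable_right:
  assumes N2: "N2 \<in> pfin_normals G2 p" and z: "central_mod G2 p N2 z"
    and tr: "\<And>a. a \<in> carrier A \<Longrightarrow> i2 a \<in> central_ext G2 N2 z \<Longrightarrow> i2 a \<in> N2"
    and sep: "separable N1 (central_ext G2 N2 z)"
  shows "separable N1 N2"
proof -
  obtain c where c: "conj_char G2 p (central_ext G2 N2 z) c"
    and k: "\<And>g. g \<in> central_ext G2 N2 z \<Longrightarrow> [c g = 0] (mod int p) \<Longrightarrow> g \<in> N2"
    and n: "\<And>g i. g \<in> central_ext G2 N2 z \<Longrightarrow> N2 #>\<^bsub>G2\<^esub> g = N2 #>\<^bsub>G2\<^esub> z [^]\<^bsub>G2\<^esub> (i::nat) \<Longrightarrow> [c g = int i] (mod int p)"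
    using G2.central_character[OF prime_p N2 z] by metis
  show ?thesis
  proof (rule separable_step[OF sep G1.conj_char_zero[of p N1] c _ k])
    fix a assume a: "a \<in> carrier A" "i2 a \<in> central_ext G2 N2 z"
    have "i2 a \<in> N2" by (rule tr[OF a])
    then have "N2 #>\<^bsub>G2\<^esub> i2 a = N2 #>\<^bsub>G2\<^esub> z [^]\<^bsub>G2\<^esub> (0::nat)"
      using G2.coset_eq_subgroup_iff[OF pfinD(1)[OF N2]] i_closed(2)[OF a(1)] pfinD(4)[OF N2] by simp
    then show "[0 = c (i2 a)] (mod int p)" using n[OF a(2), of 0] by (simp add: cong_sym)
  qed
qed

text \<open>Induction on the sum of the indices. If some central extension of order \<open>p\<close>
  on one side leaves the trace on \<open>A\<close> unchanged, that side is enlarged alone. Otherwise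
  the central elements on both sides come from \<open>A\<close> and, \<open>A\<close> being cyclic,
  generate the same subgroup of order \<open>p\<close> modulo the common trace, so both sides are
  enlarged by one element.\<close>

lemma separable_compatible:
  assumes g: "g \<in> carrier A" "carrier A = {g [^]\<^bsub>A\<^esub> t | t::int. True}"
  shows "N1 \<in> pfin_normals G1 p \<Longrightarrow> N2 \<in> pfin_normals G2 p \<Longrightarrow>
    (\<And>a. a \<in> carrier A \<Longrightarrow> i1 a \<in> N1 \<longleftrightarrow> i2 a \<in> N2) \<Longrightarrow> separable N1 N2"
proof (induction "card (rcosets\<^bsub>G1\<^esub> N1) + card (rcosets\<^bsub>G2\<^esub> N2)" arbitrary: N1 N2 rule: less_induct)
  case less
  note N1 = less.prems(1) and N2 = less.prems(2) and tr = less.prems(3)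
  note E1 = G1.central_ext_pfin[OF prime_p N1] and E2 = G2.central_ext_pfin[OF prime_p N2]
  have lt1: "card (rcosets\<^bsub>G1\<^esub> (central_ext G1 N1 z)) < card (rcosets\<^bsub>G1\<^esub> N1)" if z: "central_mod G1 p N1 z" for z
  proof (rule G1.pfin_index_less[OF N1 E1[OF z]])
    have "z \<notin> N1" using z by (simp add: central_mod_def)
    then show "N1 \<subset> central_ext G1 N1 z"
      using G1.central_ext_subset[OF prime_p N1 z] G1.central_mod_in_ext[OF prime_p N1 z] by blast
  qed
  have lt2: "card (rcosets\<^bsub>G2\<^esub> (central_ext G2 N2 z)) < card (rcosets\<^bsub>G2\<^esub> N2)" if z: "central_mod G2 p N2 z" for z
  proof (rule G2.pfin_index_less[OF N2 E2[OF z]])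
    have "z \<notin> N2" using z by (simp add: central_mod_def)
    then show "N2 \<subset> central_ext G2 N2 z"
      using G2.central_ext_subset[OF prime_p N2 z] G2.central_mod_in_ext[OF prime_p N2 z] by blast
  qed
  consider (left) z where "central_mod G1 p N1 z" "\<And>a. a \<in> carrier A \<Longrightarrow> i1 a \<in> central_ext G1 N1 z \<Longrightarrow> i1 a \<in> N1"
    | (right) z where "central_mod G2 p N2 z" "\<And>a. a \<in> carrier A \<Longrightarrow> i2 a \<in> central_ext G2 N2 z \<Longrightarrow> i2 a \<in> N2"
    | (none) "\<And>z. central_mod G1 p N1 z \<Longrightarrow> \<exists>a\<in>carrier A. i1 a \<in> central_ext G1 N1 z \<and> i1 a \<notin> N1"
      "\<And>z. central_mod G2 p N2 z \<Longrightarrow> \<exists>a\<in>carrier A. i2 a \<in> central_ext G2 N2 z \<and> i2 a \<notin> N2"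
    by blast
  then show ?case
  proof cases
    case (left z)
    have "separable (central_ext G1 N1 z) N2"
    proof (rule less.hyps[OF _ E1[OF left(1)] N2])
      fix a assume a: "a \<in> carrier A"
      show "i1 a \<in> central_ext G1 N1 z \<longleftrightarrow> i2 a \<in> N2"
        using left(2)[OF a] tr[OF a] G1.central_ext_subset[OF prime_p N1 left(1)] by blast
    qed (use lt1[OF left(1)] in simp)
    then show ?thesis using separable_left[OF N1 left(1)] left(2) by blast
  next
    case (right z)
    have "separable N1 (central_ext G2 N2 z)"
    proof (rule less.hyps[OF _ N1 E2[OF right(1)]])
      fix a assume a: "a \<in> carrier A"
      show "i1 a \<in> N1 \<longleftrightarrow> i2 a \<in> central_ext G2 N2 z"
        using right(2)[OF a] tr[OF a] G2.central_ext_subset[OF prime_p N2 right(1)] by blast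
    qed (use lt2[OF right(1)] in simp)
    then show ?thesis using separable_right[OF N2 right(1)] right(2) by blast
  next
    case none
    interpret i1: group_hom A G1 i1 by (rule i1_hom)
    interpret i2: group_hom A G2 i2 by (rule i2_hom)
    show ?thesis
    proof (cases "N1 = carrier G1 \<and> N2 = carrier G2")
      case True
      then show ?thesis using G.carrier_pfin unfolding separable_def by blast
    next
      case False
      have ex1: "\<exists>z. central_mod G1 p N1 z" if "N1 \<noteq> carrier G1"
        using G1.ex_central_mod[OF prime_p N1 pfinD(1)[OF G1.carrier_pfin]] that pfinD(4)[OF N1] by blast
      have ex2: "\<exists>z. central_mod G2 p N2 z" if "N2 \<noteq> carrier G2"
        using G2.ex_central_mod[OF prime_p N2 pfinD(1)[OF G2.carrier_pfin]] that pfinD(4)[OF N2] by blast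
      have "\<exists>z. central_mod G1 p N1 z"
      proof (rule ccontr)
        assume neg: "\<not> ?thesis"
        then have "N1 = carrier G1" using ex1 by blast
        then obtain z a where "a \<in> carrier A" "i2 a \<notin> N2" using False ex2 none(2) by blast
        then show False using tr \<open>N1 = carrier G1\<close> by auto
      qed
      then obtain z1 a1 where z1: "central_mod G1 p N1 z1" and a1: "a1 \<in> carrier A" "i1 a1 \<in> central_ext G1 N1 z1" "i1 a1 \<notin> N1"
        using none(1) by blast
      have "N2 \<noteq> carrier G2" using tr[OF a1(1)] a1 by auto
      then obtain z2 a2 where z2: "central_mod G2 p N2 z2" and a2: "a2 \<in> carrier A" "i2 a2 \<in> central_ext G2 N2 z2" "i2 a2 \<notin> N2"
        using none(2) ex2 by blast
      have c1: "central_mod G1 p N1 (i1 a1)" by (rule G1.central_mod_of_ext[OF prime_p N1 z1 a1(2,3)])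
      have c2: "central_mod G2 p N2 (i2 a2)" by (rule G2.central_mod_of_ext[OF prime_p N2 z2 a2(2,3)])
      define T where "T = {a \<in> carrier A. i1 a \<in> N1}"
      have T: "T \<in> pfin_normals A p" unfolding T_def by (rule pfin_preimage[OF prime_p A.is_group G1.is_group i1 N1])
      have T2: "T = {a \<in> carrier A. i2 a \<in> N2}" unfolding T_def using tr by blast
      have p1: "a1 \<notin> T" "a1 [^]\<^bsub>A\<^esub> p \<in> T"
        using a1 c1 i1.hom_nat_pow[OF a1(1)] unfolding T_def central_mod_def by auto
      have p2: "a2 \<notin> T" "a2 [^]\<^bsub>A\<^esub> p \<in> T"
        using a2 c2 i2.hom_nat_pow[OF a2(1)] unfolding T2 central_mod_def by auto
      \<comment> \<open>Since \<open>a1\<close> is a power of \<open>a2\<close> modulo the trace, it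
        can replace \<open>a2\<close> on the second side.\<close>
      obtain n where n: "T #>\<^bsub>A\<^esub> a1 = T #>\<^bsub>A\<^esub> a2 [^]\<^bsub>A\<^esub> (n::nat)"
        using A.cyclic_order_p_cosets[OF prime_p g T a1(1) p1 a2(1) p2] by blast
      then have "a1 \<otimes>\<^bsub>A\<^esub> inv\<^bsub>A\<^esub> (a2 [^]\<^bsub>A\<^esub> n) \<in> T"
        using A.normal_Mod_eq_iff[OF pfinD(1)[OF T]] a1(1) a2(1) by auto
      then have "N2 #>\<^bsub>G2\<^esub> i2 a1 = N2 #>\<^bsub>G2\<^esub> i2 a2 [^]\<^bsub>G2\<^esub> n"
        using trace_mult_iff2[OF pfinD(1)[OF N2] a1(1) a2(1)] unfolding T2 by blast
      then have "i2 a1 \<in> central_ext G2 N2 (i2 a2)" using a1(1) unfolding central_ext_def by auto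
      moreover have "i2 a1 \<notin> N2" using tr[OF a1(1)] a1 by blast
      ultimately have c2': "central_mod G2 p N2 (i2 a1)" by (rule G2.central_mod_of_ext[OF prime_p N2 c2])
      show ?thesis
      proof (rule separable_jump[OF N1 N2 tr a1(1) c1 c2'])
        assume ext: "\<And>a. a \<in> carrier A \<Longrightarrow> i1 a \<in> central_ext G1 N1 (i1 a1) \<longleftrightarrow> i2 a \<in> central_ext G2 N2 (i2 a1)"
        show "separable (central_ext G1 N1 (i1 a1)) (central_ext G2 N2 (i2 a1))"
          by (rule less.hyps[OF _ E1[OF c1] E2[OF c2'] ext]) (use lt1[OF c1] lt2[OF c2'] in simp)
      qed
    qed
  qed
qed

text \<open>Traces on an infinite cyclic \<open>A\<close> are given by exponents of
  \<open>p\<close>; both are deepened to the larger exponent, and the smaller subgroups so obtained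
  have equal traces. For trivial \<open>A\<close> the traces are equal from the start.\<close>

lemma separable_all:
  assumes inj: "inj_on i1 (carrier A)" "inj_on i2 (carrier A)"
    and res: "residually_p_finite G1 p" "residually_p_finite G2 p"
    and g: "g \<in> carrier A" "carrier A = {g [^]\<^bsub>A\<^esub> t | t::int. True}"
    and tf: "\<And>m::nat. m > 0 \<Longrightarrow> g [^]\<^bsub>A\<^esub> m = \<one>\<^bsub>A\<^esub> \<Longrightarrow> g = \<one>\<^bsub>A\<^esub>"
    and N1: "N1 \<in> pfin_normals G1 p" and N2: "N2 \<in> pfin_normals G2 p"
  shows "separable N1 N2"
proof (cases "g = \<one>\<^bsub>A\<^esub>")
  case True
  interpret i1: group_hom A G1 i1 by (rule i1_hom)
  interpret i2: group_hom A G2 i2 by (rule i2_hom)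
  have "carrier A = {\<one>\<^bsub>A\<^esub>}" using g(2) True by auto
  then have "i1 a \<in> N1 \<longleftrightarrow> i2 a \<in> N2" if "a \<in> carrier A" for a
    using that subgroup.one_closed[OF pfinD(2)[OF N1]] subgroup.one_closed[OF pfinD(2)[OF N2]] by auto
  then show ?thesis by (rule separable_compatible[OF g N1 N2])
next
  case False
  then have tf': "\<And>m::nat. m > 0 \<Longrightarrow> g [^]\<^bsub>A\<^esub> m \<noteq> \<one>\<^bsub>A\<^esub>" using tf by blast
  have tr: "\<exists>k. \<forall>t::int. i (g [^]\<^bsub>A\<^esub> t) \<in> N \<longleftrightarrow> int (p ^ k) dvd t"
    if tN: "{a \<in> carrier A. i a \<in> N} \<in> pfin_normals A p" for i and N :: "'x set"
  proof -
    obtain k where "\<And>t::int. g [^]\<^bsub>A\<^esub> t \<in> {a \<in> carrier A. i a \<in> N} \<longleftrightarrow> int (p ^ k) dvd t"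
      by (rule A.pfin_cyclic_trace[OF prime_p g(1) tN]) (rule that)
    then show ?thesis using g(1) by (intro exI[of _ k]) auto
  qed
  obtain k1 where k1: "\<And>t::int. i1 (g [^]\<^bsub>A\<^esub> t) \<in> N1 \<longleftrightarrow> int (p ^ k1) dvd t"
    using tr[OF pfin_preimage[OF prime_p A.is_group G1.is_group i1 N1]] by blast
  obtain k2 where k2: "\<And>t::int. i2 (g [^]\<^bsub>A\<^esub> t) \<in> N2 \<longleftrightarrow> int (p ^ k2) dvd t"
    using tr[OF pfin_preimage[OF prime_p A.is_group G2.is_group i2 N2]] by blast
  define l where "l = max k1 k2"
  obtain N1' where N1': "N1' \<in> pfin_normals G1 p" "N1' \<subseteq> N1" "\<forall>t::int. i1 (g [^]\<^bsub>A\<^esub> t) \<in> N1' \<longleftrightarrow> int (p ^ l) dvd t"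
    using pfin_deepen_trace_le[OF prime_p G1.is_group A.is_group i1 inj(1) res(1) g(1) tf' N1 k1, of l]
    unfolding l_def by auto
  obtain N2' where N2': "N2' \<in> pfin_normals G2 p" "N2' \<subseteq> N2" "\<forall>t::int. i2 (g [^]\<^bsub>A\<^esub> t) \<in> N2' \<longleftrightarrow> int (p ^ l) dvd t"
    using pfin_deepen_trace_le[OF prime_p G2.is_group A.is_group i2 inj(2) res(2) g(1) tf' N2 k2, of l]
    unfolding l_def by auto
  have "separable N1' N2'"
  proof (rule separable_compatible[OF g N1'(1) N2'(1)])
    fix a assume "a \<in> carrier A"
    then obtain t :: int where "a = g [^]\<^bsub>A\<^esub> t" using g(2) by blast
    then show "i1 a \<in> N1' \<longleftrightarrow> i2 a \<in> N2'" using N1'(3) N2'(3) by simp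
  qed
  then show ?thesis using N1'(2) N2'(2) unfolding separable_def by blast
qed

end

subsection \<open>Homogeneous cochains\<close>

lemma tuples_0 [simp]: "tuples S 0 = {[]}"
  by (auto simp: tuples_def)

lemma Cons_in_tuples [simp]: "x # xs \<in> tuples S (Suc n) \<longleftrightarrow> x \<in> S \<and> xs \<in> tuples S n"
  by (auto simp: tuples_def)

lemma tuples_SucE:
  assumes "xs \<in> tuples S (Suc n)" obtains x ys where "xs = x # ys" "x \<in> S" "ys \<in> tuples S n"
  using assms by (cases xs) (auto simp: tuples_def)

lemma append_in_tuples: "xs \<in> tuples S m \<Longrightarrow> ys \<in> tuples S n \<Longrightarrow> xs @ ys \<in> tuples S (m + n)"
  by (auto simp: tuples_def)

lemma tuples_length: "xs \<in> tuples S n \<Longrightarrow> length xs = n"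
  by (simp add: tuples_def)

lemma tuples_lists: "xs \<in> tuples S n \<Longrightarrow> xs \<in> lists S"
  by (auto simp: tuples_def)

lemma tuples_eq: "xs \<in> tuples S n \<longleftrightarrow> xs \<in> lists S \<and> length xs = n"
  by (auto simp: tuples_def)

lemma map_in_tuples: "xs \<in> tuples S n \<Longrightarrow> (\<And>x. x \<in> S \<Longrightarrow> f x \<in> T) \<Longrightarrow> map f xs \<in> tuples T n"
  by (auto simp: tuples_def)

section \<open>The homogeneous differential and the prism homotopy\<close>

text \<open>The alternating sum over omitted entries, by recursion on the first. Lists of length n +
  1 carry degree n; the empty list is included, so that the value on singletons is the
  augmentation.\<close>

fun bd :: "('g list \<Rightarrow> 'k::ab_group_add) \<Rightarrow> 'g list \<Rightarrow> 'k" where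
  "bd f [] = 0"
| "bd f (x # xs) = f xs - bd (\<lambda>zs. f (x # zs)) xs"

lemma bd_add: "bd (\<lambda>zs. f zs + g zs) xs = bd f xs + bd g xs"
  by (induction xs arbitrary: f g) (simp_all add: algebra_simps)

lemma bd_minus: "bd (\<lambda>zs. - f zs) xs = - bd f xs"
  by (induction xs arbitrary: f) simp_all

lemma bd_diff: "bd (\<lambda>zs. f zs - g zs) xs = bd f xs - bd g xs"
  using bd_add[of f "\<lambda>zs. - g zs" xs] by (simp add: bd_minus)

lemma bd_zero [simp]: "bd (\<lambda>zs. 0) xs = 0"
  by (induction xs) simp_all

lemma bd_bd [simp]: "bd (bd f) xs = 0"
  by (induction xs arbitrary: f) (simp_all add: bd_diff)

lemma bd_bd' [simp]: "bd (\<lambda>zs. bd f zs) xs = 0"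
  using bd_bd[of f xs] by simp

lemma bd_map: "bd f (map r xs) = bd (\<lambda>zs. f (map r zs)) xs"
  by (induction xs arbitrary: f) simp_all

lemma bd_commute: "bd (\<lambda>zs. bd (\<Phi> zs) ys) xs = bd (\<lambda>ws. bd (\<lambda>zs. \<Phi> zs ws) xs) ys"
  by (induction xs arbitrary: \<Phi>) (simp_all add: bd_diff)

text \<open>One principle covers equality, translation and congruence of cochains: the boundary at related
  lists only sees related faces.\<close>

lemma bd_rel:
  assumes "list_all2 R xs xs'" "length xs = Suc n"
    and "\<And>zs zs'. list_all2 R zs zs' \<Longrightarrow> length zs = n \<Longrightarrow> f zs = g zs'"
  shows "bd f xs = bd g xs'"
  using assms
proof (induction n arbitrary: xs xs' f g)
  case 0
  then obtain x x' where "xs = [x]" "xs' = [x']"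
    by (cases xs; cases xs') auto
  then show ?case using 0 by simp
next
  case (Suc n)
  then obtain x x' zs zs' where eq: "xs = x # zs" "xs' = x' # zs'" and R: "R x x'" "list_all2 R zs zs'"
    by (cases xs; cases xs') auto
  have "bd (\<lambda>ws. f (x # ws)) zs = bd (\<lambda>ws. g (x' # ws)) zs'"
    by (rule Suc.IH[OF R(2)]) (use Suc.prems eq R in auto)
  then show ?case using Suc.prems eq R by simp
qed

lemma list_all2_same_tuples: "list_all2 (\<lambda>x y. x \<in> S \<and> y = x) xs ys \<longleftrightarrow> xs \<in> lists S \<and> ys = xs"
  by (induction xs arbitrary: ys) (auto simp: list_all2_Cons1)

lemma bd_cong:
  assumes "xs \<in> tuples S (Suc n)" "\<And>zs. zs \<in> tuples S n \<Longrightarrow> f zs = g zs"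
  shows "bd f xs = bd g xs"
proof (rule bd_rel[where R = "\<lambda>x y. x \<in> S \<and> y = x" and n = n])
  show "list_all2 (\<lambda>x y. x \<in> S \<and> y = x) xs xs"
    using assms(1) by (simp add: list_all2_same_tuples tuples_lists)
qed (use assms in \<open>auto simp: list_all2_same_tuples tuples_eq\<close>)

lemma bd_closed:
  assumes "xs \<in> tuples S (Suc n)" "\<And>zs. zs \<in> tuples S n \<Longrightarrow> f zs \<in> W"
    and "\<And>a b. a \<in> W \<Longrightarrow> b \<in> W \<Longrightarrow> a - b \<in> W" "0 \<in> W"
  shows "bd f xs \<in> W"
  using assms(1,2)
proof (induction n arbitrary: xs f)
  case 0
  then obtain x where "xs = [x]" by (auto elim: tuples_SucE)
  then show ?case using 0 by simp
next
  case (Suc n)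
  then obtain x zs where xs: "xs = x # zs" "x \<in> S" "zs \<in> tuples S (Suc n)" by (auto elim: tuples_SucE)
  have "bd (\<lambda>ws. f (x # ws)) zs \<in> W" by (rule Suc.IH[OF xs(3)]) (use Suc.prems xs in auto)
  then show ?case using Suc.prems xs assms(3) by simp
qed

text \<open>The prism operator between the identity and the map induced by \<open>r\<close>: the
  alternating sum of f(r y_0, ..., r y_i, y_i, ..., y_n).\<close>

fun prism :: "('g \<Rightarrow> 'g) \<Rightarrow> ('g list \<Rightarrow> 'k::ab_group_add) \<Rightarrow> 'g list \<Rightarrow> 'k" where
  "prism r f [] = 0"
| "prism r f (y # ys) = f (r y # y # ys) - prism r (\<lambda>zs. f (r y # zs)) ys"

lemma prism_diff: "prism r (\<lambda>zs. f zs - g zs) xs = prism r f xs - prism r g xs"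
  by (induction xs arbitrary: f g) (simp_all add: algebra_simps)

lemma prism_homotopy: "bd (prism r f) ys + prism r (bd f) ys = f ys - f (map r ys)"
proof (induction ys arbitrary: f)
  case (Cons y ys)
  let ?f = "\<lambda>zs. f (r y # zs)"
  have 1: "bd (prism r f) (y # ys) = prism r f ys - bd (\<lambda>zs. ?f (y # zs)) ys + bd (prism r ?f) ys"
    by (simp add: bd_diff algebra_simps)
  have 2: "prism r (bd f) (y # ys) = f (y # ys) - (?f ys - bd (\<lambda>zs. ?f (y # zs)) ys)
      - (prism r f ys - prism r (bd ?f) ys)"
    by (simp add: prism_diff)
  show ?case unfolding 1 2 using Cons[of ?f] by (simp add: algebra_simps)
qed simp

lemma prism_rel:
  assumes "list_all2 R xs xs'" "\<And>x x'. R x x' \<Longrightarrow> R (r x) (r x')"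
    and "\<And>zs zs'. list_all2 R zs zs' \<Longrightarrow> length zs = Suc (length xs) \<Longrightarrow> f zs = g zs'"
  shows "prism r f xs = prism r g xs'"
  using assms(1,3)
proof (induction xs xs' arbitrary: f g rule: list_all2_induct)
  case (Cons x xs x' xs')
  have "prism r (\<lambda>zs. f (r x # zs)) xs = prism r (\<lambda>zs. g (r x' # zs)) xs'"
    by (rule Cons.IH) (use Cons.prems Cons.hyps assms(2) in auto)
  moreover have "f (r x # x # xs) = g (r x' # x' # xs')"
    by (rule Cons.prems) (use Cons.hyps assms(2) in auto)
  ultimately show ?case by simp
qed simp

lemma prism_closed:
  assumes "xs \<in> lists S" "\<And>x. x \<in> S \<Longrightarrow> r x \<in> S" "\<And>zs. zs \<in> tuples S (Suc (length xs)) \<Longrightarrow> f zs \<in> W"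
    and W: "\<And>a b. a \<in> W \<Longrightarrow> b \<in> W \<Longrightarrow> a - b \<in> W" "0 \<in> W"
  shows "prism r f xs \<in> W"
  using assms(1,3)
proof (induction xs arbitrary: f)
  case (Cons x xs)
  have "prism r (\<lambda>zs. f (r x # zs)) xs \<in> W"
    by (rule Cons.IH) (use Cons assms(2) in auto)
  moreover have "f (r x # x # xs) \<in> W" using Cons assms(2) by (auto simp: tuples_eq)
  ultimately show ?case using W by simp
qed (use W in simp)

lemma (in group) lact_tuples:
  "g \<in> carrier G \<Longrightarrow> xs \<in> tuples (carrier G) k \<Longrightarrow> lact G g xs \<in> tuples (carrier G) k"
  by (simp add: tuples_eq)

section \<open>Coset tuples and locally constant cochains\<close>

definition cosets :: "('a, 'm) monoid_scheme \<Rightarrow> 'a set \<Rightarrow> 'a list \<Rightarrow> 'a set list" where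
  "cosets G N xs = map (\<lambda>x. N #>\<^bsub>G\<^esub> x) xs"

lemma cosets_simps [simp]: "cosets G N [] = []" "cosets G N (x # xs) = (N #>\<^bsub>G\<^esub> x) # cosets G N xs"
  "length (cosets G N xs) = length xs"
  by (simp_all add: cosets_def)

lemma cosets_eq_iff:
  assumes "xs \<in> lists S" "ys \<in> lists S"
  shows "cosets G N xs = cosets G N ys \<longleftrightarrow>
    list_all2 (\<lambda>x y. x \<in> S \<and> y \<in> S \<and> N #>\<^bsub>G\<^esub> x = N #>\<^bsub>G\<^esub> y) xs ys"
  using assms
proof (induction xs arbitrary: ys)
  case (Cons x xs)
  then show ?case by (cases ys) auto
qed (auto simp: cosets_def)

lemma list_all2_lists: "list_all2 (\<lambda>x y. x \<in> S \<and> y \<in> T \<and> P x y) xs ys \<Longrightarrow> xs \<in> lists S \<and> ys \<in> lists T"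
  by (induction rule: list_all2_induct) auto

lemma (in group) cosets_mono:
  assumes "N \<lhd> G" "M \<lhd> G" "N \<subseteq> M" "xs \<in> lists (carrier G)" "ys \<in> lists (carrier G)"
    "cosets G N xs = cosets G N ys"
  shows "cosets G M xs = cosets G M ys"
proof -
  have "list_all2 (\<lambda>x y. x \<in> carrier G \<and> y \<in> carrier G \<and> N #> x = N #> y) xs ys"
    by (rule iffD1[OF cosets_eq_iff[OF assms(4,5)] assms(6)])
  then have "list_all2 (\<lambda>x y. x \<in> carrier G \<and> y \<in> carrier G \<and> M #> x = M #> y) xs ys"
  proof (rule list_all2_mono)
    fix x y assume xy: "x \<in> carrier G \<and> y \<in> carrier G \<and> N #> x = N #> y"
    then have "x \<otimes> inv y \<in> M" using normal_Mod_eq_iff[OF assms(1), of x y] assms(3) by auto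
    then show "x \<in> carrier G \<and> y \<in> carrier G \<and> M #> x = M #> y"
      using xy normal_Mod_eq_iff[OF assms(2), of x y] by simp
  qed
  then show ?thesis by (rule iffD2[OF cosets_eq_iff[OF assms(4,5)]])
qed

lemma (in group) cosets_lact_cong:
  assumes "N \<lhd> G" "g \<in> carrier G" "xs \<in> lists (carrier G)" "ys \<in> lists (carrier G)"
    "cosets G N xs = cosets G N ys"
  shows "cosets G N (lact G g xs) = cosets G N (lact G g ys)"
proof -
  have "list_all2 (\<lambda>x y. x \<in> carrier G \<and> y \<in> carrier G \<and> N #> x = N #> y) xs ys"
    by (rule iffD1[OF cosets_eq_iff[OF assms(3,4)] assms(5)])
  then show ?thesis
  proof (induction rule: list_all2_induct)
    case (Cons x xs y ys)
    then show ?case using coset_mult_left_cancel[OF assms(1,2), of x y] by simp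
  qed simp
qed

lemma (in group) cosets_lact_normal:
  assumes "N \<lhd> G" "n \<in> N" "xs \<in> lists (carrier G)"
  shows "cosets G N (lact G n xs) = cosets G N xs"
  using assms(3)
proof (induction xs)
  case (Cons x xs)
  have "n \<in> carrier G" using assms normal_imp_subgroup subgroup.subset by blast
  then have "N #> (n \<otimes> x) = N #> x" using Cons assms by (simp add: normal_Mod_eq_iff m_assoc)
  then show ?case using Cons by simp
qed simp

context zmod_coeff begin

text \<open>The first list carries the continuous variables and the second the abstract ones; \<open>S\<close> acts on both
  through \<open>j\<close>. Local constancy is uniform in the abstract variables.\<close>

definition adm :: "('g, 'm) monoid_scheme \<Rightarrow> ('s, 'n) monoid_scheme \<Rightarrow> ('s \<Rightarrow> 'g) \<Rightarrow> nat \<Rightarrow> nat \<Rightarrow>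
    ('g list \<Rightarrow> 'g list \<Rightarrow> 'k) \<Rightarrow> bool" where
  "adm G S j m n \<Phi> \<longleftrightarrow>
    (\<forall>xs\<in>tuples (carrier G) m. \<forall>ys\<in>tuples (carrier G) n. \<Phi> xs ys \<in> V) \<and>
    (\<forall>xs\<in>tuples (carrier G) m. \<forall>ys\<in>tuples (carrier G) n. \<forall>s\<in>carrier S.
      \<Phi> (lact G (j s) xs) (lact G (j s) ys) = \<Phi> xs ys) \<and>
    (\<exists>N\<in>pfin_normals G p. \<forall>xs\<in>tuples (carrier G) m. \<forall>xs'\<in>tuples (carrier G) m. \<forall>ys\<in>tuples (carrier G) n.
      cosets G N xs = cosets G N xs' \<longrightarrow> \<Phi> xs ys = \<Phi> xs' ys)"

lemma adm_V: "adm G S j m n \<Phi> \<Longrightarrow> xs \<in> tuples (carrier G) m \<Longrightarrow> ys \<in> tuples (carrier G) n \<Longrightarrow> \<Phi> xs ys \<in> V"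
  by (simp add: adm_def)

lemma adm_inv: "adm G S j m n \<Phi> \<Longrightarrow> xs \<in> tuples (carrier G) m \<Longrightarrow> ys \<in> tuples (carrier G) n \<Longrightarrow>
    s \<in> carrier S \<Longrightarrow> \<Phi> (lact G (j s) xs) (lact G (j s) ys) = \<Phi> xs ys"
  by (simp add: adm_def)

lemma adm_loc:
  assumes "adm G S j m n \<Phi>"
  obtains N where "N \<in> pfin_normals G p" "\<And>xs xs' ys. xs \<in> tuples (carrier G) m \<Longrightarrow>
    xs' \<in> tuples (carrier G) m \<Longrightarrow> ys \<in> tuples (carrier G) n \<Longrightarrow> cosets G N xs = cosets G N xs' \<Longrightarrow> \<Phi> xs ys = \<Phi> xs' ys"
  using assms unfolding adm_def by (elim conjE bexE) blast

lemma admI: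
  assumes "\<And>xs ys. xs \<in> tuples (carrier G) m \<Longrightarrow> ys \<in> tuples (carrier G) n \<Longrightarrow> \<Phi> xs ys \<in> V"
    and "\<And>xs ys s. xs \<in> tuples (carrier G) m \<Longrightarrow> ys \<in> tuples (carrier G) n \<Longrightarrow> s \<in> carrier S \<Longrightarrow>
      \<Phi> (lact G (j s) xs) (lact G (j s) ys) = \<Phi> xs ys"
    and "N \<in> pfin_normals G p" "\<And>xs xs' ys. xs \<in> tuples (carrier G) m \<Longrightarrow> xs' \<in> tuples (carrier G) m \<Longrightarrow>
      ys \<in> tuples (carrier G) n \<Longrightarrow> cosets G N xs = cosets G N xs' \<Longrightarrow> \<Phi> xs ys = \<Phi> xs' ys"
  shows "adm G S j m n \<Phi>"
  unfolding adm_def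
proof (intro conjI ballI)
  show "\<exists>N\<in>pfin_normals G p. \<forall>xs\<in>tuples (carrier G) m. \<forall>xs'\<in>tuples (carrier G) m. \<forall>ys\<in>tuples (carrier G) n.
      cosets G N xs = cosets G N xs' \<longrightarrow> \<Phi> xs ys = \<Phi> xs' ys"
    by (rule bexI[OF _ assms(3)]) (intro ballI impI, rule assms(4))
qed (rule assms(1,2); assumption)+

lemma adm_cong:
  assumes "group G" "j \<in> carrier S \<rightarrow> carrier G"
    and "\<And>xs ys. xs \<in> tuples (carrier G) m \<Longrightarrow> ys \<in> tuples (carrier G) n \<Longrightarrow> \<Phi> xs ys = \<Psi> xs ys"
    and "adm G S j m n \<Phi>"
  shows "adm G S j m n \<Psi>"
proof -
  interpret group G by fact
  obtain N where N: "N \<in> pfin_normals G p" "\<And>xs xs' ys. xs \<in> tuples (carrier G) m \<Longrightarrow>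
    xs' \<in> tuples (carrier G) m \<Longrightarrow> ys \<in> tuples (carrier G) n \<Longrightarrow> cosets G N xs = cosets G N xs' \<Longrightarrow> \<Phi> xs ys = \<Phi> xs' ys"
    by (rule adm_loc[OF assms(4)]) (rule that)
  show ?thesis
  proof (rule admI[OF _ _ N(1)])
    fix xs ys s assume *: "xs \<in> tuples (carrier G) m" "ys \<in> tuples (carrier G) n" "s \<in> carrier S"
    moreover have "j s \<in> carrier G" using *(3) assms(2) by blast
    ultimately have "lact G (j s) xs \<in> tuples (carrier G) m" "lact G (j s) ys \<in> tuples (carrier G) n"
      using lact_tuples by blast+
    then show "\<Psi> (lact G (j s) xs) (lact G (j s) ys) = \<Psi> xs ys"
      using assms(3) * adm_inv[OF assms(4) *] by simp
  next
    fix xs xs' ys assume "xs \<in> tuples (carrier G) m" "xs' \<in> tuples (carrier G) m" "ys \<in> tuples (carrier G) n"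
      "cosets G N xs = cosets G N xs'"
    then show "\<Psi> xs ys = \<Psi> xs' ys" using N(2) assms(3) by metis
  next
    fix xs ys assume "xs \<in> tuples (carrier G) m" "ys \<in> tuples (carrier G) n"
    then show "\<Psi> xs ys \<in> V" using assms(3) adm_V[OF assms(4)] by metis
  qed
qed

lemma adm_zero: "group G \<Longrightarrow> adm G S j m n (\<lambda>_ _. 0)"
  by (rule admI[OF _ _ group.carrier_pfin]) simp_all

lemma adm_diff:
  assumes G: "group G" and "adm G S j m n \<Phi>" "adm G S j m n \<Psi>"
  shows "adm G S j m n (\<lambda>xs ys. \<Phi> xs ys - \<Psi> xs ys)"
proof -
  interpret group G by fact
  obtain N where N: "N \<in> pfin_normals G p" "\<And>xs xs' ys. xs \<in> tuples (carrier G) m \<Longrightarrow>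
    xs' \<in> tuples (carrier G) m \<Longrightarrow> ys \<in> tuples (carrier G) n \<Longrightarrow> cosets G N xs = cosets G N xs' \<Longrightarrow> \<Phi> xs ys = \<Phi> xs' ys"
    by (rule adm_loc[OF assms(2)]) (rule that)
  obtain M where M: "M \<in> pfin_normals G p" "\<And>xs xs' ys. xs \<in> tuples (carrier G) m \<Longrightarrow>
    xs' \<in> tuples (carrier G) m \<Longrightarrow> ys \<in> tuples (carrier G) n \<Longrightarrow> cosets G M xs = cosets G M xs' \<Longrightarrow> \<Psi> xs ys = \<Psi> xs' ys"
    by (rule adm_loc[OF assms(3)]) (rule that)
  have NM: "N \<inter> M \<in> pfin_normals G p" by (rule pfin_inter[OF prime_p N(1) M(1)])
  show ?thesis
  proof (rule admI[OF _ _ NM])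
    fix xs xs' ys assume t: "xs \<in> tuples (carrier G) m" "xs' \<in> tuples (carrier G) m" "ys \<in> tuples (carrier G) n"
      and c: "cosets G (N \<inter> M) xs = cosets G (N \<inter> M) xs'"
    have "cosets G N xs = cosets G N xs'"
      by (rule cosets_mono[OF pfinD(1)[OF NM] pfinD(1)[OF N(1)] _ _ _ c]) (use t in \<open>auto simp: tuples_eq\<close>)
    moreover have "cosets G M xs = cosets G M xs'"
      by (rule cosets_mono[OF pfinD(1)[OF NM] pfinD(1)[OF M(1)] _ _ _ c]) (use t in \<open>auto simp: tuples_eq\<close>)
    ultimately show "\<Phi> xs ys - \<Psi> xs ys = \<Phi> xs' ys - \<Psi> xs' ys" using N(2)[OF t] M(2)[OF t] by simp
  next
    fix xs ys s assume *: "xs \<in> tuples (carrier G) m" "ys \<in> tuples (carrier G) n" "s \<in> carrier S"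
    then show "\<Phi> (lact G (j s) xs) (lact G (j s) ys) - \<Psi> (lact G (j s) xs) (lact G (j s) ys) = \<Phi> xs ys - \<Psi> xs ys"
      using adm_inv[OF assms(2) *] adm_inv[OF assms(3) *] by simp
  next
    fix xs ys assume *: "xs \<in> tuples (carrier G) m" "ys \<in> tuples (carrier G) n"
    then show "\<Phi> xs ys - \<Psi> xs ys \<in> V" using adm_V[OF assms(2) *] adm_V[OF assms(3) *] by simp
  qed
qed

lemma adm_minus:
  assumes G: "group G" and "adm G S j m n \<Phi>"
  shows "adm G S j m n (\<lambda>xs ys. - \<Phi> xs ys)"
  using adm_diff[OF G adm_zero[OF G] assms(2)] by simp

lemma adm_add:
  assumes G: "group G" and "adm G S j m n \<Phi>" "adm G S j m n \<Psi>"
  shows "adm G S j m n (\<lambda>xs ys. \<Phi> xs ys + \<Psi> xs ys)"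
  using adm_diff[OF G assms(2) adm_minus[OF G assms(3)]] by simp

lemma list_all2_lact: "list_all2 (\<lambda>x y. x \<in> S \<and> y = g \<otimes>\<^bsub>G\<^esub> x) xs ys \<longleftrightarrow> xs \<in> lists S \<and> ys = lact G g xs"
  by (induction xs arbitrary: ys) (auto simp: list_all2_Cons1)

lemma adm_bd_right:
  assumes G: "group G" and \<Phi>: "adm G S j m n \<Phi>"
  shows "adm G S j m (Suc n) (\<lambda>xs ys. bd (\<Phi> xs) ys)"
proof -
  interpret group G by fact
  obtain N where N: "N \<in> pfin_normals G p" "\<And>xs xs' ys. xs \<in> tuples (carrier G) m \<Longrightarrow>
    xs' \<in> tuples (carrier G) m \<Longrightarrow> ys \<in> tuples (carrier G) n \<Longrightarrow> cosets G N xs = cosets G N xs' \<Longrightarrow> \<Phi> xs ys = \<Phi> xs' ys"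
    by (rule adm_loc[OF \<Phi>]) (rule that)
  show ?thesis
  proof (rule admI[OF _ _ N(1)])
    fix xs ys assume "xs \<in> tuples (carrier G) m" "ys \<in> tuples (carrier G) (Suc n)"
    then show "bd (\<Phi> xs) ys \<in> V" using adm_V[OF \<Phi>] by (intro bd_closed[where n = n]) auto
  next
    fix xs ys s assume *: "xs \<in> tuples (carrier G) m" "ys \<in> tuples (carrier G) (Suc n)" "s \<in> carrier S"
    have "bd (\<Phi> xs) ys = bd (\<Phi> (lact G (j s) xs)) (lact G (j s) ys)"
    proof (rule bd_rel[where R = "\<lambda>x y. x \<in> carrier G \<and> y = j s \<otimes>\<^bsub>G\<^esub> x" and n = n])
      fix zs zs' assume "list_all2 (\<lambda>x y. x \<in> carrier G \<and> y = j s \<otimes>\<^bsub>G\<^esub> x) zs zs'" "length zs = n"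
      then have "zs \<in> tuples (carrier G) n" "zs' = lact G (j s) zs" by (auto simp: list_all2_lact tuples_eq)
      then show "\<Phi> xs zs = \<Phi> (lact G (j s) xs) zs'" using adm_inv[OF \<Phi> *(1) _ *(3)] by simp
    qed (use * in \<open>auto simp: list_all2_lact tuples_eq\<close>)
    then show "bd (\<Phi> (lact G (j s) xs)) (lact G (j s) ys) = bd (\<Phi> xs) ys" by simp
  next
    fix xs xs' ys assume "xs \<in> tuples (carrier G) m" "xs' \<in> tuples (carrier G) m" "ys \<in> tuples (carrier G) (Suc n)"
      "cosets G N xs = cosets G N xs'"
    then show "bd (\<Phi> xs) ys = bd (\<Phi> xs') ys" using N(2) by (intro bd_cong[where n = n]) auto
  qed
qed

lemma adm_bd_left:
  assumes G: "group G" and \<Phi>: "adm G S j m n \<Phi>"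
  shows "adm G S j (Suc m) n (\<lambda>xs ys. bd (\<lambda>zs. \<Phi> zs ys) xs)"
proof -
  interpret group G by fact
  obtain N where N: "N \<in> pfin_normals G p" "\<And>xs xs' ys. xs \<in> tuples (carrier G) m \<Longrightarrow>
    xs' \<in> tuples (carrier G) m \<Longrightarrow> ys \<in> tuples (carrier G) n \<Longrightarrow> cosets G N xs = cosets G N xs' \<Longrightarrow> \<Phi> xs ys = \<Phi> xs' ys"
    by (rule adm_loc[OF \<Phi>]) (rule that)
  show ?thesis
  proof (rule admI[OF _ _ N(1)])
    fix xs ys assume "xs \<in> tuples (carrier G) (Suc m)" "ys \<in> tuples (carrier G) n"
    then show "bd (\<lambda>zs. \<Phi> zs ys) xs \<in> V" using adm_V[OF \<Phi>] by (intro bd_closed[where n = m]) auto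
  next
    fix xs ys s assume *: "xs \<in> tuples (carrier G) (Suc m)" "ys \<in> tuples (carrier G) n" "s \<in> carrier S"
    have "bd (\<lambda>zs. \<Phi> zs ys) xs = bd (\<lambda>zs. \<Phi> zs (lact G (j s) ys)) (lact G (j s) xs)"
    proof (rule bd_rel[where R = "\<lambda>x y. x \<in> carrier G \<and> y = j s \<otimes>\<^bsub>G\<^esub> x" and n = m])
      fix zs zs' assume "list_all2 (\<lambda>x y. x \<in> carrier G \<and> y = j s \<otimes>\<^bsub>G\<^esub> x) zs zs'" "length zs = m"
      then have "zs \<in> tuples (carrier G) m" "zs' = lact G (j s) zs" by (auto simp: list_all2_lact tuples_eq)
      then show "\<Phi> zs ys = \<Phi> zs' (lact G (j s) ys)" using adm_inv[OF \<Phi> _ *(2,3)] by simp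
    qed (use * in \<open>auto simp: list_all2_lact tuples_eq\<close>)
    then show "bd (\<lambda>zs. \<Phi> zs (lact G (j s) ys)) (lact G (j s) xs) = bd (\<lambda>zs. \<Phi> zs ys) xs" by simp
  next
    fix xs xs' ys assume t: "xs \<in> tuples (carrier G) (Suc m)" "xs' \<in> tuples (carrier G) (Suc m)" "ys \<in> tuples (carrier G) n"
      and c: "cosets G N xs = cosets G N xs'"
    let ?R = "\<lambda>x y. x \<in> carrier G \<and> y \<in> carrier G \<and> N #>\<^bsub>G\<^esub> x = N #>\<^bsub>G\<^esub> y"
    have xl: "xs \<in> lists (carrier G)" "xs' \<in> lists (carrier G)" using t by (auto simp: tuples_eq)
    show "bd (\<lambda>zs. \<Phi> zs ys) xs = bd (\<lambda>zs. \<Phi> zs ys) xs'"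
    proof (rule bd_rel[where R = ?R and n = m])
      show "list_all2 ?R xs xs'" by (rule iffD1[OF cosets_eq_iff[OF xl] c])
      fix zs zs' assume z: "list_all2 ?R zs zs'" "length zs = m"
      then have zl: "zs \<in> lists (carrier G)" "zs' \<in> lists (carrier G)" using list_all2_lists[OF z(1)] by auto
      then have "zs \<in> tuples (carrier G) m" "zs' \<in> tuples (carrier G) m"
        using z list_all2_lengthD[OF z(1)] by (auto simp: tuples_eq)
      moreover have "cosets G N zs = cosets G N zs'" by (rule iffD2[OF cosets_eq_iff[OF zl] z(1)])
      ultimately show "\<Phi> zs ys = \<Phi> zs' ys" using N(2) t(3) by blast
    qed (use t in \<open>simp add: tuples_eq\<close>)
  qed
qed

definition uadm :: "('g, 'm) monoid_scheme \<Rightarrow> nat \<Rightarrow> ('g list \<Rightarrow> 'k) \<Rightarrow> bool" where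
  "uadm G n f \<longleftrightarrow> (\<forall>ys\<in>tuples (carrier G) n. f ys \<in> V) \<and>
    (\<exists>N\<in>pfin_normals G p. \<forall>g\<in>N. \<forall>ys\<in>tuples (carrier G) n. f (lact G g ys) = f ys)"

text \<open>The direct limit of $H^n(N, \mathbb{Z}/p)$ over the normal subgroups \<open>N\<close> of p-power index vanishes: a cochain
  on \<open>G\<close> that is invariant under \<open>N\<close> computes the cohomology of \<open>N\<close>, since \<open>G\<close> is \<open>N\<close>-free.\<close>

definition locally_acyclic :: "('g, 'm) monoid_scheme \<Rightarrow> nat \<Rightarrow> bool" where
  "locally_acyclic G n \<longleftrightarrow> (\<forall>f. uadm G (Suc n) f \<and> (\<forall>ys\<in>tuples (carrier G) (Suc (Suc n)). bd f ys = 0) \<longrightarrow>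
    (\<exists>h. uadm G n h \<and> (\<forall>ys\<in>tuples (carrier G) (Suc n). f ys = bd h ys)))"

section \<open>Shapiro's lemma for locally constant families\<close>

text \<open>Local constancy leaves finitely many coset tuples. A primitive on \<open>S\<close> is
  chosen for each of them, transported along the \<open>S\<close>-orbits by an equivariant section,
  and extended from \<open>S\<close> to \<open>G\<close> by an equivariant map together with the
  prism homotopy. Finiteness and \<open>top\<close> provide one subgroup small enough for all
  choices.\<close>

lemma shapiro:
  fixes G :: "('g, 'm) monoid_scheme" and S :: "('s, 'n) monoid_scheme" and F :: "'g list \<Rightarrow> 'g list \<Rightarrow> 'k"
  assumes S: "group S" and G: "group G" and j: "j \<in> hom S G" and inj: "inj_on j (carrier S)"
    and top: "\<And>N. N \<in> pfin_normals S p \<Longrightarrow> \<exists>K\<in>pfin_normals G p. \<forall>s\<in>carrier S. j s \<in> K \<longrightarrow> s \<in> N"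
    and F: "adm G S j (Suc m) (Suc n) F"
    and closed: "\<And>xs ys. xs \<in> tuples (carrier G) (Suc m) \<Longrightarrow> ys \<in> tuples (carrier G) (Suc (Suc n)) \<Longrightarrow> bd (F xs) ys = 0"
    and exact: "\<And>xs. xs \<in> tuples (carrier G) (Suc m) \<Longrightarrow>
      \<exists>h. uadm S n h \<and> (\<forall>ss\<in>tuples (carrier S) (Suc n). F xs (map j ss) = bd h ss)"
  shows "\<exists>H. adm G S j (Suc m) n H \<and>
    (\<forall>xs\<in>tuples (carrier G) (Suc m). \<forall>ys\<in>tuples (carrier G) (Suc n). F xs ys = bd (H xs) ys)"
proof -
  interpret S: group S by fact
  interpret G: group G by fact
  interpret j: group_hom S G j using S G j by (simp add: group_hom_def group_hom_axioms_def)
  let ?T = "tuples (carrier G)" and ?TS = "tuples (carrier S)"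
  obtain K where K: "K \<in> pfin_normals G p" and Kloc: "\<And>xs xs' ys. xs \<in> ?T (Suc m) \<Longrightarrow>
    xs' \<in> ?T (Suc m) \<Longrightarrow> ys \<in> ?T (Suc n) \<Longrightarrow> cosets G K xs = cosets G K xs' \<Longrightarrow> F xs ys = F xs' ys"
    by (rule adm_loc[OF F]) (rule that)
  note KN = pfinD(1)[OF K]
  have lactT: "lact G g xs \<in> ?T k" if "g \<in> carrier G" "xs \<in> ?T k" for g xs k using that by (simp add: tuples_eq)
  have lactTS: "lact S g xs \<in> ?TS k" if "g \<in> carrier S" "xs \<in> ?TS k" for g xs k using that by (simp add: tuples_eq)
  have mapj: "map j ss \<in> ?T k" if "ss \<in> ?TS k" for ss k using that by (intro map_in_tuples) auto
  have mapj_lact: "map j (lact S s ss) = lact G (j s) (map j ss)" if "s \<in> carrier S" "ss \<in> ?TS k" for s ss k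
    using that(1) tuples_lists[OF that(2)] by (induction ss) auto
  \<comment> \<open>The tuples of \<open>K\<close>-cosets are finite in number, and one primitive is
    chosen for each of them, not one for each \<open>xs\<close>.\<close>
  define cl where "cl = cosets G K ` ?T (Suc m)"
  have fin: "finite cl"
  proof (rule finite_subset)
    show "cl \<subseteq> {c. set c \<subseteq> rcosets\<^bsub>G\<^esub> K \<and> length c = Suc m}"
      unfolding cl_def by (auto simp: cosets_def tuples_def intro!: G.rcosetsI pfinD(4)[OF K])
  qed (rule finite_lists_length_eq[OF pfinD(3)[OF K]])
  define rp where "rp c = (SOME xs. xs \<in> ?T (Suc m) \<and> cosets G K xs = c)" for c
  have rp: "rp c \<in> ?T (Suc m) \<and> cosets G K (rp c) = c" if c: "c \<in> cl" for c
  proof -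
    have ex: "\<exists>xs. xs \<in> ?T (Suc m) \<and> cosets G K xs = c" using c unfolding cl_def by blast
    show ?thesis unfolding rp_def by (rule someI_ex[OF ex])
  qed
  define h where "h c = (SOME h. uadm S n h \<and> (\<forall>ss\<in>?TS (Suc n). F (rp c) (map j ss) = bd h ss))" for c
  have h: "uadm S n (h c) \<and> (\<forall>ss\<in>?TS (Suc n). F (rp c) (map j ss) = bd (h c) ss)" if c: "c \<in> cl" for c
  proof -
    have ex: "\<exists>h. uadm S n h \<and> (\<forall>ss\<in>?TS (Suc n). F (rp c) (map j ss) = bd h ss)"
      by (rule exact) (use rp[OF c] in blast)
    show ?thesis unfolding h_def by (rule someI_ex[OF ex])
  qed
  define Nc where "Nc c = (SOME N. N \<in> pfin_normals S p \<and> (\<forall>g\<in>N. \<forall>ss\<in>?TS n. h c (lact S g ss) = h c ss))" for c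
  have Nc: "Nc c \<in> pfin_normals S p \<and> (\<forall>g\<in>Nc c. \<forall>ss\<in>?TS n. h c (lact S g ss) = h c ss)" if c: "c \<in> cl" for c
  proof -
    have ex: "\<exists>N. N \<in> pfin_normals S p \<and> (\<forall>g\<in>N. \<forall>ss\<in>?TS n. h c (lact S g ss) = h c ss)"
      using h[OF c] unfolding uadm_def by blast
    show ?thesis unfolding Nc_def by (rule someI_ex[OF ex])
  qed
  \<comment> \<open>A common refinement leaves every chosen primitive invariant; \<open>top\<close>
    then captures it by a subgroup of \<open>G\<close>.\<close>
  obtain N where N: "N \<in> pfin_normals S p" "\<forall>M\<in>Nc ` cl. N \<subseteq> M"
    using S.pfin_refine[OF prime_p, of "Nc ` cl"] fin Nc by auto
  have hN: "h c (lact S g ss) = h c ss" if "c \<in> cl" "g \<in> N" "ss \<in> ?TS n" for c g ss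
    using Nc[OF that(1)] N(2) that by blast
  obtain K0 where K0: "K0 \<in> pfin_normals G p" "\<forall>s\<in>carrier S. j s \<in> K0 \<longrightarrow> s \<in> N" using top[OF N(1)] by blast
  define K' where "K' = K \<inter> K0"
  have K': "K' \<in> pfin_normals G p" unfolding K'_def by (rule G.pfin_inter[OF prime_p K K0(1)])
  note KN' = pfinD(1)[OF K']
  have K'K: "K' \<subseteq> K" by (simp add: K'_def)
  have K'N: "s \<in> N" if "s \<in> carrier S" "j s \<in> K'" for s using that K0(2) by (simp add: K'_def)
  obtain \<sigma> where \<sigma>: "\<And>x. x \<in> carrier G \<Longrightarrow> \<sigma> x \<in> carrier S"
    and \<sigma>_cong: "\<And>x y. x \<in> carrier G \<Longrightarrow> y \<in> carrier G \<Longrightarrow> K' #>\<^bsub>G\<^esub> x = K' #>\<^bsub>G\<^esub> y \<Longrightarrow> \<sigma> x = \<sigma> y"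
    and \<sigma>_eq: "\<And>x s. x \<in> carrier G \<Longrightarrow> s \<in> carrier S \<Longrightarrow>
      K' #>\<^bsub>G\<^esub> j (\<sigma> (j s \<otimes>\<^bsub>G\<^esub> x)) = K' #>\<^bsub>G\<^esub> j (s \<otimes>\<^bsub>S\<^esub> \<sigma> x)"
    by (rule equivariant_section[OF S G j KN']) (rule that)
  \<comment> \<open>With the trivial subgroup in place of \<open>K\<close> the section is strictly
    equivariant, as \<open>j\<close> is injective.\<close>
  obtain r where r: "\<And>x. x \<in> carrier G \<Longrightarrow> r x \<in> carrier S"
    and r_eq0: "\<And>x s. x \<in> carrier G \<Longrightarrow> s \<in> carrier S \<Longrightarrow>
      {\<one>\<^bsub>G\<^esub>} #>\<^bsub>G\<^esub> j (r (j s \<otimes>\<^bsub>G\<^esub> x)) = {\<one>\<^bsub>G\<^esub>} #>\<^bsub>G\<^esub> j (s \<otimes>\<^bsub>S\<^esub> r x)"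
    by (rule equivariant_section[OF S G j G.one_is_normal]) (rule that)
  have r_eq: "r (j s \<otimes>\<^bsub>G\<^esub> x) = s \<otimes>\<^bsub>S\<^esub> r x" if x: "x \<in> carrier G" and s: "s \<in> carrier S" for x s
  proof -
    have "{\<one>\<^bsub>G\<^esub>} #>\<^bsub>G\<^esub> u = {u}" if "u \<in> carrier G" for u using that by (auto simp: r_coset_def)
    then have "j (r (j s \<otimes>\<^bsub>G\<^esub> x)) = j (s \<otimes>\<^bsub>S\<^esub> r x)" using r_eq0[OF x s] r x s by simp
    then show ?thesis using inj_onD[OF inj] r x s by simp
  qed
  have map_r_lact: "map r (lact G (j s) ys) = lact S s (map r ys)" if "s \<in> carrier S" "ys \<in> ?T k" for s ys k
    using that(1) tuples_lists[OF that(2)] by (induction ys) (auto simp: r_eq)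
  have mapr: "map r ys \<in> ?TS k" if "ys \<in> ?T k" for ys k using that r by (intro map_in_tuples)
  \<comment> \<open>Translation by this element brings the first entry of \<open>xs\<close>, modulo
    \<open>K'\<close>, to the representative of its \<open>S\<close>-orbit.\<close>
  define sg where "sg xs = inv\<^bsub>S\<^esub> \<sigma> (hd xs)" for xs
  have sg: "sg xs \<in> carrier S" if "xs \<in> ?T (Suc m)" for xs
    using that \<sigma> by (auto simp: sg_def elim: tuples_SucE)
  define H0 where "H0 xs ss = h (cosets G K (lact G (j (sg xs)) xs)) (lact S (sg xs) ss)" for xs ss
  have clI: "cosets G K (lact G (j (sg xs)) xs) \<in> cl" if "xs \<in> ?T (Suc m)" for xs
    unfolding cl_def using lactT[OF j.hom_closed[OF sg[OF that]] that] by blast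
  have H0_V: "H0 xs ss \<in> V" if "xs \<in> ?T (Suc m)" "ss \<in> ?TS n" for xs ss
    using h[OF clI[OF that(1)]] lactTS[OF sg[OF that(1)] that(2)] by (simp add: H0_def uadm_def)
  have H0_inv: "H0 (lact G (j s) xs) (lact S s ss) = H0 xs ss"
    if xs: "xs \<in> ?T (Suc m)" and ss: "ss \<in> ?TS n" and s: "s \<in> carrier S" for xs ss s
  proof -
    obtain x xs0 where x: "xs = x # xs0" "x \<in> carrier G" using xs by (auto elim: tuples_SucE)
    let ?b = "s \<otimes>\<^bsub>S\<^esub> \<sigma> x" and ?c = "\<sigma> (j s \<otimes>\<^bsub>G\<^esub> x)"
    have bc: "?b \<in> carrier S" "?c \<in> carrier S" using s x \<sigma> by auto
    \<comment> \<open>\<nu> measures the failure of \<sigma> to be equivariant. It maps into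
      \<open>K'\<close>, hence lies in \<open>N\<close>, under which all chosen primitives are
      invariant.\<close>
    define \<nu> where "\<nu> = inv\<^bsub>S\<^esub> ?c \<otimes>\<^bsub>S\<^esub> ?b"
    have \<nu>c: "\<nu> \<in> carrier S" unfolding \<nu>_def using bc by simp
    have "inv\<^bsub>G\<^esub> j ?c \<otimes>\<^bsub>G\<^esub> j ?b \<in> K'"
      using G.coset_inv_mult_eq_iff[OF KN', of "j ?c" "j ?b"] \<sigma>_eq[OF x(2) s] bc by simp
    then have \<nu>K: "j \<nu> \<in> K'" unfolding \<nu>_def using bc by simp
    have sgs: "sg (lact G (j s) xs) \<otimes>\<^bsub>S\<^esub> s = \<nu> \<otimes>\<^bsub>S\<^esub> sg xs"
      unfolding sg_def \<nu>_def using x s \<sigma>[OF x(2)] bc by (simp add: S.m_assoc)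
    have sgc: "sg xs \<in> carrier S" "sg (lact G (j s) xs) \<in> carrier S"
      using sg[OF xs] sg[OF lactT[OF j.hom_closed[OF s] xs]] by auto
    have "lact G (j (sg (lact G (j s) xs))) (lact G (j s) xs) = lact G (j \<nu>) (lact G (j (sg xs)) xs)"
      using sgc s \<nu>c tuples_lists[OF xs] by (simp add: G.lact_lact sgs del: j.hom_mult flip: j.hom_mult)
    moreover have "cosets G K (lact G (j \<nu>) (lact G (j (sg xs)) xs)) = cosets G K (lact G (j (sg xs)) xs)"
      by (rule G.cosets_lact_normal[OF KN]) (use \<nu>K K'K sgc tuples_lists[OF xs] in auto)
    moreover have "lact S (sg (lact G (j s) xs)) (lact S s ss) = lact S \<nu> (lact S (sg xs) ss)"
      using sgc s \<nu>c tuples_lists[OF ss] by (simp add: S.lact_lact sgs)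
    ultimately show ?thesis
      unfolding H0_def using hN[OF clI[OF xs] K'N[OF \<nu>c \<nu>K] lactTS[OF sgc(1) ss]] by simp
  qed
  have H0_loc: "H0 xs ss = H0 xs' ss"
    if xs: "xs \<in> ?T (Suc m)" "xs' \<in> ?T (Suc m)" and c: "cosets G K' xs = cosets G K' xs'" for xs xs' ss
  proof -
    obtain x zs where x: "xs = x # zs" "x \<in> carrier G" using xs(1) by (rule tuples_SucE)
    obtain x' zs' where x': "xs' = x' # zs'" "x' \<in> carrier G" using xs(2) by (rule tuples_SucE)
    have "\<sigma> x = \<sigma> x'" by (rule \<sigma>_cong[OF x(2) x'(2)]) (use c x x' in simp)
    then have "sg xs = sg xs'" by (simp add: sg_def x x')
    moreover have "cosets G K xs = cosets G K xs'"
      by (rule G.cosets_mono[OF KN' KN K'K _ _ c]) (use xs tuples_lists in blast)+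
    then have "cosets G K (lact G (j (sg xs)) xs) = cosets G K (lact G (j (sg xs)) xs')"
      by (intro G.cosets_lact_cong[OF KN]) (use xs tuples_lists sg[OF xs(1)] in auto)
    ultimately show ?thesis by (simp add: H0_def)
  qed
  have bd_H0: "bd (H0 xs) ss = F xs (map j ss)" if xs: "xs \<in> ?T (Suc m)" and ss: "ss \<in> ?TS (Suc n)" for xs ss
  proof -
    let ?c = "cosets G K (lact G (j (sg xs)) xs)"
    have c: "?c \<in> cl" by (rule clI[OF xs])
    note s = sg[OF xs]
    have "bd (H0 xs) ss = bd (h ?c) (lact S (sg xs) ss)"
      unfolding H0_def lact_def[of S] by (simp add: bd_map)
    also have "\<dots> = F (rp ?c) (map j (lact S (sg xs) ss))" using h[OF c] lactTS[OF s ss] by simp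
    also have "\<dots> = F (lact G (j (sg xs)) xs) (map j (lact S (sg xs) ss))"
      using rp[OF c] lactT[OF j.hom_closed[OF s] xs] mapj[OF lactTS[OF s ss]] by (intro Kloc) auto
    also have "\<dots> = F xs (map j ss)"
      using adm_inv[OF F xs mapj[OF ss] s] mapj_lact[OF s ss] by simp
    finally show ?thesis .
  qed
  let ?\<rho> = "\<lambda>x. j (r x)"
  \<comment> \<open>The first term is a primitive of the pullback of \<open>F\<close> along
    \<open>r\<close>; the prism accounts for the difference between \<open>F\<close> and this
    pullback.\<close>
  define H where "H xs ys = H0 xs (map r ys) + prism ?\<rho> (F xs) ys" for xs ys
  have "adm G S j (Suc m) n H"
  proof (rule admI[OF _ _ K'])
    fix xs ys assume xs: "xs \<in> ?T (Suc m)" and ys: "ys \<in> ?T n"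
    have "prism ?\<rho> (F xs) ys \<in> V"
      by (rule prism_closed[where S = "carrier G"]) (use r ys adm_V[OF F xs] in \<open>auto simp: tuples_eq\<close>)
    then show "H xs ys \<in> V" using H0_V[OF xs mapr[OF ys]] by (simp add: H_def)
  next
    fix xs ys s assume xs: "xs \<in> ?T (Suc m)" and ys: "ys \<in> ?T n" and s: "s \<in> carrier S"
    have "prism ?\<rho> (F xs) ys = prism ?\<rho> (F (lact G (j s) xs)) (lact G (j s) ys)"
    proof (rule prism_rel[where R = "\<lambda>x y. x \<in> carrier G \<and> y = j s \<otimes>\<^bsub>G\<^esub> x"])
      fix zs zs' assume "list_all2 (\<lambda>x y. x \<in> carrier G \<and> y = j s \<otimes>\<^bsub>G\<^esub> x) zs zs'" "length zs = Suc (length ys)"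
      then have "zs \<in> ?T (Suc n)" "zs' = lact G (j s) zs" using ys by (auto simp: list_all2_lact tuples_eq)
      then show "F xs zs = F (lact G (j s) xs) zs'" using adm_inv[OF F xs _ s] by simp
    qed (use ys s r r_eq in \<open>auto simp: list_all2_lact tuples_eq\<close>)
    then show "H (lact G (j s) xs) (lact G (j s) ys) = H xs ys"
      using H0_inv[OF xs mapr[OF ys] s] map_r_lact[OF s ys] by (simp add: H_def)
  next
    fix xs xs' ys assume xs: "xs \<in> ?T (Suc m)" "xs' \<in> ?T (Suc m)" and ys: "ys \<in> ?T n"
      and c: "cosets G K' xs = cosets G K' xs'"
    have cK: "cosets G K xs = cosets G K xs'"
      by (rule G.cosets_mono[OF KN' KN K'K _ _ c]) (use xs tuples_lists in blast)+
    have "prism ?\<rho> (F xs) ys = prism ?\<rho> (F xs') ys"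
    proof (rule prism_rel[where R = "\<lambda>x y. x \<in> carrier G \<and> y = x"])
      fix zs zs' assume "list_all2 (\<lambda>x y. x \<in> carrier G \<and> y = x) zs zs'" "length zs = Suc (length ys)"
      then have "zs \<in> ?T (Suc n)" "zs' = zs" using ys by (auto simp: list_all2_same_tuples tuples_eq)
      then show "F xs zs = F xs' zs'" using Kloc[OF xs _ cK] by simp
    qed (use ys r in \<open>auto simp: list_all2_same_tuples tuples_eq\<close>)
    then show "H xs ys = H xs' ys" using H0_loc[OF xs c] by (simp add: H_def)
  qed
  moreover have "F xs ys = bd (H xs) ys" if xs: "xs \<in> ?T (Suc m)" and ys: "ys \<in> ?T (Suc n)" for xs ys
  proof -
    have "prism ?\<rho> (bd (F xs)) ys = prism ?\<rho> (\<lambda>_. 0) ys"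
    proof (rule prism_rel[where R = "\<lambda>x y. x \<in> carrier G \<and> y = x"])
      fix zs zs' assume "list_all2 (\<lambda>x y. x \<in> carrier G \<and> y = x) zs zs'" "length zs = Suc (length ys)"
      then have "zs \<in> ?T (Suc (Suc n))" using ys by (auto simp: list_all2_same_tuples tuples_eq)
      then show "bd (F xs) zs = 0" by (rule closed[OF xs])
    qed (use ys r in \<open>auto simp: list_all2_same_tuples tuples_eq\<close>)
    moreover have "prism ?\<rho> (\<lambda>_. 0::'k) zs = 0" for zs by (induction zs) auto
    ultimately have "bd (prism ?\<rho> (F xs)) ys = F ys' ys - F xs (map ?\<rho> ys)" if "ys' = xs" for ys'
      using prism_homotopy[of ?\<rho> "F xs" ys] that by simp
    moreover have "bd (\<lambda>zs. H0 xs (map r zs)) ys = F xs (map ?\<rho> ys)"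
      using bd_H0[OF xs mapr[OF ys]] by (simp add: bd_map comp_def)
    ultimately show ?thesis unfolding H_def by (simp add: bd_add)
  qed
  ultimately show ?thesis by blast
qed

end

subsection \<open>The double complex\<close>

definition alt :: "nat \<Rightarrow> 'k::ab_group_add \<Rightarrow> 'k" where
  "alt n a = (if even n then a else - a)"

lemma alt_simps [simp]: "alt n 0 = 0" "alt 0 a = a" "alt (Suc n) a = - alt n a" "alt n (alt n a) = a"
  "alt n (a + b) = alt n a + alt n b" "alt n (a - b) = alt n a - alt n b" "alt n (- a) = - alt n a"
  by (auto simp: alt_def)

lemma bd_alt: "bd (\<lambda>zs. alt n (f zs)) xs = alt n (bd f xs)"
  by (auto simp: alt_def bd_minus)

lemma bd_alt_length: "bd (\<lambda>zs. alt (length zs) (f zs)) xs = - alt (length xs) (bd f xs)"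
  by (induction xs arbitrary: f) (simp_all add: bd_minus algebra_simps)

text \<open>The sign depends on the number of entries of the first list and makes the two partial
  differentials anticommute.\<close>

definition totd :: "('g list \<Rightarrow> 'g list \<Rightarrow> 'k::ab_group_add) \<Rightarrow> 'g list \<Rightarrow> 'g list \<Rightarrow> 'k" where
  "totd \<Phi> xs ys = bd (\<lambda>zs. \<Phi> zs ys) xs + alt (length xs) (bd (\<Phi> xs) ys)"

lemma totd_diff: "totd (\<lambda>xs ys. \<Phi> xs ys - \<Psi> xs ys) xs ys = totd \<Phi> xs ys - totd \<Psi> xs ys"
  by (simp add: totd_def bd_diff algebra_simps)

lemma totd_add: "totd (\<lambda>xs ys. \<Phi> xs ys + \<Psi> xs ys) xs ys = totd \<Phi> xs ys + totd \<Psi> xs ys"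
  by (simp add: totd_def bd_add algebra_simps)

lemma totd_zero [simp]: "totd (\<lambda>_ _. 0) xs ys = 0"
  by (simp add: totd_def)

lemma totd_totd [simp]: "totd (totd \<Phi>) xs ys = 0"
proof -
  have "totd (totd \<Phi>) xs ys = bd (\<lambda>zs. alt (length zs) (bd (\<Phi> zs) ys)) xs
      + alt (length xs) (bd (\<lambda>ws. bd (\<lambda>zs. \<Phi> zs ws) xs) ys)"
    by (simp add: totd_def[abs_def] bd_add bd_alt)
  also have "bd (\<lambda>zs. alt (length zs) (bd (\<Phi> zs) ys)) xs = - alt (length xs) (bd (\<lambda>zs. bd (\<Phi> zs) ys) xs)"
    by (rule bd_alt_length)
  finally show ?thesis unfolding bd_commute[of \<Phi> ys xs] by simp
qed

text \<open>Concatenation is a chain map from homogeneous cochains to the total complex. It is the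
  identity where either list is empty, which is how the continuous and the abstract edge are
  compared.\<close>

lemma totd_append: "totd (\<lambda>xs ys. f (xs @ ys)) xs ys = bd f (xs @ ys)"
proof (induction xs arbitrary: f)
  case (Cons x xs)
  show ?case using Cons[of "\<lambda>zs. f (x # zs)"] by (simp add: totd_def algebra_simps)
qed (simp add: totd_def)

context zmod_coeff begin

abbreviation gadm :: "('g, 'm) monoid_scheme \<Rightarrow> nat \<Rightarrow> nat \<Rightarrow> ('g list \<Rightarrow> 'g list \<Rightarrow> 'k) \<Rightarrow> bool" where
  "gadm G m n \<Phi> \<equiv> adm G G (\<lambda>x. x) m n \<Phi>"

lemma gadm_cong:
  assumes "group G" "\<And>xs ys. xs \<in> tuples (carrier G) m \<Longrightarrow> ys \<in> tuples (carrier G) n \<Longrightarrow> \<Phi> xs ys = \<Psi> xs ys"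
    and "gadm G m n \<Phi>"
  shows "gadm G m n \<Psi>"
  by (rule adm_cong[OF assms(1) _ assms(2,3)]) auto

text \<open>A total cochain is a single function of two lists, meaningful where the lengths sum to
  \<open>s\<close>; values elsewhere are arbitrary, hence the relative notions \<open>vanish\<close>
  and \<open>teq\<close>.\<close>

definition tadm :: "('g, 'm) monoid_scheme \<Rightarrow> nat \<Rightarrow> ('g list \<Rightarrow> 'g list \<Rightarrow> 'k) \<Rightarrow> bool" where
  "tadm G s \<Phi> \<longleftrightarrow> (\<forall>m n. m + n = s \<longrightarrow> gadm G m n \<Phi>)"

definition vanish :: "('g, 'm) monoid_scheme \<Rightarrow> (nat \<Rightarrow> nat \<Rightarrow> nat) \<Rightarrow> nat \<Rightarrow> nat \<Rightarrow> ('g list \<Rightarrow> 'g list \<Rightarrow> 'k) \<Rightarrow> bool" where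
  "vanish G lev s k \<Phi> \<longleftrightarrow> (\<forall>m n. m + n = s \<longrightarrow> lev m n < k \<longrightarrow>
    (\<forall>xs\<in>tuples (carrier G) m. \<forall>ys\<in>tuples (carrier G) n. \<Phi> xs ys = 0))"

definition teq :: "('g, 'm) monoid_scheme \<Rightarrow> nat \<Rightarrow> ('g list \<Rightarrow> 'g list \<Rightarrow> 'k) \<Rightarrow> ('g list \<Rightarrow> 'g list \<Rightarrow> 'k) \<Rightarrow> bool" where
  "teq G s \<Phi> \<Psi> \<longleftrightarrow> (\<forall>m n. m + n = s \<longrightarrow>
    (\<forall>xs\<in>tuples (carrier G) m. \<forall>ys\<in>tuples (carrier G) n. \<Phi> xs ys = \<Psi> xs ys))"

lemma tadmD: "tadm G s \<Phi> \<Longrightarrow> m + n = s \<Longrightarrow> gadm G m n \<Phi>"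
  by (simp add: tadm_def)

lemma vanishD: "vanish G lev s k \<Phi> \<Longrightarrow> m + n = s \<Longrightarrow> lev m n < k \<Longrightarrow> xs \<in> tuples (carrier G) m \<Longrightarrow>
    ys \<in> tuples (carrier G) n \<Longrightarrow> \<Phi> xs ys = 0"
  by (simp add: vanish_def)

lemma teqD: "teq G s \<Phi> \<Psi> \<Longrightarrow> m + n = s \<Longrightarrow> xs \<in> tuples (carrier G) m \<Longrightarrow>
    ys \<in> tuples (carrier G) n \<Longrightarrow> \<Phi> xs ys = \<Psi> xs ys"
  by (simp add: teq_def)

lemma tadm_zero: "group G \<Longrightarrow> tadm G s (\<lambda>_ _. 0)"
  by (simp add: tadm_def adm_zero)

lemma tadm_diff: "group G \<Longrightarrow> tadm G s \<Phi> \<Longrightarrow> tadm G s \<Psi> \<Longrightarrow> tadm G s (\<lambda>xs ys. \<Phi> xs ys - \<Psi> xs ys)"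
  by (simp add: tadm_def adm_diff)

lemma tadm_add: "group G \<Longrightarrow> tadm G s \<Phi> \<Longrightarrow> tadm G s \<Psi> \<Longrightarrow> tadm G s (\<lambda>xs ys. \<Phi> xs ys + \<Psi> xs ys)"
  by (simp add: tadm_def adm_add)

lemma gadm_alt:
  assumes "group G" "gadm G m n \<Phi>"
  shows "gadm G m n (\<lambda>xs ys. alt k (\<Phi> xs ys))"
  using assms adm_minus[OF assms] by (cases "even k") (simp_all add: alt_def)

lemma totd_tadm:
  assumes G: "group G" and \<Phi>: "tadm G s \<Phi>"
  shows "tadm G (Suc s) (totd \<Phi>)"
  unfolding tadm_def
proof (intro allI impI)
  fix m n assume mn: "m + n = Suc s"
  have left: "gadm G m n (\<lambda>xs ys. bd (\<lambda>zs. \<Phi> zs ys) xs)"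
  proof (cases m)
    case 0
    show ?thesis by (rule gadm_cong[OF G _ adm_zero[OF G]]) (simp add: 0)
  next
    case (Suc m')
    then show ?thesis using adm_bd_left[OF G tadmD[OF \<Phi>, of m' n]] mn by simp
  qed
  have right: "gadm G m n (\<lambda>xs ys. bd (\<Phi> xs) ys)"
  proof (cases n)
    case 0
    show ?thesis by (rule gadm_cong[OF G _ adm_zero[OF G]]) (simp add: 0)
  next
    case (Suc n')
    then show ?thesis using adm_bd_right[OF G tadmD[OF \<Phi>, of m n']] mn by simp
  qed
  show "gadm G m n (totd \<Phi>)"
    by (rule gadm_cong[OF G _ adm_add[OF G left gadm_alt[OF G right, of m]]])
      (simp add: totd_def tuples_length)
qed

text \<open>Descending along a filtration of the total complex by the level \<open>lev\<close>.\<close>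

lemma tot_exact:
  assumes G: "group G"
    and step: "\<And>k \<Phi>. k0 \<le> k \<Longrightarrow> tadm G (Suc s) \<Phi> \<Longrightarrow> vanish G lev (Suc s) k \<Phi> \<Longrightarrow>
      teq G (Suc (Suc s)) (totd \<Phi>) (\<lambda>_ _. 0) \<Longrightarrow>
      \<exists>\<Psi>. tadm G s \<Psi> \<and> vanish G lev s k \<Psi> \<and> vanish G lev (Suc s) (Suc k) (\<lambda>xs ys. \<Phi> xs ys - totd \<Psi> xs ys)"
    and bound: "\<And>m n. m + n = Suc s \<Longrightarrow> lev m n \<le> Suc s"
    and \<Phi>: "tadm G (Suc s) \<Phi>" "vanish G lev (Suc s) k0 \<Phi>" "teq G (Suc (Suc s)) (totd \<Phi>) (\<lambda>_ _. 0)"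
  shows "\<exists>\<Psi>. tadm G s \<Psi> \<and> vanish G lev s k0 \<Psi> \<and> teq G (Suc s) \<Phi> (totd \<Psi>)"
proof -
  have "\<exists>\<Psi>. tadm G s \<Psi> \<and> vanish G lev s k \<Psi> \<and> teq G (Suc s) \<Phi> (totd \<Psi>)"
    if "k0 \<le> k" "tadm G (Suc s) \<Phi>" "vanish G lev (Suc s) k \<Phi>" "teq G (Suc (Suc s)) (totd \<Phi>) (\<lambda>_ _. 0)"
    for k \<Phi> using that
  \<comment> \<open>The filtration is finite: \<open>bound\<close> puts every component below level
    \<open>Suc (Suc s)\<close>, where nothing is left to correct.\<close>
  proof (induction "Suc (Suc s) - k" arbitrary: k \<Phi>)
    case 0
    have "teq G (Suc s) \<Phi> (totd (\<lambda>_ _. 0))"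
      unfolding teq_def
    proof (intro allI impI ballI)
      fix m n xs ys assume mn: "m + n = Suc s" and xs: "xs \<in> tuples (carrier G) m" "ys \<in> tuples (carrier G) n"
      have "lev m n < k" using bound[OF mn] 0 by simp
      then show "\<Phi> xs ys = totd (\<lambda>_ _. 0) xs ys" using vanishD[OF 0(4) mn _ xs] by simp
    qed
    moreover have "vanish G lev s k (\<lambda>_ _. 0)" by (simp add: vanish_def)
    ultimately show ?case using tadm_zero[OF G] by blast
  next
    case (Suc i)
    obtain \<Psi> where \<Psi>: "tadm G s \<Psi>" "vanish G lev s k \<Psi>"
      "vanish G lev (Suc s) (Suc k) (\<lambda>xs ys. \<Phi> xs ys - totd \<Psi> xs ys)"
      using step[OF Suc.prems] by blast
    let ?\<Phi> = "\<lambda>xs ys. \<Phi> xs ys - totd \<Psi> xs ys"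
    have 1: "tadm G (Suc s) ?\<Phi>" by (rule tadm_diff[OF G Suc.prems(2) totd_tadm[OF G \<Psi>(1)]])
    have 2: "teq G (Suc (Suc s)) (totd ?\<Phi>) (\<lambda>_ _. 0)"
      using Suc.prems(4) by (simp add: teq_def totd_diff)
    have i: "i = Suc (Suc s) - Suc k" using Suc.hyps(2) by simp
    obtain \<Psi>' where \<Psi>': "tadm G s \<Psi>'" "vanish G lev s (Suc k) \<Psi>'" "teq G (Suc s) ?\<Phi> (totd \<Psi>')"
      using Suc.hyps(1)[OF i _ 1 \<Psi>(3) 2] Suc.prems(1) by auto
    have "teq G (Suc s) \<Phi> (totd (\<lambda>xs ys. \<Psi> xs ys + \<Psi>' xs ys))"
      using \<Psi>'(3) by (simp add: teq_def totd_add algebra_simps)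
    moreover have "vanish G lev s k (\<lambda>xs ys. \<Psi> xs ys + \<Psi>' xs ys)"
      using \<Psi>(2) \<Psi>'(2) by (simp add: vanish_def)
    ultimately show ?case using tadm_add[OF G \<Psi>(1) \<Psi>'(1)] by blast
  qed
  then show ?thesis using \<Phi> by blast
qed

section \<open>Exactness of columns and rows\<close>

definition column_exact :: "('g, 'm) monoid_scheme \<Rightarrow> nat \<Rightarrow> nat \<Rightarrow> bool" where
  "column_exact G k n \<longleftrightarrow> (\<forall>\<Phi>. gadm G k (Suc n) \<Phi> \<and>
      (\<forall>xs\<in>tuples (carrier G) k. \<forall>ys\<in>tuples (carrier G) (Suc (Suc n)). bd (\<Phi> xs) ys = 0) \<longrightarrow>
    (\<exists>\<Psi>. gadm G k n \<Psi> \<and> (\<forall>xs\<in>tuples (carrier G) k. \<forall>ys\<in>tuples (carrier G) (Suc n). \<Phi> xs ys = bd (\<Psi> xs) ys)))"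

abbreviation levL :: "nat \<Rightarrow> nat \<Rightarrow> nat" where "levL m n \<equiv> m"
abbreviation levR :: "nat \<Rightarrow> nat \<Rightarrow> nat" where "levR m n \<equiv> n"

text \<open>The lowest surviving column of a total cocycle is closed for the differential in
  \<open>ys\<close>, because the column before it vanishes. A primitive in this column, used as a
  correction, pushes the cocycle one column further.\<close>

lemma columns_exact:
  assumes G: "group G" and col: "\<And>k n. k0 \<le> k \<Longrightarrow> k + Suc n = Suc s \<Longrightarrow> column_exact G k n"
    and \<Phi>: "tadm G (Suc s) \<Phi>" "vanish G levL (Suc s) k0 \<Phi>" "teq G (Suc (Suc s)) (totd \<Phi>) (\<lambda>_ _. 0)"
  shows "\<exists>\<Psi>. tadm G s \<Psi> \<and> vanish G levL s k0 \<Psi> \<and> teq G (Suc s) \<Phi> (totd \<Psi>)"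
proof (rule tot_exact[OF G _ _ \<Phi>])
  interpret group G by fact
  fix k \<Phi>
  assume k: "k0 \<le> k" and \<Phi>: "tadm G (Suc s) \<Phi>" and van: "vanish G levL (Suc s) k \<Phi>"
    and cl: "teq G (Suc (Suc s)) (totd \<Phi>) (\<lambda>_ _. 0)"
  have left0: "bd (\<lambda>zs. \<Phi> zs ys) xs = 0"
    if "k + n = Suc (Suc s)" "xs \<in> tuples (carrier G) k" "ys \<in> tuples (carrier G) n" for n xs ys
  proof (cases k)
    case (Suc k')
    have "xs \<in> tuples (carrier G) (Suc k')" using that Suc by simp
    then have "bd (\<lambda>zs. \<Phi> zs ys) xs = bd (\<lambda>zs. 0) xs"
      by (rule bd_cong) (use vanishD[OF van, of k' n] that Suc in auto)
    then show ?thesis by simp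
  qed (use that in simp)
  have closed: "bd (\<Phi> xs) ys = 0"
    if "k + n = Suc (Suc s)" "xs \<in> tuples (carrier G) k" "ys \<in> tuples (carrier G) n" for n xs ys
  proof -
    have "alt (length xs) (bd (\<Phi> xs) ys) = 0"
      using teqD[OF cl that] left0[OF that] by (simp add: totd_def)
    then have "alt (length xs) (alt (length xs) (bd (\<Phi> xs) ys)) = 0" by simp
    then show ?thesis by simp
  qed
  have done0: "\<exists>\<Psi>. tadm G s \<Psi> \<and> vanish G levL s k \<Psi> \<and> vanish G levL (Suc s) (Suc k) (\<lambda>xs ys. \<Phi> xs ys - totd \<Psi> xs ys)"
    if "\<And>n xs ys. k + n = Suc s \<Longrightarrow> xs \<in> tuples (carrier G) k \<Longrightarrow> ys \<in> tuples (carrier G) n \<Longrightarrow> \<Phi> xs ys = 0"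
  proof -
    have "vanish G levL (Suc s) (Suc k) (\<lambda>xs ys. \<Phi> xs ys - totd (\<lambda>_ _. 0) xs ys)"
      using van that by (auto simp: vanish_def less_Suc_eq)
    moreover have "vanish G levL s k (\<lambda>_ _. 0)" by (simp add: vanish_def)
    ultimately show ?thesis using tadm_zero[OF G] by blast
  qed
  have "Suc s < k \<or> k = Suc s \<or> (\<exists>n. k + Suc n = Suc s)"
  proof (cases "k \<le> s")
    case True
    then have "k + Suc (s - k) = Suc s" by simp
    then show ?thesis by blast
  qed auto
  then consider (big) "Suc s < k" | (eq) "k = Suc s" | (less) n where "k + Suc n = Suc s" by blast
  then show "\<exists>\<Psi>. tadm G s \<Psi> \<and> vanish G levL s k \<Psi> \<and> vanish G levL (Suc s) (Suc k) (\<lambda>xs ys. \<Phi> xs ys - totd \<Psi> xs ys)"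
  proof cases
    case big
    then show ?thesis by (intro done0) simp
  next
    case eq
    show ?thesis
    proof (rule done0)
      fix n xs ys assume "k + n = Suc s" "xs \<in> tuples (carrier G) k" "ys \<in> tuples (carrier G) n"
      \<comment> \<open>Here \<open>ys\<close> is empty, and the boundary over a single entry
        returns the value itself.\<close>
      then show "\<Phi> xs ys = 0" using eq closed[of 1 xs "[\<one>\<^bsub>G\<^esub>]"] by simp
    qed
  next
    case (less n)
    obtain \<psi> where \<psi>: "gadm G k n \<psi>"
      "\<And>xs ys. xs \<in> tuples (carrier G) k \<Longrightarrow> ys \<in> tuples (carrier G) (Suc n) \<Longrightarrow> \<Phi> xs ys = bd (\<psi> xs) ys"
      using col[OF k less] tadmD[OF \<Phi> less] closed[of "Suc (Suc n)"] less unfolding column_exact_def by auto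
    \<comment> \<open>The correction lives in column \<open>k\<close> alone, and its sign cancels
      the one in \<open>totd\<close>.\<close>
    define \<Psi> where "\<Psi> xs ys = (if length xs = k then alt k (\<psi> xs ys) else 0)" for xs ys
    have "gadm G m n' \<Psi>" if mn: "m + n' = s" for m n'
    proof (cases "m = k")
      case True
      then have "n' = n" using mn less by simp
      moreover have "gadm G k n \<Psi>"
        by (rule gadm_cong[OF G _ gadm_alt[OF G \<psi>(1), of k]]) (simp add: \<Psi>_def tuples_length)
      ultimately show ?thesis using True by simp
    next
      case False
      then show ?thesis by (intro gadm_cong[OF G _ adm_zero[OF G]]) (auto simp: \<Psi>_def tuples_length)
    qed
    moreover have "vanish G levL s k \<Psi>" by (auto simp: vanish_def \<Psi>_def tuples_length)
    moreover have "vanish G levL (Suc s) (Suc k) (\<lambda>xs ys. \<Phi> xs ys - totd \<Psi> xs ys)"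
      unfolding vanish_def
    proof (intro allI impI ballI)
      fix m n' xs ys assume mn: "m + n' = Suc s" "m < Suc k" and xs: "xs \<in> tuples (carrier G) m" and ys: "ys \<in> tuples (carrier G) n'"
      have l: "bd (\<lambda>zs. \<Psi> zs ys) xs = 0"
      proof (cases m)
        case (Suc m')
        have "xs \<in> tuples (carrier G) (Suc m')" using xs Suc by simp
        then have "bd (\<lambda>zs. \<Psi> zs ys) xs = bd (\<lambda>zs. 0) xs"
          by (rule bd_cong) (use mn Suc in \<open>auto simp: \<Psi>_def tuples_length\<close>)
        then show ?thesis by simp
      qed (use xs in simp)
      show "\<Phi> xs ys - totd \<Psi> xs ys = 0"
      proof (cases "m = k")
        case True
        then have n': "n' = Suc n" using mn less by simp
        have "totd \<Psi> xs ys = alt k (bd (\<lambda>ws. alt k (\<psi> xs ws)) ys)"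
          using l xs True by (simp add: totd_def \<Psi>_def[abs_def] tuples_length)
        also have "\<dots> = \<Phi> xs ys" using \<psi>(2)[of xs ys] xs ys n' True by (simp add: bd_alt)
        finally show ?thesis by simp
      next
        case False
        then have "\<Psi> xs = (\<lambda>_. 0)" using xs by (simp add: \<Psi>_def[abs_def] tuples_length)
        then have "totd \<Psi> xs ys = 0" using l by (simp add: totd_def)
        moreover have "\<Phi> xs ys = 0" by (rule vanishD[OF van mn(1) _ xs ys]) (use mn False in simp)
        ultimately show ?thesis by simp
      qed
    qed
    ultimately show ?thesis unfolding tadm_def by blast
  qed
qed simp

text \<open>Over nonempty \<open>ys\<close>, prefixing \<open>xs\<close> with the head of
  \<open>ys\<close> is a contracting homotopy of the row. It is equivariant, and it keeps local
  constancy because that is uniform in \<open>ys\<close>.\<close>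

lemma rows_exact:
  assumes G: "group G"
    and \<Phi>: "tadm G (Suc s) \<Phi>" "vanish G levR (Suc s) 1 \<Phi>" "teq G (Suc (Suc s)) (totd \<Phi>) (\<lambda>_ _. 0)"
  shows "\<exists>\<Psi>. tadm G s \<Psi> \<and> vanish G levR s 1 \<Psi> \<and> teq G (Suc s) \<Phi> (totd \<Psi>)"
proof (rule tot_exact[OF G _ _ \<Phi>])
  interpret group G by fact
  fix k \<Phi>
  assume k: "1 \<le> k" and \<Phi>: "tadm G (Suc s) \<Phi>" and van: "vanish G levR (Suc s) k \<Phi>"
    and cl: "teq G (Suc (Suc s)) (totd \<Phi>) (\<lambda>_ _. 0)"
  obtain k' where k': "k = Suc k'" using k by (cases k) auto
  have closed: "bd (\<lambda>zs. \<Phi> zs ys) xs = 0"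
    if "m + k = Suc (Suc s)" "xs \<in> tuples (carrier G) m" "ys \<in> tuples (carrier G) k" for m xs ys
  proof -
    have "ys \<in> tuples (carrier G) (Suc k')" using that k' by simp
    then have "bd (\<Phi> xs) ys = bd (\<lambda>zs. 0) ys"
      by (rule bd_cong) (use vanishD[OF van, of m k'] that k' in auto)
    then show ?thesis using teqD[OF cl that] by (simp add: totd_def)
  qed
  define \<psi> where "\<psi> xs ys = \<Phi> (hd ys # xs) ys" for xs ys
  have eq: "\<Phi> xs ys = bd (\<lambda>zs. \<psi> zs ys) xs"
    if mk: "m + k = Suc s" and xs: "xs \<in> tuples (carrier G) m" and ys: "ys \<in> tuples (carrier G) k" for m xs ys
  proof -
    obtain y ws where y: "ys = y # ws" "y \<in> carrier G" using ys k' by (auto elim: tuples_SucE)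
    then have "bd (\<lambda>zs. \<Phi> zs ys) (y # xs) = 0" using mk xs ys by (intro closed[of "Suc m"]) auto
    then show ?thesis by (simp add: \<psi>_def y)
  qed
  have \<psi>adm: "gadm G m k \<psi>" if mk: "Suc m + k = Suc s" for m
  proof -
    note a = tadmD[OF \<Phi> mk]
    obtain N where N: "N \<in> pfin_normals G p" and loc: "\<And>xs xs' ys. xs \<in> tuples (carrier G) (Suc m) \<Longrightarrow>
      xs' \<in> tuples (carrier G) (Suc m) \<Longrightarrow> ys \<in> tuples (carrier G) k \<Longrightarrow> cosets G N xs = cosets G N xs' \<Longrightarrow> \<Phi> xs ys = \<Phi> xs' ys"
      by (rule adm_loc[OF a]) (rule that)
    have hd: "hd ys \<in> carrier G" if "ys \<in> tuples (carrier G) k" for ys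
      using that k' by (auto elim: tuples_SucE)
    show ?thesis
    proof (rule admI[OF _ _ N])
      fix xs ys assume "xs \<in> tuples (carrier G) m" "ys \<in> tuples (carrier G) k"
      then show "\<psi> xs ys \<in> V" using adm_V[OF a] hd by (simp add: \<psi>_def)
    next
      fix xs ys g assume xs: "xs \<in> tuples (carrier G) m" and ys: "ys \<in> tuples (carrier G) k" and g: "g \<in> carrier G"
      have "hd (lact G g ys) = g \<otimes>\<^bsub>G\<^esub> hd ys" using ys k' by (auto elim!: tuples_SucE)
      then show "\<psi> (lact G g xs) (lact G g ys) = \<psi> xs ys"
        using adm_inv[OF a, of "hd ys # xs" ys g] xs ys hd[OF ys] g by (simp add: \<psi>_def)
    next
      fix xs xs' ys assume "xs \<in> tuples (carrier G) m" "xs' \<in> tuples (carrier G) m" and ys: "ys \<in> tuples (carrier G) k"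
        and "cosets G N xs = cosets G N xs'"
      then show "\<psi> xs ys = \<psi> xs' ys" unfolding \<psi>_def using hd[OF ys] by (intro loc) auto
    qed
  qed
  define \<Psi> where "\<Psi> xs ys = (if length ys = k then \<psi> xs ys else 0)" for xs ys
  have "gadm G m n \<Psi>" if mn: "m + n = s" for m n
  proof (cases "n = k")
    case True
    have "gadm G m k \<Psi>"
      by (rule gadm_cong[OF G _ \<psi>adm]) (use mn True in \<open>simp_all add: \<Psi>_def tuples_length\<close>)
    then show ?thesis using True by simp
  next
    case False
    then show ?thesis by (intro gadm_cong[OF G _ adm_zero[OF G]]) (auto simp: \<Psi>_def tuples_length)
  qed
  moreover have "vanish G levR s k \<Psi>" by (auto simp: vanish_def \<Psi>_def tuples_length)
  moreover have "vanish G levR (Suc s) (Suc k) (\<lambda>xs ys. \<Phi> xs ys - totd \<Psi> xs ys)"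
    unfolding vanish_def
  proof (intro allI impI ballI)
    fix m n xs ys assume mn: "m + n = Suc s" "n < Suc k" and xs: "xs \<in> tuples (carrier G) m" and ys: "ys \<in> tuples (carrier G) n"
    have r: "bd (\<Psi> xs) ys = 0"
    proof (cases n)
      case (Suc n')
      have "ys \<in> tuples (carrier G) (Suc n')" using ys Suc by simp
      then have "bd (\<Psi> xs) ys = bd (\<lambda>zs. 0) ys"
        by (rule bd_cong) (use mn Suc in \<open>auto simp: \<Psi>_def tuples_length\<close>)
      then show ?thesis by simp
    qed (use ys in simp)
    show "\<Phi> xs ys - totd \<Psi> xs ys = 0"
    proof (cases "n = k")
      case True
      then have "totd \<Psi> xs ys = bd (\<lambda>zs. \<psi> zs ys) xs"
        using r ys by (simp add: totd_def \<Psi>_def tuples_length)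
      then show ?thesis using eq[of m xs ys] mn xs ys True by simp
    next
      case False
      then have "totd \<Psi> xs ys = 0" using r ys by (simp add: totd_def \<Psi>_def tuples_length)
      moreover have "\<Phi> xs ys = 0" by (rule vanishD[OF van mn(1) _ xs ys]) (use mn False in simp)
      ultimately show ?thesis by simp
    qed
  qed
  ultimately show "\<exists>\<Psi>. tadm G s \<Psi> \<and> vanish G levR s k \<Psi> \<and> vanish G levR (Suc s) (Suc k) (\<lambda>xs ys. \<Phi> xs ys - totd \<Psi> xs ys)"
    unfolding tadm_def by blast
qed simp

text \<open>Exactness at the augmentation: a closed cochain of one variable does not depend on
  it.\<close>

lemma column_exact_0:
  assumes G: "group G" shows "column_exact G k 0"
  unfolding column_exact_def
proof (intro allI impI, elim conjE)
  interpret group G by fact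
  fix \<Phi> assume a: "gadm G k (Suc 0) \<Phi>"
    and cl: "\<forall>xs\<in>tuples (carrier G) k. \<forall>ys\<in>tuples (carrier G) (Suc (Suc 0)). bd (\<Phi> xs) ys = 0"
  have const: "\<Phi> xs [y] = \<Phi> xs [z]" if "xs \<in> tuples (carrier G) k" "y \<in> carrier G" "z \<in> carrier G" for xs y z
    using cl[rule_format, of xs "[y, z]"] that by simp
  obtain N where N: "N \<in> pfin_normals G p" and loc: "\<And>xs xs' ys. xs \<in> tuples (carrier G) k \<Longrightarrow>
      xs' \<in> tuples (carrier G) k \<Longrightarrow> ys \<in> tuples (carrier G) (Suc 0) \<Longrightarrow> cosets G N xs = cosets G N xs' \<Longrightarrow> \<Phi> xs ys = \<Phi> xs' ys"
    by (rule adm_loc[OF a]) (rule that)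
  have a1: "gadm G k 0 (\<lambda>xs ys. \<Phi> xs [\<one>\<^bsub>G\<^esub>])"
  proof (rule admI[OF _ _ N])
    fix xs ys g assume xs: "xs \<in> tuples (carrier G) k" and g: "g \<in> carrier G"
    show "\<Phi> (lact G g xs) [\<one>\<^bsub>G\<^esub>] = \<Phi> xs [\<one>\<^bsub>G\<^esub>]"
      using adm_inv[OF a xs, of "[\<one>\<^bsub>G\<^esub>]" g] const[OF lact_tuples[OF g xs], of "\<one>\<^bsub>G\<^esub>" g] g by simp
  next
    fix xs ys assume "xs \<in> tuples (carrier G) k"
    then show "\<Phi> xs [\<one>\<^bsub>G\<^esub>] \<in> V" using adm_V[OF a] by simp
  next
    fix xs xs' ys assume "xs \<in> tuples (carrier G) k" "xs' \<in> tuples (carrier G) k" "cosets G N xs = cosets G N xs'"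
    then show "\<Phi> xs [\<one>\<^bsub>G\<^esub>] = \<Phi> xs' [\<one>\<^bsub>G\<^esub>]" by (intro loc) auto
  qed
  have a2: "\<Phi> xs ys = bd (\<lambda>_. \<Phi> xs [\<one>\<^bsub>G\<^esub>]) ys" if "xs \<in> tuples (carrier G) k" "ys \<in> tuples (carrier G) (Suc 0)" for xs ys
  proof -
    obtain y where y: "ys = [y]" "y \<in> carrier G" using \<open>ys \<in> _\<close> by (auto elim: tuples_SucE)
    then show ?thesis using const[OF \<open>xs \<in> _\<close> y(2) one_closed] by simp
  qed
  show "\<exists>\<Psi>. gadm G k 0 \<Psi> \<and> (\<forall>xs\<in>tuples (carrier G) k. \<forall>ys\<in>tuples (carrier G) (Suc 0). \<Phi> xs ys = bd (\<Psi> xs) ys)"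
    by (rule exI[of _ "\<lambda>xs ys. \<Phi> xs [\<one>\<^bsub>G\<^esub>]"]) (intro conjI ballI a1 a2)
qed

text \<open>For fixed \<open>xs\<close>, an element \<open>s\<close> with \<open>j s\<close> in
  \<open>K\<close> can be moved from the abstract to the continuous variables, where it does not
  change cosets. So each slice is invariant under the preimage of \<open>K\<close>, and acyclicity
  of \<open>S\<close> gives its primitive.\<close>

lemma shapiro_locally_acyclic:
  fixes G :: "('g, 'm) monoid_scheme" and S :: "('s, 'n) monoid_scheme" and F :: "'g list \<Rightarrow> 'g list \<Rightarrow> 'k"
  assumes S: "group S" and G: "group G" and j: "j \<in> hom S G" and inj: "inj_on j (carrier S)"
    and top: "\<And>N. N \<in> pfin_normals S p \<Longrightarrow> \<exists>K\<in>pfin_normals G p. \<forall>s\<in>carrier S. j s \<in> K \<longrightarrow> s \<in> N"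
    and F: "adm G S j (Suc m) (Suc n) F"
    and closed: "\<And>xs ys. xs \<in> tuples (carrier G) (Suc m) \<Longrightarrow> ys \<in> tuples (carrier G) (Suc (Suc n)) \<Longrightarrow> bd (F xs) ys = 0"
    and Ex: "locally_acyclic S n"
  shows "\<exists>H. adm G S j (Suc m) n H \<and>
    (\<forall>xs\<in>tuples (carrier G) (Suc m). \<forall>ys\<in>tuples (carrier G) (Suc n). F xs ys = bd (H xs) ys)"
proof (rule shapiro[OF S G j inj top F closed])
  interpret S: group S by fact
  interpret G: group G by fact
  interpret j: group_hom S G j using S G j by (simp add: group_hom_def group_hom_axioms_def)
  fix xs assume xs: "xs \<in> tuples (carrier G) (Suc m)"
  obtain K where K: "K \<in> pfin_normals G p" and Kloc: "\<And>xs xs' ys. xs \<in> tuples (carrier G) (Suc m) \<Longrightarrow>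
    xs' \<in> tuples (carrier G) (Suc m) \<Longrightarrow> ys \<in> tuples (carrier G) (Suc n) \<Longrightarrow> cosets G K xs = cosets G K xs' \<Longrightarrow> F xs ys = F xs' ys"
    by (rule adm_loc[OF F]) (rule that)
  have mapj: "map j ss \<in> tuples (carrier G) k" if "ss \<in> tuples (carrier S) k" for ss k
    using that by (intro map_in_tuples) auto
  have mapj_lact: "map j (lact S s ss) = lact G (j s) (map j ss)" if "s \<in> carrier S" "ss \<in> tuples (carrier S) k" for s ss k
    using that(1) tuples_lists[OF that(2)] by (induction ss) auto
  define f where "f ss = F xs (map j ss)" for ss
  have "uadm S (Suc n) f"
    unfolding uadm_def
  proof (intro conjI ballI bexI)
    show "{s \<in> carrier S. j s \<in> K} \<in> pfin_normals S p" by (rule pfin_preimage[OF prime_p S G j K])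
    fix ss assume ss: "ss \<in> tuples (carrier S) (Suc n)"
    then show "f ss \<in> V" unfolding f_def by (intro adm_V[OF F xs] mapj)
    fix s assume "s \<in> {s \<in> carrier S. j s \<in> K}"
    then have s: "s \<in> carrier S" "j s \<in> K" by auto
    let ?i = "inv\<^bsub>S\<^esub> s"
    have i: "?i \<in> carrier S" "j ?i \<in> K" using s subgroup.m_inv_closed[OF pfinD(2)[OF K]] by auto
    have "f (lact S s ss) = F (lact G (j ?i) xs) (lact G (j ?i) (lact G (j s) (map j ss)))"
      using adm_inv[OF F xs mapj[OF S.lact_tuples[OF s(1) ss]] i(1)] mapj_lact[OF s(1) ss] by (simp add: f_def)
    also have "lact G (j ?i) (lact G (j s) (map j ss)) = map j ss"
      using s i tuples_lists[OF mapj[OF ss]] by (simp add: G.lact_lact)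
    also have "F (lact G (j ?i) xs) (map j ss) = F xs (map j ss)"
      using G.lact_tuples[OF j.hom_closed[OF i(1)] xs] G.cosets_lact_normal[OF pfinD(1)[OF K] i(2) tuples_lists[OF xs]]
      by (intro Kloc[OF _ xs mapj[OF ss]]) auto
    finally show "f (lact S s ss) = f ss" by (simp add: f_def)
  qed
  moreover have "bd f ss = 0" if "ss \<in> tuples (carrier S) (Suc (Suc n))" for ss
    using closed[OF xs mapj[OF that]] by (simp add: f_def[abs_def] bd_map)
  ultimately show "\<exists>h. uadm S n h \<and> (\<forall>ss\<in>tuples (carrier S) (Suc n). F xs (map j ss) = bd h ss)"
    using Ex unfolding locally_acyclic_def f_def by blast
qed

lemma id_hom: "(\<lambda>x. x) \<in> hom G G" by (simp add: hom_def)

text \<open>The case \<open>S = G\<close>. The column has at least one continuous variable; without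
  any, it would be the complex of abstract invariant cochains.\<close>

lemma column_exact_of_locally_acyclic:
  assumes G: "group G" and Ex: "locally_acyclic G n"
  shows "column_exact G (Suc m) n"
  unfolding column_exact_def
proof (intro allI impI, elim conjE)
  fix \<Phi> assume a: "gadm G (Suc m) (Suc n) \<Phi>"
    and cl: "\<forall>xs\<in>tuples (carrier G) (Suc m). \<forall>ys\<in>tuples (carrier G) (Suc (Suc n)). bd (\<Phi> xs) ys = 0"
  show "\<exists>\<Psi>. gadm G (Suc m) n \<Psi> \<and> (\<forall>xs\<in>tuples (carrier G) (Suc m). \<forall>ys\<in>tuples (carrier G) (Suc n). \<Phi> xs ys = bd (\<Psi> xs) ys)"
    by (rule shapiro_locally_acyclic[OF G G id_hom _ _ a _ Ex]) (use cl in \<open>auto simp: inj_on_def\<close>)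
qed

text \<open>Surjectivity and injectivity in degree \<open>n\<close> of the map from continuous to abstract cohomology.\<close>

definition completion_surj :: "('g, 'm) monoid_scheme \<Rightarrow> nat \<Rightarrow> bool" where
  "completion_surj G n \<longleftrightarrow> (\<forall>f. gadm G 0 (Suc n) (\<lambda>_. f) \<and> (\<forall>ys\<in>tuples (carrier G) (Suc (Suc n)). bd f ys = 0) \<longrightarrow>
    (\<exists>F u. gadm G (Suc n) 0 (\<lambda>xs _. F xs) \<and> (\<forall>ys\<in>tuples (carrier G) (Suc (Suc n)). bd F ys = 0) \<and>
      gadm G 0 n (\<lambda>_. u) \<and> (\<forall>ys\<in>tuples (carrier G) (Suc n). f ys = F ys + bd u ys)))"

definition completion_inj :: "('g, 'm) monoid_scheme \<Rightarrow> nat \<Rightarrow> bool" where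
  "completion_inj G n \<longleftrightarrow> (\<forall>F u. gadm G (Suc n) 0 (\<lambda>xs _. F xs) \<and> gadm G 0 n (\<lambda>_. u) \<and>
      (\<forall>ys\<in>tuples (carrier G) (Suc n). F ys = bd u ys) \<longrightarrow>
    (\<exists>h. gadm G n 0 (\<lambda>xs _. h xs) \<and> (\<forall>ys\<in>tuples (carrier G) (Suc n). F ys = bd h ys)))"

section \<open>Comparison of the two edges of the double complex\<close>

lemma tadm_append:
  assumes G: "group G" and f: "gadm G s 0 (\<lambda>xs _. f xs)"
  shows "tadm G s (\<lambda>xs ys. f (xs @ ys))"
  unfolding tadm_def
proof (intro allI impI)
  interpret group G by fact
  fix m n assume mn: "m + n = s"
  obtain N where N: "N \<in> pfin_normals G p" and loc: "\<And>xs xs' ys::'a list. xs \<in> tuples (carrier G) s \<Longrightarrow>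
    xs' \<in> tuples (carrier G) s \<Longrightarrow> ys \<in> tuples (carrier G) 0 \<Longrightarrow> cosets G N xs = cosets G N xs' \<Longrightarrow> f xs = f xs'"
    by (rule adm_loc[OF f]) (rule that)
  have ap: "xs @ ys \<in> tuples (carrier G) s" if "xs \<in> tuples (carrier G) m" "ys \<in> tuples (carrier G) n" for xs ys
    using append_in_tuples[OF that] mn by simp
  show "gadm G m n (\<lambda>xs ys. f (xs @ ys))"
  proof (rule admI[OF _ _ N])
    fix xs ys assume "xs \<in> tuples (carrier G) m" "ys \<in> tuples (carrier G) n"
    then show "f (xs @ ys) \<in> V" using adm_V[OF f ap, of xs ys "[]"] by simp
  next
    fix xs ys g assume "xs \<in> tuples (carrier G) m" "ys \<in> tuples (carrier G) n" "g \<in> carrier G"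
    then show "f (lact G g xs @ lact G g ys) = f (xs @ ys)" using adm_inv[OF f ap, of xs ys "[]" g] by simp
  next
    fix xs xs' ys assume "xs \<in> tuples (carrier G) m" "xs' \<in> tuples (carrier G) m" "ys \<in> tuples (carrier G) n"
      "cosets G N xs = cosets G N xs'"
    then show "f (xs @ ys) = f (xs' @ ys)" using ap by (intro loc[of _ _ "[]"]) (auto simp: cosets_def)
  qed
qed

lemma gadm_left_Nil:
  assumes "group G" "gadm G 0 n \<Phi>" shows "gadm G 0 n (\<lambda>_. \<Phi> [])"
  by (rule gadm_cong[OF assms(1) _ assms(2)]) simp

lemma gadm_right_Nil:
  assumes "group G" "gadm G n 0 \<Phi>" shows "gadm G n 0 (\<lambda>xs _. \<Phi> xs [])"
  by (rule gadm_cong[OF assms(1) _ assms(2)]) simp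

lemma tadm_single:
  assumes G: "group G" and u: "gadm G k n \<Phi>" and s: "k + n = s"
  shows "tadm G s (\<lambda>xs ys. if length xs = k then \<Phi> xs ys else 0)"
  unfolding tadm_def
proof (intro allI impI)
  fix m n' assume mn: "m + n' = s"
  show "gadm G m n' (\<lambda>xs ys. if length xs = k then \<Phi> xs ys else 0)"
  proof (cases "m = k")
    case True
    then have "n' = n" using mn s by simp
    moreover have "gadm G k n (\<lambda>xs ys. if length xs = k then \<Phi> xs ys else 0)"
      by (rule gadm_cong[OF G _ u]) (simp add: tuples_length)
    ultimately show ?thesis using True by simp
  next
    case False
    then show ?thesis by (intro gadm_cong[OF G _ adm_zero[OF G]]) (auto simp: tuples_length)
  qed
qed

text \<open>A staircase: \<open>f\<close>, placed in column 0, is completed to a total cocycle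
  because the columns from 1 on are exact. Its values at empty \<open>ys\<close> form a continuous
  cocycle \<open>F\<close>. The total cocycle and the concatenation of \<open>F\<close> agree on
  that row, so by exactness of the other rows they differ by a boundary.\<close>

lemma completion_surj_of_columns:
  assumes G: "group G" and col: "\<And>k n. 1 \<le> k \<Longrightarrow> column_exact G k n"
  shows "completion_surj G n"
  unfolding completion_surj_def
proof (intro allI impI, elim conjE)
  let ?T = "tuples (carrier G)"
  fix f assume f: "gadm G 0 (Suc n) (\<lambda>_. f)" and cl: "\<forall>ys\<in>?T (Suc (Suc n)). bd f ys = 0"
  define \<Phi>0 where "\<Phi>0 xs ys = (if length xs = 0 then f ys else 0)" for xs ys :: "'a list"
  have t0: "tadm G (Suc n) \<Phi>0" using tadm_single[OF G f, of "Suc n"] by (simp add: \<Phi>0_def[abs_def])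
  have "vanish G levL (Suc (Suc n)) 1 (totd \<Phi>0)"
    using cl by (auto simp: vanish_def totd_def \<Phi>0_def[abs_def])
  then obtain \<psi> where \<psi>: "tadm G (Suc n) \<psi>" "vanish G levL (Suc n) 1 \<psi>" "teq G (Suc (Suc n)) (totd \<Phi>0) (totd \<psi>)"
    using columns_exact[OF G _ totd_tadm[OF G t0], of 1] col by (auto simp: teq_def)
  define X where "X xs ys = \<Phi>0 xs ys - \<psi> xs ys" for xs ys
  have X: "tadm G (Suc n) X" unfolding X_def by (rule tadm_diff[OF G t0 \<psi>(1)])
  have X0: "totd X xs ys = 0" if "m + n' = Suc (Suc n)" "xs \<in> ?T m" "ys \<in> ?T n'" for m n' xs ys
    using teqD[OF \<psi>(3) that] by (simp add: X_def[abs_def] totd_diff)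
  define F where "F xs = X xs []" for xs
  have F: "gadm G (Suc n) 0 (\<lambda>xs _. F xs)" unfolding F_def by (rule gadm_right_Nil[OF G tadmD[OF X]]) simp
  have F0: "bd F xs = 0" if "xs \<in> ?T (Suc (Suc n))" for xs
    using X0[of "Suc (Suc n)" 0 xs "[]"] that by (simp add: totd_def F_def[abs_def])
  define Y where "Y xs ys = F (xs @ ys) - X xs ys" for xs ys
  have "tadm G (Suc n) Y" unfolding Y_def by (rule tadm_diff[OF G tadm_append[OF G F] X])
  moreover have "vanish G levR (Suc n) 1 Y" by (auto simp: vanish_def Y_def F_def)
  moreover have "teq G (Suc (Suc n)) (totd Y) (\<lambda>_ _. 0)"
    unfolding teq_def
  proof (intro allI impI ballI)
    fix m n' xs ys assume *: "m + n' = Suc (Suc n)" "xs \<in> ?T m" "ys \<in> ?T n'"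
    have "xs @ ys \<in> ?T (Suc (Suc n))" using append_in_tuples[OF *(2,3)] *(1) by simp
    then show "totd Y xs ys = 0" using X0[OF *] F0 by (simp add: Y_def[abs_def] totd_diff totd_append)
  qed
  ultimately obtain \<theta> where \<theta>: "tadm G n \<theta>" "teq G (Suc n) Y (totd \<theta>)" using rows_exact[OF G] by blast
  \<comment> \<open>Column 0 of the primitive is the abstract cochain that links \<open>f\<close>
    and \<open>F\<close>.\<close>
  have "gadm G 0 n (\<lambda>_. \<theta> [])" by (rule gadm_left_Nil[OF G tadmD[OF \<theta>(1)]]) simp
  then have u: "gadm G 0 n (\<lambda>_ ys. - \<theta> [] ys)" by (rule adm_minus[OF G])
  have "f ys = F ys + bd (\<lambda>ys. - \<theta> [] ys) ys" if ys: "ys \<in> ?T (Suc n)" for ys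
  proof -
    have "\<psi> [] ys = 0" using vanishD[OF \<psi>(2), of 0 "Suc n" "[]" ys] ys by simp
    then have "F ys - f ys = bd (\<theta> []) ys"
      using teqD[OF \<theta>(2), of 0 "Suc n" "[]" ys] ys by (simp add: Y_def X_def \<Phi>0_def totd_def)
    then show ?thesis by (simp add: bd_minus algebra_simps)
  qed
  then show "\<exists>F u. gadm G (Suc n) 0 (\<lambda>xs _. F xs) \<and> (\<forall>ys\<in>?T (Suc (Suc n)). bd F ys = 0) \<and>
      gadm G 0 n (\<lambda>_. u) \<and> (\<forall>ys\<in>?T (Suc n). f ys = F ys + bd u ys)"
    using F F0 u by blast
qed

text \<open>In column 0 the concatenation of \<open>F\<close> is the coboundary of \<open>u\<close>.
  Subtracting it leaves a total cocycle in the exact columns, and the part of its primitive at empty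
  \<open>ys\<close> is a continuous primitive of \<open>F\<close>.\<close>

lemma completion_inj_of_columns:
  assumes G: "group G" and col: "\<And>k n. 1 \<le> k \<Longrightarrow> column_exact G k n" and n: "1 \<le> n"
  shows "completion_inj G n"
  unfolding completion_inj_def
proof (intro allI impI, elim conjE)
  let ?T = "tuples (carrier G)"
  fix F u assume F: "gadm G (Suc n) 0 (\<lambda>xs _. F xs)" and u: "gadm G 0 n (\<lambda>_. u)"
    and eq: "\<forall>ys\<in>?T (Suc n). F ys = bd u ys"
  define U where "U xs ys = (if length xs = 0 then u ys else 0)" for xs ys :: "'a list"
  have U: "tadm G n U" using tadm_single[OF G u, of n] by (simp add: U_def[abs_def])
  define X where "X xs ys = F (xs @ ys) - totd U xs ys" for xs ys
  have X: "tadm G (Suc n) X" unfolding X_def by (rule tadm_diff[OF G tadm_append[OF G F] totd_tadm[OF G U]])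
  have F0: "bd F ys = 0" if "ys \<in> ?T (Suc (Suc n))" for ys
  proof -
    have "bd F ys = bd (bd u) ys" by (rule bd_cong[OF that]) (use eq in simp)
    then show ?thesis by simp
  qed
  have "teq G (Suc (Suc n)) (totd X) (\<lambda>_ _. 0)"
    unfolding teq_def
  proof (intro allI impI ballI)
    fix m n' xs ys assume *: "m + n' = Suc (Suc n)" "xs \<in> ?T m" "ys \<in> ?T n'"
    have "xs @ ys \<in> ?T (Suc (Suc n))" using append_in_tuples[OF *(2,3)] *(1) by simp
    then show "totd X xs ys = 0" using F0 by (simp add: X_def[abs_def] totd_diff totd_append)
  qed
  moreover have "vanish G levL (Suc n) 1 X"
    using eq by (auto simp: vanish_def X_def totd_def U_def[abs_def])
  ultimately obtain \<psi> where \<psi>: "tadm G n \<psi>" "teq G (Suc n) X (totd \<psi>)"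
    using columns_exact[OF G _ X, of 1] col by blast
  have h: "gadm G n 0 (\<lambda>xs _. \<psi> xs [])" by (rule gadm_right_Nil[OF G tadmD[OF \<psi>(1)]]) simp
  have "F xs = bd (\<lambda>xs. \<psi> xs []) xs" if xs: "xs \<in> ?T (Suc n)" for xs
  proof -
    \<comment> \<open>The faces of \<open>xs\<close> have \<open>n\<close> entries with
      \<open>n\<close> positive, while \<open>U\<close> lives on empty first lists.\<close>
    have "bd (\<lambda>zs. U zs []) xs = bd (\<lambda>zs. 0) xs"
      by (rule bd_cong[OF xs]) (use n in \<open>auto simp: U_def tuples_length\<close>)
    then have "X xs [] = F xs" by (simp add: X_def totd_def)
    then show ?thesis using teqD[OF \<psi>(2), of "Suc n" 0 xs "[]"] xs by (simp add: totd_def)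
  qed
  then show "\<exists>h. gadm G n 0 (\<lambda>xs _. h xs) \<and> (\<forall>ys\<in>?T (Suc n). F ys = bd h ys)"
    using h by (intro exI[of _ "\<lambda>xs. \<psi> xs []"]) simp
qed

text \<open>The columns from 1 on form the fibre of the comparison from continuous to abstract
  cochains: the rows over nonempty lists are exact, and column 0 is the abstract complex. By the
  long exact sequence a class in this degree is excluded by injectivity in degree
  \<open>n + 1\<close> and surjectivity in degree \<open>n\<close>; the proof is that diagram
  chase.\<close>

lemma tot_exact_of_completion:
  assumes G: "group G" and completion_inj: "completion_inj G (Suc n)" and completion_surj: "completion_surj G n"
    and \<Phi>: "tadm G (Suc (Suc n)) \<Phi>" "vanish G levL (Suc (Suc n)) 1 \<Phi>" "teq G (Suc (Suc (Suc n))) (totd \<Phi>) (\<lambda>_ _. 0)"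
  shows "\<exists>\<Psi>. tadm G (Suc n) \<Psi> \<and> vanish G levL (Suc n) 1 \<Psi> \<and> teq G (Suc (Suc n)) \<Phi> (totd \<Psi>)"
proof -
  let ?T = "tuples (carrier G)"
  define E where "E xs = \<Phi> xs []" for xs
  have E: "gadm G (Suc (Suc n)) 0 (\<lambda>xs _. E xs)" unfolding E_def by (rule gadm_right_Nil[OF G tadmD[OF \<Phi>(1)]]) simp
  have E0: "bd E xs = 0" if "xs \<in> ?T (Suc (Suc (Suc n)))" for xs
    using teqD[OF \<Phi>(3), of "Suc (Suc (Suc n))" 0 xs "[]"] that by (simp add: totd_def E_def[abs_def])
  define Y where "Y xs ys = \<Phi> xs ys - E (xs @ ys)" for xs ys
  have "tadm G (Suc (Suc n)) Y" unfolding Y_def by (rule tadm_diff[OF G \<Phi>(1) tadm_append[OF G E]])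
  moreover have "vanish G levR (Suc (Suc n)) 1 Y" by (auto simp: vanish_def Y_def E_def)
  moreover have "teq G (Suc (Suc (Suc n))) (totd Y) (\<lambda>_ _. 0)"
    unfolding teq_def
  proof (intro allI impI ballI)
    fix m n' xs ys assume *: "m + n' = Suc (Suc (Suc n))" "xs \<in> ?T m" "ys \<in> ?T n'"
    have "xs @ ys \<in> ?T (Suc (Suc (Suc n)))" using append_in_tuples[OF *(2,3)] *(1) by simp
    then show "totd Y xs ys = 0" using teqD[OF \<Phi>(3) *] E0 by (simp add: Y_def[abs_def] totd_diff totd_append)
  qed
  ultimately obtain \<theta> where \<theta>: "tadm G (Suc n) \<theta>" "teq G (Suc (Suc n)) Y (totd \<theta>)" using rows_exact[OF G] by blast
  have \<theta>0: "gadm G 0 (Suc n) (\<lambda>_. \<theta> [])" by (rule gadm_left_Nil[OF G tadmD[OF \<theta>(1)]]) simp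
  then have u: "gadm G 0 (Suc n) (\<lambda>_ ys. - \<theta> [] ys)" by (rule adm_minus[OF G])
  have \<theta>E: "- E ys = bd (\<theta> []) ys" if ys: "ys \<in> ?T (Suc (Suc n))" for ys
    using teqD[OF \<theta>(2), of 0 "Suc (Suc n)" "[]" ys] vanishD[OF \<Phi>(2), of 0 "Suc (Suc n)" "[]" ys] ys
    by (simp add: Y_def totd_def)
  have "E ys = bd (\<lambda>ys. - \<theta> [] ys) ys" if ys: "ys \<in> ?T (Suc (Suc n))" for ys
    unfolding bd_minus \<theta>E[OF ys, symmetric] by simp
  \<comment> \<open>Column 0 of \<Phi> vanishes, so the continuous cocycle \<open>E\<close> is an
    abstract coboundary; injectivity makes it a continuous one.\<close>
  then obtain h where h: "gadm G (Suc n) 0 (\<lambda>xs _. h xs)" and hE: "\<And>ys. ys \<in> ?T (Suc (Suc n)) \<Longrightarrow> E ys = bd h ys"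
    using completion_inj E u unfolding completion_inj_def by blast
  have hn: "tadm G (Suc n) (\<lambda>xs ys. h (xs @ ys))" by (rule tadm_append[OF G h])
  \<comment> \<open>The abstract primitive \<open>- \<theta> []\<close> and the continuous primitive
    \<open>h\<close> of \<open>E\<close> differ by an abstract cocycle, to which surjectivity
    applies.\<close>
  define g where "g ys = \<theta> [] ys + h ys" for ys
  have "gadm G 0 (Suc n) (\<lambda>_ ys. h ys)"
    using gadm_left_Nil[OF G tadmD[OF hn, of 0 "Suc n"]] by simp
  then have g: "gadm G 0 (Suc n) (\<lambda>_. g)" unfolding g_def using adm_add[OF G \<theta>0] by blast
  have g0: "bd g ys = 0" if ys: "ys \<in> ?T (Suc (Suc n))" for ys
    using \<theta>E[OF ys] hE[OF ys] by (simp add: g_def[abs_def] bd_add) (metis add.left_inverse)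
  obtain F w where F: "gadm G (Suc n) 0 (\<lambda>xs _. F xs)" and F0: "\<And>ys. ys \<in> ?T (Suc (Suc n)) \<Longrightarrow> bd F ys = 0"
    and w: "gadm G 0 n (\<lambda>_. w)" and gF: "\<And>ys. ys \<in> ?T (Suc n) \<Longrightarrow> g ys = F ys + bd w ys"
    using completion_surj g g0 unfolding completion_surj_def by blast
  define U where "U xs ys = (if length xs = 0 then w ys else 0)" for xs ys :: "'a list"
  have U: "tadm G n U" using tadm_single[OF G w, of n] by (simp add: U_def[abs_def])
  \<comment> \<open>Arranged to vanish in column 0, where it reads
    \<open>g - F - bd w\<close>.\<close>
  define \<Psi> where "\<Psi> xs ys = \<theta> xs ys + h (xs @ ys) - F (xs @ ys) - totd U xs ys" for xs ys
  have "tadm G (Suc n) \<Psi>" unfolding \<Psi>_def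
    by (intro tadm_diff[OF G] tadm_add[OF G] \<theta>(1) hn tadm_append[OF G F] totd_tadm[OF G U])
  moreover have "vanish G levL (Suc n) 1 \<Psi>"
    unfolding vanish_def
  proof (intro allI impI ballI)
    fix m n' xs ys assume *: "m + n' = Suc n" "m < 1" "xs \<in> ?T m" "ys \<in> ?T n'"
    then have "xs = []" "ys \<in> ?T (Suc n)" by auto
    then show "\<Psi> xs ys = 0" using gF[of ys] by (simp add: \<Psi>_def totd_def U_def[abs_def] g_def)
  qed
  moreover have "teq G (Suc (Suc n)) \<Phi> (totd \<Psi>)"
    unfolding teq_def
  proof (intro allI impI ballI)
    fix m n' xs ys assume *: "m + n' = Suc (Suc n)" "xs \<in> ?T m" "ys \<in> ?T n'"
    have ap: "xs @ ys \<in> ?T (Suc (Suc n))" using append_in_tuples[OF *(2,3)] *(1) by simp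
    have "totd \<Psi> xs ys = totd \<theta> xs ys + bd h (xs @ ys) - bd F (xs @ ys)"
      by (simp add: \<Psi>_def[abs_def] totd_diff totd_add totd_append)
    also have "\<dots> = Y xs ys + E (xs @ ys)" using teqD[OF \<theta>(2) *] hE[OF ap] F0[OF ap] by simp
    finally show "\<Phi> xs ys = totd \<Psi> xs ys" by (simp add: Y_def)
  qed
  ultimately show ?thesis by blast
qed

end

subsection \<open>Local acyclicity\<close>

lemma iterated_difference:
  fixes a :: "nat \<Rightarrow> int"
  shows "((\<lambda>a k. a (Suc k) - a k) ^^ n) a k = (\<Sum>i\<le>n. (-1) ^ (n + i) * int (n choose i) * a (k + i))"
proof (induction n arbitrary: k)
  case (Suc n)
  let ?c = "\<lambda>i. (-1) ^ (n + i) * int (n choose i)"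
  have "(\<Sum>i\<le>Suc n. (-1) ^ (Suc n + i) * int (Suc n choose i) * a (k + i))
      = (-1) ^ Suc n * a k + (\<Sum>i\<le>n. ?c i * a (Suc k + i) + (-1) ^ (n + i) * int (n choose Suc i) * a (k + Suc i))"
    by (subst sum.atMost_Suc_shift) (simp add: algebra_simps)
  also have "\<dots> = (\<Sum>i\<le>n. ?c i * a (Suc k + i))
      + ((-1) ^ Suc n * a k + (\<Sum>i\<le>n. (-1) ^ (n + i) * int (n choose Suc i) * a (k + Suc i)))"
    by (simp add: sum.distrib)
  also have "(-1) ^ Suc n * a k + (\<Sum>i\<le>n. (-1) ^ (n + i) * int (n choose Suc i) * a (k + Suc i))
      = (\<Sum>i\<le>Suc n. (-1) ^ (Suc n + i) * int (n choose i) * a (k + i))"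
    by (subst sum.atMost_Suc_shift) simp
  also have "\<dots> = - (\<Sum>i\<le>n. ?c i * a (k + i))"
    by (simp add: sum_negf)
  finally show ?case using Suc[of k] Suc[of "Suc k"] by simp
qed simp

text \<open>The identity (T - 1)^p = T^p - 1 in characteristic \<open>p\<close>: the inner binomial
  coefficients are divisible by \<open>p\<close>.\<close>

lemma iterated_difference_prime:
  fixes a :: "nat \<Rightarrow> int"
  assumes p: "prime p"
  shows "[((\<lambda>a k. a (Suc k) - a k) ^^ p) a 0 = a p - a 0] (mod int p)"
proof -
  have p2: "p \<ge> 2" using p prime_ge_2_nat by blast
  have split: "{..p} = insert 0 (insert p {1..<p})" using p2 by auto
  have mid: "int p dvd (\<Sum>i\<in>{1..<p}. (-1) ^ (p + i) * int (p choose i) * a i)"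
  proof (rule dvd_sum)
    fix i assume "i \<in> {1..<p}"
    then have "p dvd p choose i" using p by (intro dvd_choose_prime) auto
    then show "int p dvd (-1) ^ (p + i) * int (p choose i) * a i" by (simp add: dvd_mult dvd_mult2)
  qed
  have sgn: "[(-1) ^ p = -1] (mod int p)"
  \<comment> \<open>For \<open>p = 2\<close> the signs 1 and -1 agree modulo
    \<open>p\<close>.\<close>
  proof (cases "p = 2")
    case False
    then have "odd p" using p p2 by (metis prime_odd_nat le_neq_implies_less)
    then show ?thesis by simp
  qed (simp add: cong_def)
  have one: "(-1::int) ^ (p + p) = 1" by (simp flip: mult_2)
  have "((\<lambda>a k. a (Suc k) - a k) ^^ p) a 0 = (\<Sum>i\<le>p. (-1) ^ (p + i) * int (p choose i) * a i)"
    by (simp add: iterated_difference)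
  also have "\<dots> = (-1) ^ p * a 0 + (a p + (\<Sum>i\<in>{1..<p}. (-1) ^ (p + i) * int (p choose i) * a i))"
    unfolding split using p2 one by simp
  finally have eq: "((\<lambda>a k. a (Suc k) - a k) ^^ p) a 0 =
    (-1) ^ p * a 0 + (a p + (\<Sum>i\<in>{1..<p}. (-1) ^ (p + i) * int (p choose i) * a i))" .
  have "[(\<Sum>i\<in>{1..<p}. (-1) ^ (p + i) * int (p choose i) * a i) = 0] (mod int p)"
    using mid by (simp add: cong_0_iff)
  then have "[((\<lambda>a k. a (Suc k) - a k) ^^ p) a 0 = -1 * a 0 + (a p + 0)] (mod int p)"
    unfolding eq by (intro cong_add cong_mult sgn cong_refl)
  then show ?thesis by simp
qed

context zmod_coeff begin

lemma uadm_V: "uadm G n f \<Longrightarrow> ys \<in> tuples (carrier G) n \<Longrightarrow> f ys \<in> V"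
  by (simp add: uadm_def)

lemma uadm_inv:
  assumes "uadm G n f"
  obtains N where "N \<in> pfin_normals G p" "\<And>g ys. g \<in> N \<Longrightarrow> ys \<in> tuples (carrier G) n \<Longrightarrow> f (lact G g ys) = f ys"
  using assms unfolding uadm_def by blast

lemma uadmI:
  assumes "\<And>ys. ys \<in> tuples (carrier G) n \<Longrightarrow> f ys \<in> V" "N \<in> pfin_normals G p"
    "\<And>g ys. g \<in> N \<Longrightarrow> ys \<in> tuples (carrier G) n \<Longrightarrow> f (lact G g ys) = f ys"
  shows "uadm G n f"
  using assms unfolding uadm_def by blast

lemma uadm_diff:
  assumes G: "group G" and f: "uadm G n f" and g: "uadm G n g"
  shows "uadm G n (\<lambda>ys. f ys - g ys)"
proof -
  interpret group G by fact
  obtain N where N: "N \<in> pfin_normals G p" "\<And>x ys. x \<in> N \<Longrightarrow> ys \<in> tuples (carrier G) n \<Longrightarrow> f (lact G x ys) = f ys"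
    by (rule uadm_inv[OF f]) (rule that)
  obtain M where M: "M \<in> pfin_normals G p" "\<And>x ys. x \<in> M \<Longrightarrow> ys \<in> tuples (carrier G) n \<Longrightarrow> g (lact G x ys) = g ys"
    by (rule uadm_inv[OF g]) (rule that)
  show ?thesis
    by (rule uadmI[OF _ pfin_inter[OF prime_p N(1) M(1)]]) (use uadm_V[OF f] uadm_V[OF g] N(2) M(2) in auto)
qed

lemma uadm_zero: "group G \<Longrightarrow> uadm G n (\<lambda>_. 0)"
  by (rule uadmI[OF _ group.carrier_pfin]) auto

lemma uadm_minus: "group G \<Longrightarrow> uadm G n f \<Longrightarrow> uadm G n (\<lambda>ys. - f ys)"
  using uadm_diff[OF _ uadm_zero, of G n f] by simp

lemma uadm_translate:
  assumes G: "group G" and f: "uadm G n f" and x: "x \<in> carrier G"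
  shows "uadm G n (\<lambda>ys. f (lact G x ys))"
proof -
  interpret group G by fact
  obtain N where N: "N \<in> pfin_normals G p" and inv: "\<And>x ys. x \<in> N \<Longrightarrow> ys \<in> tuples (carrier G) n \<Longrightarrow> f (lact G x ys) = f ys"
    by (rule uadm_inv[OF f]) (rule that)
  show ?thesis
  proof (rule uadmI[OF _ N])
    fix ys assume "ys \<in> tuples (carrier G) n"
    then show "f (lact G x ys) \<in> V" by (intro uadm_V[OF f] lact_tuples x)
  next
    fix g ys assume g: "g \<in> N" and ys: "ys \<in> tuples (carrier G) n"
    have gc: "g \<in> carrier G" using g pfinD(4)[OF N] by blast
    let ?g = "x \<otimes>\<^bsub>G\<^esub> g \<otimes>\<^bsub>G\<^esub> inv\<^bsub>G\<^esub> x"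
    have "?g \<in> N" by (rule normal.inv_op_closed2[OF pfinD(1)[OF N] x g])
    moreover have "lact G x (lact G g ys) = lact G ?g (lact G x ys)"
      using x gc tuples_lists[OF ys] by (simp add: lact_lact m_assoc)
    ultimately show "f (lact G x (lact G g ys)) = f (lact G x ys)"
      using inv lact_tuples[OF x ys] by simp
  qed
qed

section \<open>Classes fixed by the group\<close>

definition Bd :: "('g, 'm) monoid_scheme \<Rightarrow> nat \<Rightarrow> ('g list \<Rightarrow> 'k) \<Rightarrow> bool" where
  "Bd G n f \<longleftrightarrow> (\<exists>h. uadm G n h \<and> (\<forall>ys\<in>tuples (carrier G) (Suc n). f ys = bd h ys))"

lemma Bd_cong: "Bd G n f \<Longrightarrow> (\<And>ys. ys \<in> tuples (carrier G) (Suc n) \<Longrightarrow> f ys = g ys) \<Longrightarrow> Bd G n g"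
  unfolding Bd_def by metis

lemma Bd_zero: "group G \<Longrightarrow> Bd G n (\<lambda>_. 0)"
  unfolding Bd_def using uadm_zero[of G n] by (intro exI[of _ "\<lambda>_. 0"]) simp

lemma Bd_diff:
  assumes G: "group G" and f: "Bd G n f" and g: "Bd G n g"
  shows "Bd G n (\<lambda>ys. f ys - g ys)"
proof -
  obtain h k where "uadm G n h" "\<forall>ys\<in>tuples (carrier G) (Suc n). f ys = bd h ys"
    "uadm G n k" "\<forall>ys\<in>tuples (carrier G) (Suc n). g ys = bd k ys" using f g unfolding Bd_def by blast
  then show ?thesis unfolding Bd_def
    using uadm_diff[OF G, of n h k] by (intro exI[of _ "\<lambda>ys. h ys - k ys"]) (simp add: bd_diff)
qed

lemma Bd_add:
  assumes G: "group G" and f: "Bd G n f" and g: "Bd G n g"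
  shows "Bd G n (\<lambda>ys. f ys + g ys)"
  using Bd_diff[OF G f Bd_diff[OF G Bd_zero[OF G] g]] by simp

lemma Bd_translate:
  assumes G: "group G" and f: "Bd G n f" and x: "x \<in> carrier G"
  shows "Bd G n (\<lambda>ys. f (lact G x ys))"
proof -
  interpret group G by fact
  obtain h where h: "uadm G n h" "\<forall>ys\<in>tuples (carrier G) (Suc n). f ys = bd h ys" using f unfolding Bd_def by blast
  have "f (lact G x ys) = bd (\<lambda>ys. h (lact G x ys)) ys" if "ys \<in> tuples (carrier G) (Suc n)" for ys
    using h(2) lact_tuples[OF x that] by (simp add: lact_def bd_map)
  then show ?thesis unfolding Bd_def using uadm_translate[OF G h(1) x] by blast
qed

text \<open>The continuous variable records a translate. Together with evaluation at the identity
  this identifies column 1 with the complex of cochains invariant under some subgroup of p-power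
  index.\<close>

lemma gadm_of_uadm:
  assumes G: "group G" and f: "uadm G n f"
  shows "gadm G (Suc 0) n (\<lambda>xs ys. f (lact G (inv\<^bsub>G\<^esub> hd xs) ys))"
proof -
  interpret group G by fact
  obtain N where N: "N \<in> pfin_normals G p" and inv: "\<And>x ys. x \<in> N \<Longrightarrow> ys \<in> tuples (carrier G) n \<Longrightarrow> f (lact G x ys) = f ys"
    by (rule uadm_inv[OF f]) (rule that)
  show ?thesis
  proof (rule admI[OF _ _ N])
    fix xs ys assume xs: "xs \<in> tuples (carrier G) (Suc 0)" and ys: "ys \<in> tuples (carrier G) n"
    then have "inv\<^bsub>G\<^esub> hd xs \<in> carrier G" by (auto elim: tuples_SucE)
    then show "f (lact G (inv\<^bsub>G\<^esub> hd xs) ys) \<in> V" by (intro uadm_V[OF f] lact_tuples ys)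
  next
    fix xs ys g assume xs: "xs \<in> tuples (carrier G) (Suc 0)" and ys: "ys \<in> tuples (carrier G) n" and g: "g \<in> carrier G"
    obtain x where x: "xs = [x]" "x \<in> carrier G" using xs by (auto elim: tuples_SucE)
    then show "f (lact G (inv\<^bsub>G\<^esub> hd (lact G g xs)) (lact G g ys)) = f (lact G (inv\<^bsub>G\<^esub> hd xs) ys)"
      using g tuples_lists[OF ys] by (simp add: lact_lact inv_mult_group m_assoc)
  next
    fix xs xs' ys assume xs: "xs \<in> tuples (carrier G) (Suc 0)" "xs' \<in> tuples (carrier G) (Suc 0)" and ys: "ys \<in> tuples (carrier G) n"
      and c: "cosets G N xs = cosets G N xs'"
    obtain x where x: "xs = [x]" "x \<in> carrier G" using xs(1) by (auto elim: tuples_SucE)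
    obtain x' where x': "xs' = [x']" "x' \<in> carrier G" using xs(2) by (auto elim: tuples_SucE)
    have m: "inv\<^bsub>G\<^esub> x \<otimes>\<^bsub>G\<^esub> x' \<in> N" using c coset_inv_mult_eq_iff[OF pfinD(1)[OF N] x(2) x'(2)] by (simp add: x x')
    have "lact G (inv\<^bsub>G\<^esub> x) ys = lact G (inv\<^bsub>G\<^esub> x \<otimes>\<^bsub>G\<^esub> x') (lact G (inv\<^bsub>G\<^esub> x') ys)"
      using x x' tuples_lists[OF ys] by (simp add: lact_lact m_assoc)
    then show "f (lact G (inv\<^bsub>G\<^esub> hd xs) ys) = f (lact G (inv\<^bsub>G\<^esub> hd xs') ys)"
      using inv[OF m lact_tuples[OF inv_closed[OF x'(2)] ys]] by (simp add: x x')
  qed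
qed

lemma uadm_of_gadm:
  assumes G: "group G" and H: "gadm G (Suc 0) n H"
  shows "uadm G n (H [\<one>\<^bsub>G\<^esub>])"
proof -
  interpret group G by fact
  obtain N where N: "N \<in> pfin_normals G p" and loc: "\<And>xs xs' ys. xs \<in> tuples (carrier G) (Suc 0) \<Longrightarrow>
    xs' \<in> tuples (carrier G) (Suc 0) \<Longrightarrow> ys \<in> tuples (carrier G) n \<Longrightarrow> cosets G N xs = cosets G N xs' \<Longrightarrow> H xs ys = H xs' ys"
    by (rule adm_loc[OF H]) (rule that)
  show ?thesis
  proof (rule uadmI[OF _ N])
    fix ys assume "ys \<in> tuples (carrier G) n"
    then show "H [\<one>\<^bsub>G\<^esub>] ys \<in> V" by (intro adm_V[OF H]) auto
  next
    fix g ys assume g: "g \<in> N" and ys: "ys \<in> tuples (carrier G) n"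
    have gc: "g \<in> carrier G" using g pfinD(4)[OF N] by blast
    have "H [\<one>\<^bsub>G\<^esub>] (lact G g ys) = H [g] (lact G g ys)"
      using g gc lact_tuples[OF gc ys] coset_eq_subgroup_iff[OF pfinD(1)[OF N]] pfinD(4)[OF N]
      by (intro loc) auto
    also have "\<dots> = H [\<one>\<^bsub>G\<^esub>] ys" using adm_inv[OF H, of "[\<one>\<^bsub>G\<^esub>]" ys g] ys gc by simp
    finally show "H [\<one>\<^bsub>G\<^esub>] (lact G g ys) = H [\<one>\<^bsub>G\<^esub>] ys" .
  qed
qed

text \<open>Invariance of the class fills column 2 and acyclicity in lower degrees fills the columns
  from 3 on; this gives a total cocycle in columns from 1 on with \<open>f\<close> in column 1. By
  injectivity and surjectivity it is the boundary of a cochain without column 0, whose column 1 then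
  bounds \<open>f\<close>.\<close>

lemma exact_of_fixed_class:
  assumes G: "group G" and n: "1 \<le> n" and Ex: "\<And>k. 1 \<le> k \<Longrightarrow> k < n \<Longrightarrow> locally_acyclic G k"
    and completion_inj: "completion_inj G (Suc n)" and completion_surj: "completion_surj G n"
    and f: "uadm G (Suc n) f" and cl: "\<And>ys. ys \<in> tuples (carrier G) (Suc (Suc n)) \<Longrightarrow> bd f ys = 0"
    and fix_class: "\<And>g. g \<in> carrier G \<Longrightarrow> Bd G n (\<lambda>ys. f (lact G g ys) - f ys)"
  shows "Bd G n f"
proof -
  interpret group G by fact
  let ?T = "tuples (carrier G)"
  define F where "F xs ys = f (lact G (inv\<^bsub>G\<^esub> hd xs) ys)" for xs ys
  have F: "gadm G (Suc 0) (Suc n) F" unfolding F_def by (rule gadm_of_uadm[OF G f])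
  define \<Phi>1 where "\<Phi>1 xs ys = (if length xs = Suc 0 then F xs ys else 0)" for xs ys
  have \<Phi>1: "tadm G (Suc (Suc n)) \<Phi>1" unfolding \<Phi>1_def by (rule tadm_single[OF G F]) simp
  have closedF: "bd (F xs) ys = 0" if xs: "xs \<in> ?T (Suc 0)" and ys: "ys \<in> ?T (Suc (Suc n))" for xs ys
  proof -
    have x: "inv\<^bsub>G\<^esub> hd xs \<in> carrier G" using xs by (auto elim: tuples_SucE)
    then show ?thesis using cl[OF lact_tuples[OF x ys]] by (simp add: F_def[abs_def] lact_def bd_map)
  qed
  \<comment> \<open>At \<open>[x, y]\<close> this is the difference of two translates of
    \<open>f\<close>, a coboundary by invariance of the class.\<close>
  define W where "W xs ys = bd (\<lambda>zs. F zs ys) xs" for xs ys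
  have W: "gadm G (Suc (Suc 0)) (Suc n) W" unfolding W_def by (rule adm_bd_left[OF G F])
  have "\<exists>H. gadm G (Suc (Suc 0)) n H \<and> (\<forall>xs\<in>?T (Suc (Suc 0)). \<forall>ys\<in>?T (Suc n). W xs ys = bd (H xs) ys)"
  proof (rule shapiro[OF G G id_hom _ _ W])
    fix xs ys assume xs: "xs \<in> ?T (Suc (Suc 0))" and ys: "ys \<in> ?T (Suc (Suc n))"
    have "bd (W xs) ys = bd (\<lambda>zs. bd (F zs) ys) xs"
      unfolding W_def[abs_def] by (rule bd_commute[symmetric])
    also have "\<dots> = bd (\<lambda>zs. 0) xs" by (rule bd_cong[OF xs]) (rule closedF[OF _ ys])
    finally show "bd (W xs) ys = 0" by simp
  next
    fix xs assume "xs \<in> ?T (Suc (Suc 0))"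
    then obtain x y where x: "xs = [x, y]" "x \<in> carrier G" "y \<in> carrier G" by (auto elim!: tuples_SucE)
    have "Bd G n (\<lambda>ys. (f (lact G (inv\<^bsub>G\<^esub> y) ys) - f ys) - (f (lact G (inv\<^bsub>G\<^esub> x) ys) - f ys))"
      using x by (intro Bd_diff[OF G] fix_class) auto
    then have "Bd G n (W xs)" by (rule Bd_cong) (simp add: W_def F_def x)
    then show "\<exists>h. uadm G n h \<and> (\<forall>ss\<in>?T (Suc n). W xs (map (\<lambda>x. x) ss) = bd h ss)"
      unfolding Bd_def by simp
  qed (auto simp: inj_on_def)
  then obtain H where H: "gadm G (Suc (Suc 0)) n H"
    and WH: "\<And>xs ys. xs \<in> ?T (Suc (Suc 0)) \<Longrightarrow> ys \<in> ?T (Suc n) \<Longrightarrow> W xs ys = bd (H xs) ys" by blast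
  define \<Phi>2 where "\<Phi>2 xs ys = (if length xs = Suc (Suc 0) then H xs ys else 0)" for xs ys
  have \<Phi>2: "tadm G (Suc (Suc n)) \<Phi>2" unfolding \<Phi>2_def by (rule tadm_single[OF G H]) simp
  define X where "X xs ys = \<Phi>1 xs ys - \<Phi>2 xs ys" for xs ys
  have X: "tadm G (Suc (Suc n)) X" unfolding X_def by (rule tadm_diff[OF G \<Phi>1 \<Phi>2])
  have X1: "X xs = F xs" if "length xs = Suc 0" for xs using that by (simp add: X_def[abs_def] \<Phi>1_def \<Phi>2_def)
  have X2: "X xs = (\<lambda>ys. - H xs ys)" if "length xs = Suc (Suc 0)" for xs using that by (simp add: X_def[abs_def] \<Phi>1_def \<Phi>2_def)
  have X0: "X [] = (\<lambda>_. 0)" by (simp add: X_def[abs_def] \<Phi>1_def \<Phi>2_def)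
  have van: "vanish G levL (Suc (Suc (Suc n))) 3 (totd X)"
    unfolding vanish_def
  proof (intro allI impI ballI)
    fix m n' xs ys assume mn: "m + n' = Suc (Suc (Suc n))" "m < 3" and xs: "xs \<in> ?T m" and ys: "ys \<in> ?T n'"
    consider "m = 0" | "m = Suc 0" | "m = Suc (Suc 0)" using mn(2) by linarith
    then show "totd X xs ys = 0"
    proof cases
      case 1
      then show ?thesis using xs by (simp add: totd_def X0)
    next
      case 2
      then obtain x where x: "xs = [x]" using xs by (auto elim: tuples_SucE)
      then show ?thesis using closedF[of xs ys] xs ys mn 2 by (simp add: totd_def X0 X1)
    next
      case 3
      then have n': "n' = Suc n" using mn by simp
      have xs2: "xs \<in> ?T (Suc (Suc 0))" using xs 3 by simp
      have "bd (\<lambda>zs. X zs ys) xs = W xs ys"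
        unfolding W_def by (rule bd_cong[OF xs2]) (simp add: X1 tuples_length)
      moreover have "bd (X xs) ys = - bd (H xs) ys" using X2[of xs] xs2 by (simp add: tuples_length bd_minus)
      ultimately show ?thesis using WH[OF xs2] ys n' xs2 by (simp add: totd_def tuples_length)
    qed
  qed
  have "\<exists>\<Psi>. tadm G (Suc (Suc n)) \<Psi> \<and> vanish G levL (Suc (Suc n)) 3 \<Psi> \<and> teq G (Suc (Suc (Suc n))) (totd X) (totd \<Psi>)"
  proof (rule columns_exact[OF G _ totd_tadm[OF G X] van])
    fix k l assume kl: "3 \<le> k" "k + Suc l = Suc (Suc (Suc n))"
    \<comment> \<open>From \<open>3 \<le> k\<close> follows \<open>l < n\<close>, so acyclicity in
      lower degrees is enough.\<close>
    show "column_exact G k l"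
    proof (cases "l = 0")
      case True
      then show ?thesis using column_exact_0[OF G] by simp
    next
      case False
      obtain k' where "k = Suc k'" using kl by (cases k) auto
      then show ?thesis using column_exact_of_locally_acyclic[OF G Ex, of l k'] False kl by simp
    qed
  qed (simp add: teq_def)
  then obtain \<Psi> where \<Psi>: "tadm G (Suc (Suc n)) \<Psi>" "vanish G levL (Suc (Suc n)) 3 \<Psi>"
    "teq G (Suc (Suc (Suc n))) (totd X) (totd \<Psi>)" by blast
  define Y where "Y xs ys = X xs ys - \<Psi> xs ys" for xs ys
  have "\<exists>\<Theta>. tadm G (Suc n) \<Theta> \<and> vanish G levL (Suc n) 1 \<Theta> \<and> teq G (Suc (Suc n)) Y (totd \<Theta>)"
  proof (rule tot_exact_of_completion[OF G completion_inj completion_surj])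
    show "tadm G (Suc (Suc n)) Y" unfolding Y_def by (rule tadm_diff[OF G X \<Psi>(1)])
    show "vanish G levL (Suc (Suc n)) 1 Y"
      using \<Psi>(2) X0 by (auto simp: vanish_def Y_def)
    show "teq G (Suc (Suc (Suc n))) (totd Y) (\<lambda>_ _. 0)"
      using \<Psi>(3) by (simp add: teq_def Y_def[abs_def] totd_diff)
  qed
  then obtain \<Theta> where \<Theta>: "tadm G (Suc n) \<Theta>" "vanish G levL (Suc n) 1 \<Theta>" "teq G (Suc (Suc n)) Y (totd \<Theta>)" by blast
  have "uadm G n (\<lambda>ys. - \<Theta> [\<one>\<^bsub>G\<^esub>] ys)"
    by (rule uadm_minus[OF G uadm_of_gadm[OF G tadmD[OF \<Theta>(1)]]]) simp
  moreover have "f ys = bd (\<lambda>ys. - \<Theta> [\<one>\<^bsub>G\<^esub>] ys) ys" if ys: "ys \<in> ?T (Suc n)" for ys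
  proof -
    have "Y [\<one>\<^bsub>G\<^esub>] ys = f ys"
      using vanishD[OF \<Psi>(2), of "Suc 0" "Suc n" "[\<one>\<^bsub>G\<^esub>]" ys] ys tuples_lists[OF ys]
      by (simp add: Y_def X1 F_def)
    moreover have "Y [\<one>\<^bsub>G\<^esub>] ys = totd \<Theta> [\<one>\<^bsub>G\<^esub>] ys"
      by (rule teqD[OF \<Theta>(3), of "Suc 0" "Suc n"]) (use ys in auto)
    moreover have "\<Theta> [] ys = 0" using vanishD[OF \<Theta>(2), of 0 "Suc n" "[]" ys] ys by simp
    ultimately show ?thesis by (simp add: totd_def bd_minus)
  qed
  ultimately show ?thesis unfolding Bd_def by blast
qed

text \<open>In characteristic \<open>p\<close> an element \<open>z\<close> with \<open>z\<^sup>p\<close> acting trivially acts unipotently, because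
  \<open>(z - 1)\<^sup>p = z\<^sup>p - 1\<close>; so a nonzero class fixed by \<open>L\<close> yields a nonzero class fixed by \<open>L\<close> and \<open>z\<close>.\<close>

lemma exact_unipotent_step:
  assumes G: "group G" and L: "L \<in> pfin_normals G p" and z: "central_mod G p L z"
    and IH: "\<And>f. uadm G (Suc n) f \<Longrightarrow> (\<And>ys. ys \<in> tuples (carrier G) (Suc (Suc n)) \<Longrightarrow> bd f ys = 0) \<Longrightarrow>
      (\<And>g. g \<in> central_ext G L z \<Longrightarrow> Bd G n (\<lambda>ys. f (lact G g ys) - f ys)) \<Longrightarrow> Bd G n f"
    and f: "uadm G (Suc n) f" and cl: "\<And>ys. ys \<in> tuples (carrier G) (Suc (Suc n)) \<Longrightarrow> bd f ys = 0"
    and fix_class: "\<And>g. g \<in> L \<Longrightarrow> Bd G n (\<lambda>ys. f (lact G g ys) - f ys)"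
  shows "Bd G n f"
proof -
  interpret group G by fact
  let ?T = "tuples (carrier G)"
  note LN = pfinD(1)[OF L]
  have zc: "z \<in> carrier G" by (rule central_mod_closed[OF prime_p L z])
  \<comment> \<open>The operator z - 1 on cochains; \<open>Z\<close> collects the cocycles whose
    class is fixed by \<open>L\<close>, and \<open>T\<close> preserves them.\<close>
  define T where "T f = (\<lambda>ys. f (lact G z ys) - f ys :: 'k)" for f
  define Z where "Z f \<longleftrightarrow> uadm G (Suc n) f \<and> (\<forall>ys\<in>?T (Suc (Suc n)). bd f ys = 0) \<and>
      (\<forall>g\<in>L. Bd G n (\<lambda>ys. f (lact G g ys) - f ys))" for f
  have Lc: "g \<in> carrier G" if "g \<in> L" for g using that pfinD(4)[OF L] by blast
  have ZT: "Z (T f)" if f: "Z f" for f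
  proof -
    have 1: "uadm G (Suc n) f" and 2: "\<And>ys. ys \<in> ?T (Suc (Suc n)) \<Longrightarrow> bd f ys = 0"
      and 3: "\<And>g. g \<in> L \<Longrightarrow> Bd G n (\<lambda>ys. f (lact G g ys) - f ys)" using f unfolding Z_def by auto
    have "uadm G (Suc n) (T f)" unfolding T_def by (rule uadm_diff[OF G uadm_translate[OF G 1 zc] 1])
    moreover have "bd (T f) ys = 0" if ys: "ys \<in> ?T (Suc (Suc n))" for ys
      using 2[OF ys] 2[OF lact_tuples[OF zc ys]] by (simp add: T_def bd_diff lact_def bd_map)
    moreover have "Bd G n (\<lambda>ys. T f (lact G g ys) - T f ys)" if g: "g \<in> L" for g
    proof -
      let ?g = "z \<otimes>\<^bsub>G\<^esub> g \<otimes>\<^bsub>G\<^esub> inv\<^bsub>G\<^esub> z"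
      have g': "?g \<in> L" by (rule normal.inv_op_closed2[OF LN zc g])
      have "Bd G n (\<lambda>ys. (f (lact G ?g (lact G z ys)) - f (lact G z ys)) - (f (lact G g ys) - f ys))"
        by (rule Bd_diff[OF G Bd_translate[OF G 3[OF g'] zc] 3[OF g]])
      then show ?thesis
      proof (rule Bd_cong)
        fix ys assume ys: "ys \<in> ?T (Suc n)"
        have "lact G ?g (lact G z ys) = lact G z (lact G g ys)"
          using zc Lc[OF g] tuples_lists[OF ys] by (simp add: lact_lact m_assoc)
        then show "f (lact G ?g (lact G z ys)) - f (lact G z ys) - (f (lact G g ys) - f ys) = T f (lact G g ys) - T f ys"
          by (simp add: T_def)
      qed
    qed
    ultimately show ?thesis unfolding Z_def by blast
  qed
  \<comment> \<open>A class fixed by \<open>L\<close> and killed by z - 1 is fixed by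
    \<open>central_ext G L z\<close>, so the hypothesis for the larger subgroup applies.\<close>
  have down: "Bd G n f" if f: "Z f" and Tf: "Bd G n (T f)" for f
  proof (rule IH)
    show "uadm G (Suc n) f" "\<And>ys. ys \<in> ?T (Suc (Suc n)) \<Longrightarrow> bd f ys = 0" using f unfolding Z_def by auto
    have pw: "Bd G n (\<lambda>ys. f (lact G (z [^]\<^bsub>G\<^esub> i) ys) - f ys)" for i :: nat
    proof (induction i)
      case 0
      show ?case by (rule Bd_cong[OF Bd_zero[OF G]]) (simp add: tuples_lists)
    next
      case (Suc i)
      have "Bd G n (\<lambda>ys. (f (lact G (z [^]\<^bsub>G\<^esub> i) (lact G z ys)) - f (lact G z ys)) + T f ys)"
        by (rule Bd_add[OF G Bd_translate[OF G Suc zc] Tf])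
      then show ?case
        by (rule Bd_cong) (use zc in \<open>simp add: T_def lact_lact tuples_lists\<close>)
    qed
    fix g assume "g \<in> central_ext G L z"
    then obtain i where g: "g \<in> carrier G" "L #>\<^bsub>G\<^esub> g = L #>\<^bsub>G\<^esub> z [^]\<^bsub>G\<^esub> (i::nat)" unfolding central_ext_def by blast
    let ?l = "g \<otimes>\<^bsub>G\<^esub> inv\<^bsub>G\<^esub> (z [^]\<^bsub>G\<^esub> i)"
    have l: "?l \<in> L" using g normal_Mod_eq_iff[OF LN g(1)] zc by simp
    have "Bd G n (\<lambda>ys. f (lact G ?l ys) - f ys)" using f l unfolding Z_def by blast
    then have "Bd G n (\<lambda>ys. (f (lact G ?l (lact G (z [^]\<^bsub>G\<^esub> i) ys)) - f (lact G (z [^]\<^bsub>G\<^esub> i) ys)) +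
        (f (lact G (z [^]\<^bsub>G\<^esub> i) ys) - f ys))"
      using zc by (intro Bd_add[OF G Bd_translate[OF G] pw]) auto
    then show "Bd G n (\<lambda>ys. f (lact G g ys) - f ys)"
      by (rule Bd_cong) (use zc g in \<open>simp add: lact_lact tuples_lists m_assoc\<close>)
  qed
  have Zf: "Z f" unfolding Z_def using f cl fix_class by blast
  have Zi: "Z ((T ^^ i) f)" for i by (induction i) (auto intro: Zf ZT)
  have "(T ^^ p) f ys = f (lact G (z [^]\<^bsub>G\<^esub> p) ys) - f ys" if ys: "ys \<in> ?T (Suc n)" for ys
  proof -
    \<comment> \<open>Values in \<open>V\<close> are lifted to integers, where the congruence for
      iterated differences is available.\<close>
    have "\<exists>a. e a = f (lact G (z [^]\<^bsub>G\<^esub> k) ys)" for k :: nat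
      using uadm_V[OF f lact_tuples[OF nat_pow_closed[OF zc] ys]] unfolding V_def by (metis rangeE)
    then obtain a where a: "\<And>k::nat. e (a k) = f (lact G (z [^]\<^bsub>G\<^esub> k) ys)" by metis
    have "(T ^^ i) f (lact G (z [^]\<^bsub>G\<^esub> k) ys) = e (((\<lambda>a k. a (Suc k) - a k) ^^ i) a k)" for i k
    proof (induction i arbitrary: k)
      case (Suc i)
      have "lact G z (lact G (z [^]\<^bsub>G\<^esub> k) ys) = lact G (z [^]\<^bsub>G\<^esub> Suc k) ys"
        using zc tuples_lists[OF ys] nat_pow_Suc2[OF zc, of k] by (simp add: lact_lact)
      then have "(T ^^ Suc i) f (lact G (z [^]\<^bsub>G\<^esub> k) ys)
          = (T ^^ i) f (lact G (z [^]\<^bsub>G\<^esub> Suc k) ys) - (T ^^ i) f (lact G (z [^]\<^bsub>G\<^esub> k) ys)"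
        by (simp add: T_def)
      then show ?case unfolding Suc by (simp add: e_diff)
    qed (simp add: a)
    from this[of p 0] have "(T ^^ p) f ys = e (((\<lambda>a k. a (Suc k) - a k) ^^ p) a 0)"
      using tuples_lists[OF ys] by simp
    also have "\<dots> = e (a p - a 0)" unfolding e_eq_iff by (rule iterated_difference_prime[OF prime_p])
    finally show ?thesis using tuples_lists[OF ys] by (simp add: e_diff a)
  qed
  moreover have "z [^]\<^bsub>G\<^esub> p \<in> L" using z unfolding central_mod_def by blast
  ultimately have top: "Bd G n ((T ^^ p) f)"
    by (intro Bd_cong[OF fix_class]) auto
  \<comment> \<open>Descent to \<open>f\<close> from the \<open>p\<close>-th iterate, which bounds
    because \<open>z [^] p\<close> lies in \<open>L\<close>.\<close>
  have "Bd G n ((T ^^ (p - i)) f)" if "i \<le> p" for i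
    using that
  proof (induction i)
    case (Suc i)
    have "T ((T ^^ (p - Suc i)) f) = (T ^^ (p - i)) f"
      using Suc.prems by (metis Suc_diff_Suc Suc_le_lessD comp_apply funpow.simps(2))
    then show ?case using Suc by (intro down[OF Zi]) simp
  qed (use top in simp)
  from this[of p] show ?thesis by simp
qed

text \<open>Induction on the degree makes the lower degrees available. Within a degree, a class is
  fixed by some subgroup of p-power index, which is enlarged by central elements of order
  \<open>p\<close> until it is all of \<open>G\<close>.\<close>

lemma locally_acyclic_of_completion:
  assumes G: "group G" and QI: "\<And>n. 1 \<le> n \<Longrightarrow> completion_inj G n" "\<And>n. 1 \<le> n \<Longrightarrow> completion_surj G n"
  shows "1 \<le> n \<Longrightarrow> locally_acyclic G n"
proof (induction n rule: less_induct)
  case (less n)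
  interpret group G by fact
  have step: "Bd G n f" if "M \<in> pfin_normals G p" "uadm G (Suc n) f"
    "\<And>ys. ys \<in> tuples (carrier G) (Suc (Suc n)) \<Longrightarrow> bd f ys = 0"
    "\<And>g. g \<in> M \<Longrightarrow> Bd G n (\<lambda>ys. f (lact G g ys) - f ys)" for M f
    using that
  proof (induction "card (rcosets\<^bsub>G\<^esub> M)" arbitrary: M f rule: less_induct)
    case (less M)
    show ?case
    proof (cases "M = carrier G")
      case True
      show ?thesis
        by (rule exact_of_fixed_class[OF G _ _ QI(1) QI(2) less.prems(2,3)])
          (use \<open>1 \<le> n\<close> \<open>\<And>y. y < n \<Longrightarrow> 1 \<le> y \<Longrightarrow> locally_acyclic G y\<close> less.prems(4) True in auto)
    next
      case False
      then have "M \<subset> carrier G" using pfinD(4)[OF less.prems(1)] by blast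
      then obtain z where z: "central_mod G p M z"
        using ex_central_mod[OF prime_p less.prems(1) pfinD(1)[OF carrier_pfin]] by blast
      have E: "central_ext G M z \<in> pfin_normals G p" by (rule central_ext_pfin[OF prime_p less.prems(1) z])
      have "z \<notin> M" using z by (simp add: central_mod_def)
      then have "M \<subset> central_ext G M z"
        using central_ext_subset[OF prime_p less.prems(1) z] central_mod_in_ext[OF prime_p less.prems(1) z] by blast
      then have lt: "card (rcosets\<^bsub>G\<^esub> (central_ext G M z)) < card (rcosets\<^bsub>G\<^esub> M)"
        by (rule pfin_index_less[OF less.prems(1) E])
      show ?thesis
        by (rule exact_unipotent_step[OF G less.prems(1) z less.hyps[OF lt E] less.prems(2,3,4)])
    qed
  qed
  show ?case
    unfolding locally_acyclic_def
  proof (intro allI impI, elim conjE)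
    fix f assume f: "uadm G (Suc n) f" and cl: "\<forall>ys\<in>tuples (carrier G) (Suc (Suc n)). bd f ys = 0"
    obtain N where N: "N \<in> pfin_normals G p" and inv: "\<And>x ys. x \<in> N \<Longrightarrow> ys \<in> tuples (carrier G) (Suc n) \<Longrightarrow> f (lact G x ys) = f ys"
      by (rule uadm_inv[OF f]) (rule that)
    have "Bd G n f"
      by (rule step[OF N f]) (use cl inv in \<open>auto intro: Bd_cong[OF Bd_zero[OF G]]\<close>)
    then show "\<exists>h. uadm G n h \<and> (\<forall>ys\<in>tuples (carrier G) (Suc n). f ys = bd h ys)" unfolding Bd_def .
  qed
qed

text \<open>The translates of a cocycle in degree 1 assemble to the crossed homomorphism \<delta>,
  whose kernel in \<open>N\<close> has p-power index. The primitive obtained by inserting the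
  identity is invariant under this kernel.\<close>

lemma locally_acyclic_1:
  assumes G: "group G" shows "locally_acyclic G 1"
  unfolding locally_acyclic_def
proof (intro allI impI, elim conjE)
  interpret group G by fact
  fix f assume f: "uadm G (Suc 1) f" and cl: "\<forall>ys\<in>tuples (carrier G) (Suc (Suc 1)). bd f ys = 0"
  have coc: "f [b, c] = f [a, c] - f [a, b]" if "a \<in> carrier G" "b \<in> carrier G" "c \<in> carrier G" for a b c
    using cl[rule_format, of "[a, b, c]"] that by (simp add: algebra_simps)
  obtain N where N: "N \<in> pfin_normals G p" and inv: "\<And>x ys. x \<in> N \<Longrightarrow> ys \<in> tuples (carrier G) (Suc 1) \<Longrightarrow> f (lact G x ys) = f ys"
    by (rule uadm_inv[OF f]) (rule that)
  note NN = pfinD(1)[OF N]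
  define \<delta> where "\<delta> g x = f [inv\<^bsub>G\<^esub> x, inv\<^bsub>G\<^esub> x \<otimes>\<^bsub>G\<^esub> g]" for g x
  define K where "K = {k \<in> N. \<forall>x\<in>carrier G. \<delta> k x = 0}"
  have K: "K \<in> pfin_normals G p"
    unfolding K_def
  proof (rule derivation_kernel_pfin[OF G N])
    fix g x assume "g \<in> carrier G" "x \<in> carrier G"
    then show "\<delta> g x \<in> V" unfolding \<delta>_def by (intro uadm_V[OF f]) auto
  next
    fix g h x assume *: "g \<in> carrier G" "h \<in> carrier G" "x \<in> carrier G"
    have "inv\<^bsub>G\<^esub> (inv\<^bsub>G\<^esub> g \<otimes>\<^bsub>G\<^esub> x) = inv\<^bsub>G\<^esub> x \<otimes>\<^bsub>G\<^esub> g" using * by (simp add: inv_mult_group)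
    then show "\<delta> (g \<otimes>\<^bsub>G\<^esub> h) x = \<delta> g x + \<delta> h (inv\<^bsub>G\<^esub> g \<otimes>\<^bsub>G\<^esub> x)"
      using * coc[of "inv\<^bsub>G\<^esub> x" "inv\<^bsub>G\<^esub> x \<otimes>\<^bsub>G\<^esub> g" "inv\<^bsub>G\<^esub> x \<otimes>\<^bsub>G\<^esub> g \<otimes>\<^bsub>G\<^esub> h"]
      by (simp add: \<delta>_def m_assoc)
  next
    fix g x y assume *: "g \<in> carrier G" "x \<in> carrier G" "y \<in> carrier G" "N #>\<^bsub>G\<^esub> x = N #>\<^bsub>G\<^esub> y"
    have m: "inv\<^bsub>G\<^esub> x \<otimes>\<^bsub>G\<^esub> y \<in> N" using coset_inv_mult_eq_iff[OF NN *(2,3)] * by simp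
    have "[inv\<^bsub>G\<^esub> x, inv\<^bsub>G\<^esub> x \<otimes>\<^bsub>G\<^esub> g] = lact G (inv\<^bsub>G\<^esub> x \<otimes>\<^bsub>G\<^esub> y) [inv\<^bsub>G\<^esub> y, inv\<^bsub>G\<^esub> y \<otimes>\<^bsub>G\<^esub> g]"
      using * by (simp add: m_assoc) (simp add: m_assoc[symmetric])
    then show "\<delta> g x = \<delta> g y" using inv[OF m, of "[inv\<^bsub>G\<^esub> y, inv\<^bsub>G\<^esub> y \<otimes>\<^bsub>G\<^esub> g]"] * by (simp add: \<delta>_def)
  qed
  define h where "h ys = f (\<one>\<^bsub>G\<^esub> # ys)" for ys
  have "uadm G 1 h"
  proof (rule uadmI[OF _ K])
    fix ys assume "ys \<in> tuples (carrier G) 1"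
    then show "h ys \<in> V" unfolding h_def by (intro uadm_V[OF f]) auto
  next
    fix k ys assume k: "k \<in> K" and ys: "ys \<in> tuples (carrier G) 1"
    obtain y where y: "ys = [y]" "y \<in> carrier G" using ys by (auto elim: tuples_SucE)
    have kN: "k \<in> N" and kc: "k \<in> carrier G" and k0: "\<delta> k \<one>\<^bsub>G\<^esub> = 0" using k pfinD(4)[OF N] unfolding K_def by auto
    have "f [\<one>\<^bsub>G\<^esub>, k \<otimes>\<^bsub>G\<^esub> y] = f [k, k \<otimes>\<^bsub>G\<^esub> y] + f [\<one>\<^bsub>G\<^esub>, k]"
      using coc[of "\<one>\<^bsub>G\<^esub>" k "k \<otimes>\<^bsub>G\<^esub> y"] kc y by simp
    also have "f [k, k \<otimes>\<^bsub>G\<^esub> y] = f [\<one>\<^bsub>G\<^esub>, y]" using inv[OF kN, of "[\<one>\<^bsub>G\<^esub>, y]"] kc y by simp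
    also have "f [\<one>\<^bsub>G\<^esub>, k] = 0" using k0 kc by (simp add: \<delta>_def)
    finally show "h (lact G k ys) = h ys" by (simp add: h_def y)
  qed
  moreover have "f ys = bd h ys" if ys: "ys \<in> tuples (carrier G) (Suc 1)" for ys
  proof -
    obtain a b where ab: "ys = [a, b]" "a \<in> carrier G" "b \<in> carrier G" using ys by (auto elim!: tuples_SucE)
    then show ?thesis using coc[of "\<one>\<^bsub>G\<^esub>" a b] by (simp add: h_def)
  qed
  ultimately show "\<exists>h. uadm G 1 h \<and> (\<forall>ys\<in>tuples (carrier G) (Suc 1). f ys = bd h ys)" by blast
qed

end

section \<open>Cyclic groups\<close>

context zmod_coeff begin

text \<open>A discrete antiderivative on the integers with value 0 at 0; it solves the difference
  equation along an orbit of an infinite cyclic group.\<close>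

definition antidiff :: "(int \<Rightarrow> 'k) \<Rightarrow> int \<Rightarrow> 'k" where
  "antidiff s q = (if q \<ge> 0 then \<Sum>i<nat q. s (int i) else - (\<Sum>i<nat (- q). s (- int i - 1)))"

lemma antidiff: "antidiff s (q + 1) - antidiff s q = s q"
proof -
  consider "q \<ge> 0" | "q = -1" | "q < -1" by linarith
  then show ?thesis
  proof cases
    case 1
    then have "nat (q + 1) = Suc (nat q)" by simp
    then show ?thesis using 1 by (simp add: antidiff_def)
  next
    case 3
    then have "nat (- q) = Suc (nat (- (q + 1)))" by simp
    then show ?thesis using 3 by (simp add: antidiff_def)
  qed (simp add: antidiff_def)
qed

lemma antidiff_V: "(\<And>i. s i \<in> V) \<Longrightarrow> antidiff s q \<in> V"
  by (auto simp: antidiff_def intro!: V_sum V_minus)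

text \<open>If \<open>g\<close> has infinite order, \<open>N\<close> is infinite cyclic with
  generator \<open>z\<close>, of cohomological dimension 1. Concretely, the primitive
  \<open>h0\<close> fails to be \<open>z\<close>-invariant by a cocycle \<open>c\<close>, which is
  the boundary of \<open>u\<close>. A solution \<open>w\<close> of the difference equation with
  right-hand side \<open>u\<close> along the orbits of \<open>z\<close> corrects \<open>h0\<close>
  to an invariant primitive.\<close>

lemma locally_acyclic_cyclic:
  assumes A: "group A" and g: "g \<in> carrier A" "carrier A = {g [^]\<^bsub>A\<^esub> t | t::int. True}"
    and tf: "\<And>m::nat. m > 0 \<Longrightarrow> g [^]\<^bsub>A\<^esub> m = \<one>\<^bsub>A\<^esub> \<Longrightarrow> g = \<one>\<^bsub>A\<^esub>" and n: "2 \<le> n"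
  shows "locally_acyclic A n"
  unfolding locally_acyclic_def
proof (intro allI impI, elim conjE)
  interpret group A by fact
  let ?T = "tuples (carrier A)"
  fix f assume f: "uadm A (Suc n) f" and cl: "\<forall>ys\<in>?T (Suc (Suc n)). bd f ys = 0"
  obtain N where N: "N \<in> pfin_normals A p" and inv: "\<And>x ys. x \<in> N \<Longrightarrow> ys \<in> ?T (Suc n) \<Longrightarrow> f (lact A x ys) = f ys"
    by (rule uadm_inv[OF f]) (rule that)
  define h0 where "h0 ys = f (\<one>\<^bsub>A\<^esub> # ys)" for ys
  have h0V: "h0 ys \<in> V" if "ys \<in> ?T n" for ys using that by (auto simp: h0_def intro!: uadm_V[OF f])
  have fh0: "f ys = bd h0 ys" if "ys \<in> ?T (Suc n)" for ys
    using cl[rule_format, of "\<one>\<^bsub>A\<^esub> # ys"] that by (simp add: h0_def[abs_def])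
  show "\<exists>h. uadm A n h \<and> (\<forall>ys\<in>?T (Suc n). f ys = bd h ys)"
  proof (cases "g = \<one>\<^bsub>A\<^esub>")
    case True
    then have triv: "carrier A = {\<one>\<^bsub>A\<^esub>}" using g by auto
    have "uadm A n h0"
    proof (rule uadmI[OF h0V carrier_pfin])
      fix x ys assume "x \<in> carrier A" and ys: "ys \<in> ?T n"
      then have "x = \<one>\<^bsub>A\<^esub>" using triv by simp
      then show "h0 (lact A x ys) = h0 ys" using lact_one[OF tuples_lists[OF ys]] by simp
    qed
    then show ?thesis using fh0 by blast
  next
    case False
    then have "ord g = 0" unfolding ord_eq_0[OF g(1)] using tf by auto
    then have inj: "s = t" if "g [^]\<^bsub>A\<^esub> s = g [^]\<^bsub>A\<^esub> t" for s t :: int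
      using int_pow_eq[OF g(1), of s t] that by simp
    obtain k where k: "\<And>t::int. g [^]\<^bsub>A\<^esub> t \<in> N \<longleftrightarrow> int (p ^ k) dvd t"
      by (rule pfin_cyclic_trace[OF prime_p g(1) N]) (rule that)
    define m where "m = int (p ^ k)"
    have m0: "m > 0" using prime_gt_0_nat[OF prime_p] by (simp add: m_def)
    define z where "z = g [^]\<^bsub>A\<^esub> m"
    have zc: "z \<in> carrier A" unfolding z_def by (rule int_pow_closed[OF g(1)])
    have zN: "z \<in> N" unfolding z_def k m_def by simp
    \<comment> \<open>The exponents of \<open>g\<close> are cut into blocks of length
      \<open>m\<close>, the fundamental domains of \<open>z\<close>; \<open>q\<close> numbers the
      blocks.\<close>
    define q where "q x = (SOME t. x = g [^]\<^bsub>A\<^esub> t) div m" for x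
    have q: "q (g [^]\<^bsub>A\<^esub> t) = t div m" for t
    proof -
      have "(SOME s. g [^]\<^bsub>A\<^esub> t = g [^]\<^bsub>A\<^esub> s) = t"
        by (rule some_equality) (auto dest: inj)
      then show ?thesis by (simp add: q_def)
    qed
    have qz: "q (z \<otimes>\<^bsub>A\<^esub> x) = q x + 1" if x: "x \<in> carrier A" for x
    proof -
      obtain t :: int where t: "x = g [^]\<^bsub>A\<^esub> t" using x g(2) by blast
      have "z \<otimes>\<^bsub>A\<^esub> x = g [^]\<^bsub>A\<^esub> (m + t)" using g(1) by (simp add: z_def t int_pow_mult)
      then show ?thesis using m0 by (simp add: q t)
    qed
    \<comment> \<open>Degree at least 2 leaves at least one entry in the arguments of
      \<open>u\<close>, from which the block number is read.\<close>
    obtain l where l: "n = Suc (Suc l)" using n by (metis One_nat_def Suc_1 Suc_le_D Suc_le_mono)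
    define c where "c ys = h0 (lact A z ys) - h0 ys" for ys
    have bdc: "bd c ys = 0" if ys: "ys \<in> ?T (Suc n)" for ys
    proof -
      have "bd (\<lambda>ys. h0 (lact A z ys)) ys = f (lact A z ys)"
        using fh0[OF lact_tuples[OF zc ys]] by (simp add: lact_def bd_map)
      then show ?thesis using fh0[OF ys] inv[OF zN ys] by (simp add: c_def[abs_def] bd_diff)
    qed
    define u where "u ys = c (\<one>\<^bsub>A\<^esub> # ys)" for ys
    have cu: "c ys = bd u ys" if "ys \<in> ?T n" for ys
      using bdc[of "\<one>\<^bsub>A\<^esub> # ys"] that by (simp add: u_def[abs_def])
    have uV: "u ys \<in> V" if ys: "ys \<in> ?T (Suc l)" for ys
    proof -
      have "\<one>\<^bsub>A\<^esub> # ys \<in> ?T n" using ys l by simp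
      then show ?thesis unfolding u_def c_def by (intro V_diff h0V lact_tuples[OF zc])
    qed
    \<comment> \<open>The list is moved along its \<open>z\<close>-orbit until its head lies in
      block 0.\<close>
    define b where "b ys = lact A (z [^]\<^bsub>A\<^esub> (- q (hd ys))) ys" for ys
    define w where "w ys = antidiff (\<lambda>i. u (lact A (z [^]\<^bsub>A\<^esub> i) (b ys))) (q (hd ys))" for ys
    have bT: "b ys \<in> ?T j" if "ys \<in> ?T j" for ys j unfolding b_def by (intro lact_tuples int_pow_closed zc that)
    have wV: "w ys \<in> V" if "ys \<in> ?T (Suc l)" for ys
      unfolding w_def by (intro antidiff_V uV lact_tuples int_pow_closed zc bT that)
    have wz: "w (lact A z ys) - w ys = u ys" if ys: "ys \<in> ?T (Suc l)" for ys
    proof -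
      obtain y where y: "hd ys = y" "y \<in> carrier A" "hd (lact A z ys) = z \<otimes>\<^bsub>A\<^esub> y"
        using ys by (auto elim: tuples_SucE)
      have "z [^]\<^bsub>A\<^esub> (- (q y + 1)) \<otimes>\<^bsub>A\<^esub> z = z [^]\<^bsub>A\<^esub> (- (q y + 1)) \<otimes>\<^bsub>A\<^esub> z [^]\<^bsub>A\<^esub> (1::int)"
        using zc int_pow_1[of z] by simp
      also have "\<dots> = z [^]\<^bsub>A\<^esub> (- (q y + 1) + 1)" using int_pow_mult[OF zc, of "- (q y + 1)" 1] by simp
      also have "- (q y + 1) + 1 = - q y" by simp
      finally have "z [^]\<^bsub>A\<^esub> (- (q y + 1)) \<otimes>\<^bsub>A\<^esub> z = z [^]\<^bsub>A\<^esub> (- q y)" .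
      then have bz: "b (lact A z ys) = b ys"
        using zc tuples_lists[OF ys] y by (simp add: b_def qz lact_lact)
      have "z [^]\<^bsub>A\<^esub> q y \<otimes>\<^bsub>A\<^esub> z [^]\<^bsub>A\<^esub> (- q y) = \<one>\<^bsub>A\<^esub>"
        using int_pow_mult[OF zc, of "q y" "- q y"] by simp
      then have "lact A (z [^]\<^bsub>A\<^esub> q y) (b ys) = ys"
        using zc tuples_lists[OF ys] y by (simp add: b_def lact_lact)
      then show ?thesis
        using antidiff[of "\<lambda>i. u (lact A (z [^]\<^bsub>A\<^esub> i) (b ys))" "q y"] y by (simp add: w_def bz qz)
    qed
    define h where "h ys = h0 ys - bd w ys" for ys
    have hz: "h (lact A z ys) = h ys" if ys: "ys \<in> ?T n" for ys
    proof -
      have ys': "ys \<in> ?T (Suc (Suc l))" using ys l by simp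
      have "bd w (lact A z ys) - bd w ys = bd (\<lambda>ys. w (lact A z ys) - w ys) ys"
        by (simp add: bd_diff lact_def bd_map)
      also have "\<dots> = bd u ys" by (rule bd_cong[OF ys' wz])
      also have "\<dots> = c ys" using cu[OF ys] by simp
      finally show ?thesis by (simp add: h_def c_def algebra_simps)
    qed
    have hzn: "h (lact A (z [^]\<^bsub>A\<^esub> (i::nat)) ys) = h ys" if ys: "ys \<in> ?T n" for i ys
    proof (induction i)
      case (Suc i)
      have "lact A (z [^]\<^bsub>A\<^esub> Suc i) ys = lact A z (lact A (z [^]\<^bsub>A\<^esub> i) ys)"
        using zc tuples_lists[OF ys] nat_pow_Suc2[OF zc, of i] by (simp add: lact_lact)
      then show ?case using hz[OF lact_tuples[OF nat_pow_closed[OF zc] ys]] Suc by simp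
    qed (use tuples_lists[OF ys] in simp)
    have "uadm A n h"
    proof (rule uadmI[OF _ N])
      fix ys assume ys: "ys \<in> ?T n"
      have "bd w ys \<in> V" by (rule bd_closed[of _ "carrier A" "Suc l"]) (use ys l wV in auto)
      then show "h ys \<in> V" using h0V[OF ys] by (simp add: h_def)
    next
      fix x ys assume x: "x \<in> N" and ys: "ys \<in> ?T n"
      have xc: "x \<in> carrier A" using x pfinD(4)[OF N] by blast
      obtain t :: int where t: "x = g [^]\<^bsub>A\<^esub> t" using xc g(2) by blast
      obtain s where s: "t = m * s" using k[of t] x t unfolding m_def by (auto elim: dvdE)
      have xs: "x = z [^]\<^bsub>A\<^esub> s" unfolding t s z_def using g(1) by (simp add: int_pow_pow)
      show "h (lact A x ys) = h ys"
      proof (cases "s \<ge> 0")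
        case True
        then have "x = z [^]\<^bsub>A\<^esub> nat s" using xs by (metis int_pow_int nat_0_le)
        then show ?thesis using hzn[OF ys] by simp
      next
        case False
        define i where "i = nat (- s)"
        have "s = - int i" using False by (simp add: i_def)
        then have "z [^]\<^bsub>A\<^esub> i \<otimes>\<^bsub>A\<^esub> x = \<one>\<^bsub>A\<^esub>"
          using xs zc by (simp add: int_pow_neg_int)
        then have "lact A (z [^]\<^bsub>A\<^esub> i) (lact A x ys) = ys"
          using zc xc tuples_lists[OF ys] by (simp add: lact_lact)
        then show ?thesis using hzn[OF lact_tuples[OF xc ys], of i] by simp
      qed
    qed
    moreover have "f ys = bd h ys" if "ys \<in> ?T (Suc n)" for ys
      using fh0[OF that] by (simp add: h_def[abs_def] bd_diff)
    ultimately show ?thesis by blast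
  qed
qed

lemma adm_restrict:
  assumes \<Phi>: "gadm G m n \<Phi>" and j: "\<And>s. s \<in> carrier S \<Longrightarrow> j s \<in> carrier G"
  shows "adm G S j m n \<Phi>"
proof -
  obtain N where N: "N \<in> pfin_normals G p" and loc: "\<And>xs xs' ys. xs \<in> tuples (carrier G) m \<Longrightarrow>
    xs' \<in> tuples (carrier G) m \<Longrightarrow> ys \<in> tuples (carrier G) n \<Longrightarrow> cosets G N xs = cosets G N xs' \<Longrightarrow> \<Phi> xs ys = \<Phi> xs' ys"
    by (rule adm_loc[OF \<Phi>]) (rule that)
  show ?thesis
    by (rule admI[OF adm_V[OF \<Phi>] _ N loc]) (assumption | rule adm_inv[OF \<Phi>] j)+
qed

end

subsection \<open>The Mayer-Vietoris argument\<close>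

context amalgam_coeff begin

lemma invariant_if_both:
  assumes \<Phi>1: "adm G G1 j1 m n \<Phi>" and \<Phi>2: "\<And>xs ys s. xs \<in> tuples (carrier G) m \<Longrightarrow> ys \<in> tuples (carrier G) n \<Longrightarrow>
      s \<in> carrier G2 \<Longrightarrow> \<Phi> (lact G (j2 s) xs) (lact G (j2 s) ys) = \<Phi> xs ys"
  shows "gadm G m n \<Phi>"
proof -
  obtain N where N: "N \<in> pfin_normals G p" and loc: "\<And>xs xs' ys. xs \<in> tuples (carrier G) m \<Longrightarrow>
    xs' \<in> tuples (carrier G) m \<Longrightarrow> ys \<in> tuples (carrier G) n \<Longrightarrow> cosets G N xs = cosets G N xs' \<Longrightarrow> \<Phi> xs ys = \<Phi> xs' ys"
    by (rule adm_loc[OF \<Phi>1]) (rule that)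
  have inv: "\<forall>xs\<in>tuples (carrier G) m. \<forall>ys\<in>tuples (carrier G) n. \<Phi> (lact G g xs) (lact G g ys) = \<Phi> xs ys"
    if "g \<in> carrier G" for g
    using that
  proof (induction rule: amalgam_induct)
    case (left s)
    then show ?case using adm_inv[OF \<Phi>1] by blast
  next
    case (right s)
    then show ?case using \<Phi>2 by blast
  next
    case (mult x y)
    show ?case
    proof (intro ballI)
      fix xs ys assume xs: "xs \<in> tuples (carrier G) m" and ys: "ys \<in> tuples (carrier G) n"
      have "\<Phi> (lact G x (lact G y xs)) (lact G x (lact G y ys)) = \<Phi> (lact G y xs) (lact G y ys)"
        by (rule mult.IH(1)[rule_format]) (rule G.lact_tuples[OF mult.hyps(2)], fact)+
      also have "\<dots> = \<Phi> xs ys" by (rule mult.IH(2)[rule_format, OF xs ys])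
      finally show "\<Phi> (lact G (x \<otimes>\<^bsub>G\<^esub> y) xs) (lact G (x \<otimes>\<^bsub>G\<^esub> y) ys) = \<Phi> xs ys"
        using mult.hyps tuples_lists[OF xs] tuples_lists[OF ys] by (simp add: G.lact_lact)
    qed
  qed
  show ?thesis
    by (rule admI[OF adm_V[OF \<Phi>1] _ N loc]) (assumption | rule inv[rule_format])+
qed

text \<open>The derivation that vanishes on \<open>G1\<close> and is the inner derivation of \<open>v\<close> on \<open>G2\<close> becomes inner
  on all of \<open>G\<close>, because cochains in \<open>ys\<close> form a coinduced module: \<open>u\<close> is read off by evaluating it
  at the first entry of \<open>ys\<close>.\<close>

lemma split_invariant:
  assumes v: "adm G A (\<lambda>a. j1 (i1 a)) (Suc 0) (Suc n) v"
  obtains v1 v2 where "adm G G1 j1 (Suc 0) (Suc n) v1" "adm G G2 j2 (Suc 0) (Suc n) v2"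
    "\<And>xs ys. v xs ys = v1 xs ys - v2 xs ys"
proof -
  let ?T = "tuples (carrier G)"
  obtain N where N: "N \<in> pfin_normals G p" and loc: "\<And>xs xs' ys. xs \<in> ?T (Suc 0) \<Longrightarrow>
    xs' \<in> ?T (Suc 0) \<Longrightarrow> ys \<in> ?T (Suc n) \<Longrightarrow> cosets G N xs = cosets G N xs' \<Longrightarrow> v xs ys = v xs' ys"
    by (rule adm_loc[OF v]) (rule that)
  note NN = pfinD(1)[OF N]
  \<comment> \<open>The two arguments are packed into one list, as \<open>ex_derivation\<close>
    expects; lists of other lengths get the filler 0.\<close>
  define vv where "vv zs = (if length zs = Suc (Suc n) then v [hd zs] (tl zs) else 0)" for zs
  have vvC: "vv (x # ys) = v [x] ys" if "ys \<in> ?T (Suc n)" for x ys using that by (simp add: vv_def tuples_length)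
  define \<delta>2 where "\<delta>2 s zs = vv (lact G (inv\<^bsub>G\<^esub> j2 s) zs) - vv zs" for s zs
  obtain \<delta> where der: "\<And>g h zs. g \<in> carrier G \<Longrightarrow> h \<in> carrier G \<Longrightarrow> zs \<in> lists (carrier G) \<Longrightarrow>
        \<delta> (g \<otimes>\<^bsub>G\<^esub> h) zs = \<delta> g zs + \<delta> h (lact G (inv\<^bsub>G\<^esub> g) zs)"
    and \<delta>j1: "\<And>s zs. s \<in> carrier G1 \<Longrightarrow> zs \<in> lists (carrier G) \<Longrightarrow> \<delta> (j1 s) zs = 0"
    and \<delta>j2: "\<And>s zs. s \<in> carrier G2 \<Longrightarrow> zs \<in> lists (carrier G) \<Longrightarrow> \<delta> (j2 s) zs = \<delta>2 s zs"
  proof (rule ex_derivation[of "\<lambda>_ _. 0" \<delta>2])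
    fix s t zs assume "s \<in> carrier G2" "t \<in> carrier G2" "zs \<in> lists (carrier G)"
    then show "\<delta>2 (s \<otimes>\<^bsub>G2\<^esub> t) zs = \<delta>2 s zs + \<delta>2 t (lact G (inv\<^bsub>G\<^esub> j2 s) zs)"
      by (simp add: \<delta>2_def G.lact_lact G.inv_mult_group)
  next
    fix a zs assume a: "a \<in> carrier A" and zs: "zs \<in> lists (carrier G)"
    show "0 = \<delta>2 (i2 a) zs"
    proof (cases "length zs = Suc (Suc n)")
      case True
      then obtain x ys where z: "zs = x # ys" "x \<in> carrier G" "ys \<in> ?T (Suc n)"
        using zs by (cases zs) (auto simp: tuples_eq)
      \<comment> \<open>On \<open>A\<close> the inner derivation of \<open>v\<close> vanishes
        because \<open>v\<close> is \<open>A\<close>-invariant; this is its agreement with the zero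
        derivation of \<open>G1\<close>.\<close>
      have ia: "inv\<^bsub>G\<^esub> j2 (i2 a) = j1 (i1 (inv\<^bsub>A\<^esub> a))"
        using a j_agree[OF a] i_closed[OF a] group_hom.hom_inv[OF i1_hom a] by simp
      have "vv (lact G (j1 (i1 (inv\<^bsub>A\<^esub> a))) zs) = vv zs"
        using adm_inv[OF v, of "[x]" ys "inv\<^bsub>A\<^esub> a"] a z
          G.lact_tuples[OF _ z(3), of "j1 (i1 (inv\<^bsub>A\<^esub> a))"] i_closed(1)[of "inv\<^bsub>A\<^esub> a"]
        by (simp add: vvC)
      then show ?thesis by (simp add: \<delta>2_def ia)
    qed (simp add: \<delta>2_def vv_def)
  qed (simp, rule that)
  have zsT: "x # ys \<in> lists (carrier G)" if "x \<in> carrier G" "ys \<in> ?T (Suc n)" for x ys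
    using that tuples_lists by auto
  have vV: "v [x] ys \<in> V" if "x \<in> carrier G" "ys \<in> ?T (Suc n)" for x ys
    using that by (intro adm_V[OF v]) auto
  have vloc: "v [x] ys = v [x'] ys"
    if "x \<in> carrier G" "x' \<in> carrier G" "ys \<in> ?T (Suc n)" "N #>\<^bsub>G\<^esub> x = N #>\<^bsub>G\<^esub> x'" for x x' ys
    using that by (intro loc) auto
  have cong: "N #>\<^bsub>G\<^esub> (g \<otimes>\<^bsub>G\<^esub> x) = N #>\<^bsub>G\<^esub> (g \<otimes>\<^bsub>G\<^esub> y)"
    if "g \<in> carrier G" "x \<in> carrier G" "y \<in> carrier G" "N #>\<^bsub>G\<^esub> x = N #>\<^bsub>G\<^esub> y" for g x y
    using that G.coset_mult_left_cancel[OF NN] by blast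
  have \<delta>V: "\<forall>x\<in>carrier G. \<forall>ys\<in>?T (Suc n). \<delta> g (x # ys) \<in> V" if "g \<in> carrier G" for g
    using that
  proof (induction rule: amalgam_induct)
    case (left s)
    then show ?case using \<delta>j1 zsT by simp
  next
    case (right s)
    show ?case
    proof (intro ballI)
      fix x ys assume x: "x \<in> carrier G" and ys: "ys \<in> ?T (Suc n)"
      have i: "inv\<^bsub>G\<^esub> j2 s \<in> carrier G" using right by simp
      show "\<delta> (j2 s) (x # ys) \<in> V"
        unfolding \<delta>j2[OF right zsT[OF x ys]] \<delta>2_def
        using vV[OF _ G.lact_tuples[OF i ys], of "inv\<^bsub>G\<^esub> j2 s \<otimes>\<^bsub>G\<^esub> x"] vV[OF x ys] i x
        by (simp add: vvC[OF ys] vvC[OF G.lact_tuples[OF i ys]])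
    qed
  next
    case (mult g h)
    show ?case
    proof (intro ballI)
      fix x ys assume x: "x \<in> carrier G" and ys: "ys \<in> ?T (Suc n)"
      have i: "inv\<^bsub>G\<^esub> g \<in> carrier G" using mult by simp
      have "\<delta> h (inv\<^bsub>G\<^esub> g \<otimes>\<^bsub>G\<^esub> x # lact G (inv\<^bsub>G\<^esub> g) ys) \<in> V"
        using mult.IH(2) G.lact_tuples[OF i ys] i x by blast
      moreover have "\<delta> g (x # ys) \<in> V" using mult.IH(1) x ys by blast
      ultimately show "\<delta> (g \<otimes>\<^bsub>G\<^esub> h) (x # ys) \<in> V" using der[OF mult.hyps zsT[OF x ys]] by simp
    qed
  qed
  have \<delta>K: "\<forall>x\<in>carrier G. \<forall>x'\<in>carrier G. \<forall>ys\<in>?T (Suc n). N #>\<^bsub>G\<^esub> x = N #>\<^bsub>G\<^esub> x' \<longrightarrow> \<delta> g (x # ys) = \<delta> g (x' # ys)"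
    if "g \<in> carrier G" for g
    using that
  proof (induction rule: amalgam_induct)
    case (left s)
    show ?case
    proof (intro ballI impI)
      fix x x' ys assume *: "x \<in> carrier G" "x' \<in> carrier G" "ys \<in> ?T (Suc n)"
      show "\<delta> (j1 s) (x # ys) = \<delta> (j1 s) (x' # ys)"
        unfolding \<delta>j1[OF left zsT[OF *(1,3)]] \<delta>j1[OF left zsT[OF *(2,3)]] ..
    qed
  next
    case (right s)
    show ?case
    proof (intro ballI impI)
      fix x x' ys assume *: "x \<in> carrier G" "x' \<in> carrier G" "ys \<in> ?T (Suc n)" and eq: "N #>\<^bsub>G\<^esub> x = N #>\<^bsub>G\<^esub> x'"
      have i: "inv\<^bsub>G\<^esub> j2 s \<in> carrier G" using right by simp
      have 1: "v [inv\<^bsub>G\<^esub> j2 s \<otimes>\<^bsub>G\<^esub> x] (lact G (inv\<^bsub>G\<^esub> j2 s) ys) = v [inv\<^bsub>G\<^esub> j2 s \<otimes>\<^bsub>G\<^esub> x'] (lact G (inv\<^bsub>G\<^esub> j2 s) ys)"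
        by (rule vloc) (use i * cong[OF i *(1,2) eq] G.lact_tuples[OF i *(3)] in auto)
      show "\<delta> (j2 s) (x # ys) = \<delta> (j2 s) (x' # ys)"
        unfolding \<delta>j2[OF right zsT[OF *(1,3)]] \<delta>j2[OF right zsT[OF *(2,3)]] \<delta>2_def
        using 1 vloc[OF * eq] by (simp add: vvC[OF *(3)] vvC[OF G.lact_tuples[OF i *(3)]])
    qed
  next
    case (mult g h)
    show ?case
    proof (intro ballI impI)
      fix x x' ys assume *: "x \<in> carrier G" "x' \<in> carrier G" "ys \<in> ?T (Suc n)" and eq: "N #>\<^bsub>G\<^esub> x = N #>\<^bsub>G\<^esub> x'"
      have i: "inv\<^bsub>G\<^esub> g \<in> carrier G" using mult by simp
      have "\<delta> h (inv\<^bsub>G\<^esub> g \<otimes>\<^bsub>G\<^esub> x # lact G (inv\<^bsub>G\<^esub> g) ys) = \<delta> h (inv\<^bsub>G\<^esub> g \<otimes>\<^bsub>G\<^esub> x' # lact G (inv\<^bsub>G\<^esub> g) ys)"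
        by (rule mult.IH(2)[rule_format]) (use i * cong[OF i *(1,2) eq] G.lact_tuples[OF i *(3)] in auto)
      moreover have "\<delta> g (x # ys) = \<delta> g (x' # ys)" by (rule mult.IH(1)[rule_format, OF * eq])
      ultimately show "\<delta> (g \<otimes>\<^bsub>G\<^esub> h) (x # ys) = \<delta> (g \<otimes>\<^bsub>G\<^esub> h) (x' # ys)"
        using der[OF mult.hyps zsT[OF *(1,3)]] der[OF mult.hyps zsT[OF *(2,3)]] by simp
    qed
  qed
  define u where "u xs ys = \<delta> (hd ys) (hd xs # ys)" for xs ys
  have uV: "u xs ys \<in> V" if xs: "xs \<in> ?T (Suc 0)" and ys: "ys \<in> ?T (Suc n)" for xs ys
  proof -
    have "hd xs \<in> carrier G" "hd ys \<in> carrier G" using xs ys by (auto elim: tuples_SucE)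
    then show ?thesis using \<delta>V ys unfolding u_def by blast
  qed
  have uloc: "u xs ys = u xs' ys"
    if xs: "xs \<in> ?T (Suc 0)" "xs' \<in> ?T (Suc 0)" and ys: "ys \<in> ?T (Suc n)" and c: "cosets G N xs = cosets G N xs'" for xs xs' ys
  proof -
    have "hd xs \<in> carrier G" "hd xs' \<in> carrier G" "hd ys \<in> carrier G" "N #>\<^bsub>G\<^esub> hd xs = N #>\<^bsub>G\<^esub> hd xs'"
      using xs ys c by (auto elim!: tuples_SucE)
    then show ?thesis using \<delta>K[rule_format] ys unfolding u_def by blast
  qed
  \<comment> \<open>The derivation rule at the product of \<open>g\<close> with the inverse
    translate of the head of \<open>ys\<close>; it exhibits \<delta> as the inner derivation of
    \<open>- u\<close>.\<close>
  have udiff: "u xs ys - u (lact G (inv\<^bsub>G\<^esub> g) xs) (lact G (inv\<^bsub>G\<^esub> g) ys) = \<delta> g (hd xs # ys)"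
    if xs: "xs \<in> ?T (Suc 0)" and ys: "ys \<in> ?T (Suc n)" and g: "g \<in> carrier G" for xs ys g
  proof -
    obtain x where x: "xs = [x]" "x \<in> carrier G" using xs by (auto elim: tuples_SucE)
    obtain y ys0 where y: "ys = y # ys0" "y \<in> carrier G" using ys by (auto elim: tuples_SucE)
    have "\<delta> (g \<otimes>\<^bsub>G\<^esub> (inv\<^bsub>G\<^esub> g \<otimes>\<^bsub>G\<^esub> y)) (x # ys)
        = \<delta> g (x # ys) + \<delta> (inv\<^bsub>G\<^esub> g \<otimes>\<^bsub>G\<^esub> y) (lact G (inv\<^bsub>G\<^esub> g) (x # ys))"
      using g y zsT[OF x(2) ys] by (intro der) auto
    moreover have "g \<otimes>\<^bsub>G\<^esub> (inv\<^bsub>G\<^esub> g \<otimes>\<^bsub>G\<^esub> y) = y" using g y by (simp add: G.m_assoc[symmetric])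
    ultimately show ?thesis by (simp add: u_def x y)
  qed
  have u1: "u (lact G (j1 s) xs) (lact G (j1 s) ys) = u xs ys"
    if xs: "xs \<in> ?T (Suc 0)" and ys: "ys \<in> ?T (Suc n)" and s: "s \<in> carrier G1" for xs ys s
  proof -
    have hd: "hd xs \<in> carrier G" using xs by (auto elim: tuples_SucE)
    have "\<delta> (j1 (inv\<^bsub>G1\<^esub> s)) (hd xs # ys) = 0" using s zsT[OF hd ys] by (intro \<delta>j1) auto
    then show ?thesis using udiff[OF xs ys, of "j1 (inv\<^bsub>G1\<^esub> s)"] s by simp
  qed
  have u2: "v (lact G (j2 s) xs) (lact G (j2 s) ys) + u (lact G (j2 s) xs) (lact G (j2 s) ys) = v xs ys + u xs ys"
    if xs: "xs \<in> ?T (Suc 0)" and ys: "ys \<in> ?T (Suc n)" and s: "s \<in> carrier G2" for xs ys s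
  proof -
    obtain x where x: "xs = [x]" "x \<in> carrier G" using xs by (auto elim: tuples_SucE)
    have jc: "j2 s \<in> carrier G" using s by simp
    have "\<delta> (j2 (inv\<^bsub>G2\<^esub> s)) (x # ys) = \<delta>2 (inv\<^bsub>G2\<^esub> s) (x # ys)" using s zsT[OF x(2) ys] by (intro \<delta>j2) auto
    also have "\<dots> = v (lact G (j2 s) xs) (lact G (j2 s) ys) - v xs ys"
      using s x by (simp add: \<delta>2_def vvC[OF ys] vvC[OF G.lact_tuples[OF jc ys]])
    finally show ?thesis using udiff[OF xs ys, of "j2 (inv\<^bsub>G2\<^esub> s)"] s x by (simp add: algebra_simps)
  qed
  have vV': "v xs ys \<in> V" if "xs \<in> ?T (Suc 0)" "ys \<in> ?T (Suc n)" for xs ys by (rule adm_V[OF v that])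
  have a1: "adm G G1 j1 (Suc 0) (Suc n) (\<lambda>xs ys. - u xs ys)"
  proof (rule admI[OF _ _ N])
    fix xs ys s assume "xs \<in> ?T (Suc 0)" "ys \<in> ?T (Suc n)" "s \<in> carrier G1"
    then show "- u (lact G (j1 s) xs) (lact G (j1 s) ys) = - u xs ys" using u1 by presburger
  next
    fix xs xs' ys assume *: "xs \<in> ?T (Suc 0)" "xs' \<in> ?T (Suc 0)" "ys \<in> ?T (Suc n)" "cosets G N xs = cosets G N xs'"
    show "- u xs ys = - u xs' ys" using uloc[OF *] by simp
  next
    fix xs ys assume *: "xs \<in> ?T (Suc 0)" "ys \<in> ?T (Suc n)"
    show "- u xs ys \<in> V" using uV[OF *] by simp
  qed
  have a2: "adm G G2 j2 (Suc 0) (Suc n) (\<lambda>xs ys. - (v xs ys + u xs ys))"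
  proof (rule admI[OF _ _ N])
    fix xs ys s assume "xs \<in> ?T (Suc 0)" "ys \<in> ?T (Suc n)" "s \<in> carrier G2"
    then show "- (v (lact G (j2 s) xs) (lact G (j2 s) ys) + u (lact G (j2 s) xs) (lact G (j2 s) ys)) = - (v xs ys + u xs ys)"
      using u2 by presburger
  next
    fix xs xs' ys assume *: "xs \<in> ?T (Suc 0)" "xs' \<in> ?T (Suc 0)" "ys \<in> ?T (Suc n)" "cosets G N xs = cosets G N xs'"
    show "- (v xs ys + u xs ys) = - (v xs' ys + u xs' ys)" using uloc[OF *] loc[OF *] by simp
  next
    fix xs ys assume *: "xs \<in> ?T (Suc 0)" "ys \<in> ?T (Suc n)"
    show "- (v xs ys + u xs ys) \<in> V" using uV[OF *] vV'[OF *] by simp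
  qed
  show thesis by (rule that[OF a1 a2]) simp
qed

text \<open>The restrictions of a cocycle to the factors have primitives \<open>H1\<close> and
  \<open>H2\<close>. On \<open>A\<close> these differ by a cocycle one degree lower, with primitive
  \<open>v\<close>. Splitting \<open>v\<close> into a \<open>G1\<close>-invariant and a
  \<open>G2\<close>-invariant part corrects \<open>H1\<close> and \<open>H2\<close> to one and the
  same cochain, which is invariant under both factors and hence under the amalgam.\<close>

lemma locally_acyclic_amalgam:
  assumes inj: "inj_on j1 (carrier G1)" "inj_on j2 (carrier G2)" "inj_on i1 (carrier A)"
    and top1: "\<And>N. N \<in> pfin_normals G1 p \<Longrightarrow> \<exists>K\<in>pfin_normals G p. \<forall>s\<in>carrier G1. j1 s \<in> K \<longrightarrow> s \<in> N"
    and top2: "\<And>N. N \<in> pfin_normals G2 p \<Longrightarrow> \<exists>K\<in>pfin_normals G p. \<forall>s\<in>carrier G2. j2 s \<in> K \<longrightarrow> s \<in> N"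
    and topA: "\<And>N. N \<in> pfin_normals A p \<Longrightarrow> \<exists>K\<in>pfin_normals G p. \<forall>s\<in>carrier A. j1 (i1 s) \<in> K \<longrightarrow> s \<in> N"
    and Ex: "locally_acyclic G1 (Suc (Suc n))" "locally_acyclic G2 (Suc (Suc n))" "locally_acyclic A (Suc n)"
  shows "locally_acyclic G (Suc (Suc n))"
  unfolding locally_acyclic_def
proof (intro allI impI, elim conjE)
  let ?T = "tuples (carrier G)"
  let ?n = "Suc (Suc n)"
  fix f assume f: "uadm G (Suc ?n) f" and cl: "\<forall>ys\<in>?T (Suc (Suc ?n)). bd f ys = 0"
  define F where "F xs ys = f (lact G (inv\<^bsub>G\<^esub> hd xs) ys)" for xs ys
  have F: "gadm G (Suc 0) (Suc ?n) F" unfolding F_def by (rule gadm_of_uadm[OF G.is_group f])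
  have F1: "adm G G1 j1 (Suc 0) (Suc ?n) F" by (rule adm_restrict[OF F j1.hom_closed])
  have F2: "adm G G2 j2 (Suc 0) (Suc ?n) F" by (rule adm_restrict[OF F j2.hom_closed])
  have closedF: "bd (F xs) ys = 0" if xs: "xs \<in> ?T (Suc 0)" and ys: "ys \<in> ?T (Suc (Suc ?n))" for xs ys
  proof -
    have x: "inv\<^bsub>G\<^esub> hd xs \<in> carrier G" using xs by (auto elim: tuples_SucE)
    then show ?thesis using cl[rule_format, OF G.lact_tuples[OF x ys]] by (simp add: F_def[abs_def] lact_def bd_map)
  qed
  have "\<exists>H. adm G G1 j1 (Suc 0) ?n H \<and> (\<forall>xs\<in>?T (Suc 0). \<forall>ys\<in>?T (Suc ?n). F xs ys = bd (H xs) ys)"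
    by (rule shapiro_locally_acyclic[OF G1.is_group G.is_group j1_hom inj(1) top1 F1 closedF Ex(1)])
  then obtain H1 where H1: "adm G G1 j1 (Suc 0) ?n H1"
    and FH1: "\<And>xs ys. xs \<in> ?T (Suc 0) \<Longrightarrow> ys \<in> ?T (Suc ?n) \<Longrightarrow> F xs ys = bd (H1 xs) ys" by blast
  have "\<exists>H. adm G G2 j2 (Suc 0) ?n H \<and> (\<forall>xs\<in>?T (Suc 0). \<forall>ys\<in>?T (Suc ?n). F xs ys = bd (H xs) ys)"
    by (rule shapiro_locally_acyclic[OF G2.is_group G.is_group j2_hom inj(2) top2 F2 closedF Ex(2)])
  then obtain H2 where H2: "adm G G2 j2 (Suc 0) ?n H2"
    and FH2: "\<And>xs ys. xs \<in> ?T (Suc 0) \<Longrightarrow> ys \<in> ?T (Suc ?n) \<Longrightarrow> F xs ys = bd (H2 xs) ys" by blast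
  let ?j = "\<lambda>a. j1 (i1 a)"
  have A1: "adm G A ?j (Suc 0) ?n H1"
  proof -
    obtain N where N: "N \<in> pfin_normals G p" and loc: "\<And>xs xs' ys. xs \<in> ?T (Suc 0) \<Longrightarrow>
      xs' \<in> ?T (Suc 0) \<Longrightarrow> ys \<in> ?T ?n \<Longrightarrow> cosets G N xs = cosets G N xs' \<Longrightarrow> H1 xs ys = H1 xs' ys"
      by (rule adm_loc[OF H1]) (rule that)
    show ?thesis
      by (rule admI[OF adm_V[OF H1] _ N loc]) (assumption | rule adm_inv[OF H1] i_closed(1))+
  qed
  have A2: "adm G A ?j (Suc 0) ?n H2"
  proof -
    obtain N where N: "N \<in> pfin_normals G p" and loc: "\<And>xs xs' ys. xs \<in> ?T (Suc 0) \<Longrightarrow>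
      xs' \<in> ?T (Suc 0) \<Longrightarrow> ys \<in> ?T ?n \<Longrightarrow> cosets G N xs = cosets G N xs' \<Longrightarrow> H2 xs ys = H2 xs' ys"
      by (rule adm_loc[OF H2]) (rule that)
    have inv: "H2 (lact G (j1 (i1 a)) xs) (lact G (j1 (i1 a)) ys) = H2 xs ys"
      if "xs \<in> ?T (Suc 0)" "ys \<in> ?T ?n" "a \<in> carrier A" for xs ys a
      unfolding j_agree[OF that(3)] by (rule adm_inv[OF H2 that(1,2) i_closed(2)[OF that(3)]])
    show ?thesis by (rule admI[OF adm_V[OF H2] _ N loc]) (assumption | rule inv)+
  qed
  have D: "adm G A ?j (Suc 0) ?n (\<lambda>xs ys. H1 xs ys - H2 xs ys)" by (rule adm_diff[OF G.is_group A1 A2])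
  have injA: "inj_on ?j (carrier A)"
    by (intro inj_onI) (metis inj_onD[OF inj(1)] inj_onD[OF inj(3)] i_closed(1))
  have Dcl: "bd (\<lambda>ys. H1 xs ys - H2 xs ys) ys = 0" if "xs \<in> ?T (Suc 0)" "ys \<in> ?T (Suc ?n)" for xs ys
    using FH1[OF that] FH2[OF that] by (simp add: bd_diff)
  have "\<exists>H. adm G A ?j (Suc 0) (Suc n) H \<and>
      (\<forall>xs\<in>?T (Suc 0). \<forall>ys\<in>?T ?n. H1 xs ys - H2 xs ys = bd (H xs) ys)"
    by (rule shapiro_locally_acyclic[OF A.is_group G.is_group j1i1_hom injA topA D Dcl Ex(3)])
  then obtain v where v: "adm G A ?j (Suc 0) (Suc n) v"
    and Dv: "\<And>xs ys. xs \<in> ?T (Suc 0) \<Longrightarrow> ys \<in> ?T ?n \<Longrightarrow> H1 xs ys - H2 xs ys = bd (v xs) ys" by blast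
  obtain v1 v2 where v1: "adm G G1 j1 (Suc 0) (Suc n) v1" and v2: "adm G G2 j2 (Suc 0) (Suc n) v2"
    and vv: "\<And>xs ys. v xs ys = v1 xs ys - v2 xs ys" by (rule split_invariant[OF v]) (rule that)
  define H where "H xs ys = H1 xs ys - bd (v1 xs) ys" for xs ys
  have Ha: "adm G G1 j1 (Suc 0) ?n H" unfolding H_def by (rule adm_diff[OF G.is_group H1 adm_bd_right[OF G.is_group v1]])
  have Hb: "adm G G2 j2 (Suc 0) ?n (\<lambda>xs ys. H2 xs ys - bd (v2 xs) ys)"
    by (rule adm_diff[OF G.is_group H2 adm_bd_right[OF G.is_group v2]])
  have H12: "H xs ys = H2 xs ys - bd (v2 xs) ys" if "xs \<in> ?T (Suc 0)" "ys \<in> ?T ?n" for xs ys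
  proof -
    have "bd (v xs) ys = bd (v1 xs) ys - bd (v2 xs) ys" by (simp add: vv[abs_def] bd_diff)
    then show ?thesis using Dv[OF that] by (simp add: H_def algebra_simps)
  qed
  have HG: "gadm G (Suc 0) ?n H"
  proof (rule invariant_if_both[OF Ha])
    fix xs ys s assume *: "xs \<in> ?T (Suc 0)" "ys \<in> ?T ?n" "s \<in> carrier G2"
    have jc: "j2 s \<in> carrier G" using * by simp
    show "H (lact G (j2 s) xs) (lact G (j2 s) ys) = H xs ys"
      using adm_inv[OF Hb *] H12[OF *(1,2)] H12[OF G.lact_tuples[OF jc *(1)] G.lact_tuples[OF jc *(2)]] by simp
  qed
  have "f ys = bd (H [\<one>\<^bsub>G\<^esub>]) ys" if ys: "ys \<in> ?T (Suc ?n)" for ys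
  proof -
    have one: "[\<one>\<^bsub>G\<^esub>] \<in> ?T (Suc 0)" by simp
    have "f ys = F [\<one>\<^bsub>G\<^esub>] ys" using tuples_lists[OF ys] by (simp add: F_def)
    also have "\<dots> = bd (H1 [\<one>\<^bsub>G\<^esub>]) ys" by (rule FH1[OF one ys])
    also have "\<dots> = bd (H [\<one>\<^bsub>G\<^esub>]) ys" by (simp add: H_def[abs_def] bd_diff)
    finally show ?thesis .
  qed
  then show "\<exists>h. uadm G ?n h \<and> (\<forall>ys\<in>?T (Suc ?n). f ys = bd h ys)"
    using uadm_of_gadm[OF G.is_group HG] by blast
qed

end

subsection \<open>Inhomogeneous and homogeneous cochains\<close>

text \<open>The inhomogeneous differential without its first face, in recursive form; a single entry
  leaves only the last face.\<close>

fun inner_bd :: "('g, 'm) monoid_scheme \<Rightarrow> ('g list \<Rightarrow> int) \<Rightarrow> 'g list \<Rightarrow> int" where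
  "inner_bd G f [] = 0"
| "inner_bd G f [y] = - f []"
| "inner_bd G f (y # z # ys) = - f ((y \<otimes>\<^bsub>G\<^esub> z) # ys) - inner_bd G (\<lambda>zs. f (y # zs)) (z # ys)"

lemma cobound_eq_inner_bd:
  assumes "length xs = Suc n"
  shows "cobound G n f xs = f (tl xs) + inner_bd G f xs"
  using assms
proof (induction n arbitrary: xs f)
  case 0
  then obtain y where "xs = [y]" by (auto simp: length_Suc_conv)
  then show ?case by (simp add: cobound_def)
next
  case (Suc n)
  then obtain y z ys where xs: "xs = y # z # ys" and len: "length ys = n"
    by (auto simp: length_Suc_conv)
  let ?t = "\<lambda>i. take (i - 1) (z # ys) @ [(z # ys) ! (i - 1) \<otimes>\<^bsub>G\<^esub> (z # ys) ! i] @ drop (i + 1) (z # ys)"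
  let ?s = "\<lambda>i. take (i - 1) xs @ [xs ! (i - 1) \<otimes>\<^bsub>G\<^esub> xs ! i] @ drop (i + 1) xs"
  have "(\<Sum>i\<in>{1..Suc n}. (-1) ^ i * f (?s i))
      = - f ((y \<otimes>\<^bsub>G\<^esub> z) # ys) + (\<Sum>i\<in>{Suc 1..Suc n}. (-1) ^ i * f (?s i))"
    by (subst sum.atLeast_Suc_atMost) (simp_all add: xs)
  also have "(\<Sum>i\<in>{Suc 1..Suc n}. (-1) ^ i * f (?s i)) = (\<Sum>i\<in>{1..n}. (-1) ^ Suc i * f (?s (Suc i)))"
    by (rule sum.atLeast_Suc_atMost_Suc_shift[of _ 1 n, unfolded comp_def])
  also have "\<dots> = (\<Sum>i\<in>{1..n}. - ((-1) ^ i * f (y # ?t i)))"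
  proof (rule sum.cong[OF HOL.refl])
    fix i assume "i \<in> {1..n}"
    then have "?s (Suc i) = y # ?t i" by (cases i) (auto simp: xs)
    then show "(-1) ^ Suc i * f (?s (Suc i)) = - ((-1) ^ i * f (y # ?t i))" by simp
  qed
  also have "\<dots> = - (\<Sum>i\<in>{1..n}. (-1) ^ i * f (y # ?t i))" by (rule sum_negf)
  finally have sum: "(\<Sum>i\<in>{1..Suc n}. (-1) ^ i * f (?s i))
      = - f ((y \<otimes>\<^bsub>G\<^esub> z) # ys) - (\<Sum>i\<in>{1..n}. (-1) ^ i * f (y # ?t i))" by simp
  have "cobound G n (\<lambda>zs. f (y # zs)) (z # ys) = f (y # ys) + inner_bd G (\<lambda>zs. f (y # zs)) (z # ys)"
    using Suc.IH[of "z # ys" "\<lambda>zs. f (y # zs)"] len by simp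
  then have "(\<Sum>i\<in>{1..n}. (-1) ^ i * f (y # ?t i)) + (-1) ^ (n + 1) * f (y # take n (z # ys))
      = inner_bd G (\<lambda>zs. f (y # zs)) (z # ys)"
    unfolding cobound_def by simp
  moreover have "cobound G (Suc n) f xs = f (tl xs) + (\<Sum>i\<in>{1..Suc n}. (-1) ^ i * f (?s i))
      + (-1) ^ (Suc n + 1) * f (take (Suc n) xs)" unfolding cobound_def ..
  ultimately show ?case using sum by (simp add: xs)
qed

lemma inner_bd_rel:
  assumes "list_all2 Q xs ys" "length xs = Suc n"
    and mult: "\<And>x y x' y'. Q x y \<Longrightarrow> Q x' y' \<Longrightarrow> Q (x \<otimes>\<^bsub>H\<^esub> x') (y \<otimes>\<^bsub>G\<^esub> y')"
    and f: "\<And>zs ws. list_all2 Q zs ws \<Longrightarrow> length zs = n \<Longrightarrow> f zs = f' ws"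
  shows "inner_bd H f xs = inner_bd G f' ys"
  using assms(1,2) f
proof (induction n arbitrary: xs ys f f')
  case 0
  then obtain x where x: "xs = [x]" by (auto simp: length_Suc_conv)
  then obtain y where "ys = [y]" using 0 by (auto simp: list_all2_Cons1)
  then show ?case using x 0 by simp
next
  case (Suc n)
  then obtain x x' xs' where x: "xs = x # x' # xs'" "length xs' = n" by (auto simp: length_Suc_conv)
  then obtain y y' ys' where y: "ys = y # y' # ys'" "Q x y" "Q x' y'" "list_all2 Q xs' ys'"
    using Suc.prems(1) by (auto simp: list_all2_Cons1)
  have "inner_bd H (\<lambda>zs. f (x # zs)) (x' # xs') = inner_bd G (\<lambda>zs. f' (y # zs)) (y' # ys')"
    by (rule Suc.IH) (use x y Suc.prems(3) in auto)
  moreover have "f ((x \<otimes>\<^bsub>H\<^esub> x') # xs') = f' ((y \<otimes>\<^bsub>G\<^esub> y') # ys')"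
    by (rule Suc.prems(3)) (use x y mult in auto)
  ultimately show ?case using x y by simp
qed

text \<open>\<open>Q\<close> is a relation and not a map, because it is to link an element of the
  completion with every group element that lies in its coset at a fixed level.\<close>

lemma cobound_rel:
  assumes "list_all2 Q xs ys" "length xs = Suc n"
    and "\<And>x y x' y'. Q x y \<Longrightarrow> Q x' y' \<Longrightarrow> Q (x \<otimes>\<^bsub>H\<^esub> x') (y \<otimes>\<^bsub>G\<^esub> y')"
    and f: "\<And>zs ws. list_all2 Q zs ws \<Longrightarrow> length zs = n \<Longrightarrow> f zs = f' ws"
  shows "cobound H n f xs = cobound G n f' ys"
proof -
  have "inner_bd H f xs = inner_bd G f' ys" by (rule inner_bd_rel[OF assms])
  moreover have "f (tl xs) = f' (tl ys)" using assms(1,2) by (intro f) (auto simp: list_all2_Cons1 length_Suc_conv)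
  ultimately show ?thesis
    using assms(2) list_all2_lengthD[OF assms(1)] by (simp add: cobound_eq_inner_bd)
qed

section \<open>Homogeneous and inhomogeneous tuples\<close>

text \<open>The standard passage from (x_0, ..., x_n) to (x_0^-1 x_1, ..., x_(n-1)^-1 x_n), with the
  base point kept as a separate argument; \<open>pprods\<close> goes back.\<close>

fun diffs :: "('g, 'm) monoid_scheme \<Rightarrow> 'g \<Rightarrow> 'g list \<Rightarrow> 'g list" where
  "diffs G x [] = []"
| "diffs G x (h # hs) = (inv\<^bsub>G\<^esub> x \<otimes>\<^bsub>G\<^esub> h) # diffs G h hs"

fun pprods :: "('g, 'm) monoid_scheme \<Rightarrow> 'g \<Rightarrow> 'g list \<Rightarrow> 'g list" where
  "pprods G g [] = []"
| "pprods G g (y # ys) = (g \<otimes>\<^bsub>G\<^esub> y) # pprods G (g \<otimes>\<^bsub>G\<^esub> y) ys"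

context group begin

lemma diffs_in_tuples: "x \<in> carrier G \<Longrightarrow> xs \<in> tuples (carrier G) n \<Longrightarrow> diffs G x xs \<in> tuples (carrier G) n"
  by (induction n arbitrary: x xs) (auto elim!: tuples_SucE)

lemma pprods_in_tuples: "x \<in> carrier G \<Longrightarrow> xs \<in> tuples (carrier G) n \<Longrightarrow> pprods G x xs \<in> tuples (carrier G) n"
  by (induction n arbitrary: x xs) (auto elim!: tuples_SucE)

lemma diffs_pprods: "x \<in> carrier G \<Longrightarrow> xs \<in> lists (carrier G) \<Longrightarrow> diffs G x (pprods G x xs) = xs"
  by (induction xs arbitrary: x) (auto simp: inv_solve_left')

lemma pprods_diffs:
  "g \<in> carrier G \<Longrightarrow> x \<in> carrier G \<Longrightarrow> xs \<in> lists (carrier G) \<Longrightarrow>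
    pprods G g (diffs G x xs) = lact G (g \<otimes> inv x) xs"
proof (induction xs arbitrary: g x)
  case (Cons h hs)
  have "g \<otimes> (inv x \<otimes> h) \<otimes> inv h = g \<otimes> inv x" using Cons.prems by (simp add: m_assoc)
  then show ?case using Cons by (simp add: m_assoc)
qed simp

lemma diffs_lact:
  "g \<in> carrier G \<Longrightarrow> x \<in> carrier G \<Longrightarrow> xs \<in> lists (carrier G) \<Longrightarrow>
    diffs G (g \<otimes> x) (lact G g xs) = diffs G x xs"
  by (induction xs arbitrary: x) (auto simp: inv_mult_group m_assoc inv_solve_left')

lemma cosets_diffs:
  assumes "N \<lhd> G" "x \<in> carrier G" "x' \<in> carrier G" "N #> x = N #> x'"
    "xs \<in> lists (carrier G)" "xs' \<in> lists (carrier G)" "cosets G N xs = cosets G N xs'"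
  shows "cosets G N (diffs G x xs) = cosets G N (diffs G x' xs')"
proof -
  have "list_all2 (\<lambda>x y. x \<in> carrier G \<and> y \<in> carrier G \<and> N #> x = N #> y) xs xs'"
    by (rule iffD1[OF cosets_eq_iff[OF assms(5,6)] assms(7)])
  then show ?thesis using assms(2-4)
  proof (induction arbitrary: x x' rule: list_all2_induct)
    case (Cons y ys y' ys')
    interpret normal N G by fact
    have "N #> inv x = N #> inv x'" using Cons.prems by (metis rcos_inv)
    then show ?case using Cons coset_mult_cong[OF assms(1)] by simp
  qed simp
qed

lemma cosets_pprods:
  assumes "N \<lhd> G" "x \<in> carrier G"
    "xs \<in> lists (carrier G)" "xs' \<in> lists (carrier G)" "cosets G N xs = cosets G N xs'"
  shows "cosets G N (pprods G x xs) = cosets G N (pprods G x xs')"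
proof -
  have "list_all2 (\<lambda>x y. x \<in> carrier G \<and> y \<in> carrier G \<and> N #> x = N #> y) xs xs'"
    by (rule iffD1[OF cosets_eq_iff[OF assms(3,4)] assms(5)])
  then have "cosets G N (pprods G x xs) = cosets G N (pprods G x' xs')"
    if "x' \<in> carrier G" "N #> x = N #> x'" for x'
    using that assms(2)
  proof (induction arbitrary: x x' rule: list_all2_induct)
    case (Cons y ys y' ys')
    have "N #> (x \<otimes> y) = N #> (x' \<otimes> y')" using Cons coset_mult_cong[OF assms(1)] by simp
    then show ?case using Cons by simp
  qed simp
  then show ?thesis using assms(2) by simp
qed

end

context zmod_coeff begin

text \<open>Degree \<open>n\<close> becomes \<open>n + 1\<close> entries, and integer values are
  reduced through \<open>e\<close>; 0 on the empty list is a filler.\<close>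

fun homog :: "('g, 'm) monoid_scheme \<Rightarrow> ('g list \<Rightarrow> int) \<Rightarrow> 'g list \<Rightarrow> 'k" where
  "homog G f [] = 0"
| "homog G f (x # xs) = e (f (diffs G x xs))"

lemma homog_V: "homog G f xs \<in> V"
  by (cases xs) auto

lemma bd_diffs:
  assumes "group G" "x \<in> carrier G" "h \<in> carrier G" "hs \<in> lists (carrier G)"
  shows "bd (\<lambda>zs. e (f (diffs G x zs))) (h # hs) = - e (inner_bd G f (diffs G x (h # hs)))"
proof -
  interpret group G by fact
  show ?thesis using assms(2-)
  proof (induction hs arbitrary: x h f)
    case (Cons k hs)
    have "h \<otimes>\<^bsub>G\<^esub> (inv\<^bsub>G\<^esub> h \<otimes>\<^bsub>G\<^esub> k) = k" using Cons.prems by (simp flip: m_assoc)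
    then have "inv\<^bsub>G\<^esub> x \<otimes>\<^bsub>G\<^esub> h \<otimes>\<^bsub>G\<^esub> (inv\<^bsub>G\<^esub> h \<otimes>\<^bsub>G\<^esub> k) = inv\<^bsub>G\<^esub> x \<otimes>\<^bsub>G\<^esub> k"
      using Cons.prems by (simp add: m_assoc)
    moreover have "bd (\<lambda>zs. e (f ((inv\<^bsub>G\<^esub> x \<otimes>\<^bsub>G\<^esub> h) # diffs G h zs))) (k # hs)
      = - e (inner_bd G (\<lambda>zs. f ((inv\<^bsub>G\<^esub> x \<otimes>\<^bsub>G\<^esub> h) # zs)) (diffs G h (k # hs)))"
      using Cons.prems by (intro Cons.IH) auto
    ultimately show ?case by (simp add: e_diff e_minus)
  qed (simp add: e_minus)
qed

lemma bd_homog: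
  assumes "group G" "x \<in> carrier G" "xs \<in> tuples (carrier G) (Suc n)"
  shows "bd (homog G f) (x # xs) = e (cobound G n f (diffs G x xs))"
proof -
  interpret group G by fact
  obtain h hs where xs: "xs = h # hs" "h \<in> carrier G" "hs \<in> tuples (carrier G) n"
    using assms(3) by (rule tuples_SucE)
  have "length (diffs G x xs) = Suc n" using tuples_length[OF diffs_in_tuples[OF assms(2,3)]] .
  then show ?thesis
    using bd_diffs[OF assms(1,2) xs(2) tuples_lists[OF xs(3)], of f]
    by (simp add: xs(1) cobound_eq_inner_bd e_add)
qed

lemma homog_surj_diffs:
  assumes "group G" "gs \<in> tuples (carrier G) n"
  shows "\<one>\<^bsub>G\<^esub> # pprods G \<one>\<^bsub>G\<^esub> gs \<in> tuples (carrier G) (Suc n)" "diffs G \<one>\<^bsub>G\<^esub> (pprods G \<one>\<^bsub>G\<^esub> gs) = gs"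
proof -
  interpret group G by fact
  show "\<one>\<^bsub>G\<^esub> # pprods G \<one>\<^bsub>G\<^esub> gs \<in> tuples (carrier G) (Suc n)" using pprods_in_tuples[OF one_closed assms(2)] by simp
  show "diffs G \<one>\<^bsub>G\<^esub> (pprods G \<one>\<^bsub>G\<^esub> gs) = gs" using diffs_pprods[OF one_closed tuples_lists[OF assms(2)]] .
qed

lemma cocycle_iff:
  assumes "group G"
  shows "is_cocycle G p n f \<longleftrightarrow> (\<forall>ys\<in>tuples (carrier G) (Suc (Suc n)). bd (homog G f) ys = 0)"
proof -
  interpret group G by fact
  show ?thesis
  proof
    assume c: "is_cocycle G p n f"
    show "\<forall>ys\<in>tuples (carrier G) (Suc (Suc n)). bd (homog G f) ys = 0"
    proof
      fix ys assume "ys \<in> tuples (carrier G) (Suc (Suc n))"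
      then obtain x xs where ys: "ys = x # xs" "x \<in> carrier G" "xs \<in> tuples (carrier G) (Suc n)" by (rule tuples_SucE)
      have "[cobound G n f (diffs G x xs) = 0] (mod int p)"
        using c diffs_in_tuples[OF ys(2,3)] unfolding is_cocycle_def by blast
      then show "bd (homog G f) ys = 0" using bd_homog[OF assms ys(2,3)] ys(1) e_eq_iff by (metis e_0)
    qed
  next
    assume c: "\<forall>ys\<in>tuples (carrier G) (Suc (Suc n)). bd (homog G f) ys = 0"
    show "is_cocycle G p n f" unfolding is_cocycle_def
    proof
      fix gs assume gs: "gs \<in> tuples (carrier G) (Suc n)"
      have "bd (homog G f) (\<one>\<^bsub>G\<^esub> # pprods G \<one>\<^bsub>G\<^esub> gs) = 0" using c homog_surj_diffs(1)[OF assms gs] by blast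
      then have "e (cobound G n f gs) = e 0"
        using bd_homog[OF assms one_closed pprods_in_tuples[OF one_closed gs], of f] homog_surj_diffs(2)[OF assms gs] by simp
      then show "[cobound G n f gs = 0] (mod int p)" by (simp only: e_eq_iff)
    qed
  qed
qed

lemma cobound_iff:
  assumes "group G"
  shows "(\<forall>xs\<in>tuples (carrier G) (Suc m). [f xs = cobound G m h xs] (mod int p)) \<longleftrightarrow>
    (\<forall>ys\<in>tuples (carrier G) (Suc (Suc m)). homog G f ys = bd (homog G h) ys)"
proof -
  interpret group G by fact
  show ?thesis
  proof
    assume c: "\<forall>xs\<in>tuples (carrier G) (Suc m). [f xs = cobound G m h xs] (mod int p)"
    show "\<forall>ys\<in>tuples (carrier G) (Suc (Suc m)). homog G f ys = bd (homog G h) ys"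
    proof
      fix ys assume "ys \<in> tuples (carrier G) (Suc (Suc m))"
      then obtain x xs where ys: "ys = x # xs" "x \<in> carrier G" "xs \<in> tuples (carrier G) (Suc m)" by (rule tuples_SucE)
      have "[f (diffs G x xs) = cobound G m h (diffs G x xs)] (mod int p)"
        using c diffs_in_tuples[OF ys(2,3)] by blast
      then show "homog G f ys = bd (homog G h) ys" using bd_homog[OF assms ys(2,3), of h] ys(1) e_eq_iff by simp
    qed
  next
    assume c: "\<forall>ys\<in>tuples (carrier G) (Suc (Suc m)). homog G f ys = bd (homog G h) ys"
    show "\<forall>xs\<in>tuples (carrier G) (Suc m). [f xs = cobound G m h xs] (mod int p)"
    proof
      fix gs assume gs: "gs \<in> tuples (carrier G) (Suc m)"
      have "homog G f (\<one>\<^bsub>G\<^esub> # pprods G \<one>\<^bsub>G\<^esub> gs) = bd (homog G h) (\<one>\<^bsub>G\<^esub> # pprods G \<one>\<^bsub>G\<^esub> gs)"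
        using c homog_surj_diffs(1)[OF assms gs] by blast
      then have "e (f gs) = e (cobound G m h gs)"
        using bd_homog[OF assms one_closed pprods_in_tuples[OF one_closed gs], of h] homog_surj_diffs(2)[OF assms gs] by simp
      then show "[f gs = cobound G m h gs] (mod int p)" by (simp only: e_eq_iff)
    qed
  qed
qed

lemma homog_lact:
  assumes "group G" "g \<in> carrier G" "xs \<in> tuples (carrier G) (Suc n)"
  shows "homog G f (lact G g xs) = homog G f xs"
proof -
  interpret group G by fact
  obtain x zs where "xs = x # zs" "x \<in> carrier G" "zs \<in> tuples (carrier G) n" using assms(3) by (rule tuples_SucE)
  then show ?thesis using diffs_lact[OF assms(2)] by (simp add: tuples_lists)
qed

lemma gadm_homog:
  assumes "group G" shows "gadm G 0 (Suc n) (\<lambda>_. homog G f)"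
proof -
  interpret group G by fact
  show ?thesis by (rule admI[OF _ _ carrier_pfin]) (simp_all add: homog_V homog_lact[OF assms])
qed

lemma gadm_homog_loc:
  assumes "group G" and N: "N \<in> pfin_normals G p"
    and f: "\<And>gs hs. gs \<in> tuples (carrier G) n \<Longrightarrow> hs \<in> tuples (carrier G) n \<Longrightarrow> cosets G N gs = cosets G N hs \<Longrightarrow> f gs = f hs"
  shows "gadm G (Suc n) 0 (\<lambda>xs _. homog G f xs)"
proof -
  interpret group G by fact
  show ?thesis
  proof (rule admI[OF _ _ N])
    fix xs xs' ys :: "'a list"
    assume "xs \<in> tuples (carrier G) (Suc n)" "xs' \<in> tuples (carrier G) (Suc n)"
      and c: "cosets G N xs = cosets G N xs'"
    then obtain x zs x' zs' where x: "xs = x # zs" "x \<in> carrier G" "zs \<in> tuples (carrier G) n"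
      "xs' = x' # zs'" "x' \<in> carrier G" "zs' \<in> tuples (carrier G) n" by (elim tuples_SucE)
    have "cosets G N (diffs G x zs) = cosets G N (diffs G x' zs')"
      by (rule cosets_diffs[OF pfinD(1)[OF N]]) (use x c in \<open>auto simp: tuples_lists\<close>)
    then have "f (diffs G x zs) = f (diffs G x' zs')"
      by (intro f diffs_in_tuples) (use x in auto)
    then show "homog G f xs = homog G f xs'" using x by simp
  qed (simp_all add: homog_V homog_lact[OF assms(1)])
qed

text \<open>The inhomogeneous cochain is read off at tuples that start with the identity. The chosen
  integer depends only on the value of \<open>F\<close>, so the same \<open>f\<close> inherits local
  constancy at every level at which \<open>F\<close> has it.\<close>

lemma dehomog:
  assumes G: "group G" and F: "gadm G 0 (Suc n) (\<lambda>_. F)"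
  obtains f where "\<And>ys. ys \<in> tuples (carrier G) (Suc n) \<Longrightarrow> homog G f ys = F ys"
    "\<And>N gs hs. N \<in> pfin_normals G p \<Longrightarrow> (\<And>xs ys. xs \<in> tuples (carrier G) (Suc n) \<Longrightarrow> ys \<in> tuples (carrier G) (Suc n) \<Longrightarrow>
      cosets G N xs = cosets G N ys \<Longrightarrow> F xs = F ys) \<Longrightarrow> gs \<in> tuples (carrier G) n \<Longrightarrow> hs \<in> tuples (carrier G) n \<Longrightarrow>
      cosets G N gs = cosets G N hs \<Longrightarrow> f gs = f hs"
proof -
  interpret group G by fact
  define f where "f gs = (SOME a. e a = F (\<one>\<^bsub>G\<^esub> # pprods G \<one>\<^bsub>G\<^esub> gs))" for gs
  have ef: "e (f gs) = F (\<one>\<^bsub>G\<^esub> # pprods G \<one>\<^bsub>G\<^esub> gs)" if "gs \<in> tuples (carrier G) n" for gs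
  proof -
    have "F (\<one>\<^bsub>G\<^esub> # pprods G \<one>\<^bsub>G\<^esub> gs) \<in> V" using adm_V[OF F _ homog_surj_diffs(1)[OF G that]] by simp
    then have "\<exists>a. e a = F (\<one>\<^bsub>G\<^esub> # pprods G \<one>\<^bsub>G\<^esub> gs)" by (auto simp: V_def)
    then show ?thesis unfolding f_def by (rule someI_ex)
  qed
  show ?thesis
  proof (rule that)
    fix ys assume "ys \<in> tuples (carrier G) (Suc n)"
    then obtain x xs where ys: "ys = x # xs" "x \<in> carrier G" "xs \<in> tuples (carrier G) n" by (rule tuples_SucE)
    have "F (lact G (inv\<^bsub>G\<^esub> x) ys) = F ys"
      using adm_inv[OF F, of "[]" ys "inv\<^bsub>G\<^esub> x"] ys by simp
    moreover have "lact G (inv\<^bsub>G\<^esub> x) ys = \<one>\<^bsub>G\<^esub> # pprods G \<one>\<^bsub>G\<^esub> (diffs G x xs)"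
      using ys pprods_diffs[OF one_closed ys(2) tuples_lists[OF ys(3)]] by simp
    ultimately show "homog G f ys = F ys" using ef[OF diffs_in_tuples[OF ys(2,3)]] ys(1) by simp
  next
    fix N gs hs
    assume N: "N \<in> pfin_normals G p" and F: "\<And>xs ys. xs \<in> tuples (carrier G) (Suc n) \<Longrightarrow> ys \<in> tuples (carrier G) (Suc n) \<Longrightarrow>
      cosets G N xs = cosets G N ys \<Longrightarrow> F xs = F ys" and gs: "gs \<in> tuples (carrier G) n" "hs \<in> tuples (carrier G) n"
      and c: "cosets G N gs = cosets G N hs"
    have "cosets G N (\<one>\<^bsub>G\<^esub> # pprods G \<one>\<^bsub>G\<^esub> gs) = cosets G N (\<one>\<^bsub>G\<^esub> # pprods G \<one>\<^bsub>G\<^esub> hs)"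
      using cosets_pprods[OF pfinD(1)[OF N] one_closed tuples_lists[OF gs(1)] tuples_lists[OF gs(2)] c] by simp
    then have "F (\<one>\<^bsub>G\<^esub> # pprods G \<one>\<^bsub>G\<^esub> gs) = F (\<one>\<^bsub>G\<^esub> # pprods G \<one>\<^bsub>G\<^esub> hs)"
      by (rule F[OF homog_surj_diffs(1)[OF G gs(1)] homog_surj_diffs(1)[OF G gs(2)]])
    then show "f gs = f hs" by (simp add: f_def)
  qed
qed

end

subsection \<open>Continuous cochains on the completion\<close>

lemma prop_carrierD:
  assumes "x \<in> prop_carrier G p"
  shows "N \<in> pfin_normals G p \<Longrightarrow> x N \<in> rcosets\<^bsub>G\<^esub> N" "N \<notin> pfin_normals G p \<Longrightarrow> x N = undefined"
    "N \<in> pfin_normals G p \<Longrightarrow> M \<in> pfin_normals G p \<Longrightarrow> N \<subseteq> M \<Longrightarrow> x N \<subseteq> x M"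
  using assms unfolding prop_carrier_def by blast+

lemma carrier_completion: "carrier (pro_p_completion G p) = prop_carrier G p"
  by (simp add: pro_p_completion_def)

lemma prop_carrier_subset: "prop_carrier G p \<subseteq> (\<Pi>\<^sub>E N\<in>pfin_normals G p. rcosets\<^bsub>G\<^esub> N)"
proof
  fix x assume x: "x \<in> prop_carrier G p"
  show "x \<in> (\<Pi>\<^sub>E N\<in>pfin_normals G p. rcosets\<^bsub>G\<^esub> N)"
    by (rule PiE_I[OF prop_carrierD(1)[OF x] prop_carrierD(2)[OF x]])
qed

lemma topspace_pro_p: "topspace (pro_p_topology G p) = prop_carrier G p"
  by (simp add: pro_p_topology_def inf_absorb2[OF prop_carrier_subset])

lemma continuous_coord:
  assumes "N \<in> pfin_normals G p"
  shows "continuous_map (pro_p_topology G p) (discrete_topology (rcosets\<^bsub>G\<^esub> N)) (\<lambda>x. x N)"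
  unfolding pro_p_topology_def
  by (rule continuous_map_from_subtopology[OF continuous_map_product_projection[OF assms]])

lemma openin_coord:
  assumes N: "N \<in> pfin_normals G p"
  shows "openin (pro_p_topology G p) {x \<in> prop_carrier G p. x N = c}"
proof -
  have "openin (pro_p_topology G p) {x \<in> topspace (pro_p_topology G p). x N \<in> {c} \<inter> rcosets\<^bsub>G\<^esub> N}"
    by (rule openin_continuous_map_preimage[OF continuous_coord[OF N]]) simp
  moreover have "{x \<in> topspace (pro_p_topology G p). x N \<in> {c} \<inter> rcosets\<^bsub>G\<^esub> N} = {x \<in> prop_carrier G p. x N = c}"
    unfolding topspace_pro_p using prop_carrierD(1)[OF _ N] by blast
  ultimately show ?thesis by simp
qed

text \<open>Compatibility concerns two coordinates at a time, so its failure is an open condition in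
  a product of finite discrete spaces.\<close>

lemma compact_space_pro_p: "compact_space (pro_p_topology G p)"
proof -
  let ?P = "pfin_normals G p"
  let ?X = "product_topology (\<lambda>N. discrete_topology (rcosets\<^bsub>G\<^esub> N)) ?P"
  have X: "compact_space ?X"
    unfolding compact_space_product_topology
    by (intro disjI2 ballI) (simp add: compact_space_discrete_topology pfinD(3))
  have "closedin ?X (prop_carrier G p)"
    unfolding closedin_def
  proof
    show "prop_carrier G p \<subseteq> topspace ?X" using prop_carrier_subset by simp
    show "openin ?X (topspace ?X - prop_carrier G p)"
    proof (subst openin_subopen, rule ballI)
      fix x assume x: "x \<in> topspace ?X - prop_carrier G p"
      then have t: "\<And>N. N \<in> ?P \<Longrightarrow> x N \<in> rcosets\<^bsub>G\<^esub> N" "\<And>N. N \<notin> ?P \<Longrightarrow> x N = undefined"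
        by (auto simp: PiE_iff extensional_def)
      then obtain N M where NM: "N \<in> ?P" "M \<in> ?P" "N \<subseteq> M" "\<not> x N \<subseteq> x M"
        using x unfolding prop_carrier_def by blast
      have o: "openin ?X {y \<in> topspace ?X. y L \<in> {x L}}" if "L \<in> ?P" for L
        by (rule openin_continuous_map_preimage[OF continuous_map_product_projection[OF that]]) (use t that in simp)
      let ?T = "{y \<in> topspace ?X. y N \<in> {x N}} \<inter> {y \<in> topspace ?X. y M \<in> {x M}}"
      have "?T \<subseteq> topspace ?X - prop_carrier G p"
      proof
        fix y assume y: "y \<in> ?T"
        then have "\<not> y N \<subseteq> y M" using NM(4) by simp
        then have "y \<notin> prop_carrier G p" using prop_carrierD(3)[OF _ NM(1,2,3)] by blast
        then show "y \<in> topspace ?X - prop_carrier G p" using y by blast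
      qed
      moreover have "openin ?X ?T" by (rule openin_Int[OF o[OF NM(1)] o[OF NM(2)]])
      moreover have "x \<in> ?T" using x by blast
      ultimately show "\<exists>T. openin ?X T \<and> x \<in> T \<and> T \<subseteq> topspace ?X - prop_carrier G p" by blast
    qed
  qed
  then show ?thesis unfolding pro_p_topology_def
    by (intro compact_space_subtopology closedin_compact_space[OF X])
qed

text \<open>A coset of \<open>N\<close> lies in only one coset of the larger \<open>M\<close>, so
  the finer coordinate determines the coarser one.\<close>

lemma (in group) prop_carrier_eq_mono:
  assumes N: "N \<in> pfin_normals G p" and M: "M \<in> pfin_normals G p" and "N \<subseteq> M"
    and x: "x \<in> prop_carrier G p" and y: "y \<in> prop_carrier G p" and eq: "x N = y N"
  shows "x M = y M"
proof -
  obtain g where g: "g \<in> carrier G" "x N = N #> g" using prop_carrierD(1)[OF x N] unfolding RCOSETS_def by blast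
  have "g \<in> x N" using rcos_self[OF g(1) pfinD(2)[OF N]] g(2) by simp
  then have "g \<in> x M" "g \<in> y M" using prop_carrierD(3)[OF x N M assms(3)] prop_carrierD(3)[OF y N M assms(3)] eq by auto
  then show ?thesis
    using rcos_disjoint[OF pfinD(2)[OF M]] prop_carrierD(1)[OF x M] prop_carrierD(1)[OF y M]
    unfolding disjoint_def pairwise_def disjnt_def by blast
qed

text \<open>A basic neighbourhood restricts finitely many coordinates, and the coordinate at a
  common refinement determines them all.\<close>

lemma (in group) pro_p_nbhd:
  assumes p: "prime p" and U: "openin (pro_p_topology G p) U" and x: "x \<in> U"
  shows "\<exists>N\<in>pfin_normals G p. \<forall>y\<in>prop_carrier G p. y N = x N \<longrightarrow> y \<in> U"
proof -
  let ?P = "pfin_normals G p"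
  let ?R = "\<lambda>N. discrete_topology (rcosets N)"
  obtain T where T: "openin (product_topology ?R ?P) T" "U = T \<inter> prop_carrier G p"
    using U unfolding pro_p_topology_def openin_subtopology by blast
  have "\<exists>W. finite {N \<in> ?P. W N \<noteq> topspace (?R N)} \<and> (\<forall>N\<in>?P. openin (?R N) (W N)) \<and> x \<in> PiE ?P W \<and> PiE ?P W \<subseteq> T"
    by (rule bspec[OF T(1)[unfolded openin_product_topology_alt]]) (use x T(2) in blast)
  then obtain W where W: "finite {N \<in> ?P. W N \<noteq> topspace (?R N)}" "x \<in> PiE ?P W" "PiE ?P W \<subseteq> T"
    by (elim exE conjE) (rule that)
  obtain N where N: "N \<in> ?P" "\<forall>M\<in>{N \<in> ?P. W N \<noteq> topspace (?R N)}. N \<subseteq> M"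
    using pfin_refine[OF p W(1)] by blast
  have "y \<in> U" if y: "y \<in> prop_carrier G p" and eq: "y N = x N" for y
  proof -
    have xc: "x \<in> prop_carrier G p" using x T by blast
    have "y M \<in> W M" if M: "M \<in> ?P" for M
    proof (cases "W M = rcosets M")
      case True
      then show ?thesis using prop_carrierD(1)[OF y M] by simp
    next
      case False
      then have "N \<subseteq> M" using N M by simp
      then have "y M = x M" by (rule prop_carrier_eq_mono[OF N(1) M _ y xc eq])
      then show ?thesis using W(2) M by (simp add: PiE_iff)
    qed
    then have "y \<in> PiE ?P W" using prop_carrierD(2)[OF y] by (auto simp: PiE_iff extensional_def)
    then show ?thesis using W(3) T(2) y by blast
  qed
  then show ?thesis using N(1) by blast
qed

section \<open>Continuous cochains have a finite level\<close>

definition level_at :: "('a, 'm) monoid_scheme \<Rightarrow> nat \<Rightarrow> nat \<Rightarrow> 'a set \<Rightarrow> (('a set \<Rightarrow> 'a set) list \<Rightarrow> int) \<Rightarrow> bool" where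
  "level_at G p n N F \<longleftrightarrow> (\<forall>xs\<in>tuples (prop_carrier G p) n. \<forall>ys\<in>tuples (prop_carrier G p) n.
     map (\<lambda>x. x N) xs = map (\<lambda>x. x N) ys \<longrightarrow> F xs = F ys)"

lemma level_atD:
  "level_at G p n N F \<Longrightarrow> xs \<in> tuples (prop_carrier G p) n \<Longrightarrow> ys \<in> tuples (prop_carrier G p) n \<Longrightarrow>
    map (\<lambda>x. x N) xs = map (\<lambda>x. x N) ys \<Longrightarrow> F xs = F ys"
  unfolding level_at_def by blast

lemma (in group) level_at_mono:
  assumes "level_at G p n M F" "N \<in> pfin_normals G p" "M \<in> pfin_normals G p" "N \<subseteq> M"
  shows "level_at G p n N F"
  unfolding level_at_def
proof (intro ballI impI)
  fix xs ys assume xs: "xs \<in> tuples (prop_carrier G p) n" and ys: "ys \<in> tuples (prop_carrier G p) n"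
    and eq: "map (\<lambda>x. x N) xs = map (\<lambda>x. x N) ys"
  have "map (\<lambda>x. x M) xs = map (\<lambda>x. x M) ys"
    using xs ys eq
  proof (induction n arbitrary: xs ys)
    case (Suc n)
    then obtain x zs y ws where "xs = x # zs" "ys = y # ws" "x \<in> prop_carrier G p" "y \<in> prop_carrier G p"
      "zs \<in> tuples (prop_carrier G p) n" "ws \<in> tuples (prop_carrier G p) n" by (elim tuples_SucE)
    then show ?case using Suc.IH[of zs ws] Suc.prems(3) prop_carrier_eq_mono[OF assms(2-4)] by simp
  qed simp
  then show "F xs = F ys" by (rule level_atD[OF assms(1) xs ys])
qed

lemma map_tuple:
  assumes "v \<in> (\<Pi>\<^sub>E i\<in>{..<n}. S)" shows "map v [0..<n] \<in> tuples S n"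
  using assms by (auto simp: tuples_def PiE_iff)

lemma tuple_as_map:
  assumes "xs \<in> tuples S n"
  obtains v where "v \<in> (\<Pi>\<^sub>E i\<in>{..<n}. S)" "map v [0..<n] = xs"
proof
  let ?v = "\<lambda>i. if i < n then xs ! i else undefined"
  show "?v \<in> (\<Pi>\<^sub>E i\<in>{..<n}. S)" using assms by (auto simp: tuples_def PiE_iff extensional_def)
  show "map ?v [0..<n] = xs" by (rule nth_equalityI) (use assms in \<open>auto simp: tuples_def\<close>)
qed

text \<open>Compactness turns local constancy into dependence on a single finite quotient, the form
  in which continuous cochains are handled from here on.\<close>

lemma (in group) cont_cochain_iff:
  assumes p: "prime p"
  shows "cont_cochain G p n F \<longleftrightarrow> (\<exists>N\<in>pfin_normals G p. level_at G p n N F)"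
proof
  let ?P = "pfin_normals G p"
  let ?X = "product_topology (\<lambda>i. pro_p_topology G p) {..<n}"
  let ?B = "\<lambda>N v. (\<Pi>\<^sub>E i\<in>{..<n}. {x \<in> prop_carrier G p. x N = v i N})"
  have ts: "topspace ?X = (\<Pi>\<^sub>E i\<in>{..<n}. prop_carrier G p)" by (simp add: topspace_pro_p)
  have oB: "openin ?X (?B N v)" if "N \<in> ?P" for N v
    by (rule openin_PiE[THEN iffD2]) (use openin_coord[OF that] in auto)
  have vB: "v \<in> ?B N v" if "v \<in> topspace ?X" for N v
    using that unfolding ts by (auto simp: PiE_iff)
  {
    assume "\<exists>N\<in>?P. level_at G p n N F"
    then obtain N where N: "N \<in> ?P" "level_at G p n N F" by blast
    show "cont_cochain G p n F"
      unfolding cont_cochain_def continuous_map_def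
    proof (intro conjI allI impI)
      fix U assume "openin (discrete_topology (UNIV :: int set)) U"
      show "openin ?X {v \<in> topspace ?X. F (map v [0..<n]) \<in> U}"
      proof (subst openin_subopen, rule ballI)
        fix v assume v: "v \<in> {v \<in> topspace ?X. F (map v [0..<n]) \<in> U}"
        have "?B N v \<subseteq> {v \<in> topspace ?X. F (map v [0..<n]) \<in> U}"
        proof
          fix w assume w: "w \<in> ?B N v"
          then have wt: "w \<in> topspace ?X" unfolding ts by (auto simp: PiE_iff)
          have "F (map w [0..<n]) = F (map v [0..<n])"
          proof (rule level_atD[OF N(2)])
            show "map w [0..<n] \<in> tuples (prop_carrier G p) n" using wt unfolding ts by (rule map_tuple)
            show "map v [0..<n] \<in> tuples (prop_carrier G p) n" using v unfolding ts by (auto intro: map_tuple)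
          qed (use w in \<open>auto simp: PiE_iff\<close>)
          then show "w \<in> {v \<in> topspace ?X. F (map v [0..<n]) \<in> U}" using wt v by simp
        qed
        then show "\<exists>T. openin ?X T \<and> v \<in> T \<and> T \<subseteq> {v \<in> topspace ?X. F (map v [0..<n]) \<in> U}"
          using oB[OF N(1), of v] vB[of v N] v by blast
      qed
    qed auto
  next
    assume F: "cont_cochain G p n F"
    \<comment> \<open>Each entry of the tuple has its own level; refining these finitely many levels
      gives one box around \<open>v\<close> on which \<open>F\<close> is constant.\<close>
    have loc: "\<exists>N\<in>?P. \<forall>w\<in>?B N v. F (map w [0..<n]) = F (map v [0..<n])" if v: "v \<in> topspace ?X" for v
    proof -
      have "openin ?X {w \<in> topspace ?X. F (map w [0..<n]) \<in> {F (map v [0..<n])}}"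
        using F unfolding cont_cochain_def by (rule openin_continuous_map_preimage) simp
      then have "\<exists>W. finite {i \<in> {..<n}. W i \<noteq> topspace (pro_p_topology G p)} \<and>
          (\<forall>i\<in>{..<n}. openin (pro_p_topology G p) (W i)) \<and> v \<in> PiE {..<n} W \<and>
          PiE {..<n} W \<subseteq> {w \<in> topspace ?X. F (map w [0..<n]) \<in> {F (map v [0..<n])}}"
        unfolding openin_product_topology_alt by (rule bspec) (use v in simp)
      then obtain W where W: "\<And>i. i < n \<Longrightarrow> openin (pro_p_topology G p) (W i)" "v \<in> PiE {..<n} W"
        "PiE {..<n} W \<subseteq> {w \<in> topspace ?X. F (map w [0..<n]) \<in> {F (map v [0..<n])}}"
        by (elim exE conjE) (rule that, auto)
      have "\<forall>i\<in>{..<n}. \<exists>N. N \<in> ?P \<and> (\<forall>y\<in>prop_carrier G p. y N = v i N \<longrightarrow> y \<in> W i)"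
      proof
        fix i assume "i \<in> {..<n}"
        then have "openin (pro_p_topology G p) (W i)" "v i \<in> W i" using W(1,2) by (auto simp: PiE_iff)
        from pro_p_nbhd[OF p this] show "\<exists>N. N \<in> ?P \<and> (\<forall>y\<in>prop_carrier G p. y N = v i N \<longrightarrow> y \<in> W i)" by blast
      qed
      from bchoice[OF this] obtain M where
        "\<forall>i\<in>{..<n}. M i \<in> ?P \<and> (\<forall>y\<in>prop_carrier G p. y (M i) = v i (M i) \<longrightarrow> y \<in> W i)" ..
      then have M: "\<And>i. i < n \<Longrightarrow> M i \<in> ?P"
        "\<And>i y. i < n \<Longrightarrow> y \<in> prop_carrier G p \<Longrightarrow> y (M i) = v i (M i) \<Longrightarrow> y \<in> W i" by simp_all
      have "finite (M ` {..<n})" "M ` {..<n} \<subseteq> ?P" using M(1) by auto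
      then obtain N where N: "N \<in> ?P" "\<forall>L\<in>M ` {..<n}. N \<subseteq> L" using pfin_refine[OF p] by blast
      have "F (map w [0..<n]) = F (map v [0..<n])" if w: "w \<in> ?B N v" for w
      proof -
        have "w i \<in> W i" if i: "i < n" for i
        proof -
          have wi: "w i \<in> prop_carrier G p" "w i N = v i N" using w i by (auto simp: PiE_iff)
          have vi: "v i \<in> prop_carrier G p" using v i unfolding ts by (auto simp: PiE_iff)
          have "N \<subseteq> M i" using N(2) i by blast
          then have "w i (M i) = v i (M i)"
            by (rule prop_carrier_eq_mono[OF N(1) M(1)[OF i] _ wi(1) vi wi(2)])
          then show ?thesis by (rule M(2)[OF i wi(1)])
        qed
        then have "w \<in> PiE {..<n} W" using w by (auto simp: PiE_iff)
        then show ?thesis using W(3) by auto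
      qed
      then show ?thesis using N(1) by blast
    qed
    have "\<forall>v\<in>topspace ?X. \<exists>N. N \<in> ?P \<and> (\<forall>w\<in>?B N v. F (map w [0..<n]) = F (map v [0..<n]))"
    proof
      fix v assume "v \<in> topspace ?X"
      from loc[OF this] show "\<exists>N. N \<in> ?P \<and> (\<forall>w\<in>?B N v. F (map w [0..<n]) = F (map v [0..<n]))"
        unfolding Bex_def .
    qed
    from bchoice[OF this] obtain L where
      L0: "\<forall>v\<in>topspace ?X. L v \<in> ?P \<and> (\<forall>w\<in>?B (L v) v. F (map w [0..<n]) = F (map v [0..<n]))" ..
    have L: "\<And>v. v \<in> topspace ?X \<Longrightarrow> L v \<in> ?P"
      "\<And>v w. v \<in> topspace ?X \<Longrightarrow> w \<in> ?B (L v) v \<Longrightarrow> F (map w [0..<n]) = F (map v [0..<n])"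
      by (rule conjunct1[OF bspec[OF L0]], assumption) (rule bspec[OF conjunct2[OF bspec[OF L0]]])
    \<comment> \<open>Finitely many such boxes cover the space, and a refinement of their levels
      works for all tuples.\<close>
    have "compactin ?X (topspace ?X)"
      using compact_space_pro_p unfolding compact_space_def[symmetric] compact_space_product_topology by blast
    moreover have "\<forall>U\<in>(\<lambda>v. ?B (L v) v) ` topspace ?X. openin ?X U" using oB L(1) by blast
    moreover have "topspace ?X \<subseteq> \<Union> ((\<lambda>v. ?B (L v) v) ` topspace ?X)" using vB by blast
    ultimately have "\<exists>\<F>. finite \<F> \<and> \<F> \<subseteq> (\<lambda>v. ?B (L v) v) ` topspace ?X \<and> topspace ?X \<subseteq> \<Union>\<F>"
      unfolding compactin_def by meson
    then obtain \<F> where \<F>: "finite \<F>" "\<F> \<subseteq> (\<lambda>v. ?B (L v) v) ` topspace ?X" "topspace ?X \<subseteq> \<Union>\<F>" by blast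
    obtain V where V: "V \<subseteq> topspace ?X" "finite V" "\<F> = (\<lambda>v. ?B (L v) v) ` V"
      using finite_subset_image[OF \<F>(1,2)] by blast
    have "finite (L ` V)" "L ` V \<subseteq> ?P" using V L(1) by auto
    then obtain N where N: "N \<in> ?P" "\<forall>M\<in>L ` V. N \<subseteq> M" using pfin_refine[OF p] by blast
    have "level_at G p n N F"
      unfolding level_at_def
    proof (intro ballI impI)
      fix xs ys assume xs: "xs \<in> tuples (prop_carrier G p) n" and ys: "ys \<in> tuples (prop_carrier G p) n"
        and eq: "map (\<lambda>x. x N) xs = map (\<lambda>x. x N) ys"
      obtain a where a: "a \<in> topspace ?X" "map a [0..<n] = xs" using tuple_as_map[OF xs] unfolding ts by blast
      obtain b where b: "b \<in> topspace ?X" "map b [0..<n] = ys" using tuple_as_map[OF ys] unfolding ts by blast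
      obtain v where v: "v \<in> V" "a \<in> ?B (L v) v" using \<F>(3) V(3) a(1) by blast
      have vt: "v \<in> topspace ?X" using v V by blast
      have bB: "b \<in> ?B (L v) v"
      proof (rule PiE_I)
        fix i assume i: "i \<in> {..<n}"
        have ai: "a i \<in> prop_carrier G p" and bi: "b i \<in> prop_carrier G p" using a b i unfolding ts by (auto simp: PiE_iff)
        have "a i N = b i N" using eq i unfolding a(2)[symmetric] b(2)[symmetric] by simp
        moreover have "N \<subseteq> L v" using N v by blast
        ultimately have "a i (L v) = b i (L v)" by (intro prop_carrier_eq_mono[OF N(1) L(1)[OF vt] _ ai bi])
        moreover have "a i (L v) = v i (L v)" using PiE_mem[OF v(2) i] by simp
        ultimately show "b i \<in> {x \<in> prop_carrier G p. x (L v) = v i (L v)}" using bi by simp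
      next
        fix i assume "i \<notin> {..<n}"
        then show "b i = undefined" using b(1) unfolding ts by (rule PiE_arb[rotated])
      qed
      show "F xs = F ys" using L(2)[OF vt v(2)] L(2)[OF vt bB] unfolding a(2) b(2) by simp
    qed
    then show "\<exists>N\<in>?P. level_at G p n N F" using N(1) by blast
  }
qed

section \<open>Cochains under the completion map\<close>

lemma (in group) completion_map_closed:
  assumes "g \<in> carrier G" shows "completion_map G p g \<in> prop_carrier G p"
  using assms unfolding prop_carrier_def completion_map_def r_coset_def RCOSETS_def by auto

lemma completion_map_at: "N \<in> pfin_normals G p \<Longrightarrow> completion_map G p g N = N #>\<^bsub>G\<^esub> g"
  by (simp add: completion_map_def)

lemma completion_mult_at:
  "N \<in> pfin_normals G p \<Longrightarrow> (x \<otimes>\<^bsub>pro_p_completion G p\<^esub> y) N = x N <#>\<^bsub>G\<^esub> y N"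
  by (simp add: pro_p_completion_def)

lemma (in group) completion_mult_closed:
  assumes x: "x \<in> prop_carrier G p" and y: "y \<in> prop_carrier G p"
  shows "x \<otimes>\<^bsub>pro_p_completion G p\<^esub> y \<in> prop_carrier G p"
proof -
  have 1: "x N <#> y N \<in> rcosets N" if N: "N \<in> pfin_normals G p" for N
    using normal.setmult_closed[OF pfinD(1)[OF N] prop_carrierD(1)[OF x N] prop_carrierD(1)[OF y N]] .
  have 2: "x N <#> y N \<subseteq> x M <#> y M" if "N \<in> pfin_normals G p" "M \<in> pfin_normals G p" "N \<subseteq> M" for N M
    using prop_carrierD(3)[OF x that] prop_carrierD(3)[OF y that] unfolding set_mult_def by blast
  show ?thesis using 1 2 unfolding prop_carrier_def pro_p_completion_def by auto
qed

lemma map_completion_map: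
  "N \<in> pfin_normals G p \<Longrightarrow> map (\<lambda>x. x N) (map (completion_map G p) gs) = cosets G N gs"
  by (simp add: cosets_def completion_map_at comp_def)

lemma (in group) completion_tuple:
  "gs \<in> tuples (carrier G) n \<Longrightarrow> map (completion_map G p) gs \<in> tuples (prop_carrier G p) n"
  by (rule map_in_tuples[OF _ completion_map_closed])

lemma (in group) completion_dense:
  assumes N: "N \<in> pfin_normals G p" and "xs \<in> tuples (prop_carrier G p) n"
  obtains gs where "gs \<in> tuples (carrier G) n" "map (\<lambda>x. x N) xs = cosets G N gs"
proof -
  have "\<exists>gs. gs \<in> tuples (carrier G) n \<and> map (\<lambda>x. x N) xs = cosets G N gs"
    using assms(2)
  proof (induction n arbitrary: xs)
    case 0
    then show ?case by simp
  next
    case (Suc n)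
    then obtain x zs where xs: "xs = x # zs" "x \<in> prop_carrier G p" "zs \<in> tuples (prop_carrier G p) n" by (elim tuples_SucE)
    obtain g where g: "g \<in> carrier G" "x N = N #> g" using prop_carrierD(1)[OF xs(2) N] unfolding RCOSETS_def by blast
    obtain gs where "gs \<in> tuples (carrier G) n" "map (\<lambda>x. x N) zs = cosets G N gs" using Suc.IH[OF xs(3)] by blast
    then show ?case using g xs(1) by (intro exI[of _ "g # gs"]) simp
  qed
  then show ?thesis using that by blast
qed

text \<open>At level \<open>N\<close> the product of the completion is the product of cosets, so the
  coboundary can be computed on group elements that represent the tuple.\<close>

lemma (in group) cobound_completion:
  assumes N: "N \<in> pfin_normals G p" and F: "level_at G p n N F"
    and xs: "xs \<in> tuples (prop_carrier G p) (Suc n)" and gs: "gs \<in> tuples (carrier G) (Suc n)"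
    and eq: "map (\<lambda>x. x N) xs = cosets G N gs"
  shows "cobound (pro_p_completion G p) n F xs = cobound G n (\<lambda>hs. F (map (completion_map G p) hs)) gs"
proof (rule cobound_rel)
  let ?Q = "\<lambda>x g. x \<in> prop_carrier G p \<and> g \<in> carrier G \<and> x N = N #> g"
  show "list_all2 ?Q xs gs"
    using xs gs eq unfolding list_all2_conv_all_nth
    by (auto simp: tuples_def cosets_def subset_iff map_equality_iff)
  show "length xs = Suc n" using xs by (rule tuples_length)
  show "?Q (x \<otimes>\<^bsub>pro_p_completion G p\<^esub> x') (g \<otimes> g')" if "?Q x g" "?Q x' g'" for x x' g g'
    using that normal.rcos_sum[OF pfinD(1)[OF N], of g g'] completion_mult_closed[of x p x']
    by (simp add: completion_mult_at[OF N])
  show "F zs = F (map (completion_map G p) ws)" if Q: "list_all2 ?Q zs ws" and len: "length zs = n" for zs ws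
  proof (rule level_atD[OF F])
    show "zs \<in> tuples (prop_carrier G p) n"
      using Q len by (auto simp: tuples_def list_all2_conv_all_nth in_set_conv_nth)
    have ws: "ws \<in> tuples (carrier G) n"
      using Q len by (auto simp: tuples_def list_all2_conv_all_nth in_set_conv_nth)
    show "map (completion_map G p) ws \<in> tuples (prop_carrier G p) n" by (rule completion_tuple[OF ws])
    show "map (\<lambda>x. x N) zs = map (\<lambda>x. x N) (map (completion_map G p) ws)"
      unfolding map_completion_map[OF N] using Q by (auto simp: list_all2_conv_all_nth cosets_def map_equality_iff)
  qed
qed

lemma (in group) cocycle_completion_iff:
  assumes p: "prime p" and F: "cont_cochain G p n F"
  shows "is_cocycle (pro_p_completion G p) p n F \<longleftrightarrow> is_cocycle G p n (\<lambda>hs. F (map (completion_map G p) hs))"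
proof -
  obtain N where N: "N \<in> pfin_normals G p" "level_at G p n N F" using F cont_cochain_iff[OF p] by blast
  show ?thesis unfolding is_cocycle_def carrier_completion
  proof (intro iffI ballI)
    fix gs assume a: "\<forall>xs\<in>tuples (prop_carrier G p) (Suc n). [cobound (pro_p_completion G p) n F xs = 0] (mod int p)"
      and gs: "gs \<in> tuples (carrier G) (Suc n)"
    show "[cobound G n (\<lambda>hs. F (map (completion_map G p) hs)) gs = 0] (mod int p)"
      using a completion_tuple[OF gs] cobound_completion[OF N completion_tuple[OF gs] gs map_completion_map[OF N(1)]] by metis
  next
    fix xs assume a: "\<forall>gs\<in>tuples (carrier G) (Suc n). [cobound G n (\<lambda>hs. F (map (completion_map G p) hs)) gs = 0] (mod int p)"
      and xs: "xs \<in> tuples (prop_carrier G p) (Suc n)"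
    obtain gs where gs: "gs \<in> tuples (carrier G) (Suc n)" "map (\<lambda>x. x N) xs = cosets G N gs"
      by (rule completion_dense[OF N(1) xs])
    show "[cobound (pro_p_completion G p) n F xs = 0] (mod int p)"
      using a gs(1) cobound_completion[OF N xs gs] by metis
  qed
qed

lemma (in group) coboundary_completion_iff:
  assumes p: "prime p" and F: "cont_cochain G p (Suc n) F" and h: "cont_cochain G p n h"
  shows "(\<forall>xs\<in>tuples (prop_carrier G p) (Suc n). [F xs = cobound (pro_p_completion G p) n h xs] (mod int p)) \<longleftrightarrow>
    (\<forall>gs\<in>tuples (carrier G) (Suc n). [F (map (completion_map G p) gs) =
      cobound G n (\<lambda>hs. h (map (completion_map G p) hs)) gs] (mod int p))"
proof -
  obtain N1 where N1: "N1 \<in> pfin_normals G p" "level_at G p (Suc n) N1 F" using F cont_cochain_iff[OF p] by blast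
  obtain N2 where N2: "N2 \<in> pfin_normals G p" "level_at G p n N2 h" using h cont_cochain_iff[OF p] by blast
  have N: "N1 \<inter> N2 \<in> pfin_normals G p" by (rule pfin_inter[OF p N1(1) N2(1)])
  have NF: "level_at G p (Suc n) (N1 \<inter> N2) F" by (rule level_at_mono[OF N1(2) N N1(1)]) simp
  have Nh: "level_at G p n (N1 \<inter> N2) h" by (rule level_at_mono[OF N2(2) N N2(1)]) simp
  show ?thesis
  proof (intro iffI ballI)
    fix gs assume a: "\<forall>xs\<in>tuples (prop_carrier G p) (Suc n). [F xs = cobound (pro_p_completion G p) n h xs] (mod int p)"
      and gs: "gs \<in> tuples (carrier G) (Suc n)"
    show "[F (map (completion_map G p) gs) = cobound G n (\<lambda>hs. h (map (completion_map G p) hs)) gs] (mod int p)"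
      using a completion_tuple[OF gs] cobound_completion[OF N Nh completion_tuple[OF gs] gs map_completion_map[OF N]] by metis
  next
    fix xs assume a: "\<forall>gs\<in>tuples (carrier G) (Suc n). [F (map (completion_map G p) gs) =
      cobound G n (\<lambda>hs. h (map (completion_map G p) hs)) gs] (mod int p)"
      and xs: "xs \<in> tuples (prop_carrier G p) (Suc n)"
    obtain gs where gs: "gs \<in> tuples (carrier G) (Suc n)" "map (\<lambda>x. x (N1 \<inter> N2)) xs = cosets G (N1 \<inter> N2) gs"
      by (rule completion_dense[OF N xs])
    have "F xs = F (map (completion_map G p) gs)"
      by (rule level_atD[OF NF xs completion_tuple[OF gs(1)]]) (simp only: gs(2) map_completion_map[OF N])
    then show "[F xs = cobound (pro_p_completion G p) n h xs] (mod int p)"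
      using a gs(1) cobound_completion[OF N Nh xs gs] by metis
  qed
qed

text \<open>A tuple of the completion gets the value of \<open>f\<close> at some tuple of
  \<open>G\<close> with the same cosets at level \<open>N\<close>; local constancy makes the choice
  harmless.\<close>

lemma (in group) extend_to_completion:
  assumes p: "prime p" and N: "N \<in> pfin_normals G p"
    and f: "\<And>gs hs. gs \<in> tuples (carrier G) n \<Longrightarrow> hs \<in> tuples (carrier G) n \<Longrightarrow> cosets G N gs = cosets G N hs \<Longrightarrow> f gs = f hs"
  obtains F where "cont_cochain G p n F" "\<And>gs. gs \<in> tuples (carrier G) n \<Longrightarrow> F (map (completion_map G p) gs) = f gs"
proof -
  define r where "r xs = (SOME gs. gs \<in> tuples (carrier G) n \<and> map (\<lambda>x. x N) xs = cosets G N gs)" for xs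
  have r: "r (map (completion_map G p) gs) \<in> tuples (carrier G) n \<and>
      map (\<lambda>x. x N) (map (completion_map G p) gs) = cosets G N (r (map (completion_map G p) gs))"
    if "gs \<in> tuples (carrier G) n" for gs
    unfolding r_def by (rule someI[of _ gs]) (use that map_completion_map[OF N] in blast)
  show ?thesis
  proof (rule that[of "\<lambda>xs. f (r xs)"])
    have "level_at G p n N (\<lambda>xs. f (r xs))" unfolding level_at_def r_def by auto
    then show "cont_cochain G p n (\<lambda>xs. f (r xs))" using cont_cochain_iff[OF p] N by blast
    fix gs assume gs: "gs \<in> tuples (carrier G) n"
    show "f (r (map (completion_map G p) gs)) = f gs"
      by (rule f) (use r[OF gs] gs map_completion_map[OF N] in auto)
  qed
qed

lemma (in group) cont_cochain_restrict:
  assumes p: "prime p" and "cont_cochain G p n F"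
  obtains N where "N \<in> pfin_normals G p" "\<And>gs hs. gs \<in> tuples (carrier G) n \<Longrightarrow> hs \<in> tuples (carrier G) n \<Longrightarrow>
    cosets G N gs = cosets G N hs \<Longrightarrow> F (map (completion_map G p) gs) = F (map (completion_map G p) hs)"
proof -
  obtain N where N: "N \<in> pfin_normals G p" "level_at G p n N F" using assms cont_cochain_iff[OF p] by blast
  show ?thesis
  proof (rule that[OF N(1)])
    fix gs hs assume gs: "gs \<in> tuples (carrier G) n" "hs \<in> tuples (carrier G) n" and eq: "cosets G N gs = cosets G N hs"
    show "F (map (completion_map G p) gs) = F (map (completion_map G p) hs)"
      by (rule level_atD[OF N(2) completion_tuple[OF gs(1)] completion_tuple[OF gs(2)]])
        (simp only: map_completion_map[OF N(1)] eq)
  qed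
qed

context zmod_coeff begin

lemma gadm_forget:
  assumes "group G" "gadm G n 0 (\<lambda>xs _. F xs)" shows "gadm G 0 n (\<lambda>_. F)"
proof -
  interpret group G by fact
  show ?thesis
    by (rule admI[OF _ _ carrier_pfin])
      (use adm_V[OF assms(2)] adm_inv[OF assms(2)] in auto)
qed

lemma homog_restrict:
  assumes "group G" "cont_cochain G p n F"
  shows "gadm G (Suc n) 0 (\<lambda>xs _. homog G (\<lambda>gs. F (map (completion_map G p) gs)) xs)"
proof -
  obtain N where "N \<in> pfin_normals G p" "\<And>gs hs. gs \<in> tuples (carrier G) n \<Longrightarrow> hs \<in> tuples (carrier G) n \<Longrightarrow>
    cosets G N gs = cosets G N hs \<Longrightarrow> F (map (completion_map G p) gs) = F (map (completion_map G p) hs)"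
    by (rule group.cont_cochain_restrict[OF assms(1) prime_p assms(2)]) (rule that)
  then show ?thesis by (rule gadm_homog_loc[OF assms(1)])
qed

lemma homog_cong:
  assumes "group G" "\<And>gs. gs \<in> tuples (carrier G) n \<Longrightarrow> f gs = f' gs" "ys \<in> tuples (carrier G) (Suc n)"
  shows "homog G f ys = homog G f' ys"
proof -
  obtain x xs where ys: "ys = x # xs" "x \<in> carrier G" "xs \<in> tuples (carrier G) n" using assms(3) by (rule tuples_SucE)
  then show ?thesis using assms(2)[OF group.diffs_in_tuples[OF assms(1) ys(2,3)]] by simp
qed

lemma homog_diff: "homog G (\<lambda>xs. f xs - f' xs) ys = homog G f ys - homog G f' ys"
  by (cases ys) (simp_all add: e_diff)

text \<open>The double complex imitates continuous cochains by locally constant ones on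
  \<open>G\<close> itself; this turns them into cochains on the completion.\<close>

lemma lift_to_completion:
  assumes G: "group G" and F: "gadm G (Suc n) 0 (\<lambda>xs _. F xs)"
  obtains Fc where "cont_cochain G p n Fc"
    "\<And>ys. ys \<in> tuples (carrier G) (Suc n) \<Longrightarrow> homog G (\<lambda>gs. Fc (map (completion_map G p) gs)) ys = F ys"
proof -
  obtain N where N: "N \<in> pfin_normals G p" "\<And>xs xs' ys. xs \<in> tuples (carrier G) (Suc n) \<Longrightarrow>
    xs' \<in> tuples (carrier G) (Suc n) \<Longrightarrow> ys \<in> tuples (carrier G) 0 \<Longrightarrow> cosets G N xs = cosets G N xs' \<Longrightarrow> F xs = F xs'"
    by (rule adm_loc[OF F]) (rule that)
  show ?thesis
  proof (rule dehomog[OF G gadm_forget[OF G F]])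
    fix f assume f: "\<And>ys. ys \<in> tuples (carrier G) (Suc n) \<Longrightarrow> homog G f ys = F ys"
      "\<And>N gs hs. N \<in> pfin_normals G p \<Longrightarrow> (\<And>xs ys. xs \<in> tuples (carrier G) (Suc n) \<Longrightarrow> ys \<in> tuples (carrier G) (Suc n) \<Longrightarrow>
        cosets G N xs = cosets G N ys \<Longrightarrow> F xs = F ys) \<Longrightarrow> gs \<in> tuples (carrier G) n \<Longrightarrow> hs \<in> tuples (carrier G) n \<Longrightarrow>
        cosets G N gs = cosets G N hs \<Longrightarrow> f gs = f hs"
    have fN: "f gs = f hs" if "gs \<in> tuples (carrier G) n" "hs \<in> tuples (carrier G) n" "cosets G N gs = cosets G N hs" for gs hs
      by (rule f(2)[OF N(1) N(2)[of _ _ "[]"] that]) auto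
    obtain Fc where Fc: "cont_cochain G p n Fc" "\<And>gs. gs \<in> tuples (carrier G) n \<Longrightarrow> Fc (map (completion_map G p) gs) = f gs"
      by (rule group.extend_to_completion[OF G prime_p N(1) fN]; (assumption | rule that))
    show ?thesis
    proof (rule that[OF Fc(1)])
      fix ys assume ys: "ys \<in> tuples (carrier G) (Suc n)"
      show "homog G (\<lambda>gs. Fc (map (completion_map G p) gs)) ys = F ys"
        using homog_cong[OF G Fc(2) ys] f(1)[OF ys] by simp
    qed
  qed
qed

text \<open>Cochains on the completion are tested on the dense image of \<open>G\<close> and then
  made homogeneous. Degree 0 is separate because there a coboundary is defined as a vanishing
  cochain.\<close>

lemma completion_iso_iff:
  assumes G: "group G"
  shows "completion_iso G p (Suc m) \<longleftrightarrow> completion_surj G (Suc m) \<and> completion_inj G (Suc m)"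
proof -
  interpret group G by fact
  let ?T = "tuples (carrier G)"
  let ?n = "Suc m"
  let ?c = "\<lambda>F gs. F (map (completion_map G p) gs)"
  let ?cob = "\<lambda>f h. \<forall>xs\<in>?T ?n. [f xs = cobound G m h xs] (mod int p)"
  let ?H = "\<lambda>f. \<forall>ys\<in>?T (Suc (Suc ?n)). bd f ys = 0"
  have bdc: "bd f ys = bd f' ys" if "\<And>zs. zs \<in> ?T n \<Longrightarrow> f zs = f' zs" "ys \<in> ?T (Suc n)" for n ys and f f' :: "'a list \<Rightarrow> 'k"
    by (rule bd_cong[OF that(2,1)])
  have surj: "completion_surj G ?n \<longleftrightarrow> (\<forall>f. is_cocycle G p ?n f \<longrightarrow>
      (\<exists>F. cont_cochain G p ?n F \<and> is_cocycle (pro_p_completion G p) p ?n F \<and> (\<exists>h. ?cob (\<lambda>xs. f xs - ?c F xs) h)))"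
  proof
    assume Q: "completion_surj G ?n"
    show "\<forall>f. is_cocycle G p ?n f \<longrightarrow>
      (\<exists>F. cont_cochain G p ?n F \<and> is_cocycle (pro_p_completion G p) p ?n F \<and> (\<exists>h. ?cob (\<lambda>xs. f xs - ?c F xs) h))"
    proof (intro allI impI)
      fix f assume "is_cocycle G p ?n f"
      then have "?H (homog G f)" by (rule iffD1[OF cocycle_iff[OF G]])
      then have "\<exists>F u. gadm G (Suc ?n) 0 (\<lambda>xs _. F xs) \<and> ?H F \<and> gadm G 0 ?n (\<lambda>_. u) \<and>
          (\<forall>ys\<in>?T (Suc ?n). homog G f ys = F ys + bd u ys)"
        using Q gadm_homog[OF G] unfolding completion_surj_def by blast
      then obtain F u where F: "gadm G (Suc ?n) 0 (\<lambda>xs _. F xs)" "?H F" and u: "gadm G 0 ?n (\<lambda>_. u)"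
        and eq: "\<forall>ys\<in>?T (Suc ?n). homog G f ys = F ys + bd u ys" by (elim exE conjE) (rule that)
      obtain Fc where Fc: "cont_cochain G p ?n Fc" "\<And>ys. ys \<in> ?T (Suc ?n) \<Longrightarrow> homog G (?c Fc) ys = F ys"
        by (rule lift_to_completion[OF G F(1)]) (rule that)
      obtain h where h: "\<And>ys. ys \<in> ?T ?n \<Longrightarrow> homog G h ys = u ys" by (rule dehomog[OF G u]) (rule that)
      have "?H (homog G (?c Fc))"
      proof
        fix ys assume ys: "ys \<in> ?T (Suc (Suc ?n))"
        show "bd (homog G (?c Fc)) ys = 0" using bdc[OF Fc(2) ys] F(2) ys by simp
      qed
      then have "is_cocycle G p ?n (?c Fc)" by (rule iffD2[OF cocycle_iff[OF G]])
      then have cy: "is_cocycle (pro_p_completion G p) p ?n Fc" by (rule iffD2[OF cocycle_completion_iff[OF prime_p Fc(1)]])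
      have "\<forall>ys\<in>?T (Suc ?n). homog G (\<lambda>xs. f xs - ?c Fc xs) ys = bd (homog G h) ys"
      proof
        fix ys assume ys: "ys \<in> ?T (Suc ?n)"
        show "homog G (\<lambda>xs. f xs - ?c Fc xs) ys = bd (homog G h) ys"
          using eq ys Fc(2)[OF ys] bdc[OF h ys] by (simp add: homog_diff)
      qed
      then have "?cob (\<lambda>xs. f xs - ?c Fc xs) h" by (rule iffD2[OF cobound_iff[OF G]])
      then show "\<exists>F. cont_cochain G p ?n F \<and> is_cocycle (pro_p_completion G p) p ?n F \<and> (\<exists>h. ?cob (\<lambda>xs. f xs - ?c F xs) h)"
        using Fc(1) cy by blast
    qed
  next
    assume S: "\<forall>f. is_cocycle G p ?n f \<longrightarrow>
      (\<exists>F. cont_cochain G p ?n F \<and> is_cocycle (pro_p_completion G p) p ?n F \<and> (\<exists>h. ?cob (\<lambda>xs. f xs - ?c F xs) h))"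
    show "completion_surj G ?n" unfolding completion_surj_def
    proof (intro allI impI, elim conjE)
      fix f :: "'a list \<Rightarrow> 'k" assume f: "gadm G 0 (Suc ?n) (\<lambda>_. f)" "?H f"
      obtain f0 where f0: "\<And>ys. ys \<in> ?T (Suc ?n) \<Longrightarrow> homog G f0 ys = f ys" by (rule dehomog[OF G f(1)]) (rule that)
      have "?H (homog G f0)"
      proof
        fix ys assume ys: "ys \<in> ?T (Suc (Suc ?n))"
        show "bd (homog G f0) ys = 0" using bdc[OF f0 ys] f(2) ys by simp
      qed
      then have "is_cocycle G p ?n f0" by (rule iffD2[OF cocycle_iff[OF G]])
      from S[rule_format, OF this] obtain F h where F: "cont_cochain G p ?n F" "is_cocycle (pro_p_completion G p) p ?n F"
        and h: "?cob (\<lambda>xs. f0 xs - ?c F xs) h" by (elim exE conjE) (rule that)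
      have hh: "\<forall>ys\<in>?T (Suc ?n). homog G (\<lambda>xs. f0 xs - ?c F xs) ys = bd (homog G h) ys"
        by (rule iffD1[OF cobound_iff[OF G] h])
      have "is_cocycle G p ?n (?c F)" by (rule iffD1[OF cocycle_completion_iff[OF prime_p F(1)] F(2)])
      then have HF: "?H (homog G (?c F))" by (rule iffD1[OF cocycle_iff[OF G]])
      show "\<exists>F u. gadm G (Suc ?n) 0 (\<lambda>xs _. F xs) \<and> ?H F \<and> gadm G 0 ?n (\<lambda>_. u) \<and>
          (\<forall>ys\<in>?T (Suc ?n). f ys = F ys + bd u ys)"
      proof (intro exI conjI)
        show "gadm G (Suc ?n) 0 (\<lambda>xs _. homog G (?c F) xs)" by (rule homog_restrict[OF G F(1)])
        show "?H (homog G (?c F))" by (rule HF)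
        show "gadm G 0 ?n (\<lambda>_. homog G h)" by (rule gadm_homog[OF G])
        show "\<forall>ys\<in>?T (Suc ?n). f ys = homog G (?c F) ys + bd (homog G h) ys"
        proof
          fix ys assume ys: "ys \<in> ?T (Suc ?n)"
          have "homog G f0 ys - homog G (?c F) ys = bd (homog G h) ys"
            using bspec[OF hh ys] by (simp add: homog_diff)
          then show "f ys = homog G (?c F) ys + bd (homog G h) ys"
            using f0[OF ys] by (simp add: algebra_simps)
        qed
      qed
    qed
  qed
  let ?cobH = "\<lambda>F h. \<forall>xs\<in>tuples (prop_carrier G p) ?n. [F xs = cobound (pro_p_completion G p) m h xs] (mod int p)"
  have inj: "completion_inj G ?n \<longleftrightarrow> (\<forall>F. cont_cochain G p ?n F \<and> is_cocycle (pro_p_completion G p) p ?n F \<and> (\<exists>h. ?cob (?c F) h) \<longrightarrow>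
      (\<exists>h. cont_cochain G p m h \<and> ?cobH F h))"
  proof
    assume Q: "completion_inj G ?n"
    show "\<forall>F. cont_cochain G p ?n F \<and> is_cocycle (pro_p_completion G p) p ?n F \<and> (\<exists>h. ?cob (?c F) h) \<longrightarrow>
      (\<exists>h. cont_cochain G p m h \<and> ?cobH F h)"
    proof (intro allI impI, elim conjE exE)
      fix F h assume F: "cont_cochain G p ?n F" and h: "?cob (?c F) h"
      have "\<forall>ys\<in>?T (Suc ?n). homog G (?c F) ys = bd (homog G h) ys" by (rule iffD1[OF cobound_iff[OF G] h])
      then have "\<exists>k. gadm G ?n 0 (\<lambda>xs _. k xs) \<and> (\<forall>ys\<in>?T (Suc ?n). homog G (?c F) ys = bd k ys)"
        using Q homog_restrict[OF G F] gadm_homog[OF G, of m h] unfolding completion_inj_def by blast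
      then obtain k where k: "gadm G ?n 0 (\<lambda>xs _. k xs)" "\<forall>ys\<in>?T (Suc ?n). homog G (?c F) ys = bd k ys"
        by (elim exE conjE) (rule that)
      obtain kc where kc: "cont_cochain G p m kc" "\<And>ys. ys \<in> ?T ?n \<Longrightarrow> homog G (?c kc) ys = k ys"
        by (rule lift_to_completion[OF G k(1)]) (rule that)
      have "\<forall>ys\<in>?T (Suc ?n). homog G (?c F) ys = bd (homog G (?c kc)) ys"
      proof
        fix ys assume ys: "ys \<in> ?T (Suc ?n)"
        show "homog G (?c F) ys = bd (homog G (?c kc)) ys" using bspec[OF k(2) ys] bdc[OF kc(2) ys] by simp
      qed
      then have "?cob (?c F) (?c kc)" by (rule iffD2[OF cobound_iff[OF G]])
      then have "?cobH F kc" by (rule iffD2[OF coboundary_completion_iff[OF prime_p F kc(1)]])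
      then show "\<exists>h. cont_cochain G p m h \<and> ?cobH F h" using kc(1) by blast
    qed
  next
    assume S: "\<forall>F. cont_cochain G p ?n F \<and> is_cocycle (pro_p_completion G p) p ?n F \<and> (\<exists>h. ?cob (?c F) h) \<longrightarrow>
      (\<exists>h. cont_cochain G p m h \<and> ?cobH F h)"
    show "completion_inj G ?n" unfolding completion_inj_def
    proof (intro allI impI, elim conjE)
      fix F u :: "'a list \<Rightarrow> 'k" assume F: "gadm G (Suc ?n) 0 (\<lambda>xs _. F xs)" and u: "gadm G 0 ?n (\<lambda>_. u)"
        and eq: "\<forall>ys\<in>?T (Suc ?n). F ys = bd u ys"
      obtain Fc where Fc: "cont_cochain G p ?n Fc" "\<And>ys. ys \<in> ?T (Suc ?n) \<Longrightarrow> homog G (?c Fc) ys = F ys"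
        by (rule lift_to_completion[OF G F]) (rule that)
      obtain h where h: "\<And>ys. ys \<in> ?T ?n \<Longrightarrow> homog G h ys = u ys" by (rule dehomog[OF G u]) (rule that)
      have hc: "homog G (?c Fc) ys = bd (homog G h) ys" if ys: "ys \<in> ?T (Suc ?n)" for ys
        using bspec[OF eq ys] Fc(2)[OF ys] bdc[OF h ys] by simp
      then have "\<forall>ys\<in>?T (Suc ?n). homog G (?c Fc) ys = bd (homog G h) ys" by (rule ballI)
      then have cob: "?cob (?c Fc) h" by (rule iffD2[OF cobound_iff[OF G]])
      have "?H (homog G (?c Fc))"
      proof
        fix ys assume ys: "ys \<in> ?T (Suc (Suc ?n))"
        show "bd (homog G (?c Fc)) ys = 0" using bdc[OF hc ys] by simp
      qed
      then have "is_cocycle G p ?n (?c Fc)" by (rule iffD2[OF cocycle_iff[OF G]])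
      then have cy: "is_cocycle (pro_p_completion G p) p ?n Fc" by (rule iffD2[OF cocycle_completion_iff[OF prime_p Fc(1)]])
      have "\<exists>k. cont_cochain G p m k \<and> ?cobH Fc k" by (rule S[rule_format]) (intro conjI exI, rule Fc(1), rule cy, rule cob)
      then obtain k where k: "cont_cochain G p m k" "?cobH Fc k" by (elim exE conjE) (rule that)
      have "?cob (?c Fc) (?c k)" by (rule iffD1[OF coboundary_completion_iff[OF prime_p Fc(1) k(1)] k(2)])
      then have kk: "\<forall>ys\<in>?T (Suc ?n). homog G (?c Fc) ys = bd (homog G (?c k)) ys" by (rule iffD1[OF cobound_iff[OF G]])
      show "\<exists>h. gadm G ?n 0 (\<lambda>xs _. h xs) \<and> (\<forall>ys\<in>?T (Suc ?n). F ys = bd h ys)"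
      proof (intro exI conjI)
        show "gadm G ?n 0 (\<lambda>xs _. homog G (?c k) xs)" by (rule homog_restrict[OF G k(1)])
        show "\<forall>ys\<in>?T (Suc ?n). F ys = bd (homog G (?c k)) ys"
        proof
          fix ys assume ys: "ys \<in> ?T (Suc ?n)"
          show "F ys = bd (homog G (?c k)) ys" using bspec[OF kk ys] Fc(2)[OF ys] by simp
        qed
      qed
    qed
  qed
  show ?thesis unfolding surj inj completion_iso_def is_coboundary_def carrier_completion by simp
qed

text \<open>The only tuple of length 0 is the empty list, which every map preserves, so on both
  sides a cochain is a constant.\<close>

lemma completion_iso_0:
  assumes G: "group G" shows "completion_iso G p 0"
proof -
  interpret group G by fact
  have c: "cont_cochain G p 0 (\<lambda>_. a)" for a
    unfolding cont_cochain_def by simp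
  have cyc: "is_cocycle (pro_p_completion G p) p 0 (\<lambda>_. a)" for a
    unfolding is_cocycle_def cobound_def by simp
  show ?thesis unfolding completion_iso_def
  proof (intro conjI allI impI)
    fix f :: "'a list \<Rightarrow> int"
    show "\<exists>F. cont_cochain G p 0 F \<and> is_cocycle (pro_p_completion G p) p 0 F \<and>
        is_coboundary G p (\<lambda>_ _. True) 0 (\<lambda>xs. f xs - F (map (completion_map G p) xs))"
      by (intro exI[of _ "\<lambda>_. f []"] conjI c cyc) (simp add: is_coboundary_def)
  qed (simp add: is_coboundary_def)
qed

end

subsection \<open>Residues for all primes at once\<close>

text \<open>The type \<open>qz\<close> of rationals modulo integers contains $\mathbb{Z}/p$ for every prime \<open>p\<close>.\<close>

quotient_type qz = rat / "\<lambda>x y. x - y \<in> \<int>"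
proof (rule equivpI)
  show "reflp (\<lambda>x y::rat. x - y \<in> \<int>)" by (simp add: reflp_def)
  show "symp (\<lambda>x y::rat. x - y \<in> \<int>)" unfolding symp_def by (metis Ints_minus minus_diff_eq)
  show "transp (\<lambda>x y::rat. x - y \<in> \<int>)"
    unfolding transp_def by (metis Ints_add diff_add_cancel add_diff_eq)
qed

instantiation qz :: ab_group_add
begin

lift_definition zero_qz :: qz is 0 .
lift_definition plus_qz :: "qz \<Rightarrow> qz \<Rightarrow> qz" is "(+)"
proof -
  fix a b c d :: rat assume "a - b \<in> \<int>" "c - d \<in> \<int>"
  then have "(a - b) + (c - d) \<in> \<int>" by (rule Ints_add)
  then show "a + c - (b + d) \<in> \<int>" by (simp only: add_diff_add)
qed
lift_definition uminus_qz :: "qz \<Rightarrow> qz" is uminus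
proof -
  fix a b :: rat assume "a - b \<in> \<int>"
  then have "- (a - b) \<in> \<int>" by (rule Ints_minus)
  moreover have "- (a - b) = - a - - b" by simp
  ultimately show "- a - - b \<in> \<int>" by (simp only:)
qed
lift_definition minus_qz :: "qz \<Rightarrow> qz \<Rightarrow> qz" is "(-)"
proof -
  fix a b c d :: rat assume "a - b \<in> \<int>" "c - d \<in> \<int>"
  then have "(a - b) - (c - d) \<in> \<int>" by (rule Ints_diff)
  then show "a - c - (b - d) \<in> \<int>" by (simp only: algebra_simps)
qed

instance
proof
  fix a b c :: qz
  show "a + b + c = a + (b + c)" by transfer (simp add: add.assoc)
  show "a + b = b + a" by transfer (simp add: add.commute)
  show "0 + a = a" by transfer simp
  show "- a + a = 0" by transfer simp
  show "a - b = a + - b" by transfer simp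
qed

end

lift_definition qz_frac :: "nat \<Rightarrow> int \<Rightarrow> qz" is "\<lambda>n a. of_int a / of_nat n" .

lemma zmod_coeff_qz_frac:
  assumes p: "prime p" shows "zmod_coeff p (qz_frac p)"
proof
  show "prime p" by (rule p)
  show "qz_frac p (a + b) = qz_frac p a + qz_frac p b" for a b
    by transfer (simp add: add_divide_distrib)
  show "qz_frac p a = 0 \<longleftrightarrow> int p dvd a" for a
  proof -
    have p0: "(of_nat p :: rat) \<noteq> 0" using prime_gt_0_nat[OF p] by simp
    have "qz_frac p a = 0 \<longleftrightarrow> (of_int a / of_nat p - 0 :: rat) \<in> \<int>" by transfer simp
    also have "\<dots> \<longleftrightarrow> (\<exists>k. of_int a / of_nat p = (of_int k :: rat))" unfolding Ints_def by auto
    also have "\<dots> \<longleftrightarrow> (\<exists>k. of_int a = (of_int (int p * k) :: rat))"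
      using p0 by (simp add: nonzero_divide_eq_eq mult.commute)
    also have "\<dots> \<longleftrightarrow> int p dvd a" by (simp only: of_int_eq_iff dvd_def)
    finally show ?thesis .
  qed
qed

subsection \<open>Amalgams along a cyclic subgroup\<close>

lemma cyclic_groupE:
  assumes "group A" "cyclic_group A"
  obtains g where "g \<in> carrier A" "carrier A = {g [^]\<^bsub>A\<^esub> t | t::int. True}"
proof -
  interpret group A by fact
  obtain g where g: "g \<in> carrier A" "carrier A = generate A {g}"
    using assms(2) unfolding cyclic_group_def by (elim bexE) (rule that)
  have "generate A {g} = {g [^]\<^bsub>A\<^esub> t | t::int. True}" using generate_pow[OF g(1)] by simp
  then have "carrier A = {g [^]\<^bsub>A\<^esub> t | t::int. True}" using g(2) by (simp only:)
  then show ?thesis by (rule that[OF g(1)])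
qed

text \<open>If \<open>g\<close> has finite order, then residual q-finiteness for a prime \<open>q\<close> not dividing that order kills \<open>g\<close>.\<close>

lemma residually_all_torsion_free:
  assumes G: "group G" and A: "group A" and i: "i \<in> hom A G" "inj_on i (carrier A)"
    and res: "\<And>p. prime p \<Longrightarrow> residually_p_finite G p"
    and g: "g \<in> carrier A" and m: "m > 0" "g [^]\<^bsub>A\<^esub> (m::nat) = \<one>\<^bsub>A\<^esub>"
  shows "g = \<one>\<^bsub>A\<^esub>"
proof (rule ccontr)
  interpret G: group G by fact
  interpret A: group A by fact
  interpret i: group_hom A G i by (simp add: group_hom_def group_hom_axioms_def G A i(1))
  assume "g \<noteq> \<one>\<^bsub>A\<^esub>"
  then have "i g \<noteq> \<one>\<^bsub>G\<^esub>" using inj_onD[OF i(2), of g "\<one>\<^bsub>A\<^esub>"] g by auto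
  \<comment> \<open>A prime above \<open>m\<close> is coprime to \<open>m\<close>, so a
    \<open>q\<close>-finite quotient cannot detect an element whose order divides
    \<open>m\<close>.\<close>
  obtain q where q: "prime q" "m < q" using bigger_prime by blast
  then obtain N where N: "N \<in> pfin_normals G q" "i g \<notin> N"
    using res[OF q(1)] i.hom_closed[OF g] \<open>i g \<noteq> \<one>\<^bsub>G\<^esub>\<close> unfolding residually_p_finite_def by blast
  interpret N: normal N G by (rule pfinD(1)[OF N(1)])
  obtain k where k: "card (rcosets\<^bsub>G\<^esub> N) = q ^ k" using N(1) unfolding pfin_normals_def by blast
  interpret Q: group "G Mod N" by (rule N.factorgroup_is_group)
  have ic: "i g \<in> carrier G" by (rule i.hom_closed[OF g])
  let ?x = "N #>\<^bsub>G\<^esub> i g"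
  interpret r: group_hom G "G Mod N" "\<lambda>a. N #>\<^bsub>G\<^esub> a"
    by (simp add: group_hom_def group_hom_axioms_def G Q.is_group N.r_coset_hom_Mod)
  have xc: "?x \<in> carrier (G Mod N)" by (rule r.hom_closed[OF ic])
  have "?x [^]\<^bsub>G Mod N\<^esub> q ^ k = \<one>\<^bsub>G Mod N\<^esub>"
    using Q.pow_order_eq_1[OF xc] k by (simp add: Coset.order_def FactGroup_def)
  moreover have "?x [^]\<^bsub>G Mod N\<^esub> m = \<one>\<^bsub>G Mod N\<^esub>"
  proof -
    have "i g [^]\<^bsub>G\<^esub> m = \<one>\<^bsub>G\<^esub>" using i.hom_nat_pow[OF g, of m] m(2) by simp
    then show ?thesis unfolding r.hom_nat_pow[OF ic, symmetric] by simp
  qed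
  ultimately have "Q.ord ?x dvd gcd (q ^ k) m"
    using Q.pow_eq_id[OF xc] by (simp add: gcd_greatest)
  moreover have "coprime (q ^ k) m"
    using q m(1) by (intro coprime_power_left_iff[THEN iffD2] disjI1 prime_imp_coprime) (auto dest: dvd_imp_le)
  ultimately have "Q.ord ?x dvd 1" by (simp only: coprime_iff_gcd_eq_1)
  then have "Q.ord ?x = 1" by simp
  then have "?x = \<one>\<^bsub>G Mod N\<^esub>" using Q.ord_eq_1[OF xc] by simp
  then show False using G.coset_eq_subgroup_iff[OF pfinD(1)[OF N(1)] ic] N(2) by simp
qed

text \<open>An element of the kernel lies in every preimage, hence in every subgroup in
  \<open>pfin_normals H p\<close>. The factors are shown to embed in the amalgam in this way and not
  by reduced words.\<close>

lemma inj_of_separated: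
  assumes j: "group_hom H G j" and res: "residually_p_finite H p"
    and top: "\<And>N. N \<in> pfin_normals H p \<Longrightarrow> \<exists>K\<in>pfin_normals G p. \<forall>s\<in>carrier H. j s \<in> K \<longrightarrow> s \<in> N"
  shows "inj_on j (carrier H)"
proof -
  interpret j: group_hom H G j by (rule j)
  have "s = \<one>\<^bsub>H\<^esub>" if s: "s \<in> carrier H" "j s = \<one>\<^bsub>G\<^esub>" for s
  proof (rule ccontr)
    assume "s \<noteq> \<one>\<^bsub>H\<^esub>"
    then obtain N where N: "N \<in> pfin_normals H p" "s \<notin> N" using res s(1) unfolding residually_p_finite_def by blast
    obtain K where K: "K \<in> pfin_normals G p" "\<forall>s\<in>carrier H. j s \<in> K \<longrightarrow> s \<in> N" using top[OF N(1)] by blast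
    have "j s \<in> K" unfolding s(2) by (rule subgroup.one_closed[OF pfinD(2)[OF K(1)]])
    then show False using K(2) s(1) N(2) by blast
  qed
  then show ?thesis using j.inj_on_one_iff by blast
qed

lemma (in zmod_coeff) locally_acyclic_of_class_C:
  assumes H: "group H" "class_C H" and n: "1 \<le> n" shows "locally_acyclic H n"
proof -
  have QI: "completion_surj H k \<and> completion_inj H k" if k1: "1 \<le> k" for k
  proof -
    obtain m where m: "k = Suc m" using k1 by (cases k) auto
    have "completion_iso H p (Suc m)" using H(2) prime_p unfolding class_C_def by blast
    then show ?thesis unfolding m by (rule iffD1[OF completion_iso_iff[OF H(1)]])
  qed
  show ?thesis by (rule locally_acyclic_of_completion[OF H(1) QI[THEN conjunct2] QI[THEN conjunct1] n])
qed

context amalgam_coeff begin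

lemma locally_acyclic_cyclic_amalgam:
  assumes inj: "inj_on i1 (carrier A)" "inj_on i2 (carrier A)"
    and res: "residually_p_finite G1 p" "residually_p_finite G2 p"
    and g: "g \<in> carrier A" "carrier A = {g [^]\<^bsub>A\<^esub> t | t::int. True}"
    and tf: "\<And>m::nat. m > 0 \<Longrightarrow> g [^]\<^bsub>A\<^esub> m = \<one>\<^bsub>A\<^esub> \<Longrightarrow> g = \<one>\<^bsub>A\<^esub>"
    and Ex: "\<And>n. 1 \<le> n \<Longrightarrow> locally_acyclic G1 n" "\<And>n. 1 \<le> n \<Longrightarrow> locally_acyclic G2 n" and n: "1 \<le> n"
  shows "locally_acyclic G n"
proof -
  have sep: "\<exists>K\<in>pfin_normals G p. (\<forall>s\<in>carrier G1. j1 s \<in> K \<longrightarrow> s \<in> N1) \<and> (\<forall>s\<in>carrier G2. j2 s \<in> K \<longrightarrow> s \<in> N2)"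
    if "N1 \<in> pfin_normals G1 p" "N2 \<in> pfin_normals G2 p" for N1 N2
    unfolding separable_def[symmetric] by (rule separable_all[OF inj res g _ that]) (rule tf)
  \<comment> \<open>Separation of a pair whose other member is the whole group gives the topology of
    a single factor.\<close>
  have top1: "\<exists>K\<in>pfin_normals G p. \<forall>s\<in>carrier G1. j1 s \<in> K \<longrightarrow> s \<in> N" if "N \<in> pfin_normals G1 p" for N
    using sep[OF that G2.carrier_pfin] by blast
  have top2: "\<exists>K\<in>pfin_normals G p. \<forall>s\<in>carrier G2. j2 s \<in> K \<longrightarrow> s \<in> N" if "N \<in> pfin_normals G2 p" for N
    using sep[OF G1.carrier_pfin that] by blast
  have topA: "\<exists>K\<in>pfin_normals G p. \<forall>s\<in>carrier A. j1 (i1 s) \<in> K \<longrightarrow> s \<in> N" if N: "N \<in> pfin_normals A p" for N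
  proof -
    have "\<exists>M\<in>pfin_normals G1 p. \<forall>s\<in>carrier A. i1 s \<in> M \<longrightarrow> s \<in> N"
    proof (cases "g = \<one>\<^bsub>A\<^esub>")
      case True
      then have "carrier A = {\<one>\<^bsub>A\<^esub>}" using g(2) by auto
      then have "\<forall>s\<in>carrier A. i1 s \<in> carrier G1 \<longrightarrow> s \<in> N"
        using subgroup.one_closed[OF pfinD(2)[OF N]] by simp
      then show ?thesis by (rule bexI[OF _ G1.carrier_pfin])
    next
      case False
      interpret i1: group_hom A G1 i1 by (rule i1_hom)
      obtain l where l: "\<And>t::int. g [^]\<^bsub>A\<^esub> t \<in> N \<longleftrightarrow> int (p ^ l) dvd t"
        by (rule A.pfin_cyclic_trace[OF prime_p g(1) N]) (rule that)
      \<comment> \<open>\<open>G1\<close> itself has trace exponent 0 on \<open>A\<close>; it is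
        deepened to the exponent \<open>l\<close> of \<open>N\<close>.\<close>
      have "\<exists>M\<in>pfin_normals G1 p. M \<subseteq> carrier G1 \<and> (\<forall>t::int. i1 (g [^]\<^bsub>A\<^esub> t) \<in> M \<longleftrightarrow> int (p ^ l) dvd t)"
      proof (rule pfin_deepen_trace_le[OF prime_p G1.is_group A.is_group i1 inj(1) res(1) g(1), where k = 0])
        show "g [^]\<^bsub>A\<^esub> m \<noteq> \<one>\<^bsub>A\<^esub>" if "m > 0" for m :: nat using tf[OF that] False by blast
      qed (use G1.carrier_pfin g(1) in auto)
      then obtain M where M: "M \<in> pfin_normals G1 p" "\<forall>t::int. i1 (g [^]\<^bsub>A\<^esub> t) \<in> M \<longleftrightarrow> int (p ^ l) dvd t" by blast
      have "s \<in> N" if "s \<in> carrier A" "i1 s \<in> M" for s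
      proof -
        have "s \<in> {g [^]\<^bsub>A\<^esub> t | t::int. True}" using that(1) by (simp only: g(2)[symmetric])
        then obtain t where t: "s = g [^]\<^bsub>A\<^esub> (t::int)" by blast
        have "int (p ^ l) dvd t" by (rule iffD1[OF spec[OF M(2)] that(2)[unfolded t]])
        then show ?thesis unfolding t by (rule iffD2[OF l])
      qed
      then show ?thesis using M(1) by blast
    qed
    then obtain M where M: "M \<in> pfin_normals G1 p" "\<forall>s\<in>carrier A. i1 s \<in> M \<longrightarrow> s \<in> N" by blast
    obtain K where K: "K \<in> pfin_normals G p" "\<forall>s\<in>carrier G1. j1 s \<in> K \<longrightarrow> s \<in> M" using top1[OF M(1)] by blast
    then show ?thesis using M(2) i_closed(1) by blast
  qed
  consider "n = 1" | "2 \<le> n" using n by linarith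
  then show ?thesis
  proof cases
    case 1 then show ?thesis using locally_acyclic_1[OF G.is_group] by simp
  next
    case 2
    then obtain m where m: "n = Suc (Suc m)" using le_Suc_ex[of 2 n] by auto
    \<comment> \<open>Mayer-Vietoris asks for \<open>A\<close> one degree below the amalgam; for
      \<open>m = 0\<close> this is degree 1.\<close>
    have "locally_acyclic A (Suc m)"
    proof (cases m)
      case 0 then show ?thesis using locally_acyclic_1[OF A.is_group] by simp
    next
      case (Suc k) then show ?thesis using locally_acyclic_cyclic[OF A.is_group g _, of "Suc m"] tf by simp
    qed
    moreover have "inj_on j1 (carrier G1)" by (rule inj_of_separated[OF j1.group_hom_axioms res(1) top1])
    moreover have "inj_on j2 (carrier G2)" by (rule inj_of_separated[OF j2.group_hom_axioms res(2) top2])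
    ultimately show ?thesis unfolding m by (intro locally_acyclic_amalgam inj(1) top1 top2 topA Ex) auto
  qed
qed

end

theorem theorem3p10:
  fixes G1 :: "('a, 'm) monoid_scheme" and G2 :: "('b, 'n) monoid_scheme"
    and A :: "('c, 'k) monoid_scheme" and i1 :: "'c \<Rightarrow> 'a" and i2 :: "'c \<Rightarrow> 'b"
  assumes "group G1" and "group G2" and "group A" and "cyclic_group A"
    and "i1 \<in> hom A G1" and "inj_on i1 (carrier A)"
    and "i2 \<in> hom A G2" and "inj_on i2 (carrier A)"
    and "class_C G1" and "class_C G2"
    and "\<And>p. prime p \<Longrightarrow> residually_p_finite G1 p"
    and "\<And>p. prime p \<Longrightarrow> residually_p_finite G2 p"
  shows "class_C (amal_product G1 G2 A i1 i2)"
  unfolding class_C_def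
proof (intro allI impI)
  fix p n assume p: "prime (p::nat)"
  interpret z: zmod_coeff p "qz_frac p" by (rule zmod_coeff_qz_frac[OF p])
  interpret amalgam_coeff G1 G2 A i1 i2 p "qz_frac p"
    by (intro amalgam_coeff.intro amalgam.intro amalgam_axioms.intro z.zmod_coeff_axioms assms)
  obtain g where g: "g \<in> carrier A" "carrier A = {g [^]\<^bsub>A\<^esub> t | t::int. True}"
    by (rule cyclic_groupE[OF assms(3,4)])
  \<comment> \<open>Residual finiteness at all primes is used here; the remaining steps work at
    \<open>p\<close> alone.\<close>
  have tf: "g = \<one>\<^bsub>A\<^esub>" if "m > 0" "g [^]\<^bsub>A\<^esub> m = \<one>\<^bsub>A\<^esub>" for m :: nat
    by (rule residually_all_torsion_free[OF assms(1,3,5,6) _ g(1) that]) (rule assms(11))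
  have Ex: "z.locally_acyclic G k" if "1 \<le> k" for k
    by (rule locally_acyclic_cyclic_amalgam[OF assms(6,8) assms(11)[OF p] assms(12)[OF p] g tf
        z.locally_acyclic_of_class_C[OF assms(1,9)] z.locally_acyclic_of_class_C[OF assms(2,10)] that])
  have col: "z.column_exact G k l" if k1: "1 \<le> k" for k l
  proof (cases l)
    case 0 then show ?thesis using z.column_exact_0[OF G.is_group] by simp
  next
    case (Suc m)
    obtain k' where "k = Suc k'" using k1 by (cases k) auto
    then show ?thesis using z.column_exact_of_locally_acyclic[OF G.is_group Ex, of l k'] Suc by simp
  qed
  show "completion_iso G p n"
  proof (cases n)
    case 0 then show ?thesis using z.completion_iso_0[OF G.is_group] by simp
  next
    case (Suc m)
    have "z.completion_surj G (Suc m)" by (rule z.completion_surj_of_columns[OF G.is_group col])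
    moreover have "z.completion_inj G (Suc m)" by (rule z.completion_inj_of_columns[OF G.is_group col]) auto
    ultimately show ?thesis unfolding Suc using z.completion_iso_iff[OF G.is_group] by blast
  qed
qed

end
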